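(* Let $G$ be a finite group, $X$ a finite set, and $(G,X)$ a $G$-family of quandles. If two $Y$-oriented handlebody-link diagrams $L$ and $L'$ are related by a finite sequence of Reidemeister moves for handlebody-links, then the $G$-family subquandle polynomial invariants and the associated subquandle polynomial invariants agree, as multisets: $\Phi_{(G,X)}(L)=\Phi_{(G,X)}(L')$ and $\Phi^{A}_{(G,X)}(L)=\Phi^{A}_{(G,X)}(L')$.
   Context: **Quandles.** A quandle operation on a set $X$ is a binary operation $\triangleright$ such that (i) $x\triangleright x=x$ for all $x$; (ii) for all $x,y$ there is a unique $z$ with $x=z\triangleright y$; (iii) $(x\triangleright y)\triangleright z=(x\triangleright z)\triangleright(y\triangleright z)$ for all $x,y,z$. **$G$-families.** A $G$-family of quandles $(G,X)$ is a choice, for each $g\in G$, of a quandle operation $\triangleright^g$ on $X$ such that for all $x,y,z\in X$ and $g,h\in G$: $x\triangleright^g x=x$; $x\triangleright^{gh}y=(x\triangleright^g y)\triangleright^h y$ and $x\triangleright^{1}y=x$; and $(x\triangleright^g y)\triangleright^h z=(x\triangleright^h z)\triangleright^{h^{-1}gh}(y\triangleright^h z)$. The associated quandle $A(G,X)$ is the set $G\times X$ with the operation $(g,x)\triangleright(h,y)=(h^{-1}gh,\,x\triangleright^h y)$. For $Y\subseteq X$, $(G,Y)$ is a $G$-subfamily of $(G,X)$ if it is a $G$-family of quandles under the operations $\triangleright^g$ inherited from $(G,X)$. **Polynomials.** For a finite quandle $Q$ and $q\in Q$ put $c(q)=|\{p\in Q: p\triangleright q=p\}|$ and $r(q)=|\{p\in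 Q: q\triangleright p=q\}|$. For a subquandle $S\subseteq Q$ the subquandle polynomial is $\phi_{S\subset Q}=\sum_{q\in S}t^{c(q)}s^{r(q)}$, with $c,r$ computed in $Q$. For a $G$-family $(G,X)$, $g\in G$ and $x\in X$ put $c_g(x)=|\{y\in X: y\triangleright^g x=y\}|$ and $r_g(x)=|\{y\in X: x\triangleright^g y=x\}|$. For a $G$-subfamily $(G,Y)$ of $(G,X)$, the $G$-subfamily polynomial is $$\phi_{(G,Y)\subset(G,X)}=\sum_{(g,x)\in G\times Y} g\,t^{c_g(x)}s^{r_g(x)}\in\mathbb{Z}[G][t,s],$$ with $c_g,r_g$ computed in $(G,X)$, and the associated subquandle polynomial is $\phi_{A(G,Y)\subset A(G,X)}$, the subquandle polynomial of $A(G,Y)$ in $A(G,X)$. **Diagrams.** A $Y$-oriented handlebody-link diagram is a diagram in the plane of a trivalent spatial graph (finitely many trivalent vertices; circle components without vertices are allowed) whose edges are oriented so that no vertex is a source or a sink; i.e. at each vertex either two edges come in and one goes out, or one comes in and two go out. An arc of the diagram is a maximal piece of the diagram with no under-crossing or vertex in its interior. The Reidemeister moves for handlebody-links are planar isotopy together with the following local moves, in all $Y$-orientations compatible on both sides: (R1) adding or removing a kink; (R2) adding or removing two consecutive crossings of one strand over another; (R3) the usual triangle move; (R4) adding or removing a crossing (of either sign) between two edges adjacent to a vertex, next to the vertex; (R5) moving a strand over or under a vertex; (R6) the IH-move, which replaces a crossingless edge joining two distinct vertices, drawn as the bar of the letter "I" with four outgoing ends, by the edge drawn as the bar of the letter "H"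 with the same four ends (the four ends keep their orientations, and the new bar has any orientation for which no vertex is a source or sink). **Colorings.** A $(G,X)$-coloring of a diagram $K$ assigns to each arc an element of $G\times X$ such that: (a) at each crossing whose over-arc is colored $(h,y)$, if the under-arc lying on the right of the over-arc (with respect to the orientation of the over-arc) is colored $(g,x)$, then the under-arc on its left is colored $(h^{-1}gh,\,x\triangleright^h y)$; (b) at each vertex, all three incident arcs have the same $X$-component, and, looking in the direction of the orientations, if of the two like-directed edges (both incoming or both outgoing) the left one has $G$-component $g_L$ and the right one has $G$-component $g_R$, then the third edge has $G$-component $g_Rg_L$. The set of $(G,X)$-colorings is denoted $\mathcal{C}((G,X),K)$. **Invariants.** For $f\in\mathcal{C}((G,X),K)$, the image $G$-subfamily $\mathrm{Im}(f)=(G,Y_f)$ is the smallest $G$-subfamily of $(G,X)$ such that $G\times Y_f$ contains all pairs $(g,x)$ occurring as colors in $f$. Define the multisets $$\Phi_{(G,X)}(K)=\{\phi_{(G,Y_f)\subset(G,X)} \mid f\in\mathcal{C}((G,X),K)\},\qquad \Phi^{A}_{(G,X)}(K)=\{\phi_{A(G,Y_f)\subset A(G,X)}\mid f\in\mathcal{C}((G,X),K)\},$$ with one entry for each coloring $f$; the first is the $G$-family subquandle polynomial invariant and the second the associated subquandle polynomial invariant. *)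

theory Defs
  imports
    "HOL-Algebra.Group"
    "HOL-Analysis.Complex_Transcendental"
    "HOL-Computational_Algebra.Polynomial"
    "HOL-Library.Poly_Mapping"
    "HOL-Library.FuncSet"
    "HOL-Library.Multiset"
begin

section \<open>Quandles and G-families\<close>

definition quandle :: "'a set \<Rightarrow> ('a \<Rightarrow> 'a \<Rightarrow> 'a) \<Rightarrow> bool" where
  "quandle Q rhd \<longleftrightarrow>
     (\<forall>x\<in>Q. \<forall>y\<in>Q. rhd x y \<in> Q) \<and>
     (\<forall>x\<in>Q. rhd x x = x) \<and>
     (\<forall>x\<in>Q. \<forall>y\<in>Q. \<exists>!z. z \<in> Q \<and> x = rhd z y) \<and>
     (\<forall>x\<in>Q. \<forall>y\<in>Q. \<forall>z\<in>Q. rhd (rhd x y) z = rhd (rhd x z) (rhd y z))"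

text \<open>In a family \<open>q\<close>, the term \<open>q g x y\<close> stands for \<open>x \<triangleright>\<^sup>g y\<close>.\<close>

definition G_family :: "('g, 'm) monoid_scheme \<Rightarrow> 'x set \<Rightarrow> ('g \<Rightarrow> 'x \<Rightarrow> 'x \<Rightarrow> 'x) \<Rightarrow> bool" where
  "G_family G X q \<longleftrightarrow>
     (\<forall>g\<in>carrier G. quandle X (q g)) \<and>
     (\<forall>g\<in>carrier G. \<forall>x\<in>X. q g x x = x) \<and>
     (\<forall>g\<in>carrier G. \<forall>h\<in>carrier G. \<forall>x\<in>X. \<forall>y\<in>X.
        q (g \<otimes>\<^bsub>G\<^esub> h) x y = q h (q g x y) y) \<and>
     (\<forall>x\<in>X. \<forall>y\<in>X. q \<one>\<^bsub>G\<^esub> x y = x) \<and>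
     (\<forall>g\<in>carrier G. \<forall>h\<in>carrier G. \<forall>x\<in>X. \<forall>y\<in>X. \<forall>z\<in>X.
        q h (q g x y) z = q (inv\<^bsub>G\<^esub> h \<otimes>\<^bsub>G\<^esub> g \<otimes>\<^bsub>G\<^esub> h) (q h x z) (q h y z))"

definition assoc_op ::
  "('g, 'm) monoid_scheme \<Rightarrow> ('g \<Rightarrow> 'x \<Rightarrow> 'x \<Rightarrow> 'x) \<Rightarrow> 'g \<times> 'x \<Rightarrow> 'g \<times> 'x \<Rightarrow> 'g \<times> 'x" where
  "assoc_op G q a b =
     (inv\<^bsub>G\<^esub> (fst b) \<otimes>\<^bsub>G\<^esub> fst a \<otimes>\<^bsub>G\<^esub> fst b, q (fst b) (snd a) (snd b))"

definition G_subfamily ::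
  "('g, 'm) monoid_scheme \<Rightarrow> 'x set \<Rightarrow> ('g \<Rightarrow> 'x \<Rightarrow> 'x \<Rightarrow> 'x) \<Rightarrow> 'x set \<Rightarrow> bool" where
  "G_subfamily G X q Y \<longleftrightarrow> Y \<subseteq> X \<and> G_family G Y q"


section \<open>Subquandle polynomials\<close>

text \<open>
  Polynomials in \<open>t\<close> and \<open>s\<close> are polynomials in \<open>s\<close> (outer) over polynomials in \<open>t\<close> (inner), so
  \<open>a t\<^sup>c s\<^sup>r\<close> is \<open>monom (monom a c) r\<close>. The group ring of \<open>G\<close> over the integers consists of the finitely
  supported integer functions on \<open>G\<close>, and \<open>Poly_Mapping.single g 1\<close> is the element \<open>g\<close> of it.
\<close>

definition subquandle_poly :: "'a set \<Rightarrow> ('a \<Rightarrow> 'a \<Rightarrow> 'a) \<Rightarrow> 'a set \<Rightarrow> int poly poly" where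
  "subquandle_poly Q rhd S =
     (\<Sum>a\<in>S. monom (monom 1 (card {p \<in> Q. rhd p a = p})) (card {p \<in> Q. rhd a p = a}))"

definition G_subfamily_poly ::
  "('g, 'm) monoid_scheme \<Rightarrow> 'x set \<Rightarrow> ('g \<Rightarrow> 'x \<Rightarrow> 'x \<Rightarrow> 'x) \<Rightarrow> 'x set \<Rightarrow> ('g \<Rightarrow>\<^sub>0 int) poly poly" where
  "G_subfamily_poly G X q Y =
     (\<Sum>(g, x)\<in>carrier G \<times> Y.
        monom (monom (Poly_Mapping.single g 1) (card {y \<in> X. q g y x = y}))
              (card {y \<in> X. q g x y = x}))"

definition assoc_subquandle_poly ::
  "('g, 'm) monoid_scheme \<Rightarrow> 'x set \<Rightarrow> ('g \<Rightarrow> 'x \<Rightarrow> 'x \<Rightarrow> 'x) \<Rightarrow> 'x set \<Rightarrow> int poly poly" where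
  "assoc_subquandle_poly G X q Y =
     subquandle_poly (carrier G \<times> X) (assoc_op G q) (carrier G \<times> Y)"


section \<open>Diagrams in the plane\<close>

text \<open>
  Diagrams are polygonal and live in the complex plane. A diagram is a finite set of oriented
  straight segments between nodes. Over a crossing point \<open>c\<close> there are two nodes: \<open>Hi c\<close>, through
  which the over-strand passes, and \<open>Lo c\<close>, through which the under-strand passes. Every other node
  is of the form \<open>Lo z\<close>: it is either a trivalent vertex of the spatial graph or a joint, that is, a
  corner or a subdivision point of a polygonal edge. Strands may bend at crossings. A circle
  component is a closed polygon all of whose nodes are joints and crossings.
\<close>

datatype 'p node = Lo (pt: 'p) | Hi (pt: 'p)

type_synonym seg = "complex node \<times> complex node"
type_synonym diagram = "seg set"

definition seg_ends :: "seg \<Rightarrow> complex set" where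
  "seg_ends s = {pt (fst s), pt (snd s)}"

definition seg_line :: "seg \<Rightarrow> complex set" where
  "seg_line s = closed_segment (pt (fst s)) (pt (snd s))"

text \<open>The rays from \<open>c\<close> through \<open>a\<close>, \<open>b\<close>, \<open>d\<close> are distinct and occur in this counterclockwise order.\<close>

definition ccw :: "complex \<Rightarrow> complex \<Rightarrow> complex \<Rightarrow> complex \<Rightarrow> bool" where
  "ccw c a b d \<longleftrightarrow>
     0 < Arg2pi ((b - c) / (a - c)) \<and> Arg2pi ((b - c) / (a - c)) < Arg2pi ((d - c) / (a - c))"

text \<open>
  A strand runs from \<open>p\<close> to \<open>c\<close> and on to \<open>p'\<close>. Turning counterclockwise from its forward direction
  one sweeps its left side until one meets its backward direction.
\<close>

definition on_left :: "complex \<Rightarrow> complex \<Rightarrow> complex \<Rightarrow> complex \<Rightarrow> bool" where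
  "on_left p c p' u \<longleftrightarrow> ccw c p' u p"

definition on_right :: "complex \<Rightarrow> complex \<Rightarrow> complex \<Rightarrow> complex \<Rightarrow> bool" where
  "on_right p c p' u \<longleftrightarrow> ccw c p u p'"

definition in_degree :: "diagram \<Rightarrow> complex node \<Rightarrow> nat" where
  "in_degree D n = card {m. (m, n) \<in> D}"

definition out_degree :: "diagram \<Rightarrow> complex node \<Rightarrow> nat" where
  "out_degree D n = card {m. (n, m) \<in> D}"

definition bivalent :: "diagram \<Rightarrow> complex node \<Rightarrow> bool" where
  "bivalent D n \<longleftrightarrow> in_degree D n = 1 \<and> out_degree D n = 1"

definition trivalent :: "diagram \<Rightarrow> complex node \<Rightarrow> bool" where
  "trivalent D n \<longleftrightarrow>
     in_degree D n = 2 \<and> out_degree D n = 1 \<or> in_degree D n = 1 \<and> out_degree D n = 2"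

definition crossing :: "diagram \<Rightarrow> complex \<Rightarrow> bool" where
  "crossing D c \<longleftrightarrow> bivalent D (Hi c) \<and> bivalent D (Lo c) \<and>
     (\<forall>p p' u u'. (p, Hi c) \<in> D \<and> (Hi c, p') \<in> D \<and> (u, Lo c) \<in> D \<and> (Lo c, u') \<in> D \<longrightarrow>
        on_left (pt p) c (pt p') (pt u) \<and> on_right (pt p) c (pt p') (pt u') \<or>
        on_right (pt p) c (pt p') (pt u) \<and> on_left (pt p) c (pt p') (pt u'))"

definition joint :: "diagram \<Rightarrow> complex node \<Rightarrow> bool" where
  "joint D n \<longleftrightarrow> bivalent D n \<and> (\<exists>z. n = Lo z \<and> Hi z \<notin> Field D)"

definition Y_oriented_diagram :: "diagram \<Rightarrow> bool" where
  "Y_oriented_diagram D \<longleftrightarrow>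
     finite D \<and>
     (\<forall>(m, n)\<in>D. pt m \<noteq> pt n) \<and>
     (\<forall>s\<in>D. \<forall>s'\<in>D. s \<noteq> s' \<longrightarrow> seg_line s \<inter> seg_line s' \<subseteq> seg_ends s \<inter> seg_ends s') \<and>
     (\<forall>n\<in>Field D. bivalent D n \<or> trivalent D n) \<and>
     (\<forall>c. Hi c \<in> Field D \<longrightarrow> crossing D c)"

text \<open>
  Arcs are classes of segments: consecutive segments belong to the same arc if the node between
  them is a joint or an over-node.
\<close>

definition passes :: "diagram \<Rightarrow> (seg \<times> seg) set" where
  "passes D = {((m, n), (n, k)) | m n k.
     (m, n) \<in> D \<and> (n, k) \<in> D \<and> (joint D n \<or> (\<exists>c. n = Hi c))}"

definition arc_rel :: "diagram \<Rightarrow> (seg \<times> seg) set" where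
  "arc_rel D = (passes D \<union> (passes D)\<inverse>)\<^sup>* \<inter> D \<times> D"

definition arcs :: "diagram \<Rightarrow> seg set set" where
  "arcs D = D // arc_rel D"

definition arc_of :: "diagram \<Rightarrow> seg \<Rightarrow> seg set" where
  "arc_of D s = arc_rel D `` {s}"


section \<open>Reidemeister moves for handlebody-links\<close>

subsection \<open>Planar isotopy\<close>

text \<open>
  Polygonal planar isotopies are composed of subdivisions of segments, their inverses, and motions
  of the nodes in the plane through diagrams with the same combinatorial structure.
\<close>

definition subdivision :: "diagram \<Rightarrow> diagram \<Rightarrow> bool" where
  "subdivision D D' \<longleftrightarrow>
     (\<exists>m n z. (m, n) \<in> D \<and> z \<in> open_segment (pt m) (pt n) \<and>
        D' = D - {(m, n)} \<union> {(m, Lo z), (Lo z, n)})"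

definition relocate :: "(complex \<Rightarrow> complex) \<Rightarrow> diagram \<Rightarrow> diagram" where
  "relocate h D = map_prod (map_node h) (map_node h) ` D"

definition motion :: "diagram \<Rightarrow> diagram \<Rightarrow> bool" where
  "motion D D' \<longleftrightarrow>
     (\<exists>h :: real \<Rightarrow> complex \<Rightarrow> complex.
        (\<forall>p \<in> pt ` Field D. continuous_on {0..1} (\<lambda>t. h t p) \<and> h 0 p = p) \<and>
        (\<forall>t \<in> {0..1}. inj_on (h t) (pt ` Field D) \<and> Y_oriented_diagram (relocate (h t) D)) \<and>
        D' = relocate (h 1) D)"


subsection \<open>Local moves\<close>

text \<open>
  The polygonal path through the given nodes, oriented along the list if \<open>b\<close> holds and against it
  otherwise.
\<close>

definition strand :: "bool \<Rightarrow> complex node list \<Rightarrow> seg set" where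
  "strand b ns = (let ms = (if b then ns else rev ns) in set (zip ms (tl ms)))"

text \<open>
  The diagrams \<open>D\<close> and \<open>D'\<close> coincide outside a round disc, in which they are \<open>T\<close> and \<open>T'\<close>
  respectively. On the bounding circle they have the joints \<open>es\<close> in common; the points \<open>is\<close> are
  all the other nodes in the disc. Any disc can be made round by a planar isotopy.
\<close>

definition switch_in_disc ::
  "complex list \<Rightarrow> complex list \<Rightarrow> seg set \<Rightarrow> seg set \<Rightarrow> diagram \<Rightarrow> diagram \<Rightarrow> bool" where
  "switch_in_disc es is T T' D D' \<longleftrightarrow>
     (\<exists>z r R. D = R \<union> T \<and> D' = R \<union> T' \<and>
        distinct es \<and> set es \<subseteq> sphere z r \<and> set is \<subseteq> ball z r \<and>
        (\<forall>s\<in>R. seg_line s \<inter> cball z r \<subseteq> set es) \<and>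
        (\<forall>e\<in>set es. joint D (Lo e) \<and> joint D' (Lo e)))"

text \<open>
  Each local picture is given by the oriented polygonal paths it consists of. The cyclic order of
  the segments around the nodes need not be given: since the pictures are embedded in a disc with
  fixed boundary points, it is determined up to a reflection that affects both pictures in the
  same way. The orientations \<open>o1\<close>, \<open>o2\<close> etc. are arbitrary except that both sides have to be
  \<open>Y\<close>-oriented. Each move is listed in one direction only.
\<close>

inductive reidemeister :: "diagram \<Rightarrow> diagram \<Rightarrow> bool" where
  subdivision:
    "subdivision D D' \<Longrightarrow> Y_oriented_diagram D \<Longrightarrow> Y_oriented_diagram D' \<Longrightarrow> reidemeister D D'"
| motion:
    "motion D D' \<Longrightarrow> Y_oriented_diagram D \<Longrightarrow> Y_oriented_diagram D' \<Longrightarrow> reidemeister D D'"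
| R1:
    "switch_in_disc [a, b] [c, j, k]
       (strand o1 [Lo a, Lo b])
       (strand o1 [Lo a, Hi c, Lo j, Lo k, Lo c, Lo b]) D D' \<Longrightarrow>
     Y_oriented_diagram D \<Longrightarrow> Y_oriented_diagram D' \<Longrightarrow> reidemeister D D'"
| R2:
    "switch_in_disc [a, a', b, b'] [c, d, j]
       (strand o1 [Lo a, Lo a'] \<union> strand o2 [Lo b, Lo b'])
       (strand o1 [Lo a, Hi c, Hi d, Lo a'] \<union> strand o2 [Lo b, Lo c, Lo j, Lo d, Lo b']) D D' \<Longrightarrow>
     Y_oriented_diagram D \<Longrightarrow> Y_oriented_diagram D' \<Longrightarrow> reidemeister D D'"
| R3:
    "switch_in_disc [a, a', b, b', c, c'] [x, y, z, x', y', z']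
       (strand o1 [Lo a, Hi x, Hi y, Lo a'] \<union>
        strand o2 [Lo b, Lo x, Hi z, Lo b'] \<union>
        strand o3 [Lo c, Lo y, Lo z, Lo c'])
       (strand o1 [Lo a, Hi y', Hi x', Lo a'] \<union>
        strand o2 [Lo b, Hi z', Lo x', Lo b'] \<union>
        strand o3 [Lo c, Lo z', Lo y', Lo c']) D D' \<Longrightarrow>
     Y_oriented_diagram D \<Longrightarrow> Y_oriented_diagram D' \<Longrightarrow> reidemeister D D'"
| R4:
    "switch_in_disc [a, b, c] [v, v', x, j]
       (strand o1 [Lo a, Lo v] \<union> strand o2 [Lo b, Lo v] \<union> strand o3 [Lo c, Lo v])
       (strand o1 [Lo a, Hi x, Lo j, Lo v'] \<union> strand o2 [Lo b, Lo x, Lo v'] \<union>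
        strand o3 [Lo c, Lo v']) D D' \<Longrightarrow>
     Y_oriented_diagram D \<Longrightarrow> Y_oriented_diagram D' \<Longrightarrow> reidemeister D D'"
| R5_over:
    "switch_in_disc [a, b, c, d, d'] [v, v', x, y, z]
       (strand o4 [Lo d, Hi x, Lo d'] \<union>
        strand o1 [Lo a, Lo x, Lo v] \<union> strand o2 [Lo b, Lo v] \<union> strand o3 [Lo c, Lo v])
       (strand o4 [Lo d, Hi y, Hi z, Lo d'] \<union>
        strand o1 [Lo a, Lo v'] \<union> strand o2 [Lo b, Lo y, Lo v'] \<union>
        strand o3 [Lo c, Lo z, Lo v']) D D' \<Longrightarrow>
     Y_oriented_diagram D \<Longrightarrow> Y_oriented_diagram D' \<Longrightarrow> reidemeister D D'"
| R5_under:
    "switch_in_disc [a, b, c, d, d'] [v, v', x, y, z]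
       (strand o4 [Lo d, Lo x, Lo d'] \<union>
        strand o1 [Lo a, Hi x, Lo v] \<union> strand o2 [Lo b, Lo v] \<union> strand o3 [Lo c, Lo v])
       (strand o4 [Lo d, Lo y, Lo z, Lo d'] \<union>
        strand o1 [Lo a, Lo v'] \<union> strand o2 [Lo b, Hi y, Lo v'] \<union>
        strand o3 [Lo c, Hi z, Lo v']) D D' \<Longrightarrow>
     Y_oriented_diagram D \<Longrightarrow> Y_oriented_diagram D' \<Longrightarrow> reidemeister D D'"
| R6:
    "switch_in_disc [a, b, c, d] [v, w, v', w']
       (strand o1 [Lo a, Lo v] \<union> strand o2 [Lo b, Lo v] \<union>
        strand o3 [Lo c, Lo w] \<union> strand o4 [Lo d, Lo w] \<union> strand o5 [Lo v, Lo w])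
       (strand o1 [Lo a, Lo v'] \<union> strand o4 [Lo d, Lo v'] \<union>
        strand o2 [Lo b, Lo w'] \<union> strand o3 [Lo c, Lo w'] \<union> strand o6 [Lo v', Lo w']) D D' \<Longrightarrow>
     Y_oriented_diagram D \<Longrightarrow> Y_oriented_diagram D' \<Longrightarrow> reidemeister D D'"

definition reidemeister_equiv :: "diagram \<Rightarrow> diagram \<Rightarrow> bool" where
  "reidemeister_equiv = (symclp reidemeister)\<^sup>*\<^sup>*"


section \<open>Colorings and invariants\<close>

definition joins :: "seg \<Rightarrow> complex node \<Rightarrow> complex node \<Rightarrow> bool" where
  "joins s m n \<longleftrightarrow> s = (m, n) \<or> s = (n, m)"

definition colorings ::
  "('g, 'm) monoid_scheme \<Rightarrow> 'x set \<Rightarrow> ('g \<Rightarrow> 'x \<Rightarrow> 'x \<Rightarrow> 'x) \<Rightarrow> diagram \<Rightarrow> (seg set \<Rightarrow> 'g \<times> 'x) set" where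
  "colorings G X q D = {f \<in> arcs D \<rightarrow>\<^sub>E carrier G \<times> X.
     let col = (\<lambda>s. f (arc_of D s)) in
     (\<forall>c p p' u u' s s'.
        (p, Hi c) \<in> D \<and> (Hi c, p') \<in> D \<and>
        s \<in> D \<and> joins s u (Lo c) \<and> on_right (pt p) c (pt p') (pt u) \<and>
        s' \<in> D \<and> joins s' u' (Lo c) \<and> on_left (pt p) c (pt p') (pt u') \<longrightarrow>
        col s' = assoc_op G q (col s) (col (p, Hi c))) \<and>
     (\<forall>v l r w.
        (l, v) \<in> D \<and> (r, v) \<in> D \<and> (v, w) \<in> D \<and> trivalent D v \<and>
        ccw (pt v) (pt w) (pt l) (pt r) \<longrightarrow>
        snd (col (l, v)) = snd (col (v, w)) \<and> snd (col (r, v)) = snd (col (v, w)) \<and>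
        fst (col (v, w)) = fst (col (r, v)) \<otimes>\<^bsub>G\<^esub> fst (col (l, v))) \<and>
     (\<forall>v l r w.
        (v, l) \<in> D \<and> (v, r) \<in> D \<and> (w, v) \<in> D \<and> trivalent D v \<and>
        ccw (pt v) (pt w) (pt r) (pt l) \<longrightarrow>
        snd (col (v, l)) = snd (col (w, v)) \<and> snd (col (v, r)) = snd (col (w, v)) \<and>
        fst (col (w, v)) = fst (col (v, r)) \<otimes>\<^bsub>G\<^esub> fst (col (v, l)))}"

definition image_subfamily ::
  "('g, 'm) monoid_scheme \<Rightarrow> 'x set \<Rightarrow> ('g \<Rightarrow> 'x \<Rightarrow> 'x \<Rightarrow> 'x) \<Rightarrow> diagram \<Rightarrow> (seg set \<Rightarrow> 'g \<times> 'x) \<Rightarrow> 'x set"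
  where
  "image_subfamily G X q D f =
     \<Inter>{Y. G_subfamily G X q Y \<and> f ` arcs D \<subseteq> carrier G \<times> Y}"

text \<open>The intersection is itself such a subfamily, hence the smallest one.\<close>

lemma G_subfamily_Inter:
  assumes "\<Y> \<noteq> {}" and sub: "\<And>Y. Y \<in> \<Y> \<Longrightarrow> G_subfamily G X q Y" and X: "G_family G X q"
  shows "G_subfamily G X q (\<Inter>\<Y>)"
proof -
  define I where "I = \<Inter>\<Y>"
  have I_iff: "x \<in> I \<longleftrightarrow> (\<forall>Y\<in>\<Y>. x \<in> Y)" for x by (simp add: I_def)
  have YX: "Y \<subseteq> X" if "Y \<in> \<Y>" for Y using sub[OF that] by (simp add: G_subfamily_def)
  obtain Z where Z: "Z \<in> \<Y>" using assms(1) by blast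
  have IX: "I \<subseteq> X" using YX[OF Z] Z by (auto simp: I_iff)
  have restrict2: "\<forall>x\<in>I. \<forall>y\<in>I. P x y" if "\<forall>x\<in>X. \<forall>y\<in>X. P x y" for P
    using that IX by blast
  have restrict3: "\<forall>x\<in>I. \<forall>y\<in>I. \<forall>z\<in>I. P x y z" if "\<forall>x\<in>X. \<forall>y\<in>X. \<forall>z\<in>X. P x y z" for P
    using that IX by blast
  have quandle_sub: "quandle I (q g)" if g: "g \<in> carrier G" for g
  proof -
    have QX: "quandle X (q g)" using X g by (simp add: G_family_def)
    have QY: "quandle Y (q g)" if "Y \<in> \<Y>" for Y
      using sub[OF that] g by (simp add: G_subfamily_def G_family_def)
    have closed: "\<forall>x\<in>I. \<forall>y\<in>I. q g x y \<in> I"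
      using QY by (simp add: quandle_def I_iff)
    have division: "\<forall>x\<in>I. \<forall>y\<in>I. \<exists>!z. z \<in> I \<and> x = q g z y"
    proof (intro ballI)
      fix x y assume x: "x \<in> I" and y: "y \<in> I"
      have "\<exists>!z. z \<in> X \<and> x = q g z y"
        using QX subsetD[OF IX x] subsetD[OF IX y] by (simp add: quandle_def)
      then obtain z where z: "z \<in> X" "x = q g z y"
        and uniq: "\<And>u. u \<in> X \<Longrightarrow> x = q g u y \<Longrightarrow> u = z"
        by (elim ex1E) blast
      have "z \<in> Y" if Y: "Y \<in> \<Y>" for Y
      proof -
        have "x \<in> Y" "y \<in> Y" using x y Y by (auto simp: I_iff)
        then have "\<exists>!z'. z' \<in> Y \<and> x = q g z' y" using QY[OF Y] by (simp add: quandle_def)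
        then obtain z' where z': "z' \<in> Y" "x = q g z' y" by (elim ex1E conjE)
        have "z' = z" using subsetD[OF YX[OF Y] z'(1)] z'(2) by (rule uniq)
        then show ?thesis using z'(1) by simp
      qed
      then have "z \<in> I" by (simp add: I_iff)
      then show "\<exists>!z. z \<in> I \<and> x = q g z y"
        using z(2) uniq subsetD[OF IX] by blast
    qed
    have "\<forall>x\<in>X. q g x x = x"
      using QX unfolding quandle_def by (elim conjE)
    then have idem: "\<forall>x\<in>I. q g x x = x" using IX by blast
    have "\<forall>x\<in>X. \<forall>y\<in>X. \<forall>z\<in>X. q g (q g x y) z = q g (q g x z) (q g y z)"
      using QX unfolding quandle_def by (elim conjE)
    then have "\<forall>x\<in>I. \<forall>y\<in>I. \<forall>z\<in>I. q g (q g x y) z = q g (q g x z) (q g y z)"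
      by (rule restrict3)
    then show ?thesis unfolding quandle_def by (intro conjI closed idem division)
  qed
  have "G_family G I q"
    unfolding G_family_def
  proof (intro conjI)
    show "\<forall>g\<in>carrier G. quandle I (q g)" using quandle_sub by simp
    show "\<forall>g\<in>carrier G. \<forall>x\<in>I. q g x x = x"
      using quandle_sub by (simp add: quandle_def)
    have mult: "\<forall>g\<in>carrier G. \<forall>h\<in>carrier G. \<forall>x\<in>X. \<forall>y\<in>X.
        q (g \<otimes>\<^bsub>G\<^esub> h) x y = q h (q g x y) y"
      using X unfolding G_family_def by (elim conjE)
    show "\<forall>g\<in>carrier G. \<forall>h\<in>carrier G. \<forall>x\<in>I. \<forall>y\<in>I. q (g \<otimes>\<^bsub>G\<^esub> h) x y = q h (q g x y) y"
      by (rule ballI, rule ballI, rule restrict2, rule bspec[OF bspec[OF mult]])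
    have one: "\<forall>x\<in>X. \<forall>y\<in>X. q \<one>\<^bsub>G\<^esub> x y = x"
      using X unfolding G_family_def by (elim conjE)
    show "\<forall>x\<in>I. \<forall>y\<in>I. q \<one>\<^bsub>G\<^esub> x y = x"
      by (rule restrict2[OF one])
    have conj: "\<forall>g\<in>carrier G. \<forall>h\<in>carrier G. \<forall>x\<in>X. \<forall>y\<in>X. \<forall>z\<in>X.
        q h (q g x y) z = q (inv\<^bsub>G\<^esub> h \<otimes>\<^bsub>G\<^esub> g \<otimes>\<^bsub>G\<^esub> h) (q h x z) (q h y z)"
      using X unfolding G_family_def by (elim conjE)
    show "\<forall>g\<in>carrier G. \<forall>h\<in>carrier G. \<forall>x\<in>I. \<forall>y\<in>I. \<forall>z\<in>I.
        q h (q g x y) z = q (inv\<^bsub>G\<^esub> h \<otimes>\<^bsub>G\<^esub> g \<otimes>\<^bsub>G\<^esub> h) (q h x z) (q h y z)"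
      by (rule ballI, rule ballI, rule restrict3, rule bspec[OF bspec[OF conj]])
  qed
  then show ?thesis using IX by (simp add: G_subfamily_def I_def)
qed

lemma image_subfamily_smallest:
  assumes X: "G_family G X q" and f: "f \<in> colorings G X q D"
  shows "G_subfamily G X q (image_subfamily G X q D f)"
    and "f ` arcs D \<subseteq> carrier G \<times> image_subfamily G X q D f"
    and "G_subfamily G X q Y \<Longrightarrow> f ` arcs D \<subseteq> carrier G \<times> Y \<Longrightarrow> image_subfamily G X q D f \<subseteq> Y"
proof -
  have "f \<in> arcs D \<rightarrow>\<^sub>E carrier G \<times> X" using f unfolding colorings_def by blast
  then have *: "f ` arcs D \<subseteq> carrier G \<times> X" by (simp add: PiE_iff image_subset_iff)
  have **: "G_subfamily G X q X" using X unfolding G_subfamily_def by blast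
  show "G_subfamily G X q (image_subfamily G X q D f)"
    unfolding image_subfamily_def using * ** by (intro G_subfamily_Inter[OF _ _ X]) blast+
  show "f ` arcs D \<subseteq> carrier G \<times> image_subfamily G X q D f"
    unfolding image_subfamily_def using * ** by fastforce
  show "G_subfamily G X q Y \<Longrightarrow> f ` arcs D \<subseteq> carrier G \<times> Y \<Longrightarrow> image_subfamily G X q D f \<subseteq> Y"
    unfolding image_subfamily_def by blast
qed

text \<open>
  The set of colorings is finite for finite \<open>G\<close> and \<open>X\<close>; \<open>mset_set\<close> of it has every coloring once.
\<close>

definition G_family_invariant ::
  "('g, 'm) monoid_scheme \<Rightarrow> 'x set \<Rightarrow> ('g \<Rightarrow> 'x \<Rightarrow> 'x \<Rightarrow> 'x) \<Rightarrow> diagram \<Rightarrow>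
   ('g \<Rightarrow>\<^sub>0 int) poly poly multiset" where
  "G_family_invariant G X q D =
     image_mset (\<lambda>f. G_subfamily_poly G X q (image_subfamily G X q D f))
       (mset_set (colorings G X q D))"

definition assoc_invariant ::
  "('g, 'm) monoid_scheme \<Rightarrow> 'x set \<Rightarrow> ('g \<Rightarrow> 'x \<Rightarrow> 'x \<Rightarrow> 'x) \<Rightarrow> diagram \<Rightarrow> int poly poly multiset" where
  "assoc_invariant G X q D =
     image_mset (\<lambda>f. assoc_subquandle_poly G X q (image_subfamily G X q D f))
       (mset_set (colorings G X q D))"

end

theory Submission
  imports Defs
begin

text \<open>
  Reversing the orientation of an edge amounts to inverting the group component of its color, so
  colorings correspond to orientation-free colorings of directed segments. A local move replaces the
  part of a diagram inside a disc; its colorings can be solved explicitly in terms of the colors at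
  the boundary, and both sides of the move lead to the same condition on these. The signs of the
  crossings and the cyclic orders at the vertices that enter the computation are related through the
  two sides of polygonal paths cutting the disc: the side of a boundary point depends only on its
  position relative to the end points of the path on the circle, and the side of a point does not
  change along an edge that avoids the path. The resulting correspondence of colorings is the same
  for all subfamilies of \<open>(G, X)\<close>, hence it preserves the image subfamily, and with it both
  polynomials, coloring by coloring.
\<close>

section \<open>Cyclic order of rays\<close>

text \<open>A move lists its strands, but neither the signs of its crossings nor the cyclic orders
  at its vertices: a picture and its mirror image fit the same description. Planarity ties these
  data together within one picture, while two pictures of a move share only the positions of the
  ends on the circle. So every sign has to be traced back to the ends, which requires that a path
  has two sides in the disc. In place of the Jordan curve theorem an angle is used: seen from a
  point, the angle swept by the path minus that of its chord, shifted by a half-turn, is an odd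
  multiple of \<open>pi\<close>. Such a number cannot vary continuously. It is evaluated at points
  of the circle, where only the ends enter, and close to an inner node, where it tells the left of
  the path from its right.

  Without the passage to directed segments, each move would split into as many cases as it has
  admissible orientations. With it, each move depends on one or two Booleans, and for all their
  values its two sides impose the same condition on the boundary colors.\<close>

lemma Arg2pi_div_div:
  assumes "a \<noteq> 0" "b \<noteq> 0" "d \<noteq> 0"
  shows "Arg2pi (d / b) =
    (if Arg2pi (b / a) \<le> Arg2pi (d / a) then Arg2pi (d / a) - Arg2pi (b / a)
     else Arg2pi (d / a) - Arg2pi (b / a) + 2 * pi)"
proof -
  let ?x = "d / a" and ?y = "b / a"
  have "?x / ?y = d / b" using assms by simp
  moreover have "?x \<noteq> 0" "?y \<noteq> 0" using assms by auto
  ultimately show ?thesis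
    using Arg2pi_divide[of ?x ?y] Arg2pi_divide[of ?y ?x] Arg2pi_inverse[of "?y / ?x"] Arg2pi_lt_2pi
      Arg2pi_diff[of ?x ?y] by auto
qed

text \<open>Division by zero and \<open>Arg2pi 0\<close> both give 0, so a point at the centre has
  angle 0 and cannot satisfy the strict inequalities.\<close>

lemma ccw_distinct:
  assumes "ccw c a b d"
  shows "a \<noteq> c" "b \<noteq> c" "d \<noteq> c" "a \<noteq> b" "b \<noteq> d" "a \<noteq> d"
  using assms Arg2pi_of_real[of 1] by (auto simp: ccw_def split: if_splits)

text \<open>Measured from \<open>b\<close> instead of \<open>a\<close>, the angle of
  \<open>d\<close> drops by that of \<open>b\<close>, and \<open>a\<close> itself moves to the full
  turn minus the angle of \<open>b\<close>, hence behind \<open>d\<close>.\<close>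

lemma ccw_rotate:
  assumes "ccw c a b d"
  shows "ccw c b d a"
proof -
  note ne = ccw_distinct[OF assms]
  have "Arg2pi ((d - c) / (b - c)) = Arg2pi ((d - c) / (a - c)) - Arg2pi ((b - c) / (a - c))"
    using Arg2pi_div_div[of "a - c" "b - c" "d - c"] ne assms by (auto simp: ccw_def)
  moreover have "Arg2pi ((a - c) / (b - c)) = 2 * pi - Arg2pi ((b - c) / (a - c))"
    using Arg2pi_div_div[of "a - c" "b - c" "a - c"] ne assms Arg2pi_of_real[of 1]
    by (auto simp: ccw_def)
  ultimately show ?thesis
    using assms Arg2pi_lt_2pi[of "(d - c) / (a - c)"] by (auto simp: ccw_def)
qed

lemma ccw_rotate_eq: "ccw c a b d \<longleftrightarrow> ccw c b d a"
  using ccw_rotate by blast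

lemma ccw_asym: "ccw c a b d \<Longrightarrow> \<not> ccw c a d b"
  by (auto simp: ccw_def)

text \<open>Also true when \<open>a\<close> or \<open>b\<close> equals \<open>c\<close>, because
  division by zero gives 0. Its negation therefore includes that both points differ from
  \<open>c\<close>.\<close>

definition same_ray :: "complex \<Rightarrow> complex \<Rightarrow> complex \<Rightarrow> bool" where
  "same_ray c a b \<longleftrightarrow> Arg2pi ((b - c) / (a - c)) = 0"

lemma same_ray_sym: "same_ray c a b \<Longrightarrow> same_ray c b a"
  using Arg2pi_inverse_eq_0[of "(b - c) / (a - c)"] by (simp add: same_ray_def)

lemma ccw_total:
  assumes "\<not> same_ray c a b" "\<not> same_ray c a d" "\<not> same_ray c b d"
  shows "ccw c a d b \<longleftrightarrow> \<not> ccw c a b d"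
proof -
  have ne: "a - c \<noteq> 0" "b - c \<noteq> 0" "d - c \<noteq> 0"
    using assms by (auto simp: same_ray_def)
  have pos: "0 < Arg2pi ((b - c) / (a - c))" "0 < Arg2pi ((d - c) / (a - c))"
    using assms Arg2pi_ge_0 by (auto simp: same_ray_def less_le)
  have "Arg2pi ((b - c) / (a - c)) \<noteq> Arg2pi ((d - c) / (a - c))"
    using Arg2pi_div_div[OF ne(1,2,3)] assms(3) by (auto simp: same_ray_def)
  then show ?thesis using pos by (auto simp: ccw_def)
qed

text \<open>The quotient of the two difference vectors is a positive real \<open>t\<close>;
  comparing \<open>t\<close> with 1 decides which of the points is nearer to
  \<open>c\<close>.\<close>

lemma same_rayI_segments:
  assumes "same_ray c a b" "a \<noteq> c" "b \<noteq> c"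
  shows "a \<in> closed_segment c b \<or> b \<in> closed_segment c a"
proof -
  have r: "(b - c) / (a - c) \<in> \<real>" "0 \<le> Re ((b - c) / (a - c))"
    using assms(1) by (auto simp: same_ray_def Arg2pi_eq_0)
  define t where "t = Re ((b - c) / (a - c))"
  have "(b - c) / (a - c) = of_real t" using r(1) by (simp add: t_def of_real_Re)
  then have b: "b = c + t *\<^sub>R (a - c)" using assms(2) by (simp add: field_simps scaleR_conv_of_real)
  have "t \<ge> 0" using r(2) by (simp add: t_def)
  then have t: "t > 0" using assms(3) b by (cases "t = 0") auto
  show ?thesis
  proof (cases "t \<le> 1")
    case True
    have "b = (1 - t) *\<^sub>R c + t *\<^sub>R a" using b by (simp add: algebra_simps)
    then show ?thesis using True t unfolding in_segment by (metis less_eq_real_def)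
  next
    case False
    have "a = (1 - 1/t) *\<^sub>R c + (1/t) *\<^sub>R b" using t unfolding b
      by (simp add: algebra_simps)
    then show ?thesis using False t unfolding in_segment
      by (intro disjI1 exI[of _ "1/t"]) auto
  qed
qed

text \<open>The hypothesis says that the ends of the two strands alternate around \<open>c\<close>,
  a relation that is symmetric in the strands. It allows a crossing to be examined along its
  under-strand: for \<open>p\<close> left and right are exchanged, for \<open>p'\<close> they are
  kept.\<close>

lemma crossing_symmetric:
  assumes "on_left p c p' u \<and> on_right p c p' u' \<or> on_right p c p' u \<and> on_left p c p' u'"
  shows "on_left u c u' p \<longleftrightarrow> on_right p c p' u" "on_right u c u' p \<longleftrightarrow> on_left p c p' u"
    "on_left u c u' p' \<longleftrightarrow> on_left p c p' u" "on_right u c u' p' \<longleftrightarrow> on_right p c p' u"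
proof -
  \<comment> \<open>Two triples sharing \<open>x\<close> and \<open>y\<close> merge into the cyclic
    order \<open>x\<close>, \<open>u\<close>, \<open>y\<close>, \<open>v\<close>.\<close>
  have ord: "ccw c x u y \<Longrightarrow> ccw c y v x \<Longrightarrow> ccw c v x u \<and> ccw c u y v" for x y u v
  proof -
    assume *: "ccw c x u y" "ccw c y v x"
    have "ccw c x y v" using *(2) ccw_rotate by blast
    then have "ccw c x u v" using *(1) by (auto simp: ccw_def)
    moreover have "ccw c v x y" using \<open>ccw c x y v\<close> ccw_rotate by blast
    have "ccw c y x u" using *(1) ccw_rotate by blast
    then have "ccw c y v u" using *(2) by (auto simp: ccw_def)
    ultimately show "ccw c v x u \<and> ccw c u y v" using ccw_rotate by blast
  qed
  have "on_left p c p' u \<Longrightarrow> on_right p c p' u' \<Longrightarrow> on_right u c u' p \<and> on_left u c u' p'"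
    unfolding on_left_def on_right_def using ord[of p' u p u'] ccw_rotate by blast
  moreover have "on_right p c p' u \<Longrightarrow> on_left p c p' u' \<Longrightarrow> on_left u c u' p \<and> on_right u c u' p'"
    unfolding on_left_def on_right_def using ord[of p u p' u'] ccw_rotate by blast
  moreover have "\<not> (on_left p c p' u \<and> on_right p c p' u)" for p p' u
    unfolding on_left_def on_right_def using ccw_rotate ccw_asym by blast
  ultimately show "on_left u c u' p \<longleftrightarrow> on_right p c p' u" "on_right u c u' p \<longleftrightarrow> on_left p c p' u"
    "on_left u c u' p' \<longleftrightarrow> on_left p c p' u" "on_right u c u' p' \<longleftrightarrow> on_right p c p' u"
    using assms by blast+
qed

section \<open>Sides of a polygonal path in a disc\<close>

fun poly_image :: "complex list \<Rightarrow> complex set" where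
  "poly_image (p # p' # ps) = closed_segment p p' \<union> poly_image (p' # ps)"
| "poly_image [p] = {p}"
| "poly_image [] = {}"

fun simple_poly :: "complex list \<Rightarrow> bool" where
  "simple_poly (p # p' # ps) \<longleftrightarrow>
     p \<noteq> p' \<and> closed_segment p p' \<inter> poly_image (p' # ps) = {p'} \<and> simple_poly (p' # ps)"
| "simple_poly ps \<longleftrightarrow> True"

text \<open>The signed angle under which the path is seen from \<open>u\<close>. Each term is a
  principal argument, which jumps only where \<open>u\<close> crosses the corresponding
  segment.\<close>

fun swept_angle :: "complex list \<Rightarrow> complex \<Rightarrow> real" where
  "swept_angle (p # p' # ps) u = Arg ((p' - u) / (p - u)) + swept_angle (p' # ps) u"
| "swept_angle ps u = 0"

lemma poly_image_append: "poly_image (xs @ p # ys) = poly_image (xs @ [p]) \<union> poly_image (p # ys)"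
proof (induction xs)
  case Nil
  then show ?case by (cases ys) auto
next
  case (Cons x xs)
  then show ?case by (cases xs) (auto simp: )
qed

lemma swept_angle_append:
  "swept_angle (xs @ p # ys) u = swept_angle (xs @ [p]) u + swept_angle (p # ys) u"
proof (induction xs)
  case (Cons x xs)
  then show ?case by (cases xs) auto
qed auto

lemma set_subset_poly_image: "set ps \<subseteq> poly_image ps"
proof (induction ps rule: poly_image.induct)
  case (1 p p' ps)
  then show ?case by auto
qed auto

lemma simple_poly_append:
  assumes "simple_poly (xs @ c # ys)"
  shows "poly_image (xs @ [c]) \<inter> poly_image (c # ys) = {c} \<and> simple_poly (xs @ [c]) \<and> simple_poly (c # ys)"
  using assms
proof (induction xs)
  case Nil
  have "c \<in> poly_image (c # ys)" using set_subset_poly_image[of "c # ys"] by auto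
  then show ?case using Nil by simp
next
  case (Cons x xs)
  show ?case
  proof (cases xs)
    case Nil
    then show ?thesis using Cons by auto
  next
    case (Cons x' xs')
    have IH: "poly_image (x' # xs' @ [c]) \<inter> poly_image (c # ys) = {c}" "simple_poly (x' # xs' @ [c])"
      "simple_poly (c # ys)"
      using Cons.IH Cons.prems Cons by auto
    have app: "poly_image (x' # xs' @ c # ys) = poly_image (x' # xs' @ [c]) \<union> poly_image (c # ys)"
      using poly_image_append[of "x' # xs'" c ys] by simp
    have x': "x \<noteq> x'" "closed_segment x x' \<inter> poly_image (x' # xs' @ c # ys) = {x'}"
      using Cons.prems Cons by auto
    have "x' \<in> poly_image (x' # xs' @ [c])" using set_subset_poly_image[of "x' # xs' @ [c]"] by auto
    then show ?thesis using IH app x' Cons by auto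
  qed
qed

lemma simple_poly_before:
  assumes "simple_poly (xs @ p # c # ys)"
  shows "poly_image (xs @ [p]) \<inter> poly_image (c # ys) = {}" "p \<noteq> c"
    "closed_segment p c \<inter> poly_image (c # ys) = {c}"
proof -
  have 1: "poly_image (xs @ [p]) \<inter> poly_image (p # c # ys) = {p}" "simple_poly (p # c # ys)"
    using simple_poly_append[OF assms] by auto
  show "p \<noteq> c" "closed_segment p c \<inter> poly_image (c # ys) = {c}" using 1 by auto
  then have "p \<notin> poly_image (c # ys)"
    by (metis Int_iff ends_in_segment(1) singletonD)
  then show "poly_image (xs @ [p]) \<inter> poly_image (c # ys) = {}" using 1(1) by auto
qed

section \<open>Continuity and values of the swept angle\<close>

lemma not_nonpos_if_off_segment:
  fixes u :: complex
  assumes "u \<notin> closed_segment p p'"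
  shows "(p' - u) / (p - u) \<notin> \<real>\<^sub>\<le>\<^sub>0"
proof
  assume "(p' - u) / (p - u) \<in> \<real>\<^sub>\<le>\<^sub>0"
  then obtain s where s: "s \<le> 0" "(p' - u) / (p - u) = of_real s"
    by (auto elim: nonpos_Reals_cases)
  have "p \<noteq> u" using assms by auto
  then have "p' - u = s *\<^sub>R (p - u)"
    using s nonzero_divide_eq_eq[of "p - u" "p' - u" "of_real s"] by (simp add: scaleR_conv_of_real)
  then have eq: "(1 - s) *\<^sub>R u = p' - s *\<^sub>R p" by (simp add: algebra_simps)
  \<comment> \<open>Solving the equation for \<open>u\<close> exhibits it as the convex combination
    of \<open>p\<close> and \<open>p'\<close> with weight \<open>1 / (1 - s)\<close> on
    \<open>p'\<close>.\<close>
  have "u = (1 / (1 - s)) *\<^sub>R ((1 - s) *\<^sub>R u)" using s by simp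
  also have "\<dots> = (- (s / (1 - s))) *\<^sub>R p + (1 / (1 - s)) *\<^sub>R p'"
    unfolding eq by (simp add: scaleR_right_diff_distrib)
  also have "- (s / (1 - s)) = 1 - 1 / (1 - s)" using s by (simp add: field_simps)
  finally have "u \<in> closed_segment p p'"
    using s unfolding in_segment by (intro exI[of _ "1 / (1 - s)"]) auto
  then show False using assms by simp
qed

lemma continuous_on_swept_angle:
  "S \<inter> poly_image ps = {} \<Longrightarrow> continuous_on S (swept_angle ps)"
proof (induction ps rule: poly_image.induct)
  case (1 p p' ps)
  have "continuous_on S (\<lambda>u. Arg ((p' - u) / (p - u)))"
  proof (rule continuous_on_Arg')
    show "continuous_on S (\<lambda>u. (p' - u) / (p - u))"
      using 1 by (intro continuous_intros) auto
    show "(p' - u) / (p - u) \<notin> \<real>\<^sub>\<le>\<^sub>0" if "u \<in> S" for u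
      using 1 that by (intro not_nonpos_if_off_segment) auto
  qed
  then show ?case using 1 by (auto intro!: continuous_intros)
qed auto

lemma cis_Arg_ratio: "x \<noteq> 0 \<Longrightarrow> y \<noteq> 0 \<Longrightarrow> cis (Arg (x / y)) = sgn x / sgn y"
  using cis_Arg[of "x / y"] by simp

lemma cis_swept_angle:
  assumes "u \<notin> poly_image ps" "ps \<noteq> []"
  shows "cis (swept_angle ps u) = sgn (last ps - u) / sgn (hd ps - u)"
  using assms
proof (induction ps rule: poly_image.induct)
  case (1 p p' ps)
  have "p \<noteq> u" "p' \<noteq> u" using 1 by auto
  then show ?case using 1 by (auto simp: cis_mult[symmetric] cis_Arg_ratio sgn_eq_0_iff)
qed (auto simp: sgn_eq_0_iff)

lemma cis_eq_minus_1D: "cis x = - 1 \<Longrightarrow> \<exists>k :: int. x = (2 * of_int k + 1) * pi"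
proof -
  assume "cis x = -1"
  then have "cos x = -1" by (auto simp: complex_eq_iff)
  then show ?thesis using cos_eq_minus1[of x] by (auto simp: algebra_simps)
qed

text \<open>The values are odd multiples of \<open>pi\<close>. Distinct ones are at least
  \<open>2 * pi\<close> apart, and a continuous function on a connected set cannot jump across such
  a gap.\<close>

lemma constant_angle:
  assumes "connected S" "continuous_on S f" "\<And>x. x \<in> S \<Longrightarrow> cis (f x) = - 1" "x \<in> S" "y \<in> S"
  shows "f x = (f y :: real)"
proof -
  have "\<exists>e>0. \<forall>y. y \<in> S \<and> f y \<noteq> f x \<longrightarrow> e \<le> norm (f y - f x)" if x: "x \<in> S" for x
  proof (intro exI[of _ pi] conjI allI impI)
    fix y assume y: "y \<in> S \<and> f y \<noteq> f x"
    obtain k l :: int where kl: "f x = (2 * of_int k + 1) * pi" "f y = (2 * of_int l + 1) * pi"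
      using cis_eq_minus_1D assms(3) x y by metis
    then have "f y - f x = (2 * of_int (l - k)) * pi" by (simp add: algebra_simps)
    moreover have "l \<noteq> k" using kl y by auto
    then have "\<bar>l - k\<bar> \<ge> 1" by linarith
    then have "real_of_int \<bar>l - k\<bar> \<ge> 1" by linarith
    then have "\<bar>2 * real_of_int (l - k)\<bar> \<ge> 1" by (simp add: abs_mult)
    then have "\<bar>2 * real_of_int (l - k)\<bar> * pi \<ge> 1 * pi" by (intro mult_right_mono) auto
    ultimately show "pi \<le> norm (f y - f x)" by (simp add: abs_mult)
  qed auto
  then have "f constant_on S"
    using continuous_discrete_range_constant[OF assms(1,2)] by blast
  then show ?thesis using assms(4,5) by (auto simp: constant_on_def)
qed

section \<open>The disc seen from a point of its circle\<close>

lemma Arg_divide_half_plane: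
  assumes "Re (x / v) > 0" "Re (y / v) > 0"
  shows "Arg (y / x) = Arg (y / v) - Arg (x / v)"
proof -
  have v: "v \<noteq> 0" "x \<noteq> 0" "y \<noteq> 0" using assms by auto
  have "\<bar>Arg (x / v)\<bar> < pi / 2" "\<bar>Arg (y / v)\<bar> < pi / 2" using assms Arg_Re_pos by auto
  moreover have "(y / v) / (x / v) = y / x" using v by simp
  moreover have "rcis (cmod (y / v) / cmod (x / v)) (Arg (y / v) - Arg (x / v)) = (y / v) / (x / v)"
    using rcis_divide[of "cmod (y / v)" "Arg (y / v)" "cmod (x / v)" "Arg (x / v)"]
    by (simp only: rcis_cmod_Arg)
  moreover have "cmod (y / v) / cmod (x / v) > 0" using v by auto
  \<comment> \<open>Each argument is below \<open>pi / 2\<close> in absolute value, so the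
    difference is again a principal argument and no multiple of \<open>2 * pi\<close> has to be
    corrected.\<close>
  moreover have "Arg (y / v) - Arg (x / v) \<in> {-pi<..pi}" using calculation(1,2) by auto
  ultimately show ?thesis
    using Arg_unique'[of "cmod (y / v) / cmod (x / v)" "Arg (y / v) - Arg (x / v)" "y / x"]
    by metis
qed

text \<open>The tangent at \<open>e\<close> bounds a half-plane containing the rest of the disc.
  Comparing the squared distances of \<open>z\<close> from \<open>p\<close> and from
  \<open>e\<close> gives the sign of the inner product of \<open>p - e\<close> with the inward
  normal.\<close>

lemma half_plane_from_sphere:
  fixes z :: complex
  assumes "e \<in> sphere z r" "p \<in> cball z r" "p \<noteq> e"
  shows "Re ((p - e) / (z - e)) > 0"
proof -
  have r: "cmod (z - e) = r" "cmod (z - p) \<le> r" using assms by (auto simp: dist_norm)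
  have "z \<noteq> e" using r assms(3) by auto
  have "(cmod (z - p))\<^sup>2 \<le> (cmod (z - e))\<^sup>2" using r by (simp add: power_mono)
  moreover have "(cmod (z - p))\<^sup>2 = (cmod (z - e))\<^sup>2 + (cmod (p - e))\<^sup>2 - 2 * Re ((p - e) * cnj (z - e))"
    by (simp only: cmod_power2) (simp add: power2_eq_square algebra_simps)
  moreover have "(cmod (p - e))\<^sup>2 > 0" using assms(3) by simp
  ultimately have "Re ((p - e) * cnj (z - e)) > 0" by linarith
  then show ?thesis using \<open>z \<noteq> e\<close> by (simp add: Re_complex_div_gt_0)
qed

text \<open>From a point of the circle everything is seen within a half-plane, so the arguments of
  the segments telescope: the shape of the path does not matter, only its ends.\<close>

lemma swept_angle_from_sphere:
  assumes "e \<in> sphere z r" "set ps \<subseteq> cball z r" "e \<notin> set ps" "ps \<noteq> []"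
  shows "swept_angle ps e = Arg ((last ps - e) / (hd ps - e))"
proof -
  have "swept_angle ps e = Arg ((last ps - e) / (z - e)) - Arg ((hd ps - e) / (z - e))"
    using assms(2-4)
  proof (induction ps rule: poly_image.induct)
    case (1 p p' ps)
    have "Arg ((p' - e) / (p - e)) = Arg ((p' - e) / (z - e)) - Arg ((p - e) / (z - e))"
      using 1 assms(1) by (intro Arg_divide_half_plane half_plane_from_sphere) auto
    then show ?case using 1 by auto
  qed auto
  also have "\<dots> = Arg ((last ps - e) / (hd ps - e))"
    using assms(2,3) hd_in_set[OF assms(4)] last_in_set[OF assms(4)]
    by (intro Arg_divide_half_plane[symmetric] half_plane_from_sphere[OF assms(1)]) (auto dest: subsetD)
  finally show ?thesis .
qed

section \<open>The chord between the ends of a path\<close>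

lemma chord_ratio:
  fixes z :: complex
  assumes "a \<in> sphere z r" "a' \<in> sphere z r" "a \<noteq> a'" "u \<in> cball z r" "u \<noteq> a" "u \<noteq> a'"
  shows "- (a' - u) / (a - u) \<notin> \<real>\<^sub>\<le>\<^sub>0"
proof
  assume "- (a' - u) / (a - u) \<in> \<real>\<^sub>\<le>\<^sub>0"
  then obtain s where s: "s \<le> 0" "- (a' - u) / (a - u) = of_real s"
    by (auto elim: nonpos_Reals_cases)
  then have "(a' - u) / (a - u) = of_real (- s)" by (metis minus_divide_left minus_equation_iff of_real_minus)
  then have "same_ray u a a'"
    using s(1) Arg2pi_of_real[of "- s"] by (simp add: same_ray_def)
  then have "a \<in> closed_segment u a' \<or> a' \<in> closed_segment u a"
    using assms by (intro same_rayI_segments) auto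
  \<comment> \<open>An end of the chord strictly between two points of the disc would be closer to
    the centre than the radius.\<close>
  then have "a \<in> open_segment u a' \<or> a' \<in> open_segment u a"
    using assms by (auto simp: open_segment_def)
  then show False
    using dist_decreases_open_segment[of a u a' z] dist_decreases_open_segment[of a' u a z] assms
    by (auto simp: dist_commute)
qed

text \<open>The angle of the chord, shifted by a half-turn: the minus sign moves the jump of
  \<open>Arg\<close> from the chord itself to its prolongations, which lie outside the disc.\<close>

definition chord_angle :: "complex \<Rightarrow> complex \<Rightarrow> complex \<Rightarrow> real" where
  "chord_angle a a' u = Arg (- (a' - u) / (a - u))"

definition cut :: "complex \<Rightarrow> real \<Rightarrow> complex list \<Rightarrow> bool" where
  "cut z r ps \<longleftrightarrow> simple_poly ps \<and> ps \<noteq> [] \<and> hd ps \<in> sphere z r \<and> last ps \<in> sphere z r \<and>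
     hd ps \<noteq> last ps \<and> set (tl (butlast ps)) \<subseteq> ball z r"

text \<open>
  For a path cutting a disc in two, this is \<open>\<pi>\<close> on its left and \<open>- \<pi>\<close> on its right: the two angles
  differ by an odd multiple of \<open>\<pi>\<close>, and off the path this multiple is locally constant because the
  chord angle has no jump inside the disc.
\<close>

definition side :: "complex list \<Rightarrow> complex \<Rightarrow> real" where
  "side ps u = swept_angle ps u - chord_angle (hd ps) (last ps) u"

lemma cut_subset: "cut z r ps \<Longrightarrow> set ps \<subseteq> cball z r"
proof -
  assume *: "cut z r ps"
  then have "2 \<le> length ps" unfolding cut_def by (cases ps; cases "tl ps") auto
  then have "ps = hd ps # tl (butlast ps) @ [last ps]"
    by (cases ps; cases "tl ps" rule: rev_cases) auto
  moreover have "set (hd ps # tl (butlast ps) @ [last ps]) \<subseteq> cball z r"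
    using * by (auto simp: cut_def)
  ultimately show ?thesis by metis
qed

lemma cis_chord_angle:
  assumes "u \<noteq> a" "u \<noteq> a'"
  shows "cis (chord_angle a a' u) = - (sgn (a' - u) / sgn (a - u))"
  using cis_Arg_ratio[of "- (a' - u)" "a - u"] assms sgn_minus[of "a' - u"]
  by (simp add: chord_angle_def)

lemma continuous_on_chord_angle:
  assumes "cut z r ps" "S \<subseteq> cball z r" "hd ps \<notin> S" "last ps \<notin> S"
  shows "continuous_on S (chord_angle (hd ps) (last ps))"
  unfolding chord_angle_def
proof (rule continuous_on_Arg')
  show "continuous_on S (\<lambda>u. - (last ps - u) / (hd ps - u))"
    using assms by (intro continuous_intros) auto
  show "- (last ps - u) / (hd ps - u) \<notin> \<real>\<^sub>\<le>\<^sub>0" if "u \<in> S" for u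
    using assms that by (intro chord_ratio[of _ z r]) (auto simp: cut_def)
qed

text \<open>The swept angle telescopes modulo \<open>2 * pi\<close> to the angle between the
  directions of the two ends; only the half-turn built into \<open>chord_angle\<close>
  remains.\<close>

lemma cis_side:
  assumes "u \<notin> poly_image ps" "ps \<noteq> []"
  shows "cis (side ps u) = - 1"
proof -
  have "hd ps \<noteq> u" "last ps \<noteq> u"
    using assms(1) set_subset_poly_image[of ps] hd_in_set[OF assms(2)] last_in_set[OF assms(2)] by blast+
  then show ?thesis
    using assms cis_swept_angle[OF assms] cis_chord_angle[of u "hd ps" "last ps"]
    by (simp add: side_def cis_divide[symmetric] sgn_eq_0_iff)
qed

lemma side_constant:
  assumes "cut z r ps" "connected S" "S \<subseteq> cball z r" "S \<inter> poly_image ps = {}" "u \<in> S" "v \<in> S"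
  shows "side ps u = side ps v"
proof (rule constant_angle[OF assms(2) _ _ assms(5,6)])
  have ps: "ps \<noteq> []" using assms(1) by (simp add: cut_def)
  then have "hd ps \<notin> S" "last ps \<notin> S" 
    using assms(4) set_subset_poly_image[of ps] hd_in_set[OF ps] last_in_set[OF ps] by blast+
  then show "continuous_on S (side ps)"
    unfolding side_def using assms
    by (intro continuous_on_diff continuous_on_swept_angle continuous_on_chord_angle[of z r]) auto
  show "cis (side ps x) = -1" if "x \<in> S" for x
    using cis_side ps assms(4) that by blast
qed

text \<open>The formula mentions the path only through its ends. It therefore agrees for paths in
  the two pictures of a move that join the same ends.\<close>

lemma side_on_sphere:
  assumes "cut z r ps" "e \<in> sphere z r" "e \<notin> set ps"
  shows "side ps e =
    Arg ((last ps - e) / (hd ps - e)) - chord_angle (hd ps) (last ps) e"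
  using swept_angle_from_sphere[OF assms(2) cut_subset[OF assms(1)] assms(3)] assms(1)
  by (simp add: side_def cut_def)

section \<open>The side of a point next to a node of the path\<close>

lemma Arg_uminus_Arg2pi: "0 < Arg2pi x \<Longrightarrow> Arg (- x) = Arg2pi x - pi"
  using Arg2pi_Ln[of x] by (cases "x = 0") (auto simp: Arg_eq_Im_Ln)

text \<open>Let a point move from \<open>c\<close> along the ray through \<open>u\<close>. In units
  of \<open>u - c\<close>, the vector from it to \<open>p\<close> is the vector from
  \<open>c\<close> to \<open>p\<close> minus a nonnegative real, so it never becomes a nonnegative
  real. Hence the arguments of these quotients are continuous all along the ray.\<close>

lemma not_nonpos_if_not_same_ray:
  assumes "\<not> same_ray c u p" "u \<noteq> c" "0 \<le> t"
  shows "- (u - c) / (p - (c + t *\<^sub>R (u - c))) \<notin> \<real>\<^sub>\<le>\<^sub>0" "- (p - (c + t *\<^sub>R (u - c))) / (u - c) \<notin> \<real>\<^sub>\<le>\<^sub>0"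
    "p - (c + t *\<^sub>R (u - c)) \<noteq> 0"
proof -
  define x where "x = (p - (c + t *\<^sub>R (u - c))) / (u - c)"
  have x: "x = (p - c) / (u - c) - of_real t"
    using assms(2) by (simp add: x_def scaleR_conv_of_real field_simps)
  have "\<not> (x \<in> \<real> \<and> 0 \<le> Re x)"
  proof
    assume *: "x \<in> \<real> \<and> 0 \<le> Re x"
    have "(p - c) / (u - c) = x + of_real t" using x by simp
    then have "(p - c) / (u - c) \<in> \<real> \<and> 0 \<le> Re ((p - c) / (u - c))" using * assms(3) by auto
    then show False using assms(1) by (simp add: same_ray_def Arg2pi_eq_0)
  qed
  then have x': "- x \<notin> \<real>\<^sub>\<le>\<^sub>0" by (auto simp: complex_nonpos_Reals_iff complex_is_Real_iff)
  then show "- (p - (c + t *\<^sub>R (u - c))) / (u - c) \<notin> \<real>\<^sub>\<le>\<^sub>0"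
    by (metis x_def minus_divide_left)
  show "p - (c + t *\<^sub>R (u - c)) \<noteq> 0" using x' by (auto simp: x_def)
  have "inverse (- x) \<notin> \<real>\<^sub>\<le>\<^sub>0" using x' by (metis nonpos_Reals_inverse_iff)
  moreover have "inverse (- x) = - (u - c) / (p - (c + t *\<^sub>R (u - c)))"
    by (simp add: x_def divide_simps)
  ultimately show "- (u - c) / (p - (c + t *\<^sub>R (u - c))) \<notin> \<real>\<^sub>\<le>\<^sub>0" by metis
qed

lemma not_same_ray_if_segments_meet_at_end:
  assumes "closed_segment c u \<inter> closed_segment c p \<subseteq> {c}" "u \<noteq> c" "p \<noteq> c"
  shows "\<not> same_ray c u p"
  using same_rayI_segments[of c u p] assms by auto

lemma point_on_ray: "u = c + t *\<^sub>R (p' - c) \<Longrightarrow> t \<in> {0..1} \<Longrightarrow> u \<in> closed_segment c p'" for u :: complex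
  unfolding in_segment by (auto simp: algebra_simps intro!: exI[of _ t])

text \<open>
  The limit of the side function at the inner node \<open>c\<close>, from the left: it is carried along the path
  from its start, where it can be computed.
\<close>

lemma left_angle_at_node:
  assumes "cut z r (xs @ p # c # p' # ys)"
  shows "swept_angle (xs @ [p]) c + Arg2pi ((p' - c) / (p - c)) + swept_angle (p' # ys) c
    - chord_angle (hd (xs @ [p])) (last (p' # ys)) c = pi"
  using assms
proof (induction xs arbitrary: p c p' ys rule: rev_induct)
  case Nil
  define S where "S = p' # ys"
  have simp: "simple_poly (p # c # p' # ys)" and a: "p \<in> sphere z r" "last S \<in> sphere z r" "p \<noteq> last S"
    using Nil by (auto simp: cut_def S_def)
  have ne: "p \<noteq> c" "c \<noteq> p'" and meet: "closed_segment p c \<inter> poly_image (c # p' # ys) = {c}"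
    "closed_segment c p' \<inter> poly_image (p' # ys) = {p'}"
    using simp by auto
  have sub: "set (p # c # p' # ys) \<subseteq> cball z r" using cut_subset[OF Nil] by simp
  have pseg: "c \<notin> poly_image S" using meet(2) ne by (metis Int_iff S_def ends_in_segment(1) singletonD)
  have off: "closed_segment p c \<inter> poly_image S = {}"
    using meet(1) pseg by (auto simp: S_def)
  have poff: "p \<notin> poly_image (c # p' # ys)"
    using meet(1) ne by (metis Int_iff ends_in_segment(1) singletonD)
  define w where "w = c - p"
  define pt where "pt t = p + t *\<^sub>R w" for t
  have pt_seg: "pt t \<in> closed_segment p c" if "t \<in> {0..1}" for t
    using point_on_ray[of "pt t" p t c] that by (simp add: pt_def w_def)
  have ray: "\<not> same_ray c p p'"
    using meet(1) ne by (intro not_same_ray_if_segments_meet_at_end) (auto simp: closed_segment_commute)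
  \<comment> \<open>The limit of \<open>side\<close> from the left at the point \<open>pt t\<close>
    of the first segment, which seen from its left subtends \<open>pi\<close>. In the next term
    \<open>c - pt t\<close>, and in the chord angle \<open>pt t - p\<close>, are replaced by their
    common direction \<open>w\<close>; this extends the formula to both ends of the segment.\<close>
  define f where "f t = pi + Arg ((p' - pt t) / w) + swept_angle S (pt t) - Arg ((last S - pt t) / w)" for t
  have c1: "(p' - pt t) / w \<notin> \<real>\<^sub>\<le>\<^sub>0" if "t \<in> {0..1}" for t
  proof -
    have "c + (1 - t) *\<^sub>R (p - c) = pt t" by (simp add: pt_def w_def algebra_simps)
    moreover have "(p' - x) / w = - (p' - x) / (p - c)" for x
      by (metis minus_diff_eq minus_divide_divide w_def)
    ultimately show ?thesis using not_nonpos_if_not_same_ray(2)[OF ray ne(1), of "1 - t"] that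
      by simp
  qed
  \<comment> \<open>For \<open>t = 0\<close> the point is on the circle and sees the disc within a
    half-plane; afterwards \<open>w\<close> is a positive multiple of \<open>pt t - p\<close>, and
    the chord has no jump inside the disc.\<close>
  have c2: "(last S - pt t) / w \<notin> \<real>\<^sub>\<le>\<^sub>0" if t: "t \<in> {0..1}" for t
  proof (cases "t = 0")
    case True
    have "Re ((c - p) / (z - p)) > 0" "Re ((last S - p) / (z - p)) > 0"
      using a sub ne by (auto intro!: half_plane_from_sphere[of p z r])
    then have "\<bar>Arg ((c - p) / (z - p))\<bar> < pi / 2" "\<bar>Arg ((last S - p) / (z - p))\<bar> < pi / 2"
      "Arg ((last S - p) / (c - p)) = Arg ((last S - p) / (z - p)) - Arg ((c - p) / (z - p))"
      using Arg_Re_pos Arg_divide_half_plane by auto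
    then have "Arg ((last S - p) / (c - p)) < pi" by linarith
    moreover have "(last S - p) / (c - p) \<noteq> 0" using a ne by auto
    ultimately show ?thesis using True
      by (auto simp: pt_def w_def complex_nonpos_Reals_iff Arg_eq_pi complex_eq_iff less_le)
  next
    case False
    then have t0: "t > 0" using t by auto
    have "pt t \<noteq> p" using t0 ne by (auto simp: pt_def w_def)
    moreover have "last S \<in> poly_image S"
      using set_subset_poly_image[of S] last_in_set[of S] unfolding S_def by blast
    then have "pt t \<noteq> last S" using pt_seg[OF t] off by auto
    moreover have "pt t \<in> cball z r"
      using pt_seg[OF t] sub closed_segment_subset[of p "cball z r" c] by auto
    ultimately have "- (last S - pt t) / (p - pt t) \<notin> \<real>\<^sub>\<le>\<^sub>0" using chord_ratio a by blast
    moreover have "- (last S - pt t) / (p - pt t) = ((last S - pt t) / w) / of_real t"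
      using t0 ne by (simp add: pt_def scaleR_conv_of_real w_def divide_simps)
    ultimately have "((last S - pt t) / w) / of_real t \<notin> \<real>\<^sub>\<le>\<^sub>0" by metis
    moreover have "x / of_real t \<in> \<real>\<^sub>\<le>\<^sub>0" if "x \<in> \<real>\<^sub>\<le>\<^sub>0" for x :: complex
      using that t0 by (simp add: complex_nonpos_Reals_iff divide_nonpos_pos)
    ultimately show ?thesis by blast
  qed
  have pt_c: "continuous_on A pt" for A unfolding pt_def by (intro continuous_intros)
  have "f 0 = f 1"
  proof (rule constant_angle[of "{0..1}" f])
    have "continuous_on {0..1} (\<lambda>t. swept_angle S (pt t))"
      by (rule continuous_on_compose2[OF continuous_on_swept_angle[of "closed_segment p c"] pt_c])
        (use off pt_seg in auto)
    then show "continuous_on {0..1} f"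
      unfolding f_def using c1 c2 ne
      by (intro continuous_intros continuous_on_Arg' pt_c) (auto simp: w_def)
    show "cis (f t) = -1" if t: "t \<in> {0..1}" for t
    proof -
      have off': "pt t \<notin> poly_image S" using off pt_seg[OF t] by auto
      then have n: "p' - pt t \<noteq> 0" "last S - pt t \<noteq> 0"
        using set_subset_poly_image[of S] last_in_set[of S] by (auto simp: S_def)
      then show ?thesis using cis_swept_angle[OF off'] ne
        by (simp add: f_def cis_mult[symmetric] cis_divide[symmetric] cis_Arg_ratio w_def S_def sgn_eq_0_iff)
    qed
  qed auto
  \<comment> \<open>At the start, on the circle, the swept angle of the remaining path equals the
    chord term, so only \<open>pi\<close> is left.\<close>
  moreover have "f 0 = pi"
  proof -
    have "swept_angle (c # p' # ys) p = Arg ((last S - p) / (c - p))"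
      using swept_angle_from_sphere[of p z r "c # p' # ys"] a sub
        contra_subsetD[OF set_subset_poly_image poff] by (simp add: S_def)
    then show ?thesis by (simp add: f_def pt_def w_def S_def)
  qed
  moreover have "pt 1 = c" by (simp add: pt_def w_def)
  moreover have "Arg2pi ((p' - c) / (p - c)) = pi + Arg ((p' - c) / w)"
  proof -
    have "0 < Arg2pi ((p' - c) / (p - c))" using ray Arg2pi_ge_0 by (auto simp: same_ray_def less_le)
    then have "Arg (- ((p' - c) / (p - c))) = Arg2pi ((p' - c) / (p - c)) - pi" by (rule Arg_uminus_Arg2pi)
    moreover have "- ((p' - c) / (p - c)) = (p' - c) / w" by (simp add: w_def minus_divide_right)
    ultimately show ?thesis by simp
  qed
  moreover have "chord_angle p (last S) c = Arg ((last S - c) / w)"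
    by (simp add: chord_angle_def w_def) (metis minus_diff_eq minus_divide_divide)
  ultimately show ?case by (simp add: f_def S_def)
next
  case (snoc x xs)
  define P where "P = xs @ [x]"
  define S where "S = p' # ys"
  have simp: "simple_poly (P @ p # c # S)" and cut: "cut z r (xs @ x # p # c # S)"
    using snoc.prems by (auto simp: cut_def P_def S_def)
  have IH: "swept_angle P p + Arg2pi ((c - p) / (x - p)) + swept_angle (c # S) p
      - chord_angle (hd P) (last S) p = pi"
    using snoc.IH[of x p c "p' # ys"] cut by (simp add: P_def S_def)
  have simp2: "simple_poly (p # c # S)" "simple_poly (xs @ x # p # c # S)"
    using simple_poly_append[OF simp] simp by (auto simp: P_def)
  have ne: "x \<noteq> p" "p \<noteq> c" "c \<noteq> p'" using simple_poly_before[OF simp2(2)] simp2(1) by (auto simp: S_def)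
  have m1: "closed_segment p c \<inter> poly_image P = {}"
    using simple_poly_before(1)[OF simp2(2)] by (auto simp: P_def)
  have "c \<notin> poly_image S"
  proof -
    have "closed_segment c p' \<inter> poly_image S = {p'}" using simp2(1) by (simp add: S_def)
    then show ?thesis using ne(3) ends_in_segment(1)[of c p'] by blast
  qed
  moreover have "closed_segment p c \<inter> (closed_segment c p' \<union> poly_image S) = {c}"
    using simp2(1) by (simp add: S_def)
  then have "closed_segment p c \<inter> poly_image S \<subseteq> {c}" by auto
  ultimately have m2: "closed_segment p c \<inter> poly_image S = {}" by auto
  have m3: "closed_segment x p \<inter> closed_segment p c \<subseteq> {p}" "closed_segment p c \<inter> closed_segment c p' \<subseteq> {c}"
    using simple_poly_before(3)[OF simp2(2)] simp2(1) by (auto simp: S_def)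
  have "closed_segment p c \<inter> closed_segment p x \<subseteq> {p}" "closed_segment c p \<inter> closed_segment c p' \<subseteq> {c}"
    using m3 closed_segment_commute[of p x] closed_segment_commute[of p c] by blast+
  then have ray1: "\<not> same_ray p c x" and ray2: "\<not> same_ray c p p'"
    using ne not_same_ray_if_segments_meet_at_end by auto
  have ends: "hd P \<in> set P" "last S \<in> set S"
    using hd_in_set[of P] last_in_set[of S] unfolding P_def S_def by blast+
  have sub: "set (P @ p # c # S) \<subseteq> cball z r" using cut_subset[OF cut] by (auto simp: P_def)
  define w where "w = c - p"
  define pt where "pt t = p + t *\<^sub>R w" for t
  have pt_seg: "pt t \<in> closed_segment p c" if "t \<in> {0..1}" for t
    using point_on_ray[of "pt t" p t c] that by (simp add: pt_def w_def)
  have pt_cball: "pt t \<in> cball z r" if "t \<in> {0..1}" for t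
    using pt_seg[OF that] sub closed_segment_subset[of p "cball z r" c] by auto
  \<comment> \<open>Again the limit from the left, now along the inner segment from \<open>p\<close>
    to \<open>c\<close>. For the adjacent segments the vectors from \<open>pt t\<close> to
    \<open>p\<close> and to \<open>c\<close> are replaced by their directions \<open>- w\<close> and
    \<open>w\<close>. The value at \<open>t = 0\<close> is the induction hypothesis at
    \<open>p\<close>, the value at \<open>t = 1\<close> the claim at \<open>c\<close>.\<close>
  define f where "f t = swept_angle P (pt t) + Arg (- w / (x - pt t)) + pi + Arg ((p' - pt t) / w)
    + swept_angle S (pt t) - chord_angle (hd P) (last S) (pt t)" for t
  have off: "pt t \<notin> poly_image P" "pt t \<notin> poly_image S" "hd P \<noteq> pt t" "last S \<noteq> pt t" "x \<noteq> pt t" "p' \<noteq> pt t"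
    if "t \<in> {0..1}" for t
    using m1 m2 pt_seg[OF that] set_subset_poly_image[of P] set_subset_poly_image[of S] ends
    by (auto simp: P_def S_def)
  have c1: "(p' - pt t) / w \<notin> \<real>\<^sub>\<le>\<^sub>0" if "t \<in> {0..1}" for t
  proof -
    have "c + (1 - t) *\<^sub>R (p - c) = pt t" by (simp add: pt_def w_def algebra_simps)
    moreover have "(p' - x) / w = - (p' - x) / (p - c)" for x
      by (metis minus_diff_eq minus_divide_divide w_def)
    ultimately show ?thesis using not_nonpos_if_not_same_ray(2)[OF ray2 ne(2), of "1 - t"] that
      by simp
  qed
  have c2: "- w / (x - pt t) \<notin> \<real>\<^sub>\<le>\<^sub>0" if "t \<in> {0..1}" for t
    using not_nonpos_if_not_same_ray(1)[OF ray1 ne(2)[symmetric], of t] that by (simp add: w_def pt_def)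
  have pt_c: "continuous_on A pt" for A unfolding pt_def by (intro continuous_intros)
  have "f 0 = f 1"
  proof (rule constant_angle[of "{0..1}" f])
    have "continuous_on {0..1} (\<lambda>t. swept_angle S (pt t))"
      by (rule continuous_on_compose2[OF continuous_on_swept_angle[of "closed_segment p c"] pt_c])
        (use m2 pt_seg in auto)
    moreover have "continuous_on {0..1} (\<lambda>t. swept_angle P (pt t))"
      by (rule continuous_on_compose2[OF continuous_on_swept_angle[of "closed_segment p c"] pt_c])
        (use m1 pt_seg in auto)
    moreover have "continuous_on {0..1} (\<lambda>t. chord_angle (hd P) (last S) (pt t))"
    proof (rule continuous_on_compose2[OF _ pt_c])
      have "hd P = hd (xs @ x # p # c # S)" "last S = last (xs @ x # p # c # S)"
        by (auto simp: P_def S_def hd_append)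
      then show "continuous_on (pt ` {0..1}) (chord_angle (hd P) (last S))"
        using continuous_on_chord_angle[OF cut, of "pt ` {0..1}"] off(3,4) pt_cball by fastforce
    qed auto
    ultimately show "continuous_on {0..1} f"
      unfolding f_def using c1 c2 ne off(5)
      by (intro continuous_intros continuous_on_Arg' pt_c) (auto simp: w_def)
    show "cis (f t) = -1" if t: "t \<in> {0..1}" for t
      using cis_swept_angle[OF off(1)[OF t]] cis_swept_angle[OF off(2)[OF t]] off(3-6)[OF t] ne
        cis_chord_angle[of "pt t" "hd P" "last S"] sgn_minus[of w]
        cis_Arg_ratio[of "- w" "x - pt t"] cis_Arg_ratio[of "p' - pt t" w]
      by (simp add: f_def cis_mult[symmetric] cis_divide[symmetric] w_def S_def P_def sgn_eq_0_iff)
  qed auto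
  moreover have "pt 0 = p" "pt 1 = c" by (auto simp: pt_def w_def)
  moreover have "Arg (- w / (x - p)) + pi = Arg2pi ((c - p) / (x - p))"
  proof -
    have "0 < Arg2pi ((c - p) / (x - p))"
      using ray1 same_ray_sym[of p x c] Arg2pi_ge_0 by (auto simp: same_ray_def less_le)
    then show ?thesis using Arg_uminus_Arg2pi[of "(c - p) / (x - p)"]
      unfolding w_def minus_divide_left by simp
  qed
  moreover have "pi + Arg ((p' - c) / w) = Arg2pi ((p' - c) / (p - c))"
  proof -
    have "0 < Arg2pi ((p' - c) / (p - c))" using ray2 Arg2pi_ge_0 by (auto simp: same_ray_def less_le)
    then have "Arg (- ((p' - c) / (p - c))) = Arg2pi ((p' - c) / (p - c)) - pi" by (rule Arg_uminus_Arg2pi)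
    moreover have "- ((p' - c) / (p - c)) = (p' - c) / w" by (simp add: w_def minus_divide_right)
    ultimately show ?thesis by simp
  qed
  moreover have "- w / (x - c) = (p - c) / (x - c)" by (simp add: w_def)
  moreover have "swept_angle (P @ [p]) c = swept_angle P c + Arg ((p - c) / (x - c))"
    using swept_angle_append[of xs x "[p]" c] by (simp add: P_def)
  moreover have "hd (xs @ [x, p]) = hd (xs @ [x])" by (cases xs) auto
  ultimately show ?case using IH by (simp add: f_def S_def w_def P_def)
qed

text \<open>From a point close to \<open>c\<close> on the ray through \<open>u\<close>, the node is
  seen in the direction \<open>c - u\<close>. Turning from \<open>p\<close> to \<open>p'\<close> by
  way of that direction is the counterclockwise turn from \<open>p\<close> to \<open>p'\<close> if
  \<open>u\<close> is on the left, and otherwise a full turn less.\<close>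

lemma node_angle:
  assumes "\<not> same_ray c u p" "\<not> same_ray c u p'" "\<not> same_ray c p p'"
  shows "Arg (- (u - c) / (p - c)) + Arg (- (p' - c) / (u - c)) =
    Arg2pi ((p' - c) / (p - c)) + (if on_left p c p' u then 0 else - 2 * pi)"
proof -
  have ne: "u - c \<noteq> 0" "p - c \<noteq> 0" "p' - c \<noteq> 0" using assms by (auto simp: same_ray_def)
  define a where "a = Arg2pi ((u - c) / (p - c))"
  define b where "b = Arg2pi ((p' - c) / (p - c))"
  have pos: "0 < a" "0 < b" "0 < Arg2pi ((p' - c) / (u - c))"
    using assms same_ray_sym[of c p u] Arg2pi_ge_0 by (auto simp: same_ray_def less_le a_def b_def)
  have "Arg (- (u - c) / (p - c)) = a - pi"
    using pos(1) Arg_uminus_Arg2pi[of "(u - c) / (p - c)"] unfolding a_def by (metis minus_divide_left)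
  moreover have "Arg (- (p' - c) / (u - c)) = Arg2pi ((p' - c) / (u - c)) - pi"
    using pos(3) Arg_uminus_Arg2pi[of "(p' - c) / (u - c)"] by (metis minus_divide_left)
  moreover have d: "Arg2pi ((p' - c) / (u - c)) = (if a \<le> b then b - a else b - a + 2 * pi)"
    using Arg2pi_div_div[of "p - c" "u - c" "p' - c"] ne by (simp add: a_def b_def)
  moreover have "on_left p c p' u \<longleftrightarrow> b < a"
    using ccw_rotate_eq[of c p' u p] ccw_rotate_eq[of c u p p'] pos
    by (auto simp: on_left_def ccw_def a_def b_def)
  moreover have "a \<noteq> b" using d pos by auto
  ultimately show ?thesis by (auto simp flip: b_def)
qed

text \<open>As the point approaches \<open>c\<close> along the segment, its side extends
  continuously to \<open>c\<close>, where it is the limit from the left, corrected by a full turn if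
  \<open>u\<close> is on the right.\<close>

lemma side_near_node:
  assumes cut: "cut z r (xs @ p # c # p' # ys)" and u: "u \<in> cball z r" "u \<noteq> c"
    and off: "open_segment c u \<inter> poly_image (xs @ p # c # p' # ys) = {}"
    and v: "v \<in> open_segment c u"
  shows "side (xs @ p # c # p' # ys) v = (if on_left p c p' u then pi else - pi)"
proof -
  define P where "P = xs @ [p]"
  define S where "S = p' # ys"
  define ps where "ps = xs @ p # c # p' # ys"
  have simp: "simple_poly ps" using cut by (auto simp: cut_def ps_def)
  have ps1: "ps = P @ c # S" by (simp add: ps_def P_def S_def)
  have app: "poly_image ps = poly_image (P @ [c]) \<union> poly_image (c # S)"
    using poly_image_append[of P c S] by (simp add: ps1)
  have img: "poly_image (P @ [c]) = poly_image P \<union> closed_segment p c"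
    using poly_image_append[of xs p "[c]"] by (auto simp: P_def)
  have simp2: "simple_poly (c # S)" "simple_poly (xs @ p # c # S)"
    using simple_poly_append[of P c S] simp ps1 by (auto simp: P_def)
  have ne: "p \<noteq> c" "c \<noteq> p'" using simple_poly_before(2)[OF simp2(2)] simp2(1) by (auto simp: S_def)
  have m1: "c \<notin> poly_image P"
    using simple_poly_before(1)[OF simp2(2)] set_subset_poly_image[of "c # S"] by (auto simp: P_def)
  have m2: "c \<notin> poly_image S"
    using simp2(1) ne by (auto simp: S_def)
  have m3: "closed_segment c p \<inter> closed_segment c p' \<subseteq> {c}"
    using simple_poly_before(3)[OF simp2(2)] by (auto simp: S_def closed_segment_commute)
  \<comment> \<open>If \<open>u\<close> and a neighbour of \<open>c\<close> on the path lay on one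
    ray, an initial piece of the segment to \<open>u\<close> would run along the path.\<close>
  have no_ray: "\<not> same_ray c u q" if q: "closed_segment c q \<subseteq> poly_image ps" "q \<noteq> c" for q
  proof
    assume "same_ray c u q"
    then consider "u \<in> closed_segment c q" | "q \<in> closed_segment c u" using same_rayI_segments q(2) u(2) by blast
    then show False
    proof cases
      case 1
      then have "closed_segment c u \<subseteq> closed_segment c q" using 1
        by (intro closed_segment_subset) auto
      moreover have "midpoint c u \<in> open_segment c u" using u(2) by auto
      ultimately show False using off[folded ps_def] q(1) open_closed_segment[of "midpoint c u" c u] by blast
    next
      case 2
      then have "closed_segment c q \<subseteq> closed_segment c u" using 2
        by (intro closed_segment_subset) auto
      moreover have "midpoint c q \<in> open_segment c q" using q(2) by auto
      moreover have "open_segment c q \<subseteq> open_segment c u"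
        using 2 q(2) by (simp add: subset_open_segment)
      ultimately show False using off[folded ps_def] q(1) open_closed_segment[of "midpoint c q" c q] by blast
    qed
  qed
  have ray1: "\<not> same_ray c u p" using app img ne by (intro no_ray) (auto simp: closed_segment_commute)
  have ray2: "\<not> same_ray c u p'" using app ne by (intro no_ray) (auto simp: S_def)
  have ray3: "\<not> same_ray c p p'" using m3 ne by (intro not_same_ray_if_segments_meet_at_end) auto
  have sub: "set ps \<subseteq> cball z r" using cut_subset[OF cut] by (simp add: ps_def)
  have ends: "hd P = hd ps" "last S = last ps" by (auto simp: ps1 P_def S_def hd_append)
  define pt where "pt t = c + t *\<^sub>R (u - c)" for t
  have pt_seg: "pt t \<in> open_segment c u" if "0 < t" "t < 1" for t
    unfolding in_segment(2) using that u(2) by (auto simp: pt_def algebra_simps intro!: exI[of _ t])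
  have pt_cball: "pt t \<in> cball z r" if "t \<in> {0..<1}" for t
    using point_on_ray[of "pt t" c t u] closed_segment_subset[of c "cball z r" u] that u(1) sub
    by (auto simp: pt_def ps1)
  have off': "pt t \<notin> poly_image P" "pt t \<notin> poly_image S" if "t \<in> {0..<1}" for t
    using that m1 m2 pt_seg[of t] off app img
    by (cases "t = 0"; auto simp: pt_def S_def simp flip: ps_def)+
  then have off'': "hd P \<noteq> pt t" "last S \<noteq> pt t" "p \<noteq> pt t" "p' \<noteq> pt t" if "t \<in> {0..<1}" for t
    using that set_subset_poly_image[of P] set_subset_poly_image[of S] hd_in_set[of P] last_in_set[of S]
    by (auto simp: P_def S_def)
  \<comment> \<open>The side at \<open>pt t\<close> with \<open>c - pt t\<close> replaced by its
    direction \<open>- (u - c)\<close>, so that the formula makes sense at \<open>t = 0\<close>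
    too.\<close>
  define f where "f t = swept_angle P (pt t) + Arg (- (u - c) / (p - pt t)) + Arg (- (p' - pt t) / (u - c))
    + swept_angle S (pt t) - chord_angle (hd P) (last S) (pt t)" for t
  have pt_c: "continuous_on A pt" for A unfolding pt_def by (intro continuous_intros)
  obtain t where t: "0 < t" "t < 1" "v = pt t"
    using v unfolding in_segment(2) by (auto simp: pt_def algebra_simps)
  have "f 0 = f t"
  proof (rule constant_angle[of "{0..<1}" f])
    have "continuous_on {0..<1} (\<lambda>t. swept_angle Q (pt t))" if "\<And>t. t \<in> {0..<1} \<Longrightarrow> pt t \<notin> poly_image Q" for Q
      by (rule continuous_on_compose2[OF continuous_on_swept_angle[of "pt ` {0..<1}"] pt_c]) (use that in auto)
    moreover have "continuous_on {0..<1} (\<lambda>t. chord_angle (hd P) (last S) (pt t))"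
    proof (rule continuous_on_compose2[OF _ pt_c])
      show "continuous_on (pt ` {0..<1}) (chord_angle (hd P) (last S))"
        using continuous_on_chord_angle[OF cut, of "pt ` {0..<1}"] off''(1,2) pt_cball ends
        by (fastforce simp flip: ps_def)
    qed auto
    ultimately show "continuous_on {0..<1} f"
      unfolding f_def using not_nonpos_if_not_same_ray[OF ray1 u(2)] not_nonpos_if_not_same_ray[OF ray2 u(2)]
        off''(3) u(2) off'
      by (intro continuous_intros continuous_on_Arg' pt_c) (auto simp: pt_def)
    show "cis (f t) = -1" if t: "t \<in> {0..<1}" for t
      using cis_swept_angle[OF off'(1)[OF t]] cis_swept_angle[OF off'(2)[OF t]] off''[OF t] ne u(2)
        cis_chord_angle[of "pt t" "hd P" "last S"] sgn_minus[of "u - c"] sgn_minus[of "p' - pt t"]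
        cis_Arg_ratio[of "- (u - c)" "p - pt t"] cis_Arg_ratio[of "- (p' - pt t)" "u - c"]
      by (simp add: f_def cis_mult[symmetric] cis_divide[symmetric] S_def P_def sgn_eq_0_iff)
  qed (use t in auto)
  moreover have "f t = side ps v"
  proof -
    have "swept_angle ps v = swept_angle P v + Arg ((c - v) / (p - v)) + Arg ((p' - v) / (c - v)) + swept_angle S v"
      using swept_angle_append[of xs p "c # S" v] by (simp add: ps1 P_def S_def)
    moreover have "c - v = of_real t * (- (u - c))" by (simp add: t(3) pt_def scaleR_conv_of_real algebra_simps)
    then have "(c - v) / (p - v) = of_real t * (- (u - c) / (p - v))"
      "(p' - v) / (c - v) = (- (p' - v) / (u - c)) / of_real t"
      using t(1) by (simp_all add: divide_simps) (simp add: algebra_simps)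
    then have "Arg ((c - v) / (p - v)) = Arg (- (u - c) / (p - v))"
      "Arg ((p' - v) / (c - v)) = Arg (- (p' - v) / (u - c))"
      using t(1) by (simp_all only: Arg_times_of_real Arg_divide_of_real)
    ultimately show ?thesis by (simp add: f_def side_def ends t(3))
  qed
  moreover have "f 0 = (if on_left p c p' u then pi else - pi)"
    using left_angle_at_node[OF cut] node_angle[OF ray1 ray2 ray3]
    by (auto simp: f_def pt_def P_def S_def)
  ultimately show ?thesis by (simp add: ps_def)
qed

lemma side_at_node:
  assumes "cut z r (xs @ p # c # p' # ys)" "u \<in> cball z r" "u \<noteq> c"
    and off: "open_segment c u \<inter> poly_image (xs @ p # c # p' # ys) = {}"
      "u \<notin> poly_image (xs @ p # c # p' # ys)"
  shows "side (xs @ p # c # p' # ys) u = (if on_left p c p' u then pi else - pi)"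
proof -
  \<comment> \<open>The value known near the node is carried from the midpoint to \<open>u\<close>,
    as the rest of the segment avoids the path.\<close>
  let ?m = "midpoint c u"
  have m: "?m \<in> open_segment c u" using assms(3) by auto
  have "c \<in> cball z r" using cut_subset[OF assms(1)] by auto
  then have "closed_segment ?m u \<subseteq> cball z r"
    using assms(2) subsetD[OF closed_segment_subset[of c "cball z r" u] open_closed_segment[OF m]]
    by (intro closed_segment_subset) auto
  moreover have "closed_segment ?m u \<subseteq> insert u (open_segment c u)"
    using subset_open_segment[of "?m" u c u] m open_closed_segment[OF m] assms(3)
    by (auto simp: closed_segment_eq_open)
  ultimately have "side (xs @ p # c # p' # ys) ?m = side (xs @ p # c # p' # ys) u"
    using off by (intro side_constant[OF assms(1), of "closed_segment ?m u"]) auto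
  then show ?thesis using side_near_node[OF assms(1-3) off(1) m] by simp
qed

section \<open>Colors and their inverses\<close>

definition bar :: "('g, 'm) monoid_scheme \<Rightarrow> 'g \<times> 'x \<Rightarrow> 'g \<times> 'x" where
  "bar G a = (inv\<^bsub>G\<^esub> (fst a), snd a)"

text \<open>The colors belong to the edges directed away from the vertex, in counterclockwise order.
  This is one relation for all orientations: if two edges come in with components l and r, the third
  has r l, and r l times the inverse of l times the inverse of r is one.\<close>

definition vertex_rule :: "('g, 'm) monoid_scheme \<Rightarrow> 'g \<times> 'x \<Rightarrow> 'g \<times> 'x \<Rightarrow> 'g \<times> 'x \<Rightarrow> bool" where
  "vertex_rule G a b c \<longleftrightarrow>
     snd a = snd c \<and> snd b = snd c \<and> fst a \<otimes>\<^bsub>G\<^esub> fst b \<otimes>\<^bsub>G\<^esub> fst c = \<one>\<^bsub>G\<^esub>"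

locale quandle_family = group G for G :: "('g, 'm) monoid_scheme" (structure) +
  fixes X :: "'x set" and q :: "'g \<Rightarrow> 'x \<Rightarrow> 'x \<Rightarrow> 'x"
  assumes family: "G_family G X q"
begin

abbreviation op (infixl "\<rhd>" 65) where "a \<rhd> b \<equiv> assoc_op G q a b"

abbreviation colors where "colors \<equiv> carrier G \<times> X"

lemma q_closed [simp]: "g \<in> carrier G \<Longrightarrow> x \<in> X \<Longrightarrow> y \<in> X \<Longrightarrow> q g x y \<in> X"
  using family by (simp add: G_family_def quandle_def)

lemma q_idem [simp]: "g \<in> carrier G \<Longrightarrow> x \<in> X \<Longrightarrow> q g x x = x"
  using family unfolding G_family_def by blast

lemma q_mult: "g \<in> carrier G \<Longrightarrow> h \<in> carrier G \<Longrightarrow> x \<in> X \<Longrightarrow> y \<in> X \<Longrightarrow>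
    q h (q g x y) y = q (g \<otimes> h) x y"
proof -
  assume *: "g \<in> carrier G" "h \<in> carrier G" "x \<in> X" "y \<in> X"
  have "\<forall>g\<in>carrier G. \<forall>h\<in>carrier G. \<forall>x\<in>X. \<forall>y\<in>X. q (g \<otimes> h) x y = q h (q g x y) y"
    using family unfolding G_family_def by blast
  then show ?thesis using * by metis
qed

lemma q_one [simp]: "x \<in> X \<Longrightarrow> y \<in> X \<Longrightarrow> q \<one> x y = x"
  using family unfolding G_family_def by blast

lemma q_conj: "g \<in> carrier G \<Longrightarrow> h \<in> carrier G \<Longrightarrow> x \<in> X \<Longrightarrow> y \<in> X \<Longrightarrow> z \<in> X \<Longrightarrow>
    q h (q g x y) z = q (inv h \<otimes> g \<otimes> h) (q h x z) (q h y z)"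
  using family unfolding G_family_def by blast

lemma cancel_left [simp]: "g \<in> carrier G \<Longrightarrow> h \<in> carrier G \<Longrightarrow> g \<otimes> (inv g \<otimes> h) = h"
  "g \<in> carrier G \<Longrightarrow> h \<in> carrier G \<Longrightarrow> inv g \<otimes> (g \<otimes> h) = h"
  by (simp_all flip: m_assoc)

lemma fst_snd_colors [simp]: "a \<in> colors \<Longrightarrow> fst a \<in> carrier G" "a \<in> colors \<Longrightarrow> snd a \<in> X"
  by auto

lemma op_closed [simp]: "a \<in> colors \<Longrightarrow> b \<in> colors \<Longrightarrow> a \<rhd> b \<in> colors"
  by (auto simp: assoc_op_def)

lemma bar_closed [simp]: "a \<in> colors \<Longrightarrow> bar G a \<in> colors"
  by (auto simp: bar_def)

lemma bar_bar [simp]: "a \<in> colors \<Longrightarrow> bar G (bar G a) = a"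
  by (auto simp: bar_def)

lemma bar_inject: "a \<in> colors \<Longrightarrow> b \<in> colors \<Longrightarrow> bar G a = bar G b \<longleftrightarrow> a = b"
  using bar_bar by metis

lemma op_bar_cancel [simp]:
  assumes "a \<in> colors" "b \<in> colors"
  shows "a \<rhd> b \<rhd> bar G b = a" "a \<rhd> bar G b \<rhd> b = a"
  using assms by (auto simp: assoc_op_def bar_def q_mult m_assoc)

lemma bar_op: "a \<in> colors \<Longrightarrow> b \<in> colors \<Longrightarrow> bar G (a \<rhd> b) = bar G a \<rhd> b"
  by (auto simp: assoc_op_def bar_def inv_mult_group m_assoc)

text \<open>The algebra of (R1): a strand passing under itself keeps its color, whatever the sign of
  the crossing.\<close>

lemma op_self [simp]: "a \<in> colors \<Longrightarrow> a \<rhd> a = a" "a \<in> colors \<Longrightarrow> a \<rhd> bar G a = a"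
  by (auto simp: assoc_op_def bar_def m_assoc)

lemma op_distrib:
  assumes "a \<in> colors" "b \<in> colors" "c \<in> colors"
  shows "a \<rhd> b \<rhd> c = (a \<rhd> c) \<rhd> (b \<rhd> c)"
proof -
  have "fst (a \<rhd> b \<rhd> c) = fst ((a \<rhd> c) \<rhd> (b \<rhd> c))"
    using assms by (simp add: assoc_op_def inv_mult_group m_assoc)
  then show ?thesis
    using assms q_conj[of "fst b" "fst c" "snd a" "snd b" "snd c"]
    by (simp add: assoc_op_def prod_eq_iff)
qed

text \<open>Conjugation by the first factor; so only the cyclic order at the vertex matters.\<close>

lemma vertex_rule_rotate:
  assumes "vertex_rule G a b c" "a \<in> colors" "b \<in> colors" "c \<in> colors"
  shows "vertex_rule G b c a"
proof -
  have "inv (fst a) \<otimes> (fst a \<otimes> fst b \<otimes> fst c) \<otimes> fst a = \<one>"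
    using assms by (simp add: vertex_rule_def)
  then have "fst b \<otimes> fst c \<otimes> fst a = \<one>"
    using assms(2-4) by (simp add: m_assoc)
  then show ?thesis using assms by (auto simp: vertex_rule_def)
qed

lemma vertex_rule_op:
  assumes "vertex_rule G a b c" "a \<in> colors" "b \<in> colors" "c \<in> colors" "d \<in> colors"
  shows "vertex_rule G (a \<rhd> d) (b \<rhd> d) (c \<rhd> d)"
proof -
  have "inv (fst d) \<otimes> (fst a \<otimes> fst b \<otimes> fst c) \<otimes> fst d = \<one>"
    using assms by (simp add: vertex_rule_def)
  then show ?thesis using assms
    by (auto simp: vertex_rule_def assoc_op_def m_assoc)
qed

lemma vertex_rule_op_iff:
  assumes "a \<in> colors" "b \<in> colors" "c \<in> colors" "d \<in> colors"
  shows "vertex_rule G (a \<rhd> d) (b \<rhd> d) (c \<rhd> d) \<longleftrightarrow> vertex_rule G a b c"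
  using vertex_rule_op[of a b c d] vertex_rule_op[of "a \<rhd> d" "b \<rhd> d" "c \<rhd> d" "bar G d"] assms by auto

text \<open>Acting with three colors that share the second component amounts to acting with the
  product of their group components. This is the algebra of a strand passing under a vertex.\<close>

lemma vertex_rule_acts_trivially:
  assumes "vertex_rule G a b c" "a \<in> colors" "b \<in> colors" "c \<in> colors" "d \<in> colors"
  shows "d \<rhd> a \<rhd> b \<rhd> c = d"
proof -
  let ?p = "fst a \<otimes> fst b \<otimes> fst c"
  have p: "?p = \<one>" and s: "snd a = snd c" "snd b = snd c" using assms by (auto simp: vertex_rule_def)
  have "fst (d \<rhd> a \<rhd> b \<rhd> c) = inv ?p \<otimes> fst d \<otimes> ?p"
    using assms by (simp add: assoc_op_def inv_mult_group m_assoc)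
  moreover have "snd (d \<rhd> a \<rhd> b \<rhd> c) = q ?p (snd d) (snd c)"
    using assms s by (simp add: assoc_op_def q_mult)
  ultimately show ?thesis using p assms by (simp add: prod_eq_iff)
qed

text \<open>Conjugating \<open>fst b\<close> by \<open>fst a\<close> compensates for exchanging two
  factors, and idempotence keeps the second component. This is the algebra of (R4), where one edge
  passes under the next one.\<close>

lemma vertex_rule_twist:
  assumes "a \<in> colors" "b \<in> colors" "c \<in> colors"
  shows "vertex_rule G a c (b \<rhd> bar G a) \<longleftrightarrow> vertex_rule G a b c"
proof -
  have imp1: "vertex_rule G a c (b \<rhd> bar G a)" if v: "vertex_rule G a b c"
    and c: "a \<in> colors" "b \<in> colors" "c \<in> colors" for a b c
  proof -
    have "vertex_rule G c a b" using vertex_rule_rotate[OF vertex_rule_rotate[OF v c]] c by auto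
    then have "fst c \<otimes> fst a \<otimes> fst b = \<one>" by (simp add: vertex_rule_def)
    then have "fst a \<otimes> (fst c \<otimes> fst a \<otimes> fst b) \<otimes> inv (fst a) = \<one>" using c by simp
    then show ?thesis using v c by (auto simp: vertex_rule_def assoc_op_def bar_def m_assoc)
  qed
  have imp2: "vertex_rule G a b c" if v: "vertex_rule G a c (b \<rhd> bar G a)"
    and c: "a \<in> colors" "b \<in> colors" "c \<in> colors" for a b c
  proof -
    have "snd b = snd c"
    proof -
      have *: "snd a = snd c" "q (inv (fst a)) (snd b) (snd a) = snd c"
        using v by (auto simp: vertex_rule_def assoc_op_def bar_def)
      then have "q (fst a) (q (inv (fst a)) (snd b) (snd a)) (snd a) = q (fst a) (snd a) (snd a)" by simp
      then show ?thesis using * c by (simp add: q_mult)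
    qed
    moreover have "fst a \<otimes> fst c \<otimes> (fst a \<otimes> fst b \<otimes> inv (fst a)) = \<one>"
      using v c by (simp add: vertex_rule_def assoc_op_def bar_def)
    then have "inv (fst a) \<otimes> (fst a \<otimes> fst c \<otimes> (fst a \<otimes> fst b \<otimes> inv (fst a))) \<otimes> fst a = \<one>"
      using c by simp
    then have "fst c \<otimes> fst a \<otimes> fst b = \<one>" using c by (simp add: m_assoc)
    ultimately have "vertex_rule G c a b" using v by (auto simp: vertex_rule_def)
    then show ?thesis using vertex_rule_rotate c by blast
  qed
  show ?thesis using imp1 imp2 assms by blast
qed

end

section \<open>Colorings without orientation\<close>

definition unoriented :: "diagram \<Rightarrow> diagram" where
  "unoriented D = D \<union> D\<inverse>"

text \<open>The coloring conditions at the nodes over \<open>c\<close>. The sets of neighbours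
  reveal the kind of node: two neighbours of \<open>Hi c\<close>, two of \<open>Lo c\<close> in the
  absence of \<open>Hi c\<close>, or three of \<open>Lo c\<close>, since \<open>ccw\<close> forces
  distinct points. As \<open>p\<close> and \<open>p'\<close> may be exchanged, the crossing rule is
  demanded for both directions of the over-strand.\<close>

definition point_rule ::
  "('g, 'm) monoid_scheme \<Rightarrow> ('g \<Rightarrow> 'x \<Rightarrow> 'x \<Rightarrow> 'x) \<Rightarrow> diagram \<Rightarrow> (seg \<Rightarrow> 'g \<times> 'x) \<Rightarrow> complex \<Rightarrow> bool" where
  "point_rule G q U \<kappa> c \<longleftrightarrow>
     (\<forall>p p'. U `` {Hi c} = {p, p'} \<and> p \<noteq> p' \<longrightarrow> \<kappa> (p, Hi c) = \<kappa> (Hi c, p')) \<and>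
     (U `` {Hi c} = {} \<longrightarrow> (\<forall>p p'. U `` {Lo c} = {p, p'} \<and> p \<noteq> p' \<longrightarrow> \<kappa> (p, Lo c) = \<kappa> (Lo c, p'))) \<and>
     (\<forall>p p' u u'. p \<in> U `` {Hi c} \<and> p' \<in> U `` {Hi c} \<and> u \<in> U `` {Lo c} \<and> u' \<in> U `` {Lo c} \<and>
        on_right (pt p) c (pt p') (pt u) \<and> on_left (pt p) c (pt p') (pt u') \<longrightarrow>
        \<kappa> (Lo c, u') = assoc_op G q (\<kappa> (u, Lo c)) (\<kappa> (p, Hi c))) \<and>
     (\<forall>n1 n2 n3. n1 \<in> U `` {Lo c} \<and> n2 \<in> U `` {Lo c} \<and> n3 \<in> U `` {Lo c} \<and>
        ccw c (pt n1) (pt n2) (pt n3) \<longrightarrow>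
        vertex_rule G (\<kappa> (Lo c, n1)) (\<kappa> (Lo c, n2)) (\<kappa> (Lo c, n3)))"

text \<open>
  A color for each of the two directions of every segment; the reverse direction carries the inverse
  group element. The orientation of the diagram no longer matters for these.
\<close>

definition half_colorings ::
  "('g, 'm) monoid_scheme \<Rightarrow> 'x set \<Rightarrow> ('g \<Rightarrow> 'x \<Rightarrow> 'x \<Rightarrow> 'x) \<Rightarrow> diagram \<Rightarrow> (seg \<Rightarrow> 'g \<times> 'x) set" where
  "half_colorings G X q U = {\<kappa> \<in> U \<rightarrow>\<^sub>E carrier G \<times> X.
     (\<forall>m n. (m, n) \<in> U \<longrightarrow> \<kappa> (n, m) = bar G (\<kappa> (m, n))) \<and> (\<forall>c. point_rule G q U \<kappa> c)}"

lemma in_unoriented: "(m, n) \<in> unoriented D \<longleftrightarrow> (m, n) \<in> D \<or> (n, m) \<in> D"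
  by (auto simp: unoriented_def)

lemma unoriented_sym: "(m, n) \<in> unoriented D \<Longrightarrow> (n, m) \<in> unoriented D"
  by (auto simp: unoriented_def)

lemma unoriented_Un: "unoriented (A \<union> B) = unoriented A \<union> unoriented B"
  by (auto simp: unoriented_def)

lemma closed_segment_not_subset_ends: "a \<noteq> b \<Longrightarrow> \<not> closed_segment a b \<subseteq> {a, b}" for a b :: complex
proof -
  assume "a \<noteq> b"
  then have "midpoint a b \<in> open_segment a b" by auto
  then show ?thesis unfolding open_segment_def by blast
qed

section \<open>Diagrams as unoriented plane graphs\<close>

locale Y_diagram =
  fixes D :: diagram
  assumes Y: "Y_oriented_diagram D"
begin

lemma finite_D: "finite D" using Y by (simp add: Y_oriented_diagram_def)

lemma pt_neq: "(m, n) \<in> unoriented D \<Longrightarrow> pt m \<noteq> pt n"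
  using Y by (auto simp: Y_oriented_diagram_def in_unoriented)

lemma segments_meet_at_ends:
  assumes "(m, n) \<in> unoriented D" "(m', n') \<in> unoriented D" "{m, n} \<noteq> {m', n'}"
  shows "closed_segment (pt m) (pt n) \<inter> closed_segment (pt m') (pt n') \<subseteq> {pt m, pt n} \<inter> {pt m', pt n'}"
proof -
  obtain s s' where s: "s \<in> D" "s = (m, n) \<or> s = (n, m)" "s' \<in> D" "s' = (m', n') \<or> s' = (n', m')"
    using assms(1,2) unfolding in_unoriented by blast
  then have "s \<noteq> s'" using assms(3) by auto
  then have "seg_line s \<inter> seg_line s' \<subseteq> seg_ends s \<inter> seg_ends s'"
    using Y s unfolding Y_oriented_diagram_def by blast
  moreover have "seg_line s = closed_segment (pt m) (pt n)" "seg_line s' = closed_segment (pt m') (pt n')"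
    "seg_ends s = {pt m, pt n}" "seg_ends s' = {pt m', pt n'}"
    using s(2,4) by (auto simp: seg_line_def seg_ends_def closed_segment_commute)
  ultimately show ?thesis by metis
qed

text \<open>A segment and its reverse would be different segments sharing more than their
  ends.\<close>

lemma antisym_D: "(m, n) \<in> D \<Longrightarrow> (n, m) \<notin> D"
proof
  assume *: "(m, n) \<in> D" "(n, m) \<in> D"
  then have ne: "pt m \<noteq> pt n" using pt_neq by (auto simp: in_unoriented)
  then have "(m, n) \<noteq> (n, m)" by auto
  then have "seg_line (m, n) \<inter> seg_line (n, m) \<subseteq> seg_ends (m, n) \<inter> seg_ends (n, m)"
    using Y * unfolding Y_oriented_diagram_def by blast
  then have "closed_segment (pt m) (pt n) \<subseteq> {pt m, pt n}"
    by (auto simp: seg_line_def seg_ends_def closed_segment_commute)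
  then show False using closed_segment_not_subset_ends ne by blast
qed

text \<open>Segments on one ray would overlap beyond their ends. Since \<open>n\<close> and
  \<open>n'\<close> only have to lie over the same point, the two strands of a crossing are covered
  as well.\<close>

lemma not_same_ray:
  assumes "(n, m) \<in> unoriented D" "(n', k) \<in> unoriented D" "pt n = pt n'" "(n, m) \<noteq> (n', k)"
  shows "\<not> same_ray (pt n) (pt m) (pt k)"
proof
  assume "same_ray (pt n) (pt m) (pt k)"
  moreover have ne: "pt m \<noteq> pt n" "pt k \<noteq> pt n" using pt_neq assms(1-3) by fastforce+
  ultimately have *: "pt m \<in> closed_segment (pt n) (pt k) \<or> pt k \<in> closed_segment (pt n) (pt m)"
    using same_rayI_segments by blast
  have "{n, m} \<noteq> {n', k}" using assms(4,3) ne by (auto simp: doubleton_eq_iff)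
  then have meet: "closed_segment (pt n) (pt m) \<inter> closed_segment (pt n) (pt k) \<subseteq> {pt n, pt m} \<inter> {pt n, pt k}"
    using segments_meet_at_ends[OF assms(1,2)] assms(3) by simp
  have "pt x = pt y" if "{x, y} = {m, k}" "pt x \<in> closed_segment (pt n) (pt y)" for x y
  proof -
    have "closed_segment (pt n) (pt x) \<subseteq> closed_segment (pt n) (pt y)"
      using that(2) by (intro closed_segment_subset) auto
    then have "closed_segment (pt n) (pt x) \<subseteq> {pt n, pt m} \<inter> {pt n, pt k}"
      using meet that(1) by (auto simp: doubleton_eq_iff)
    moreover have "pt n \<noteq> pt x" "pt x \<in> {pt m, pt k}" using ne that(1) by (auto simp: doubleton_eq_iff)
    ultimately have "closed_segment (pt n) (pt x) \<subseteq> {pt n, pt x}" by auto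
    then have False using closed_segment_not_subset_ends \<open>pt n \<noteq> pt x\<close> by metis
    then show ?thesis ..
  qed
  from this[of m k] this[of k m] have "pt m = pt k" using * by (auto simp: insert_commute)
  then have "closed_segment (pt n) (pt m) \<subseteq> {pt n, pt m}" using meet by auto
  then show False using closed_segment_not_subset_ends ne by metis
qed

lemma finite_Image: "finite (unoriented D `` {n})"
  using finite_D by (auto simp: unoriented_def intro!: finite_Image)

lemma card_Image: "card (unoriented D `` {n}) = in_degree D n + out_degree D n"
proof -
  have "unoriented D `` {n} = {m. (m, n) \<in> D} \<union> {m. (n, m) \<in> D}" by (auto simp: unoriented_def)
  moreover have "{m. (m, n) \<in> D} \<inter> {m. (n, m) \<in> D} = {}" using antisym_D by auto
  ultimately show ?thesis
    using finite_Image[of n] by (simp add: in_degree_def out_degree_def card_Un_disjoint)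
qed

lemma node_degree: "n \<in> Field D \<Longrightarrow> bivalent D n \<or> trivalent D n"
  using Y by (auto simp: Y_oriented_diagram_def)

lemma in_Field: "(n, m) \<in> unoriented D \<Longrightarrow> n \<in> Field D"
  by (auto simp: unoriented_def Field_def)

lemma Image_eq_empty: "unoriented D `` {n} = {} \<longleftrightarrow> n \<notin> Field D"
  by (auto simp: unoriented_def Field_def)

lemma bivalent_iff: "bivalent D n \<longleftrightarrow> card (unoriented D `` {n}) = 2"
proof
  assume *: "card (unoriented D `` {n}) = 2"
  then have "unoriented D `` {n} \<noteq> {}" by auto
  then have "n \<in> Field D" using Image_eq_empty by blast
  then show "bivalent D n" using node_degree[of n] * card_Image[of n] by (auto simp: trivalent_def)
qed (auto simp: card_Image bivalent_def)

lemma trivalent_iff: "trivalent D n \<longleftrightarrow> card (unoriented D `` {n}) = 3"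
proof
  assume *: "card (unoriented D `` {n}) = 3"
  then have "unoriented D `` {n} \<noteq> {}" by auto
  then have "n \<in> Field D" using Image_eq_empty by blast
  then show "trivalent D n" using node_degree[of n] * card_Image[of n] by (auto simp: bivalent_def)
qed (auto simp: card_Image trivalent_def)

lemma Image_le_3: "card (unoriented D `` {n}) \<le> 3"
  using node_degree[of n] Image_eq_empty[of n] by (cases "n \<in> Field D") (auto simp: bivalent_iff trivalent_iff)

lemma crossing_Hi: "Hi c \<in> Field D \<Longrightarrow> crossing D c"
  using Y by (auto simp: Y_oriented_diagram_def)

lemma bivalent_cases:
  assumes "bivalent D n" "p \<in> unoriented D `` {n}" "p' \<in> unoriented D `` {n}" "p \<noteq> p'"
  shows "(p, n) \<in> D \<and> (n, p') \<in> D \<or> (p', n) \<in> D \<and> (n, p) \<in> D"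
proof -
  obtain i o' where io: "{m. (m, n) \<in> D} = {i}" "{m. (n, m) \<in> D} = {o'}"
    using assms(1) by (auto simp: bivalent_def in_degree_def out_degree_def card_1_singleton_iff)
  then have "unoriented D `` {n} = {i, o'}" by (auto simp: unoriented_def)
  then show ?thesis using io assms(2-4) by auto
qed

lemma passes_sub: "passes D \<subseteq> D \<times> D" by (auto simp: passes_def)

lemma equiv_arc_rel: "equiv D (arc_rel D)"
proof (rule equivI)
  show "refl_on D (arc_rel D)" by (auto simp: arc_rel_def refl_on_def)
  have "sym (passes D \<union> (passes D)\<inverse>)" by (auto simp: sym_def)
  then show "sym (arc_rel D)" unfolding arc_rel_def
    by (intro sym_Int sym_rtrancl) (auto simp: sym_def)
  show "trans (arc_rel D)" unfolding arc_rel_def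
    by (intro trans_Int) (auto simp: trans_def)
qed (auto simp: arc_rel_def)

lemma arc_of_passes:
  assumes "(s, s') \<in> passes D"
  shows "arc_of D s = arc_of D s'"
proof -
  have "(s, s') \<in> arc_rel D" using assms passes_sub by (auto simp: arc_rel_def)
  then show ?thesis unfolding arc_of_def using equiv_class_eq[OF equiv_arc_rel] by simp
qed

lemma arcs_eq: "arcs D = arc_of D ` D"
  by (auto simp: arcs_def arc_of_def quotient_def)

lemma constant_on_arc:
  assumes "\<And>s s'. (s, s') \<in> passes D \<Longrightarrow> g s = g s'" "s \<in> arc_of D t"
  shows "g s = g t"
proof -
  have "(t, s) \<in> (passes D \<union> (passes D)\<inverse>)\<^sup>*" using assms(2) by (auto simp: arc_of_def arc_rel_def)
  then show ?thesis by (induction rule: rtrancl_induct) (use assms(1) in force)+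
qed

lemma self_in_arc_of: "s \<in> D \<Longrightarrow> s \<in> arc_of D s"
  by (auto simp: arc_of_def arc_rel_def)

end

section \<open>Oriented coloring rules and the orientation-free rule\<close>

definition segment_rules ::
  "('g, 'm) monoid_scheme \<Rightarrow> ('g \<Rightarrow> 'x \<Rightarrow> 'x \<Rightarrow> 'x) \<Rightarrow> diagram \<Rightarrow> (seg \<Rightarrow> 'g \<times> 'x) \<Rightarrow> bool" where
  "segment_rules G q D col \<longleftrightarrow>
     (\<forall>c p p' u u' s s'.
        (p, Hi c) \<in> D \<and> (Hi c, p') \<in> D \<and>
        s \<in> D \<and> joins s u (Lo c) \<and> on_right (pt p) c (pt p') (pt u) \<and>
        s' \<in> D \<and> joins s' u' (Lo c) \<and> on_left (pt p) c (pt p') (pt u') \<longrightarrow>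
        col s' = assoc_op G q (col s) (col (p, Hi c))) \<and>
     (\<forall>v l r w.
        (l, v) \<in> D \<and> (r, v) \<in> D \<and> (v, w) \<in> D \<and> trivalent D v \<and>
        ccw (pt v) (pt w) (pt l) (pt r) \<longrightarrow>
        snd (col (l, v)) = snd (col (v, w)) \<and> snd (col (r, v)) = snd (col (v, w)) \<and>
        fst (col (v, w)) = fst (col (r, v)) \<otimes>\<^bsub>G\<^esub> fst (col (l, v))) \<and>
     (\<forall>v l r w.
        (v, l) \<in> D \<and> (v, r) \<in> D \<and> (w, v) \<in> D \<and> trivalent D v \<and>
        ccw (pt v) (pt w) (pt r) (pt l) \<longrightarrow>
        snd (col (v, l)) = snd (col (w, v)) \<and> snd (col (v, r)) = snd (col (w, v)) \<and>
        fst (col (w, v)) = fst (col (v, r)) \<otimes>\<^bsub>G\<^esub> fst (col (v, l)))"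

lemma colorings_eq:
  "colorings G X q D =
    {f \<in> arcs D \<rightarrow>\<^sub>E carrier G \<times> X. segment_rules G q D (\<lambda>s. f (arc_of D s))}"
  unfolding colorings_def segment_rules_def Let_def by blast

text \<open>\<open>g\<close> colors the oriented segments and \<open>\<kappa>\<close> both
  directions of each. Arcs are left out, so that the locale serves for a coloring of arcs as well as
  for a given coloring of directed segments.\<close>

locale colored_diagram = Y_diagram D + quandle_family G X q
  for D :: diagram and G :: "('g, 'm) monoid_scheme" (structure) and X :: "'x set" and q +
  fixes g \<kappa> :: "seg \<Rightarrow> 'g \<times> 'x"
  assumes g_color: "\<And>s. s \<in> D \<Longrightarrow> g s \<in> colors"
    and \<kappa>_fwd: "\<And>m n. (m, n) \<in> D \<Longrightarrow> \<kappa> (m, n) = g (m, n)"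
    and \<kappa>_bwd: "\<And>m n. (m, n) \<in> D \<Longrightarrow> \<kappa> (n, m) = bar G (g (m, n))"
begin

lemma \<kappa>_color: "(m, n) \<in> unoriented D \<Longrightarrow> \<kappa> (m, n) \<in> colors"
  using g_color \<kappa>_fwd \<kappa>_bwd bar_closed unfolding in_unoriented by metis

lemma \<kappa>_bar: "(m, n) \<in> unoriented D \<Longrightarrow> \<kappa> (n, m) = bar G (\<kappa> (m, n))"
  using g_color \<kappa>_fwd \<kappa>_bwd bar_bar unfolding in_unoriented by metis

text \<open>Against the orientation both colors are inverted, and \<open>bar\<close> is
  injective.\<close>

lemma through_iff:
  assumes "bivalent D n" "unoriented D `` {n} = {p, p'}" "p \<noteq> p'"
  shows "\<kappa> (p, n) = \<kappa> (n, p') \<longleftrightarrow> (\<forall>m k. (m, n) \<in> D \<and> (n, k) \<in> D \<longrightarrow> g (m, n) = g (n, k))"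
proof -
  have one: "\<exists>i. {m. (m, n) \<in> D} = {i}" "\<exists>i. {m. (n, m) \<in> D} = {i}"
    using assms(1) by (auto simp: bivalent_def in_degree_def out_degree_def card_1_singleton_iff)
  from bivalent_cases[OF assms(1), of p p'] assms(2,3)
  consider "(p, n) \<in> D" "(n, p') \<in> D" | "(p', n) \<in> D" "(n, p) \<in> D" by auto
  then show ?thesis
  proof cases
    case 1
    then have "{m. (m, n) \<in> D} = {p}" "{m. (n, m) \<in> D} = {p'}" using one by (blast dest: equalityD1)+
    then have "(m, n) \<in> D \<longleftrightarrow> m = p" "(n, m) \<in> D \<longleftrightarrow> m = p'" for m by blast+
    then show ?thesis using \<kappa>_fwd by simp
  next
    case 2
    then have "{m. (m, n) \<in> D} = {p'}" "{m. (n, m) \<in> D} = {p}" using one by (blast dest: equalityD1)+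
    then have *: "(m, n) \<in> D \<longleftrightarrow> m = p'" "(n, m) \<in> D \<longleftrightarrow> m = p" for m by blast+
    have "\<kappa> (p, n) = bar G (g (n, p))" "\<kappa> (n, p') = bar G (g (p', n))" using \<kappa>_bwd 2 by auto
    then show ?thesis using * 2 bar_inject g_color by auto
  qed
qed

text \<open>If the under-strand runs from \<open>u'\<close> to \<open>u\<close>, both sides of the
  rule are inverted, and inverting commutes with acting.\<close>

lemma crossing_equation:
  assumes "u \<in> unoriented D `` {Lo c}" "u' \<in> unoriented D `` {Lo c}" "u \<noteq> u'" "bivalent D (Lo c)"
    and s: "s \<in> D" "joins s u (Lo c)" and s': "s' \<in> D" "joins s' u' (Lo c)" and o': "o' \<in> colors"
  shows "\<kappa> (Lo c, u') = \<kappa> (u, Lo c) \<rhd> o' \<longleftrightarrow> g s' = g s \<rhd> o'"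
proof -
  from bivalent_cases[OF assms(4,1,2,3)]
  consider "(u, Lo c) \<in> D" "(Lo c, u') \<in> D" | "(u', Lo c) \<in> D" "(Lo c, u) \<in> D" by auto
  then show ?thesis
  proof cases
    case 1
    then have "s = (u, Lo c)" "s' = (Lo c, u')" using s s' antisym_D by (auto simp: joins_def)
    then show ?thesis using 1 \<kappa>_fwd by simp
  next
    case 2
    then have "s = (Lo c, u)" "s' = (u', Lo c)" using s s' antisym_D by (auto simp: joins_def)
    then have *: "\<kappa> (u, Lo c) = bar G (g s)" "\<kappa> (Lo c, u') = bar G (g s')" using 2 \<kappa>_bwd by auto
    have "bar G (g s) \<rhd> o' = bar G (g s \<rhd> o')" using g_color s(1) o' bar_op by simp
    then show ?thesis using * bar_inject g_color s(1) s'(1) o' by auto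
  qed
qed

lemma on_right_left_neq: "on_right p c p' u \<Longrightarrow> on_left p c p' u' \<Longrightarrow> u \<noteq> u'"
  using ccw_rotate ccw_asym unfolding on_right_def on_left_def by blast

lemma on_swap: "on_right p' c p u \<longleftrightarrow> on_left p c p' u" "on_left p' c p u \<longleftrightarrow> on_right p c p' u"
  by (auto simp: on_right_def on_left_def)

lemma rules_imp_point_rule:
  assumes pass: "\<And>s s'. (s, s') \<in> passes D \<Longrightarrow> g s = g s'" and rules: "segment_rules G q D g"
  shows "point_rule G q (unoriented D) \<kappa> c"
proof -
  have hi: "\<kappa> (p, Hi c) = \<kappa> (Hi c, p')" if "unoriented D `` {Hi c} = {p, p'}" "p \<noteq> p'" for p p'
  proof -
    have "bivalent D (Hi c)" using that by (simp add: bivalent_iff)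
    moreover have "((m, Hi c), (Hi c, k)) \<in> passes D" if "(m, Hi c) \<in> D" "(Hi c, k) \<in> D" for m k
      using that by (auto simp: passes_def)
    ultimately show ?thesis using through_iff[of "Hi c" p p'] that pass by blast
  qed
  moreover have "\<kappa> (p, Lo c) = \<kappa> (Lo c, p')"
    if "unoriented D `` {Hi c} = {}" "unoriented D `` {Lo c} = {p, p'}" "p \<noteq> p'" for p p'
  proof -
    have b: "bivalent D (Lo c)" using that by (simp add: bivalent_iff)
    moreover have "joint D (Lo c)" using b that(1) by (auto simp: joint_def Image_eq_empty)
    then have "((m, Lo c), (Lo c, k)) \<in> passes D" if "(m, Lo c) \<in> D" "(Lo c, k) \<in> D" for m k
      using that by (auto simp: passes_def)
    ultimately show ?thesis using through_iff[of "Lo c" p p'] that pass by blast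
  qed
  moreover have "\<kappa> (Lo c, u') = \<kappa> (u, Lo c) \<rhd> \<kappa> (p, Hi c)"
    if h: "p \<in> unoriented D `` {Hi c}" "p' \<in> unoriented D `` {Hi c}"
      "u \<in> unoriented D `` {Lo c}" "u' \<in> unoriented D `` {Lo c}"
      "on_right (pt p) c (pt p') (pt u)" "on_left (pt p) c (pt p') (pt u')" for p p' u u'
  proof -
    have "Hi c \<in> Field D" using h(1) in_Field by auto
    then have b: "bivalent D (Hi c)" "bivalent D (Lo c)" using crossing_Hi by (auto simp: crossing_def)
    have pp: "p \<noteq> p'" using h(5) ccw_distinct(6) unfolding on_right_def by metis
    have uu: "u \<noteq> u'" using h(5,6) on_right_left_neq by blast
    have img: "unoriented D `` {Hi c} = {p, p'}"
      using b(1) h(1,2) pp finite_Image card_seteq[of "unoriented D `` {Hi c}" "{p, p'}"]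
      by (auto simp: bivalent_iff)
    obtain s s' where s: "s \<in> D" "joins s u (Lo c)" "s' \<in> D" "joins s' u' (Lo c)"
      using h(3,4) by (auto simp: unoriented_def joins_def)
    have pc: "\<kappa> (p, Hi c) \<in> colors" using h(1) by (auto intro!: \<kappa>_color unoriented_sym)
    from bivalent_cases[OF b(1) h(1,2) pp]
    consider "(p, Hi c) \<in> D" "(Hi c, p') \<in> D" | "(p', Hi c) \<in> D" "(Hi c, p) \<in> D" by auto
    then show ?thesis
    proof cases
      case 1
      then have "g s' = g s \<rhd> g (p, Hi c)"
        using rules h(5,6) s unfolding segment_rules_def by blast
      then show ?thesis using crossing_equation[OF h(3,4) uu b(2) s pc] \<kappa>_fwd 1 by simp
    next
      case 2
      \<comment> \<open>The over-strand runs against the chosen direction. Left and right change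
        places, and the rule is solved for the other under-arc by acting with the inverse
        color.\<close>
      then have "g s = g s' \<rhd> g (p', Hi c)"
        using rules h(5,6) s on_swap unfolding segment_rules_def by blast
      then have "g s' = g s \<rhd> bar G (g (p', Hi c))" using g_color s 2 by simp
      moreover have "\<kappa> (p, Hi c) = bar G (g (p', Hi c))"
        using hi[OF img pp] \<kappa>_bwd[OF 2(1)] by simp
      ultimately show ?thesis using crossing_equation[OF h(3,4) uu b(2) s pc] by simp
    qed
  qed
  moreover have "vertex_rule G (\<kappa> (Lo c, n1)) (\<kappa> (Lo c, n2)) (\<kappa> (Lo c, n3))"
    if h: "n1 \<in> unoriented D `` {Lo c}" "n2 \<in> unoriented D `` {Lo c}" "n3 \<in> unoriented D `` {Lo c}"
      "ccw c (pt n1) (pt n2) (pt n3)" for n1 n2 n3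
  proof -
    note ne = ccw_distinct(4-6)[OF h(4)]
    have dist: "n1 \<noteq> n2" "n2 \<noteq> n3" "n1 \<noteq> n3" using ne by auto
    have "card {n1, n2, n3} \<le> card (unoriented D `` {Lo c})"
      using h by (intro card_mono finite_Image) auto
    then have tri: "trivalent D (Lo c)"
      using Image_le_3[of "Lo c"] dist by (auto simp: trivalent_iff)
    then have card3: "card (unoriented D `` {Lo c}) = 3" by (simp add: trivalent_iff)
    have \<kappa>c: "\<kappa> (Lo c, n) \<in> colors" if "n \<in> unoriented D `` {Lo c}" for n using that \<kappa>_color by auto
    have io: "(n, Lo c) \<in> D \<or> (Lo c, n) \<in> D" "\<not> ((n, Lo c) \<in> D \<and> (Lo c, n) \<in> D)"
      if "n \<in> unoriented D `` {Lo c}" for n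
      using that antisym_D by (auto simp: unoriented_def)
    have two_in: "vertex_rule G (\<kappa> (Lo c, w)) (\<kappa> (Lo c, l)) (\<kappa> (Lo c, r))"
      if "(l, Lo c) \<in> D" "(r, Lo c) \<in> D" "(Lo c, w) \<in> D" "ccw c (pt w) (pt l) (pt r)" for w l r
    proof -
      have "snd (g (l, Lo c)) = snd (g (Lo c, w)) \<and> snd (g (r, Lo c)) = snd (g (Lo c, w)) \<and>
        fst (g (Lo c, w)) = fst (g (r, Lo c)) \<otimes> fst (g (l, Lo c))"
        using rules that tri unfolding segment_rules_def by fastforce
      moreover have "fst (g (r, Lo c)) \<in> carrier G" "fst (g (l, Lo c)) \<in> carrier G"
        using g_color that fst_snd_colors(1) by blast+
      ultimately show ?thesis using \<kappa>_fwd \<kappa>_bwd that by (simp add: vertex_rule_def bar_def m_assoc)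
    qed
    have two_out: "vertex_rule G (\<kappa> (Lo c, w)) (\<kappa> (Lo c, r)) (\<kappa> (Lo c, l))"
      if "(Lo c, l) \<in> D" "(Lo c, r) \<in> D" "(w, Lo c) \<in> D" "ccw c (pt w) (pt r) (pt l)" for w l r
    proof -
      have "snd (g (Lo c, l)) = snd (g (w, Lo c)) \<and> snd (g (Lo c, r)) = snd (g (w, Lo c)) \<and>
        fst (g (w, Lo c)) = fst (g (Lo c, r)) \<otimes> fst (g (Lo c, l))"
        using rules that tri unfolding segment_rules_def by fastforce
      moreover have "fst (g (Lo c, r)) \<in> carrier G" "fst (g (Lo c, l)) \<in> carrier G"
        using g_color that fst_snd_colors(1) by blast+
      ultimately show ?thesis using \<kappa>_fwd \<kappa>_bwd that
        by (simp add: vertex_rule_def bar_def m_assoc inv_mult_group)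
    qed
    have inn: "card {m. (m, Lo c) \<in> D} \<in> {1, 2}" "card {m. (Lo c, m) \<in> D} \<in> {1, 2}"
      using tri by (auto simp: trivalent_def in_degree_def out_degree_def)
    \<comment> \<open>A trivalent node is neither source nor sink, so both directions occur among
      the three edges.\<close>
    have "\<not> {n1, n2, n3} \<subseteq> {m. (m, Lo c) \<in> D}" "\<not> {n1, n2, n3} \<subseteq> {m. (Lo c, m) \<in> D}"
      using inn dist card_mono[of "{m. (m, Lo c) \<in> D}" "{n1, n2, n3}"]
        card_mono[of "{m. (Lo c, m) \<in> D}" "{n1, n2, n3}"] card_ge_0_finite by fastforce+
    then have some: "\<exists>m\<in>{n1, n2, n3}. (Lo c, m) \<in> D" "\<exists>m\<in>{n1, n2, n3}. (m, Lo c) \<in> D"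
      using io h by blast+
    have main: "vertex_rule G (\<kappa> (Lo c, w)) (\<kappa> (Lo c, l)) (\<kappa> (Lo c, r))"
      if "{w, l, r} = {n1, n2, n3}" "ccw c (pt w) (pt l) (pt r)"
        "(Lo c, w) \<in> D \<and> (l, Lo c) \<in> D \<and> (r, Lo c) \<in> D \<or> (w, Lo c) \<in> D \<and> (Lo c, l) \<in> D \<and> (Lo c, r) \<in> D" for w l r
      using two_in two_out that by blast
    have rot: "ccw c (pt n2) (pt n3) (pt n1)" "ccw c (pt n3) (pt n1) (pt n2)"
      using h(4) ccw_rotate by blast+
    \<comment> \<open>One edge is directed unlike the other two. The rule is known with that edge in
      front and is rotated into the requested order.\<close>
    consider "(Lo c, n1) \<in> D \<and> (n2, Lo c) \<in> D \<and> (n3, Lo c) \<in> D \<or> (n1, Lo c) \<in> D \<and> (Lo c, n2) \<in> D \<and> (Lo c, n3) \<in> D"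
      | "(Lo c, n2) \<in> D \<and> (n3, Lo c) \<in> D \<and> (n1, Lo c) \<in> D \<or> (n2, Lo c) \<in> D \<and> (Lo c, n3) \<in> D \<and> (Lo c, n1) \<in> D"
      | "(Lo c, n3) \<in> D \<and> (n1, Lo c) \<in> D \<and> (n2, Lo c) \<in> D \<or> (n3, Lo c) \<in> D \<and> (Lo c, n1) \<in> D \<and> (Lo c, n2) \<in> D"
      using some io(1)[OF h(1)] io(1)[OF h(2)] io(1)[OF h(3)] by blast
    then show ?thesis
    proof cases
      case 1 then show ?thesis using main h(4) by blast
    next
      case 2
      have "vertex_rule G (\<kappa> (Lo c, n2)) (\<kappa> (Lo c, n3)) (\<kappa> (Lo c, n1))"
        using main[OF _ rot(1) 2] by blast
      then show ?thesis using vertex_rule_rotate \<kappa>c h(1-3) by blast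
    next
      case 3
      have "vertex_rule G (\<kappa> (Lo c, n3)) (\<kappa> (Lo c, n1)) (\<kappa> (Lo c, n2))"
        using main[OF _ rot(2) 3] by blast
      then show ?thesis using vertex_rule_rotate \<kappa>c h(1-3) by blast
    qed
  qed
  ultimately show ?thesis unfolding point_rule_def by blast
qed

lemma point_rule_imp_passes:
  assumes rule: "\<And>c. point_rule G q (unoriented D) \<kappa> c" and "(s, s') \<in> passes D"
  shows "g s = g s'"
proof -
  obtain m n k where s: "s = (m, n)" "s' = (n, k)" "(m, n) \<in> D" "(n, k) \<in> D"
    and n: "joint D n \<or> (\<exists>c. n = Hi c)"
    using assms(2) by (auto simp: passes_def)
  have mk: "m \<noteq> k" using s antisym_D by auto
  have nF: "n \<in> Field D" using s by (auto simp: Field_def)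
  have b: "bivalent D n" using n nF crossing_Hi by (auto simp: joint_def crossing_def)
  have "m \<in> unoriented D `` {n}" "k \<in> unoriented D `` {n}" using s by (auto simp: unoriented_def)
  then have img: "unoriented D `` {n} = {m, k}"
    using b mk finite_Image card_seteq[of "unoriented D `` {n}" "{m, k}"]
    by (auto simp: bivalent_iff)
  have "\<kappa> (m, n) = \<kappa> (n, k)"
  proof (cases n)
    case (Lo z)
    then have "unoriented D `` {Hi z} = {}" using n by (auto simp: joint_def Image_eq_empty)
    then show ?thesis using rule[of z] img mk Lo by (simp add: point_rule_def)
  next
    case (Hi z)
    then show ?thesis using rule[of z] img mk by (simp add: point_rule_def)
  qed
  then show ?thesis using \<kappa>_fwd s by simp
qed

lemma point_rule_imp_rules:
  assumes rule: "\<And>c. point_rule G q (unoriented D) \<kappa> c"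
  shows "segment_rules G q D g"
  unfolding segment_rules_def
proof (intro conjI allI impI; (elim conjE)?)
  fix c p p' u u' s s'
  assume h: "(p, Hi c) \<in> D" "(Hi c, p') \<in> D" "s \<in> D" "joins s u (Lo c)" "on_right (pt p) c (pt p') (pt u)"
    "s' \<in> D" "joins s' u' (Lo c)" "on_left (pt p) c (pt p') (pt u')"
  have m: "p \<in> unoriented D `` {Hi c}" "p' \<in> unoriented D `` {Hi c}"
    "u \<in> unoriented D `` {Lo c}" "u' \<in> unoriented D `` {Lo c}"
    using h by (auto simp: unoriented_def joins_def)
  have "bivalent D (Lo c)" using crossing_Hi[of c] h(1) by (auto simp: crossing_def Field_def)
  moreover have "u \<noteq> u'" using h(5,8) on_right_left_neq by blast
  moreover have "\<kappa> (Lo c, u') = \<kappa> (u, Lo c) \<rhd> \<kappa> (p, Hi c)"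
    using rule[of c] m h(5,8) unfolding point_rule_def by blast
  ultimately show "g s' = g s \<rhd> g (p, Hi c)"
    using crossing_equation[OF m(3,4) _ _ h(3,4,6,7)] g_color h(1) \<kappa>_fwd by simp
next
  fix v l r w
  assume h: "(l, v) \<in> D" "(r, v) \<in> D" "(v, w) \<in> D" "trivalent D v" "ccw (pt v) (pt w) (pt l) (pt r)"
  have "v \<in> Field D" using h(1) by (auto simp: Field_def)
  then obtain z where v: "v = Lo z"
    using h(4) crossing_Hi[of "pt v"] by (cases v) (auto simp: crossing_def trivalent_def bivalent_def)
  have c: "fst (g (r, v)) \<in> carrier G" "fst (g (l, v)) \<in> carrier G" "fst (g (v, w)) \<in> carrier G"
    using g_color h(1-3) fst_snd_colors(1) by blast+
  have "vertex_rule G (\<kappa> (Lo z, w)) (\<kappa> (Lo z, l)) (\<kappa> (Lo z, r))"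
    using rule[of z] h(1-3,5) v unfolding point_rule_def by (auto simp: unoriented_def)
  then have vr: "vertex_rule G (g (v, w)) (bar G (g (l, v))) (bar G (g (r, v)))"
    using \<kappa>_fwd \<kappa>_bwd h(1-3) v by simp
  then have "fst (g (v, w)) \<otimes> inv (fst (g (l, v))) \<otimes> inv (fst (g (r, v))) = \<one>"
    by (simp add: vertex_rule_def bar_def)
  then have "fst (g (v, w)) \<otimes> inv (fst (g (l, v))) \<otimes> inv (fst (g (r, v))) \<otimes> fst (g (r, v)) \<otimes> fst (g (l, v))
      = fst (g (r, v)) \<otimes> fst (g (l, v))" using c by simp
  then have "fst (g (v, w)) = fst (g (r, v)) \<otimes> fst (g (l, v))" using c by (simp add: m_assoc)
  then show "snd (g (l, v)) = snd (g (v, w))" "snd (g (r, v)) = snd (g (v, w))"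
    "fst (g (v, w)) = fst (g (r, v)) \<otimes> fst (g (l, v))"
    using vr by (auto simp: vertex_rule_def bar_def)
next
  fix v l r w
  assume h: "(v, l) \<in> D" "(v, r) \<in> D" "(w, v) \<in> D" "trivalent D v" "ccw (pt v) (pt w) (pt r) (pt l)"
  have "v \<in> Field D" using h(1) by (auto simp: Field_def)
  then obtain z where v: "v = Lo z"
    using h(4) crossing_Hi[of "pt v"] by (cases v) (auto simp: crossing_def trivalent_def bivalent_def)
  have c: "fst (g (v, r)) \<in> carrier G" "fst (g (v, l)) \<in> carrier G" "fst (g (w, v)) \<in> carrier G"
    using g_color h(1-3) fst_snd_colors(1) by blast+
  have "vertex_rule G (\<kappa> (Lo z, w)) (\<kappa> (Lo z, r)) (\<kappa> (Lo z, l))"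
    using rule[of z] h(1-3,5) v unfolding point_rule_def by (auto simp: unoriented_def)
  then have vr: "vertex_rule G (bar G (g (w, v))) (g (v, r)) (g (v, l))"
    using \<kappa>_fwd \<kappa>_bwd h(1-3) v by simp
  then have "inv (fst (g (w, v))) \<otimes> fst (g (v, r)) \<otimes> fst (g (v, l)) = \<one>"
    by (simp add: vertex_rule_def bar_def)
  then have "fst (g (w, v)) \<otimes> (inv (fst (g (w, v))) \<otimes> fst (g (v, r)) \<otimes> fst (g (v, l))) = fst (g (w, v))"
    using c by simp
  then have "fst (g (w, v)) = fst (g (v, r)) \<otimes> fst (g (v, l))" using c by (simp add: m_assoc)
  then show "snd (g (v, l)) = snd (g (w, v))" "snd (g (v, r)) = snd (g (w, v))"
    "fst (g (w, v)) = fst (g (v, r)) \<otimes> fst (g (v, l))"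
    using vr by (auto simp: vertex_rule_def bar_def)
qed

end

section \<open>The bijection between colorings and half colorings\<close>

definition lift_coloring :: "('g, 'm) monoid_scheme \<Rightarrow> diagram \<Rightarrow> (seg set \<Rightarrow> 'g \<times> 'x) \<Rightarrow> seg \<Rightarrow> 'g \<times> 'x" where
  "lift_coloring G D f = (\<lambda>e\<in>unoriented D.
     if e \<in> D then f (arc_of D e) else bar G (f (arc_of D (prod.swap e))))"

definition half_hull ::
  "('g, 'm) monoid_scheme \<Rightarrow> 'x set \<Rightarrow> ('g \<Rightarrow> 'x \<Rightarrow> 'x \<Rightarrow> 'x) \<Rightarrow> diagram \<Rightarrow> (seg \<Rightarrow> 'g \<times> 'x) \<Rightarrow> 'x set" where
  "half_hull G X q U \<kappa> = \<Inter>{Y. G_subfamily G X q Y \<and> (\<forall>e\<in>U. snd (\<kappa> e) \<in> Y)}"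

context
  fixes G :: "('g, 'm) monoid_scheme" and X :: "'x set" and q D
  assumes fam: "quandle_family G X q" and D: "Y_diagram D"
begin

interpretation quandle_family G X q by (rule fam)
interpretation Y_diagram D by (rule D)

lemma colored_lift:
  assumes "f \<in> arcs D \<rightarrow>\<^sub>E carrier G \<times> X"
  shows "colored_diagram D G X q (\<lambda>s. f (arc_of D s)) (lift_coloring G D f)"
proof unfold_locales
  show "f (arc_of D s) \<in> carrier G \<times> X" if "s \<in> D" for s
    using assms that by (auto simp: arcs_eq)
  show "lift_coloring G D f (m, n) = f (arc_of D (m, n))"
    "lift_coloring G D f (n, m) = bar G (f (arc_of D (m, n)))" if "(m, n) \<in> D" for m n
    using that antisym_D[OF that] by (auto simp: lift_coloring_def unoriented_def)
qed

lemma lift_in_half_colorings: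
  assumes "f \<in> colorings G X q D"
  shows "lift_coloring G D f \<in> half_colorings G X q (unoriented D)"
proof -
  have f: "f \<in> arcs D \<rightarrow>\<^sub>E carrier G \<times> X" "segment_rules G q D (\<lambda>s. f (arc_of D s))"
    using assms by (auto simp: colorings_eq)
  interpret colored_diagram D G X q "\<lambda>s. f (arc_of D s)" "lift_coloring G D f"
    using colored_lift f(1) .
  have "lift_coloring G D f \<in> unoriented D \<rightarrow>\<^sub>E carrier G \<times> X"
    using \<kappa>_color by (auto simp: lift_coloring_def simp del: mem_Sigma_iff)
  then show ?thesis
    using \<kappa>_bar rules_imp_point_rule[OF _ f(2)] arc_of_passes unfolding half_colorings_def by auto
qed

lemma inj_lift: "inj_on (lift_coloring G D) (colorings G X q D)"
proof (rule inj_onI)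
  fix f f' assume f: "f \<in> colorings G X q D" "f' \<in> colorings G X q D" and eq: "lift_coloring G D f = lift_coloring G D f'"
  show "f = f'"
  proof (rule PiE_ext[of f "arcs D" "\<lambda>_. carrier G \<times> X"])
    fix A assume "A \<in> arcs D"
    then obtain s where s: "s \<in> D" "A = arc_of D s" by (auto simp: arcs_eq)
    have "lift_coloring G D f s = lift_coloring G D f' s" using eq by simp
    then show "f A = f' A" using s by (auto simp: lift_coloring_def unoriented_def)
  qed (use f in \<open>auto simp: colorings_eq simp del: mem_Sigma_iff\<close>)
qed

text \<open>By the rules at joints and over-nodes all segments of an arc carry the same color, so
  any of them can be chosen to define the color of the arc.\<close>

lemma surj_lift:
  assumes \<kappa>: "\<kappa> \<in> half_colorings G X q (unoriented D)"
  shows "\<kappa> \<in> lift_coloring G D ` colorings G X q D"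
proof -
  have \<kappa>1: "\<kappa> \<in> unoriented D \<rightarrow>\<^sub>E carrier G \<times> X" "\<And>m n. (m, n) \<in> unoriented D \<Longrightarrow> \<kappa> (n, m) = bar G (\<kappa> (m, n))"
    "\<And>c. point_rule G q (unoriented D) \<kappa> c"
    using \<kappa> by (auto simp: half_colorings_def)
  have col: "\<kappa> s \<in> carrier G \<times> X" if "s \<in> D" for s using \<kappa>1(1) that unfolding unoriented_def by blast
  interpret K: colored_diagram D G X q \<kappa> \<kappa>
  proof unfold_locales
    show "\<kappa> s \<in> carrier G \<times> X" if "s \<in> D" for s using col that .
    show "\<kappa> (m, n) = \<kappa> (m, n)" for m n by (rule refl)
    show "\<kappa> (n, m) = bar G (\<kappa> (m, n))" if "(m, n) \<in> D" for m n
      using that by (intro \<kappa>1(2)) (simp add: in_unoriented)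
  qed
  define f where "f = (\<lambda>A\<in>arcs D. \<kappa> (SOME s. s \<in> A))"
  have f: "f (arc_of D s) = \<kappa> s" if s: "s \<in> D" for s
  proof -
    have "(SOME t. t \<in> arc_of D s) \<in> arc_of D s" using self_in_arc_of[OF s] by (rule someI)
    then have "\<kappa> (SOME t. t \<in> arc_of D s) = \<kappa> s"
      by (rule constant_on_arc[rotated]) (rule K.point_rule_imp_passes[OF \<kappa>1(3)])
    then show ?thesis using s by (simp add: f_def arcs_eq)
  qed
  have fE: "f \<in> arcs D \<rightarrow>\<^sub>E carrier G \<times> X"
    using f col by (auto simp: f_def arcs_eq simp del: mem_Sigma_iff)
  interpret F: colored_diagram D G X q "\<lambda>s. f (arc_of D s)" \<kappa>
  proof unfold_locales
    show "f (arc_of D s) \<in> carrier G \<times> X" if "s \<in> D" for s using col f that by simp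
    show "\<kappa> (m, n) = f (arc_of D (m, n))" "\<kappa> (n, m) = bar G (f (arc_of D (m, n)))" if "(m, n) \<in> D" for m n
      using that f K.\<kappa>_bwd by simp_all
  qed
  have "segment_rules G q D (\<lambda>s. f (arc_of D s))"
    using F.point_rule_imp_rules[OF \<kappa>1(3)] .
  then have "f \<in> colorings G X q D" using fE by (simp add: colorings_eq)
  moreover have "lift_coloring G D f = \<kappa>"
  proof (rule PiE_ext[of _ "unoriented D" "\<lambda>_. carrier G \<times> X"])
    show "lift_coloring G D f \<in> unoriented D \<rightarrow>\<^sub>E carrier G \<times> X"
      using lift_in_half_colorings[OF calculation] by (auto simp: half_colorings_def)
    fix e assume e: "e \<in> unoriented D"
    show "lift_coloring G D f e = \<kappa> e"
    proof (cases "e \<in> D")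
      case False
      obtain m n where mn: "e = (m, n)" by (cases e)
      then have "(n, m) \<in> D" using e False by (auto simp: unoriented_def)
      then show ?thesis using f e False mn \<kappa>1(2)[of n m] by (simp add: lift_coloring_def unoriented_def)
    qed (use e f in \<open>simp add: lift_coloring_def\<close>)
  qed (use \<kappa>1(1) in auto)
  ultimately show ?thesis by blast
qed

text \<open>Inverting a color keeps its second component, so the directed segments require exactly
  the subfamilies that the arcs require.\<close>

lemma image_subfamily_lift:
  assumes "f \<in> colorings G X q D"
  shows "image_subfamily G X q D f = half_hull G X q (unoriented D) (lift_coloring G D f)"
proof -
  have f: "f \<in> arcs D \<rightarrow>\<^sub>E carrier G \<times> X" using assms by (auto simp: colorings_eq)
  interpret colored_diagram D G X q "\<lambda>s. f (arc_of D s)" "lift_coloring G D f"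
    using colored_lift f(1) .
  have "f ` arcs D \<subseteq> carrier G \<times> Y \<longleftrightarrow> (\<forall>e\<in>unoriented D. snd (lift_coloring G D f e) \<in> Y)" for Y
  proof
    assume L: "f ` arcs D \<subseteq> carrier G \<times> Y"
    have Y: "snd (f (arc_of D s)) \<in> Y" if "s \<in> D" for s
    proof -
      have "f (arc_of D s) \<in> carrier G \<times> Y" using L that unfolding arcs_eq by blast
      then show ?thesis by (rule mem_Times_iff[THEN iffD1, THEN conjunct2])
    qed
    have "snd (lift_coloring G D f (m, n)) \<in> Y" if "(m, n) \<in> unoriented D" for m n
    proof (cases "(m, n) \<in> D")
      case True
      then show ?thesis using \<kappa>_fwd Y by metis
    next
      case False
      then have "(n, m) \<in> D" using that by (simp add: in_unoriented)
      then show ?thesis using \<kappa>_bwd Y by (simp add: bar_def)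
    qed
    then show "\<forall>e\<in>unoriented D. snd (lift_coloring G D f e) \<in> Y" by (metis surj_pair)
  next
    assume R: "\<forall>e\<in>unoriented D. snd (lift_coloring G D f e) \<in> Y"
    have "snd (f (arc_of D s)) \<in> Y" if "s \<in> D" for s
      using bspec[OF R, of s] that by (simp add: lift_coloring_def unoriented_def)
    then have "f (arc_of D s) \<in> carrier G \<times> Y" if "s \<in> D" for s
      using that fst_snd_colors(1)[OF g_color[OF that]] mem_Times_iff[of "f (arc_of D s)" "carrier G" Y] by blast
    then show "f ` arcs D \<subseteq> carrier G \<times> Y" unfolding arcs_eq by blast
  qed
  then show ?thesis by (simp add: image_subfamily_def half_hull_def)
qed

lemma invariant_via_half_colorings:
  "image_mset (\<lambda>f. P (image_subfamily G X q D f)) (mset_set (colorings G X q D)) =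
   image_mset (\<lambda>\<kappa>. P (half_hull G X q (unoriented D) \<kappa>)) (mset_set (half_colorings G X q (unoriented D)))"
proof -
  have "lift_coloring G D ` colorings G X q D = half_colorings G X q (unoriented D)"
    using lift_in_half_colorings surj_lift by blast
  then have "mset_set (half_colorings G X q (unoriented D)) =
      image_mset (lift_coloring G D) (mset_set (colorings G X q D))"
    using image_mset_mset_set[OF inj_lift] by simp
  moreover have "f \<in> colorings G X q D" if "f \<in># mset_set (colorings G X q D)" for f
    using that by (cases "finite (colorings G X q D)") auto
  ultimately show ?thesis
    using image_subfamily_lift by (auto simp: image_mset.compositionality intro!: image_mset_cong)
qed

end

text \<open>
  The correspondence has to work for every subfamily; this is why it preserves the image subfamily
  of a coloring.
\<close>

definition recolorable ::
  "('g, 'm) monoid_scheme \<Rightarrow> ('g \<Rightarrow> 'x \<Rightarrow> 'x \<Rightarrow> 'x) \<Rightarrow> diagram \<Rightarrow> diagram \<Rightarrow> bool" where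
  "recolorable G q U U' \<longleftrightarrow> (\<exists>\<rho>. \<forall>X. G_family G X q \<longrightarrow>
     (\<forall>\<kappa>\<in>half_colorings G X q U. \<exists>\<kappa>'\<in>half_colorings G X q U'. \<rho> \<kappa> \<kappa>') \<and>
     (\<forall>\<kappa>'\<in>half_colorings G X q U'. \<exists>\<kappa>\<in>half_colorings G X q U. \<rho> \<kappa> \<kappa>') \<and>
     (\<forall>\<kappa>\<in>half_colorings G X q U. \<forall>\<kappa>1\<in>half_colorings G X q U'. \<forall>\<kappa>2\<in>half_colorings G X q U'.
        \<rho> \<kappa> \<kappa>1 \<longrightarrow> \<rho> \<kappa> \<kappa>2 \<longrightarrow> \<kappa>1 = \<kappa>2) \<and>
     (\<forall>\<kappa>'\<in>half_colorings G X q U'. \<forall>\<kappa>1\<in>half_colorings G X q U. \<forall>\<kappa>2\<in>half_colorings G X q U.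
        \<rho> \<kappa>1 \<kappa>' \<longrightarrow> \<rho> \<kappa>2 \<kappa>' \<longrightarrow> \<kappa>1 = \<kappa>2))"

text \<open>The rule at a point does not mention the underlying set.\<close>

lemma half_colorings_subfamily:
  assumes "G_subfamily G X q Y"
  shows "half_colorings G Y q U = {\<kappa> \<in> half_colorings G X q U. \<forall>e\<in>U. snd (\<kappa> e) \<in> Y}"
  using assms by (fastforce simp: G_subfamily_def half_colorings_def PiE_iff mem_Times_iff)

text \<open>A partner of \<open>\<kappa>\<close> with colors in a subfamily is also a partner for
  the whole family, where it is unique; hence it is the chosen one. So \<open>\<kappa>\<close> and
  its image have their colors in the same subfamilies and generate the same one.\<close>

lemma recolorable_imp_invariant_eq:
  assumes fam: "G_family G X q" and "recolorable G q U U'"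
  shows "image_mset (\<lambda>\<kappa>. P (half_hull G X q U \<kappa>)) (mset_set (half_colorings G X q U)) =
    image_mset (\<lambda>\<kappa>. P (half_hull G X q U' \<kappa>)) (mset_set (half_colorings G X q U'))"
proof -
  obtain \<rho> where \<rho>: "\<forall>X. G_family G X q \<longrightarrow>
     (\<forall>\<kappa>\<in>half_colorings G X q U. \<exists>\<kappa>'\<in>half_colorings G X q U'. \<rho> \<kappa> \<kappa>') \<and>
     (\<forall>\<kappa>'\<in>half_colorings G X q U'. \<exists>\<kappa>\<in>half_colorings G X q U. \<rho> \<kappa> \<kappa>') \<and>
     (\<forall>\<kappa>\<in>half_colorings G X q U. \<forall>\<kappa>1\<in>half_colorings G X q U'. \<forall>\<kappa>2\<in>half_colorings G X q U'.
        \<rho> \<kappa> \<kappa>1 \<longrightarrow> \<rho> \<kappa> \<kappa>2 \<longrightarrow> \<kappa>1 = \<kappa>2) \<and>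
     (\<forall>\<kappa>'\<in>half_colorings G X q U'. \<forall>\<kappa>1\<in>half_colorings G X q U. \<forall>\<kappa>2\<in>half_colorings G X q U.
        \<rho> \<kappa>1 \<kappa>' \<longrightarrow> \<rho> \<kappa>2 \<kappa>' \<longrightarrow> \<kappa>1 = \<kappa>2)"
    using assms(2) unfolding recolorable_def by (elim exE)
  have ex1: "\<exists>\<kappa>'\<in>half_colorings G X q U'. \<rho> \<kappa> \<kappa>'"
    if "G_family G X q" "\<kappa> \<in> half_colorings G X q U" for X \<kappa>
    using \<rho>[rule_format, OF that(1)] that(2) by simp
  have ex2: "\<exists>\<kappa>\<in>half_colorings G X q U. \<rho> \<kappa> \<kappa>'"
    if "G_family G X q" "\<kappa>' \<in> half_colorings G X q U'" for X \<kappa>'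
    using \<rho>[rule_format, OF that(1)] that(2) by simp
  have un1: "\<kappa>1 = \<kappa>2" if "\<kappa> \<in> half_colorings G X q U" "\<kappa>1 \<in> half_colorings G X q U'"
    "\<kappa>2 \<in> half_colorings G X q U'" "\<rho> \<kappa> \<kappa>1" "\<rho> \<kappa> \<kappa>2" for \<kappa> \<kappa>1 \<kappa>2
    using \<rho>[rule_format, OF fam] that by blast
  have un2: "\<kappa>1 = \<kappa>2" if "\<kappa>' \<in> half_colorings G X q U'" "\<kappa>1 \<in> half_colorings G X q U"
    "\<kappa>2 \<in> half_colorings G X q U" "\<rho> \<kappa>1 \<kappa>'" "\<rho> \<kappa>2 \<kappa>'" for \<kappa>' \<kappa>1 \<kappa>2
    using \<rho>[rule_format, OF fam] that by blast
  obtain \<Phi> where \<Phi>: "\<And>\<kappa>. \<kappa> \<in> half_colorings G X q U \<Longrightarrow> \<Phi> \<kappa> \<in> half_colorings G X q U' \<and> \<rho> \<kappa> (\<Phi> \<kappa>)"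
    using ex1[OF fam] by metis
  have inj: "inj_on \<Phi> (half_colorings G X q U)"
    using un2 \<Phi> by (intro inj_onI) metis
  have surj: "\<Phi> ` half_colorings G X q U = half_colorings G X q U'"
  proof
    show "half_colorings G X q U' \<subseteq> \<Phi> ` half_colorings G X q U"
    proof
      fix \<kappa>' assume \<kappa>': "\<kappa>' \<in> half_colorings G X q U'"
      then obtain \<kappa> where \<kappa>: "\<kappa> \<in> half_colorings G X q U" "\<rho> \<kappa> \<kappa>'" using ex2[OF fam] by blast
      then have "\<Phi> \<kappa> = \<kappa>'" using un1 \<Phi> \<kappa>' by blast
      then show "\<kappa>' \<in> \<Phi> ` half_colorings G X q U" using \<kappa> by blast
    qed
  qed (use \<Phi> in blast)
  have hull: "half_hull G X q U' (\<Phi> \<kappa>) = half_hull G X q U \<kappa>" if \<kappa>: "\<kappa> \<in> half_colorings G X q U" for \<kappa>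
  proof -
    have "(\<forall>e\<in>U'. snd (\<Phi> \<kappa> e) \<in> Y) \<longleftrightarrow> (\<forall>e\<in>U. snd (\<kappa> e) \<in> Y)" if Y: "G_subfamily G X q Y" for Y
    proof -
      have famY: "G_family G Y q" using Y by (simp add: G_subfamily_def)
      have "\<Phi> \<kappa> \<in> half_colorings G Y q U' \<longleftrightarrow> \<kappa> \<in> half_colorings G Y q U"
      proof
        assume "\<Phi> \<kappa> \<in> half_colorings G Y q U'"
        then obtain \<kappa>2 where \<kappa>2: "\<kappa>2 \<in> half_colorings G Y q U" "\<rho> \<kappa>2 (\<Phi> \<kappa>)" using ex2[OF famY] by blast
        then have "\<kappa>2 = \<kappa>"
          using un2[of "\<Phi> \<kappa>" \<kappa>2 \<kappa>] \<Phi>[OF \<kappa>] \<kappa> half_colorings_subfamily[OF Y] by blast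
        then show "\<kappa> \<in> half_colorings G Y q U" using \<kappa>2 by simp
      next
        assume "\<kappa> \<in> half_colorings G Y q U"
        then obtain \<kappa>2 where \<kappa>2: "\<kappa>2 \<in> half_colorings G Y q U'" "\<rho> \<kappa> \<kappa>2" using ex1[OF famY] by blast
        then have "\<kappa>2 = \<Phi> \<kappa>"
          using un1[of \<kappa> \<kappa>2 "\<Phi> \<kappa>"] \<Phi>[OF \<kappa>] \<kappa> half_colorings_subfamily[OF Y] by blast
        then show "\<Phi> \<kappa> \<in> half_colorings G Y q U'" using \<kappa>2 by simp
      qed
      then show ?thesis using \<kappa> \<Phi>[OF \<kappa>] half_colorings_subfamily[OF Y] by blast
    qed
    then show ?thesis unfolding half_hull_def by (intro arg_cong[of _ _ Inter] Collect_cong) blast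
  qed
  have "mset_set (half_colorings G X q U') = image_mset \<Phi> (mset_set (half_colorings G X q U))"
    using image_mset_mset_set[OF inj] surj by simp
  moreover have "\<kappa> \<in> half_colorings G X q U" if "\<kappa> \<in># mset_set (half_colorings G X q U)" for \<kappa>
    using that by (cases "finite (half_colorings G X q U)") auto
  ultimately show ?thesis
    using hull by (auto simp: image_mset.compositionality intro!: image_mset_cong)
qed

text \<open>\<open>F n\<close> matches the old neighbours of the node \<open>n\<close> with the new
  ones. Injectivity is used where a node is recognized by having exactly two neighbours. The cyclic
  order is only carried from new to old, because in the rule it occurs as a premise; the three nodes
  may mix \<open>Hi c\<close> and \<open>Lo c\<close> on account of crossings.\<close>

lemma point_rule_transfer:
  assumes rule: "point_rule G q U \<kappa> c"
    and F: "\<And>N. N \<in> {Hi, Lo} \<Longrightarrow> U' `` {N c'} = F (N c) ` (U `` {N c}) \<and> inj_on (F (N c)) (U `` {N c})"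
    and \<kappa>: "\<And>N y. N \<in> {Hi, Lo} \<Longrightarrow> (N c, y) \<in> U \<Longrightarrow>
        \<kappa>' (N c', F (N c) y) = \<kappa> (N c, y) \<and> \<kappa>' (F (N c) y, N c') = \<kappa> (y, N c)"
    and ccw: "\<And>N1 N2 N3 y1 y2 y3. N1 \<in> {Hi, Lo} \<Longrightarrow> N2 \<in> {Hi, Lo} \<Longrightarrow> N3 \<in> {Hi, Lo} \<Longrightarrow>
        (N1 c, y1) \<in> U \<Longrightarrow> (N2 c, y2) \<in> U \<Longrightarrow> (N3 c, y3) \<in> U \<Longrightarrow>
        ccw c' (pt (F (N1 c) y1)) (pt (F (N2 c) y2)) (pt (F (N3 c) y3)) \<Longrightarrow> ccw c (pt y1) (pt y2) (pt y3)"
  shows "point_rule G q U' \<kappa>' c'"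
proof -
  have rHi: "\<And>p p'. U `` {Hi c} = {p, p'} \<Longrightarrow> p \<noteq> p' \<Longrightarrow> \<kappa> (p, Hi c) = \<kappa> (Hi c, p')"
    and rLo: "\<And>p p'. U `` {Hi c} = {} \<Longrightarrow> U `` {Lo c} = {p, p'} \<Longrightarrow> p \<noteq> p' \<Longrightarrow> \<kappa> (p, Lo c) = \<kappa> (Lo c, p')"
    using rule unfolding point_rule_def by simp_all
  have through: "\<kappa>' (p, N c') = \<kappa>' (N c', p')"
    if N: "N \<in> {Hi, Lo}" and r: "\<And>p p'. U `` {N c} = {p, p'} \<Longrightarrow> p \<noteq> p' \<Longrightarrow> \<kappa> (p, N c) = \<kappa> (N c, p')"
      and pp: "U' `` {N c'} = {p, p'}" "p \<noteq> p'" for p p' and N :: "complex \<Rightarrow> complex node"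
  proof -
    have "p \<in> F (N c) ` (U `` {N c})" "p' \<in> F (N c) ` (U `` {N c})"
      using F[OF N] pp by auto
    then obtain y y' where y: "p = F (N c) y" "y \<in> U `` {N c}" "p' = F (N c) y'" "y' \<in> U `` {N c}" by blast
    have "F (N c) ` (U `` {N c}) = F (N c) ` {y, y'}" using F[OF N] pp(1) y by simp
    then have "U `` {N c} = {y, y'}"
      using F[OF N] y inj_on_image_eq_iff[of "F (N c)" "U `` {N c}" "U `` {N c}" "{y, y'}"] by auto
    moreover have "y \<noteq> y'" using pp y by auto
    ultimately have "\<kappa> (y, N c) = \<kappa> (N c, y')" using r by blast
    then show ?thesis using \<kappa>[OF N] y by auto
  qed
  have 1: "\<kappa>' (p, Hi c') = \<kappa>' (Hi c', p')" if "U' `` {Hi c'} = {p, p'}" "p \<noteq> p'" for p p'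
    using through[OF _ rHi that] by simp
  have 2: "\<kappa>' (p, Lo c') = \<kappa>' (Lo c', p')"
    if "U' `` {Hi c'} = {}" "U' `` {Lo c'} = {p, p'}" "p \<noteq> p'" for p p'
  proof -
    have "U `` {Hi c} = {}" using F[of Hi] that(1) by auto
    then show ?thesis using through[OF _ rLo that(2,3)] by simp
  qed
  have 3: "\<kappa>' (Lo c', u') = assoc_op G q (\<kappa>' (u, Lo c')) (\<kappa>' (p, Hi c'))"
    if h: "p \<in> U' `` {Hi c'}" "p' \<in> U' `` {Hi c'}" "u \<in> U' `` {Lo c'}" "u' \<in> U' `` {Lo c'}"
      "on_right (pt p) c' (pt p') (pt u)" "on_left (pt p) c' (pt p') (pt u')" for p p' u u'
  proof -
    obtain y y' v v' where y: "p = F (Hi c) y" "(Hi c, y) \<in> U" "p' = F (Hi c) y'" "(Hi c, y') \<in> U"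
      "u = F (Lo c) v" "(Lo c, v) \<in> U" "u' = F (Lo c) v'" "(Lo c, v') \<in> U"
      using h(1-4) F[of Hi] F[of Lo] by auto
    have "on_right (pt y) c (pt y') (pt v)" "on_left (pt y) c (pt y') (pt v')"
      using h(5,6) y ccw[of Hi Lo Hi y v y'] ccw[of Hi Lo Hi y' v' y] unfolding on_right_def on_left_def by auto
    then have "\<kappa> (Lo c, v') = assoc_op G q (\<kappa> (v, Lo c)) (\<kappa> (y, Hi c))"
      using rule y unfolding point_rule_def by blast
    then show ?thesis using \<kappa>[of Hi] \<kappa>[of Lo] y by auto
  qed
  have 4: "vertex_rule G (\<kappa>' (Lo c', n1)) (\<kappa>' (Lo c', n2)) (\<kappa>' (Lo c', n3))"
    if h: "n1 \<in> U' `` {Lo c'}" "n2 \<in> U' `` {Lo c'}" "n3 \<in> U' `` {Lo c'}" "ccw c' (pt n1) (pt n2) (pt n3)" for n1 n2 n3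
  proof -
    obtain y1 y2 y3 where y: "n1 = F (Lo c) y1" "(Lo c, y1) \<in> U" "n2 = F (Lo c) y2" "(Lo c, y2) \<in> U"
      "n3 = F (Lo c) y3" "(Lo c, y3) \<in> U"
      using h(1-3) F[of Lo] by auto
    have "ccw c (pt y1) (pt y2) (pt y3)" using ccw[of Lo Lo Lo y1 y2 y3] y h(4) by simp
    then have "vertex_rule G (\<kappa> (Lo c, y1)) (\<kappa> (Lo c, y2)) (\<kappa> (Lo c, y3))"
      using rule y unfolding point_rule_def by blast
    then show ?thesis using \<kappa>[of Lo] y by auto
  qed
  show ?thesis using 1 2 3 4 unfolding point_rule_def by blast
qed

lemma point_rule_cong:
  assumes "U `` {Hi c} = U' `` {Hi c}" "U `` {Lo c} = U' `` {Lo c}"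
    and "\<And>N y. N \<in> {Hi, Lo} \<Longrightarrow> (N c, y) \<in> U \<Longrightarrow> \<kappa>' (N c, y) = \<kappa> (N c, y) \<and> \<kappa>' (y, N c) = \<kappa> (y, N c)"
  shows "point_rule G q U \<kappa> c \<Longrightarrow> point_rule G q U' \<kappa>' c"
  by (rule point_rule_transfer[where F = "\<lambda>n y. y" and U = U and \<kappa> = \<kappa>]) (use assms in auto)

lemma point_rule_empty: "U `` {Hi c} = {} \<Longrightarrow> U `` {Lo c} = {} \<Longrightarrow> point_rule G q U \<kappa> c"
  by (auto simp: point_rule_def)

lemma ccw_scale:
  assumes "ccw c a b d" "0 < s" "0 < t" "0 < r"
  shows "ccw c (c + s *\<^sub>R (a - c)) (c + t *\<^sub>R (b - c)) (c + r *\<^sub>R (d - c))"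
proof -
  have "Arg2pi ((x *\<^sub>R (b - c)) / (s *\<^sub>R (a - c))) = Arg2pi ((b - c) / (a - c))" if "x > 0" for x b
  proof -
    have "(x *\<^sub>R (b - c)) / (s *\<^sub>R (a - c)) = of_real (x / s) * ((b - c) / (a - c))"
      using assms(2) by (simp add: scaleR_conv_of_real)
    moreover have "0 < x / s" using that assms(2) by simp
    ultimately show ?thesis using Arg2pi_times_of_real[of "x / s" "(b - c) / (a - c)"] by (simp only:)
  qed
  then show ?thesis using assms by (simp add: ccw_def)
qed

section \<open>Subdivision and motion\<close>

lemma in_half_colorings:
  "\<kappa> \<in> half_colorings G X q U \<longleftrightarrow> \<kappa> \<in> extensional U \<and> (\<forall>e\<in>U. \<kappa> e \<in> carrier G \<times> X) \<and>
    (\<forall>m n. (m, n) \<in> U \<longrightarrow> \<kappa> (n, m) = bar G (\<kappa> (m, n))) \<and> (\<forall>c. point_rule G q U \<kappa> c)"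
  unfolding half_colorings_def PiE_def by blast

lemma half_coloringD:
  assumes "\<kappa> \<in> half_colorings G X q U"
  shows "(m, n) \<in> U \<Longrightarrow> \<kappa> (n, m) = bar G (\<kappa> (m, n))" "e \<in> U \<Longrightarrow> \<kappa> e \<in> carrier G \<times> X"
    "point_rule G q U \<kappa> c"
  using assms unfolding in_half_colorings by blast+

lemma half_coloring_ext:
  assumes "\<kappa> \<in> half_colorings G X q U" "\<kappa>' \<in> half_colorings G X q U" "\<And>e. e \<in> U \<Longrightarrow> \<kappa> e = \<kappa>' e"
  shows "\<kappa> = \<kappa>'"
  using assms unfolding in_half_colorings by (intro extensionalityI[of \<kappa> U \<kappa>']) auto

text \<open>\<open>\<psi>\<close> sends every directed segment of the new diagram to the one from
  which it inherits its color; by surjectivity the inherited coloring determines the original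
  one.\<close>

lemma recolorable_pullback:
  assumes sur: "\<psi> ` U' = U"
    and fwd: "\<And>X \<kappa>. G_family G X q \<Longrightarrow> \<kappa> \<in> half_colorings G X q U \<Longrightarrow>
      restrict (\<kappa> \<circ> \<psi>) U' \<in> half_colorings G X q U'"
    and bwd: "\<And>X \<kappa>'. G_family G X q \<Longrightarrow> \<kappa>' \<in> half_colorings G X q U' \<Longrightarrow>
      \<exists>\<kappa>\<in>half_colorings G X q U. \<forall>e\<in>U'. \<kappa>' e = \<kappa> (\<psi> e)"
  shows "recolorable G q U U'"
  unfolding recolorable_def
proof (intro exI[of _ "\<lambda>\<kappa> \<kappa>'. \<forall>e\<in>U'. \<kappa>' e = \<kappa> (\<psi> e)"] allI impI conjI ballI)
  fix X assume X: "G_family G X q"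
  show "\<exists>\<kappa>'\<in>half_colorings G X q U'. \<forall>e\<in>U'. \<kappa>' e = \<kappa> (\<psi> e)" if "\<kappa> \<in> half_colorings G X q U" for \<kappa>
    using fwd[OF X that] by (intro bexI[of _ "restrict (\<kappa> \<circ> \<psi>) U'"]) auto
  show "\<exists>\<kappa>\<in>half_colorings G X q U. \<forall>e\<in>U'. \<kappa>' e = \<kappa> (\<psi> e)" if "\<kappa>' \<in> half_colorings G X q U'" for \<kappa>'
    using bwd[OF X that] .
  show "\<kappa>1 = \<kappa>2" if "\<kappa>1 \<in> half_colorings G X q U'" "\<kappa>2 \<in> half_colorings G X q U'"
    "\<forall>e\<in>U'. \<kappa>1 e = \<kappa> (\<psi> e)" "\<forall>e\<in>U'. \<kappa>2 e = \<kappa> (\<psi> e)" for \<kappa> \<kappa>1 \<kappa>2 :: "seg \<Rightarrow> _"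
    using that by (intro half_coloring_ext[of \<kappa>1 G X q U' \<kappa>2]) auto
  show "\<kappa>1 = \<kappa>2" if "\<kappa>1 \<in> half_colorings G X q U" "\<kappa>2 \<in> half_colorings G X q U"
    "\<forall>e\<in>U'. \<kappa>' e = \<kappa>1 (\<psi> e)" "\<forall>e\<in>U'. \<kappa>' e = \<kappa>2 (\<psi> e)" for \<kappa>' \<kappa>1 \<kappa>2 :: "seg \<Rightarrow> _"
  proof (rule half_coloring_ext[OF that(1,2)])
    fix e assume "e \<in> U"
    then obtain e' where "e' \<in> U'" "e = \<psi> e'" using sur by blast
    then show "\<kappa>1 e = \<kappa>2 e" using that(3,4) by metis
  qed
qed

text \<open>Seen from an old node, a neighbour at most moves along its ray, so nothing changes
  there; at the new joint the rule says that the two halves have equal colors.\<close>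

lemma subdivision_recolorable:
  assumes D: "Y_oriented_diagram D" and D': "Y_oriented_diagram D'" and sub: "subdivision D D'"
  shows "recolorable G q (unoriented D) (unoriented D')"
proof -
  interpret D: Y_diagram D using D by unfold_locales
  obtain m n z where mn: "(m, n) \<in> D" and z: "z \<in> open_segment (pt m) (pt n)"
    and D'_eq: "D' = D - {(m, n)} \<union> {(m, Lo z), (Lo z, n)}"
    using sub unfolding subdivision_def by blast
  define U where "U = unoriented D"
  define U' where "U' = unoriented D'"
  have mnU: "(m, n) \<in> U" "(n, m) \<in> U" using mn by (auto simp: U_def in_unoriented)
  have mn_ne: "m \<noteq> n" "pt m \<noteq> pt n" using D.pt_neq mnU by (auto simp: U_def)
  have z_ne: "z \<noteq> pt m" "z \<noteq> pt n" using z by (auto simp: open_segment_def)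
  \<comment> \<open>A node at \<open>z\<close> would put on the segment from \<open>m\<close> to
    \<open>n\<close> a point of another segment that is not a common end.\<close>
  have fresh: "pt x \<noteq> z" if x: "(x, y) \<in> U" for x y
  proof
    assume eq: "pt x = z"
    have "{x, y} \<noteq> {m, n}" using eq z_ne by (auto simp: doubleton_eq_iff)
    then have "closed_segment (pt x) (pt y) \<inter> closed_segment (pt m) (pt n) \<subseteq> {pt x, pt y} \<inter> {pt m, pt n}"
      using D.segments_meet_at_ends[of x y m n] x mnU by (simp add: U_def)
    then show False using z eq z_ne open_closed_segment by fastforce
  qed
  have fresh': "pt y \<noteq> z" if "(x, y) \<in> U" for x y using fresh[of y x] that unoriented_sym by (auto simp: U_def)
  have U': "(x, y) \<in> U' \<longleftrightarrow> (x, y) \<in> U \<and> (x, y) \<noteq> (m, n) \<and> (x, y) \<noteq> (n, m) \<or>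
      (x, y) \<in> {(m, Lo z), (Lo z, m), (Lo z, n), (n, Lo z)}" for x y
    using D.antisym_D[OF mn] by (auto simp: U'_def U_def D'_eq in_unoriented)
  \<comment> \<open>Both halves inherit the color of the whole segment. Conversely, \<open>F\<close>
    replaces the far end of the subdivided segment by the new joint.\<close>
  define \<psi> where "\<psi> e = (if e \<in> {(m, Lo z), (Lo z, n)} then (m, n)
    else if e \<in> {(n, Lo z), (Lo z, m)} then (n, m) else e)" for e
  define F where "F x y = (if (x, y) \<in> {(m, n), (n, m)} then Lo z else y)" for x y
  have Lz: "(x, Lo z) \<notin> U" "(Lo z, x) \<notin> U" for x using fresh fresh' by force+
  have ne: "m \<noteq> Lo z" "n \<noteq> Lo z" using z_ne by auto
  have \<psi>F: "\<psi> (x, F x y) = (x, y)" "\<psi> (F x y, x) = (y, x)" if "(x, y) \<in> U" for x y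
    using that ne mn_ne Lz[of x] Lz[of y] by (auto simp: \<psi>_def F_def split: if_splits)
  have img: "U' `` {x} = F x ` (U `` {x}) \<and> inj_on (F x) (U `` {x})" if "pt x \<noteq> z" for x
  proof
    show "inj_on (F x) (U `` {x})"
      by (rule inj_on_inverseI[of _ "\<lambda>y. snd (\<psi> (x, y))"]) (use \<psi>F in auto)
    have "y \<in> U' `` {x} \<longleftrightarrow> y \<in> F x ` (U `` {x})" for y
      using that mnU ne Lz mn_ne unfolding Image_singleton_iff U' F_def by (auto simp: image_iff)
    then show "U' `` {x} = F x ` (U `` {x})" by blast
  qed
  obtain s where s: "0 < s" "s < 1" "z = (1 - s) *\<^sub>R pt m + s *\<^sub>R pt n"
    using z unfolding in_segment(2) by blast
  have ray: "\<exists>t>0. pt (F x y) = pt x + t *\<^sub>R (pt y - pt x)" "\<exists>t>0. pt y = pt x + t *\<^sub>R (pt (F x y) - pt x)"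
    if "(x, y) \<in> U" for x y
  proof -
    have "\<exists>t>0. pt (F x y) = pt x + t *\<^sub>R (pt y - pt x)"
    proof -
      consider "(x, y) = (m, n)" | "(x, y) = (n, m)" | "F x y = y"
        by (cases "(x, y) = (m, n) \<or> (x, y) = (n, m)") (auto simp: F_def)
      then show ?thesis
      proof cases
        case 1
        then show ?thesis using s mn_ne by (intro exI[of _ s]) (auto simp: F_def algebra_simps)
      next
        case 2
        then show ?thesis using s mn_ne by (intro exI[of _ "1 - s"]) (auto simp: F_def algebra_simps)
      next
        case 3
        then show ?thesis by (intro exI[of _ 1]) simp
      qed
    qed
    then obtain t where t: "t > 0" "pt (F x y) = pt x + t *\<^sub>R (pt y - pt x)" by blast
    then show "\<exists>t>0. pt (F x y) = pt x + t *\<^sub>R (pt y - pt x)" by blast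
    show "\<exists>t>0. pt y = pt x + t *\<^sub>R (pt (F x y) - pt x)"
      using t by (intro exI[of _ "1 / t"]) auto
  qed
  have rays: "ccw c (pt y1) (pt y2) (pt y3) \<longleftrightarrow> ccw c (pt (F x1 y1)) (pt (F x2 y2)) (pt (F x3 y3))"
    if r: "(x1, y1) \<in> U" "(x2, y2) \<in> U" "(x3, y3) \<in> U" "pt x1 = c" "pt x2 = c" "pt x3 = c" for c x1 y1 x2 y2 x3 y3
  proof
    assume *: "ccw c (pt y1) (pt y2) (pt y3)"
    show "ccw c (pt (F x1 y1)) (pt (F x2 y2)) (pt (F x3 y3))"
      using ray(1)[OF r(1)] ray(1)[OF r(2)] ray(1)[OF r(3)] r(4-6) ccw_scale[OF *] by auto
  next
    assume *: "ccw c (pt (F x1 y1)) (pt (F x2 y2)) (pt (F x3 y3))"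
    obtain t1 t2 t3 where "t1 > 0" "t2 > 0" "t3 > 0" "pt y1 = c + t1 *\<^sub>R (pt (F x1 y1) - c)"
      "pt y2 = c + t2 *\<^sub>R (pt (F x2 y2) - c)" "pt y3 = c + t3 *\<^sub>R (pt (F x3 y3) - c)"
      using ray(2)[OF r(1)] ray(2)[OF r(2)] ray(2)[OF r(3)] r(4-6) by metis
    then show "ccw c (pt y1) (pt y2) (pt y3)" using ccw_scale[OF *] by metis
  qed
  have Hz: "U `` {Hi z} = {}" "U' `` {Hi z} = {}"
    using fresh[of "Hi z"] z_ne by (auto simp: U')
  have nz: "U' `` {Lo z} = {m, n}" using Lz by (auto simp: U')
  have bar_U: "\<kappa> (y, x) = bar G (\<kappa> (x, y))" if "\<kappa> \<in> half_colorings G X q V" "(x, y) \<in> V" for X \<kappa> x y V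
    using that by (auto simp: in_half_colorings)
  have sym': "(y, x) \<in> U' \<longleftrightarrow> (x, y) \<in> U'" for x y using unoriented_sym by (auto simp: U'_def)
  have sym: "(y, x) \<in> U \<longleftrightarrow> (x, y) \<in> U" for x y using unoriented_sym by (auto simp: U_def)
  have \<psi>U: "\<psi> e \<in> U" if "e \<in> U'" for e
    using that mnU by (cases e) (auto simp: \<psi>_def U')
  have FU: "(x, F x y) \<in> U'" if "(x, y) \<in> U" for x y
    using that by (auto simp: F_def U')
  have \<psi>_swap: "\<psi> (y, x) = prod.swap (\<psi> (x, y))" for x y
    using ne mn_ne by (auto simp: \<psi>_def)
  have "recolorable G q U U'"
  proof (rule recolorable_pullback[of \<psi>])
    show "\<psi> ` U' = U" using \<psi>U \<psi>F(1) FU by (force simp: image_iff)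
  next
    fix X and \<kappa> :: "seg \<Rightarrow> _" assume X: "G_family G X q" and \<kappa>: "\<kappa> \<in> half_colorings G X q U"
    define \<kappa>' where "\<kappa>' = restrict (\<kappa> \<circ> \<psi>) U'"
    have \<kappa>': "\<kappa>' e = \<kappa> (\<psi> e)" if "e \<in> U'" for e using that by (simp add: \<kappa>'_def)
    have rule: "point_rule G q U' \<kappa>' c" for c
    proof (cases "c = z")
      case True
      have "\<not> ccw z (pt y1) (pt y2) (pt y3)" if "{y1, y2, y3} \<subseteq> {m, n}" for y1 y2 y3
      proof -
        have "y1 = y2 \<or> y2 = y3 \<or> y1 = y3" using that by auto
        then show ?thesis using ccw_distinct(4-6) by metis
      qed
      moreover have "\<kappa>' (m, Lo z) = \<kappa>' (Lo z, n)" "\<kappa>' (n, Lo z) = \<kappa>' (Lo z, m)"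
        using ne mn_ne by (auto simp: \<kappa>' U' \<psi>_def)
      ultimately show ?thesis unfolding True point_rule_def Hz nz by (auto simp: doubleton_eq_iff)
    next
      case False
      show ?thesis
      proof (rule point_rule_transfer[where F = F and U = U and \<kappa> = \<kappa> and c = c])
        show "point_rule G q U \<kappa> c" using \<kappa> by (simp add: in_half_colorings)
        fix N :: "complex \<Rightarrow> complex node" assume N: "N \<in> {Hi, Lo}"
        then have "pt (N c) = c" by auto
        then show "U' `` {N c} = F (N c) ` U `` {N c} \<and> inj_on (F (N c)) (U `` {N c})"
          using img[of "N c"] False by simp
        fix y assume y: "(N c, y) \<in> U"
        show "\<kappa>' (N c, F (N c) y) = \<kappa> (N c, y) \<and> \<kappa>' (F (N c) y, N c) = \<kappa> (y, N c)"
          using FU[OF y] \<psi>F[OF y] \<kappa>' sym' by metis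
      next
        fix N1 N2 N3 :: "complex \<Rightarrow> complex node" and y1 y2 y3
        assume "N1 \<in> {Hi, Lo}" "N2 \<in> {Hi, Lo}" "N3 \<in> {Hi, Lo}" "(N1 c, y1) \<in> U" "(N2 c, y2) \<in> U" "(N3 c, y3) \<in> U"
          "ccw c (pt (F (N1 c) y1)) (pt (F (N2 c) y2)) (pt (F (N3 c) y3))"
        then show "ccw c (pt y1) (pt y2) (pt y3)"
          using rays[of "N1 c" y1 "N2 c" y2 "N3 c" y3 c] by auto
      qed
    qed
    have "\<kappa>' (y, x) = bar G (\<kappa>' (x, y))" if "(x, y) \<in> U'" for x y
    proof -
      obtain a b where ab: "\<psi> (x, y) = (a, b)" by (metis surj_pair)
      then have "\<psi> (y, x) = (b, a)" using \<psi>_swap[of y x] by simp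
      then have "\<kappa>' (y, x) = \<kappa> (b, a)" using \<kappa>'[of "(y, x)"] that sym' by metis
      moreover have "\<kappa>' (x, y) = \<kappa> (a, b)" using \<kappa>'[OF that] ab by metis
      moreover have "(a, b) \<in> U" using \<psi>U[OF that] ab by metis
      ultimately show ?thesis using bar_U[OF \<kappa>] by metis
    qed
    then show "restrict (\<kappa> \<circ> \<psi>) U' \<in> half_colorings G X q U'"
      using rule \<psi>U \<kappa> unfolding \<kappa>'_def[symmetric] in_half_colorings[of \<kappa>']
      by (auto simp: \<kappa>' in_half_colorings simp del: mem_Sigma_iff) (auto simp: \<kappa>'_def)
  next
    fix X and \<kappa>' :: "seg \<Rightarrow> _" assume X: "G_family G X q" and \<kappa>': "\<kappa>' \<in> half_colorings G X q U'"
    \<comment> \<open>In both directions the whole segment takes the color of the half next to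
      \<open>m\<close>.\<close>
    define \<kappa> where "\<kappa> = (\<lambda>(x, y)\<in>U. if (x, y) = (n, m) then \<kappa>' (Lo z, m) else \<kappa>' (x, F x y))"
    have "point_rule G q U' \<kappa>' z" using \<kappa>' by (simp add: in_half_colorings)
    then have thr: "\<kappa>' (m, Lo z) = \<kappa>' (Lo z, n)" "\<kappa>' (n, Lo z) = \<kappa>' (Lo z, m)"
      using mn_ne unfolding point_rule_def Hz nz by (auto simp: insert_commute)
    have \<kappa>1: "\<kappa> (x, y) = \<kappa>' (x, F x y)" if "(x, y) \<in> U" for x y
      using that thr mn_ne by (auto simp: \<kappa>_def F_def)
    have \<kappa>2: "\<kappa> (y, x) = \<kappa>' (F x y, x)" if "(x, y) \<in> U" for x y
      using that \<kappa>1[of y x] thr mn_ne sym[of x y] ne by (auto simp: F_def split: if_splits)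
    have rel: "\<kappa>' e = \<kappa> (\<psi> e)" if e: "e \<in> U'" for e
    proof -
      obtain x y where xy: "e = (x, y)" by (cases e)
      show ?thesis using e \<kappa>1 \<kappa>2 mnU thr mn_ne ne Lz unfolding xy U' \<psi>_def F_def by auto
    qed
    have rule: "point_rule G q U \<kappa> c" for c
    proof (cases "c = z")
      case True
      have "U `` {Lo z} = {}" using Lz by auto
      then show ?thesis using point_rule_empty Hz(1) True by blast
    next
      case False
      define F' where "F' x y = snd (\<psi> (x, y))" for x y
      show ?thesis
      proof (rule point_rule_transfer[where F = F' and U = U' and \<kappa> = \<kappa>' and c = c])
        show "point_rule G q U' \<kappa>' c" using \<kappa>' by (simp add: in_half_colorings)
        fix N :: "complex \<Rightarrow> complex node" assume N: "N \<in> {Hi, Lo}"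
        have F'F: "F' (N c) (F (N c) y) = y" if "(N c, y) \<in> U" for y
          using \<psi>F(1)[OF that] by (simp add: F'_def)
        have "pt (N c) = c" using N by auto
        then have i: "U' `` {N c} = F (N c) ` U `` {N c}" using img[of "N c"] False by simp
        show "U `` {N c} = F' (N c) ` U' `` {N c} \<and> inj_on (F' (N c)) (U' `` {N c})"
          unfolding i by (auto simp: image_iff F'F inj_on_def)
        fix y assume y: "(N c, y) \<in> U'"
        then obtain w where w: "y = F (N c) w" "(N c, w) \<in> U" using i by blast
        show "\<kappa> (N c, F' (N c) y) = \<kappa>' (N c, y) \<and> \<kappa> (F' (N c) y, N c) = \<kappa>' (y, N c)"
          using w F'F \<kappa>1 \<kappa>2 by auto
      next
        fix N1 N2 N3 :: "complex \<Rightarrow> complex node" and y1 y2 y3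
        assume h: "N1 \<in> {Hi, Lo}" "N2 \<in> {Hi, Lo}" "N3 \<in> {Hi, Lo}" "(N1 c, y1) \<in> U'" "(N2 c, y2) \<in> U'" "(N3 c, y3) \<in> U'"
          "ccw c (pt (F' (N1 c) y1)) (pt (F' (N2 c) y2)) (pt (F' (N3 c) y3))"
        have F'F: "F' x (F x y) = y" if "(x, y) \<in> U" for x y
          using \<psi>F(1)[OF that] by (simp add: F'_def)
        have "\<exists>w. y = F (N c) w \<and> (N c, w) \<in> U"
          if N: "N \<in> {Hi, Lo}" "(N c, y) \<in> U'" for N :: "complex \<Rightarrow> complex node" and y
        proof -
          have "pt (N c) = c" using N(1) by auto
          then have "U' `` {N c} = F (N c) ` U `` {N c}" using img[of "N c"] False by simp
          then have "y \<in> F (N c) ` U `` {N c}" using N(2) by (metis Image_singleton_iff)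
          then show ?thesis by auto
        qed
        then obtain w1 w2 w3 where "y1 = F (N1 c) w1" "(N1 c, w1) \<in> U" "y2 = F (N2 c) w2" "(N2 c, w2) \<in> U"
          "y3 = F (N3 c) w3" "(N3 c, w3) \<in> U" using h(1-6) by metis
        then show "ccw c (pt y1) (pt y2) (pt y3)"
          using rays[of "N1 c" w1 "N2 c" w2 "N3 c" w3 c] h(1-3,7) F'F by auto
      qed
    qed
    have "\<kappa> (y, x) = bar G (\<kappa> (x, y))" if "(x, y) \<in> U" for x y
      using \<kappa>1[OF that] \<kappa>2[OF that] bar_U[OF \<kappa>' FU[OF that]] by simp
    moreover have "\<kappa> e \<in> carrier G \<times> X" if "e \<in> U" for e
      using \<kappa>1[of "fst e" "snd e"] FU[of "fst e" "snd e"] that \<kappa>' by (simp add: in_half_colorings)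
    moreover have "\<kappa> \<in> extensional U" by (simp add: \<kappa>_def)
    ultimately have "\<kappa> \<in> half_colorings G X q U" using rule unfolding in_half_colorings by blast
    then show "\<exists>\<kappa>\<in>half_colorings G X q U. \<forall>e\<in>U'. \<kappa>' e = \<kappa> (\<psi> e)" using rel by blast
  qed
  then show ?thesis by (simp add: U_def U'_def)
qed

text \<open>As long as the rays are distinct, the angles measured from \<open>a\<close> stay away
  from the jump of \<open>Arg2pi\<close>, and their difference, whose sign decides the cyclic order,
  never vanishes. By the intermediate value theorem it keeps its sign.\<close>

lemma ccw_continuous:
  fixes a b c d :: "real \<Rightarrow> complex"
  assumes cont: "continuous_on {0..1} a" "continuous_on {0..1} b" "continuous_on {0..1} c" "continuous_on {0..1} d"
    and ray: "\<And>t. t \<in> {0..1} \<Longrightarrow> \<not> same_ray (c t) (a t) (b t)" "\<And>t. t \<in> {0..1} \<Longrightarrow> \<not> same_ray (c t) (a t) (d t)"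
      "\<And>t. t \<in> {0..1} \<Longrightarrow> \<not> same_ray (c t) (b t) (d t)"
  shows "ccw (c 0) (a 0) (b 0) (d 0) \<longleftrightarrow> ccw (c 1) (a 1) (b 1) (d 1)"
proof -
  define f where "f t = Arg2pi ((d t - c t) / (a t - c t)) - Arg2pi ((b t - c t) / (a t - c t))" for t
  have pos: "0 < Arg2pi ((b t - c t) / (a t - c t))" "0 < Arg2pi ((d t - c t) / (a t - c t))" "a t - c t \<noteq> 0"
    if "t \<in> {0..1}" for t
    using ray(1,2)[OF that] Arg2pi_ge_0 by (auto simp: same_ray_def less_le)
  have cont_arg: "continuous_on {0..1} (\<lambda>t. Arg2pi ((x t - c t) / (a t - c t)))"
    if "continuous_on {0..1} x" "\<And>t. t \<in> {0..1} \<Longrightarrow> 0 < Arg2pi ((x t - c t) / (a t - c t))" for x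
  proof (rule continuous_on_compose2[of "{z. 0 < Arg2pi z}" Arg2pi])
    show "continuous_on {z. 0 < Arg2pi z} Arg2pi"
      by (intro continuous_at_imp_continuous_on ballI continuous_at_Arg2pi)
        (auto simp: Arg2pi_eq_0 complex_nonneg_Reals_iff complex_is_Real_iff less_le)
    show "continuous_on {0..1} (\<lambda>t. (x t - c t) / (a t - c t))"
      using that(1) cont pos(3) by (intro continuous_intros) auto
  qed (use that in auto)
  have fc: "continuous_on {0..1} f"
    unfolding f_def using pos cont by (intro continuous_on_diff cont_arg) auto
  have ccw_f: "ccw (c t) (a t) (b t) (d t) \<longleftrightarrow> 0 < f t" "f t \<noteq> 0" if "t \<in> {0..1}" for t
    using pos[OF that] ccw_total[OF ray(1)[OF that] ray(2)[OF that] ray(3)[OF that]]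
    by (auto simp: ccw_def f_def)
  have "0 < f 0 \<longleftrightarrow> 0 < f 1"
    using IVT'[of f 0 0 1] IVT2'[of f 1 0 0] fc ccw_f(2) by force
  then show ?thesis using ccw_f(1)[of 0] ccw_f(1)[of 1] by simp
qed

lemma unoriented_relocate: "unoriented (relocate h D) = map_prod (map_node h) (map_node h) ` unoriented D"
  by (force simp: unoriented_def relocate_def)

lemma pt_map_node [simp]: "pt (map_node h x) = h (pt x)"
  by (cases x) auto

text \<open>At each time the moved segments form a diagram, so distinct segments at a point keep
  distinct rays and their cyclic order cannot change. The correspondence just renames the nodes by
  their final positions.\<close>

lemma motion_recolorable:
  assumes D: "Y_oriented_diagram D" and mot: "motion D D'"
  shows "recolorable G q (unoriented D) (unoriented D')"
proof -
  interpret D: Y_diagram D using D by unfold_locales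
  obtain h :: "real \<Rightarrow> complex \<Rightarrow> complex"
    where h0: "\<And>p. p \<in> pt ` Field D \<Longrightarrow> continuous_on {0..1} (\<lambda>t. h t p) \<and> h 0 p = p"
      and ht: "\<And>t. t \<in> {0..1} \<Longrightarrow> inj_on (h t) (pt ` Field D) \<and> Y_oriented_diagram (relocate (h t) D)"
      and D': "D' = relocate (h 1) D"
    using mot unfolding motion_def by blast
  define U where "U = unoriented D"
  define M where "M t = map_prod (map_node (h t)) (map_node (h t))" for t
  define U' where "U' = M 1 ` U"
  have in_pt: "pt x \<in> pt ` Field D" "pt y \<in> pt ` Field D" "x \<in> Field D" "y \<in> Field D" if "(x, y) \<in> U" for x y
    using that D.in_Field[of x y] D.in_Field[of y x] unoriented_sym by (auto simp: U_def)
  have inj_node: "inj_on (map_node (h t)) (Field D)" if "t \<in> {0..1}" for t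
  proof (rule inj_onI)
    fix x y assume "x \<in> Field D" "y \<in> Field D" "map_node (h t) x = map_node (h t) y"
    then show "x = y" using ht[OF that] by (cases x; cases y) (auto simp: inj_on_def)
  qed
  have inj_M: "inj_on (M t) U" if "t \<in> {0..1}" for t
  proof (rule inj_onI)
    fix e e' assume e: "e \<in> U" "e' \<in> U" "M t e = M t e'"
    obtain x y x' y' where xy: "e = (x, y)" "e' = (x', y')" by (metis surj_pair)
    then have "map_node (h t) x = map_node (h t) x'" "map_node (h t) y = map_node (h t) y'"
      using e(3) by (auto simp: M_def)
    then show "e = e'" using inj_onD[OF inj_node[OF that]] in_pt(3,4) e(1,2) xy by blast
  qed
  have ccw_h: "ccw c (pt y1) (pt y2) (pt y3) \<longleftrightarrow> ccw (h 1 c) (h 1 (pt y1)) (h 1 (pt y2)) (h 1 (pt y3))"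
    if e: "(x1, y1) \<in> U" "(x2, y2) \<in> U" "(x3, y3) \<in> U" "pt x1 = c" "pt x2 = c" "pt x3 = c" for c x1 y1 x2 y2 x3 y3
  proof (cases "(x1, y1) = (x2, y2) \<or> (x1, y1) = (x3, y3) \<or> (x2, y2) = (x3, y3)")
    \<comment> \<open>Two of the neighbours coincide, so \<open>ccw\<close> fails before and after
      the motion.\<close>
    case True
    then show ?thesis using ccw_distinct(4-6) by blast
  next
    case False
    have ray: "\<not> same_ray (h t c) (h t (pt y)) (h t (pt y'))"
      if "t \<in> {0..1}" "(x, y) \<in> U" "(x', y') \<in> U" "pt x = c" "pt x' = c" "(x, y) \<noteq> (x', y')" for t x y x' y'
    proof -
      interpret Dt: Y_diagram "relocate (h t) D" using ht[OF that(1)] by unfold_locales auto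
      have "M t (x, y) \<noteq> M t (x', y')" using inj_M[OF that(1)] that(2,3,6) by (auto simp: inj_on_def)
      moreover have "M t (x, y) \<in> unoriented (relocate (h t) D)" "M t (x', y') \<in> unoriented (relocate (h t) D)"
        using that(2,3) by (auto simp: unoriented_relocate M_def U_def)
      ultimately show ?thesis
        using Dt.not_same_ray[of "map_node (h t) x" "map_node (h t) y" "map_node (h t) x'" "map_node (h t) y'"] that(4,5)
        by (simp add: M_def)
    qed
    have "ccw (h 0 c) (h 0 (pt y1)) (h 0 (pt y2)) (h 0 (pt y3)) \<longleftrightarrow> ccw (h 1 c) (h 1 (pt y1)) (h 1 (pt y2)) (h 1 (pt y3))"
      using False h0 in_pt e by (intro ccw_continuous ray[of _ x1 y1 x2 y2] ray[of _ x1 y1 x3 y3] ray[of _ x2 y2 x3 y3]) auto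
    moreover have "h 0 c = c" "h 0 (pt y1) = pt y1" "h 0 (pt y2) = pt y2" "h 0 (pt y3) = pt y3"
      using h0 in_pt(1,2) e by auto
    ultimately show ?thesis by simp
  qed
  have inj_h: "inj_on (h 1) (pt ` Field D)" using ht[of 1] by simp
  define H where "H = map_node (h 1)"
  have M1: "M 1 (x, y) = (H x, H y)" for x y by (simp add: M_def H_def)
  have HN: "N (h 1 c) = H (N c)" if "N \<in> {Hi, Lo}" for N :: "complex \<Rightarrow> complex node" and c using that by (auto simp: H_def)
  have inj_H: "x = y" if "H x = H y" "x \<in> Field D" "y \<in> Field D" for x y
    using inj_node[of 1] that by (auto simp: H_def inj_on_def)
  have U'_img: "U' `` {H x} = H ` (U `` {x})" if "x \<in> Field D" for x
  proof -
    have "y \<in> U' `` {H x} \<longleftrightarrow> y \<in> H ` (U `` {x})" for y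
    proof
      assume "y \<in> U' `` {H x}"
      then obtain a b where "(a, b) \<in> U" "H x = H a" "y = H b" by (auto simp: U'_def M1 image_iff)
      then show "y \<in> H ` (U `` {x})" using inj_H[of x a] that in_pt(3) by auto
    qed (force simp: U'_def M1 image_iff)
    then show ?thesis by blast
  qed
  have inj_HU: "inj_on H (U `` {x})" for x using inj_H in_pt(4) by (intro inj_onI) auto
  have U'E: "\<exists>a b. (a, b) \<in> U \<and> x = H a \<and> y = H b" if "(x, y) \<in> U'" for x y
    using that by (auto simp: U'_def M_def H_def)
  have FieldN: "N c \<in> Field D" if "(N c, y) \<in> U" for N :: "complex \<Rightarrow> complex node" and c y using that in_pt by auto
  define \<psi> where "\<psi> = inv_into U (M 1)"
  have \<psi>: "\<psi> (H x, H y) = (x, y)" if "(x, y) \<in> U" for x y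
    using inv_into_f_f[OF inj_M[of 1] that] by (simp add: \<psi>_def M1)
  have sym: "(y, x) \<in> U \<longleftrightarrow> (x, y) \<in> U" for x y using unoriented_sym by (auto simp: U_def)
  have in_U': "(H x, H y) \<in> U'" if "(x, y) \<in> U" for x y using that by (force simp: U'_def M1 image_iff)
  have ptH: "pt (H x) = h 1 (pt x)" for x by (simp add: H_def)
  have "recolorable G q U U'"
  proof (rule recolorable_pullback[of \<psi>])
    show "\<psi> ` U' = U" using inv_into_image_cancel[OF inj_M[of 1], of U] by (simp add: \<psi>_def U'_def)
  next
    fix X and \<kappa> :: "seg \<Rightarrow> _" assume X: "G_family G X q" and \<kappa>: "\<kappa> \<in> half_colorings G X q U"
    define \<kappa>' where "\<kappa>' = restrict (\<kappa> \<circ> \<psi>) U'"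
    have \<kappa>': "\<kappa>' (H x, H y) = \<kappa> (x, y)" if "(x, y) \<in> U" for x y
      using that in_U' \<psi> by (simp add: \<kappa>'_def)
    have rule: "point_rule G q U' \<kappa>' c'" for c'
    proof (cases "\<exists>c. c \<in> pt ` Field D \<and> c' = h 1 c")
      case True
      then obtain c where c: "c \<in> pt ` Field D" "c' = h 1 c" by blast
      have img: "U' `` {N (h 1 c)} = H ` (U `` {N c})" if N: "N \<in> {Hi, Lo}" for N :: "complex \<Rightarrow> complex node"
      proof -
        have "y \<in> U' `` {N (h 1 c)} \<longleftrightarrow> y \<in> H ` (U `` {N c})" for y
        proof
          assume "y \<in> U' `` {N (h 1 c)}"
          then obtain a b where ab: "(a, b) \<in> U" "H (N c) = H a" "y = H b" using U'E HN[OF N] by fastforce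
          have "pt (N c) = c" using N by auto
          then have "h 1 c = h 1 (pt a)" using arg_cong[OF ab(2), of pt] by (simp add: ptH)
          then have "c = pt a" using inj_onD[OF inj_h _ c(1) in_pt(1)[OF ab(1)]] by blast
          then have "a = N c" using ab(2) N by (cases a) (auto simp: H_def)
          then show "y \<in> H ` (U `` {N c})" using ab by auto
        qed (use in_U' HN[OF N] in auto)
        then show ?thesis by blast
      qed
      show ?thesis unfolding c(2)
      proof (rule point_rule_transfer[where F = "\<lambda>_. H" and U = U and \<kappa> = \<kappa> and c = c])
        show "point_rule G q U \<kappa> c" using \<kappa> by (simp add: in_half_colorings)
        fix N :: "complex \<Rightarrow> complex node" assume N: "N \<in> {Hi, Lo}"
        then show "U' `` {N (h 1 c)} = H ` U `` {N c} \<and> inj_on H (U `` {N c})"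
          using img inj_HU by auto
        fix y assume y: "(N c, y) \<in> U"
        then show "\<kappa>' (N (h 1 c), H y) = \<kappa> (N c, y) \<and> \<kappa>' (H y, N (h 1 c)) = \<kappa> (y, N c)"
          using \<kappa>' sym HN[OF N] by metis
      next
        fix N1 N2 N3 :: "complex \<Rightarrow> complex node" and y1 y2 y3
        assume "N1 \<in> {Hi, Lo}" "N2 \<in> {Hi, Lo}" "N3 \<in> {Hi, Lo}" "(N1 c, y1) \<in> U" "(N2 c, y2) \<in> U" "(N3 c, y3) \<in> U"
          "ccw (h 1 c) (pt (H y1)) (pt (H y2)) (pt (H y3))"
        then show "ccw c (pt y1) (pt y2) (pt y3)"
          using ccw_h[of "N1 c" y1 "N2 c" y2 "N3 c" y3 c] ptH by auto
      qed
    next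
      case False
      have "(x, y) \<notin> U'" if "pt x = c'" for x y
      proof
        assume "(x, y) \<in> U'"
        then obtain a b where "(a, b) \<in> U" "x = H a" using U'E by blast
        then show False using False in_pt(1) that ptH by blast
      qed
      then show ?thesis by (intro point_rule_empty) auto
    qed
    have bar_col: "\<kappa>' (y', x') = bar G (\<kappa>' (x', y')) \<and> \<kappa>' (x', y') \<in> carrier G \<times> X" if e': "(x', y') \<in> U'" for x' y'
    proof -
      obtain x y where xy: "(x, y) \<in> U" "x' = H x" "y' = H y" using U'E[OF e'] by blast
      then have "\<kappa>' (x', y') = \<kappa> (x, y)" "\<kappa>' (y', x') = \<kappa> (y, x)" using \<kappa>' sym by blast+
      then show ?thesis using half_coloringD(1,2)[OF \<kappa> xy(1)] by simp
    qed
    then have "\<kappa>' e \<in> carrier G \<times> X" if "e \<in> U'" for e using that by (metis prod.collapse)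
    moreover have "\<kappa>' \<in> extensional U'" by (simp add: \<kappa>'_def)
    ultimately show "restrict (\<kappa> \<circ> \<psi>) U' \<in> half_colorings G X q U'"
      using rule bar_col unfolding \<kappa>'_def[symmetric] in_half_colorings[of \<kappa>'] by blast
  next
    fix X and \<kappa>' :: "seg \<Rightarrow> _" assume X: "G_family G X q" and \<kappa>': "\<kappa>' \<in> half_colorings G X q U'"
    define \<kappa> where "\<kappa> = (\<lambda>(x, y)\<in>U. \<kappa>' (H x, H y))"
    have \<kappa>1: "\<kappa> (x, y) = \<kappa>' (H x, H y)" if "(x, y) \<in> U" for x y using that by (simp add: \<kappa>_def)
    define K where "K = inv_into (Field D) H"
    have K: "K (H x) = x" if "x \<in> Field D" for x
      unfolding K_def using that inj_H by (intro inv_into_f_f inj_onI) auto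
    have rule: "point_rule G q U \<kappa> c" for c
    proof (cases "c \<in> pt ` Field D")
      case True
      have img: "U' `` {N (h 1 c)} = H ` (U `` {N c})" if N: "N \<in> {Hi, Lo}" for N :: "complex \<Rightarrow> complex node"
      proof -
        have "y \<in> U' `` {N (h 1 c)} \<longleftrightarrow> y \<in> H ` (U `` {N c})" for y
        proof
          assume "y \<in> U' `` {N (h 1 c)}"
          then obtain a b where ab: "(a, b) \<in> U" "H (N c) = H a" "y = H b" using U'E HN[OF N] by fastforce
          have "pt (N c) = c" using N by auto
          then have "h 1 c = h 1 (pt a)" using arg_cong[OF ab(2), of pt] by (simp add: ptH)
          then have "c = pt a" using inj_onD[OF inj_h _ True in_pt(1)[OF ab(1)]] by blast
          then have "a = N c" using ab(2) N by (cases a) (auto simp: H_def)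
          then show "y \<in> H ` (U `` {N c})" using ab by auto
        qed (use in_U' HN[OF N] in auto)
        then show ?thesis by blast
      qed
      have KU: "K (H y) = y" if "(x, y) \<in> U" for x y using K in_pt(4) that by blast
      show ?thesis
      proof (rule point_rule_transfer[where F = "\<lambda>_. K" and U = U' and \<kappa> = \<kappa>' and c = "h 1 c"])
        show "point_rule G q U' \<kappa>' (h 1 c)" using \<kappa>' by (simp add: in_half_colorings)
        fix N :: "complex \<Rightarrow> complex node" assume N: "N \<in> {Hi, Lo}"
        show "U `` {N c} = K ` U' `` {N (h 1 c)} \<and> inj_on K (U' `` {N (h 1 c)})"
          unfolding img[OF N] by (auto simp: image_iff KU inj_on_def)
        fix y assume y: "(N (h 1 c), y) \<in> U'"
        then obtain w where "y = H w" "(N c, w) \<in> U" using img[OF N] by blast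
        then show "\<kappa> (N c, K y) = \<kappa>' (N (h 1 c), y) \<and> \<kappa> (K y, N c) = \<kappa>' (y, N (h 1 c))"
          using \<kappa>1 sym KU HN[OF N] by simp
      next
        fix N1 N2 N3 :: "complex \<Rightarrow> complex node" and y1 y2 y3
        assume e: "N1 \<in> {Hi, Lo}" "N2 \<in> {Hi, Lo}" "N3 \<in> {Hi, Lo}" "(N1 (h 1 c), y1) \<in> U'" "(N2 (h 1 c), y2) \<in> U'"
          "(N3 (h 1 c), y3) \<in> U'" "ccw c (pt (K y1)) (pt (K y2)) (pt (K y3))"
        obtain w1 w2 w3 where "y1 = H w1" "(N1 c, w1) \<in> U" "y2 = H w2" "(N2 c, w2) \<in> U" "y3 = H w3" "(N3 c, w3) \<in> U"
          using e(4-6) img[OF e(1)] img[OF e(2)] img[OF e(3)] by blast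
        then show "ccw (h 1 c) (pt y1) (pt y2) (pt y3)"
          using ccw_h[of "N1 c" w1 "N2 c" w2 "N3 c" w3 c] ptH KU e(1-3,7) by auto
      qed
    next
      case False
      then have "U `` {x} = {}" if "pt x = c" for x using in_pt(1) that by auto
      then show ?thesis by (intro point_rule_empty) auto
    qed
    have bar_col: "\<kappa> (y, x) = bar G (\<kappa> (x, y)) \<and> \<kappa> (x, y) \<in> carrier G \<times> X" if "(x, y) \<in> U" for x y
    proof -
      have "\<kappa> (x, y) = \<kappa>' (H x, H y)" "\<kappa> (y, x) = \<kappa>' (H y, H x)" using \<kappa>1 that sym by blast+
      then show ?thesis using half_coloringD(1,2)[OF \<kappa>' in_U'[OF that]] by simp
    qed
    then have "\<kappa> e \<in> carrier G \<times> X" if "e \<in> U" for e using that by (metis prod.collapse)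
    moreover have "\<kappa> \<in> extensional U" by (simp add: \<kappa>_def)
    ultimately have "\<kappa> \<in> half_colorings G X q U" using rule bar_col unfolding in_half_colorings by blast
    moreover have "\<kappa>' e = \<kappa> (\<psi> e)" if "e \<in> U'" for e
      using U'E[of "fst e" "snd e"] that \<psi> \<kappa>1 by (metis prod.collapse)
    ultimately show "\<exists>\<kappa>\<in>half_colorings G X q U. \<forall>e\<in>U'. \<kappa>' e = \<kappa> (\<psi> e)" by blast
  qed
  moreover have "U' = unoriented D'" by (simp add: U'_def U_def M_def D' unoriented_relocate)
  ultimately show ?thesis by (simp add: U_def)
qed

section \<open>Diagrams in a disc\<close>

text \<open>The rules are demanded at inner points only. \<open>\<beta> a\<close> is the color at
  the boundary joint \<open>a\<close>, in the direction into the disc.\<close>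

definition local_coloring ::
  "('g, 'm) monoid_scheme \<Rightarrow> 'x set \<Rightarrow> ('g \<Rightarrow> 'x \<Rightarrow> 'x \<Rightarrow> 'x) \<Rightarrow> complex \<Rightarrow> real \<Rightarrow> diagram \<Rightarrow>
   (complex \<Rightarrow> 'g \<times> 'x) \<Rightarrow> (seg \<Rightarrow> 'g \<times> 'x) \<Rightarrow> bool" where
  "local_coloring G X q z r V \<beta> \<kappa> \<longleftrightarrow>
     (\<forall>e\<in>V. \<kappa> e \<in> carrier G \<times> X) \<and>
     (\<forall>m n. (m, n) \<in> V \<longrightarrow> \<kappa> (n, m) = bar G (\<kappa> (m, n))) \<and>
     (\<forall>c\<in>ball z r. point_rule G q V \<kappa> c) \<and>
     (\<forall>a\<in>sphere z r. \<forall>m. (Lo a, m) \<in> V \<longrightarrow> \<kappa> (Lo a, m) = \<beta> a)"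

definition tangle :: "complex \<Rightarrow> real \<Rightarrow> complex set \<Rightarrow> diagram \<Rightarrow> bool" where
  "tangle z r E V \<longleftrightarrow> sym V \<and> E \<subseteq> sphere z r \<and>
     (\<forall>m n. (m, n) \<in> V \<longrightarrow> m \<in> Lo ` E \<or> pt m \<in> ball z r) \<and> (\<forall>a\<in>E. \<exists>!m. (Lo a, m) \<in> V)"

locale disc_diagram = Y_diagram D for D +
  fixes R T :: diagram and z :: complex and r :: real and E :: "complex set"
  assumes D_eq: "D = R \<union> T"
    and outside: "\<And>s. s \<in> R \<Longrightarrow> seg_line s \<inter> cball z r \<subseteq> E"
    and joints: "\<And>a. a \<in> E \<Longrightarrow> joint D (Lo a)"
    and tangle: "tangle z r E (unoriented T)"
begin

lemma unoriented_D: "unoriented D = unoriented R \<union> unoriented T"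
  by (simp add: D_eq unoriented_Un)

lemma sphere_E: "a \<in> E \<Longrightarrow> a \<in> sphere z r"
  using tangle by (auto simp: tangle_def)

lemma R_segment: "(m, n) \<in> unoriented R \<Longrightarrow> closed_segment (pt m) (pt n) \<inter> cball z r \<subseteq> E"
proof -
  assume "(m, n) \<in> unoriented R"
  moreover have "seg_line (m, n) = closed_segment (pt m) (pt n)" "seg_line (n, m) = closed_segment (pt m) (pt n)"
    by (auto simp: seg_line_def closed_segment_commute)
  ultimately show ?thesis using outside unfolding in_unoriented by metis
qed

lemma R_point: "(m, n) \<in> unoriented R \<Longrightarrow> pt m \<in> cball z r \<Longrightarrow> pt m \<in> E"
  using R_segment[of m n] ends_in_segment(1)[of "pt m" "pt n"] by blast

lemma R_inner: "c \<in> ball z r \<Longrightarrow> pt m = c \<Longrightarrow> unoriented R `` {m} = {}"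
  using R_point sphere_E by force

lemma T_outer: "c \<notin> ball z r \<Longrightarrow> c \<notin> E \<Longrightarrow> pt m = c \<Longrightarrow> unoriented T `` {m} = {}"
  using tangle by (auto simp: tangle_def)

lemma T_cball: "(m, n) \<in> unoriented T \<Longrightarrow> pt m \<in> cball z r"
  using tangle unfolding tangle_def by fastforce

text \<open>A segment of the inner part lies in the disc with its midpoint strictly inside, whereas
  a segment of the outer part meets the disc at most in boundary points.\<close>

lemma R_T_disjoint:
  assumes "(m, n) \<in> unoriented R" shows "(m, n) \<notin> unoriented T"
proof
  assume T: "(m, n) \<in> unoriented T"
  have ne: "pt m \<noteq> pt n" using pt_neq[of m n] assms by (simp add: unoriented_D)
  have "pt m \<in> cball z r" "pt n \<in> cball z r" using T_cball T unoriented_sym by blast+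
  then have mem: "midpoint (pt m) (pt n) \<in> closed_segment (pt m) (pt n)"
    "closed_segment (pt m) (pt n) \<subseteq> cball z r"
    using closed_segment_subset[of "pt m" "cball z r" "pt n"] by auto
  have "closed_segment (pt m) (pt n) \<inter> cball z r \<subseteq> E" using R_segment assms .
  then have "midpoint (pt m) (pt n) \<in> E" using mem by blast
  then have "dist z (midpoint (pt m) (pt n)) = r" using sphere_E by auto
  moreover have "midpoint (pt m) (pt n) \<in> open_segment (pt m) (pt n)" using ne by auto
  then have "dist z (midpoint (pt m) (pt n)) < r"
    using dist_decreases_open_segment[of "midpoint (pt m) (pt n)" "pt m" "pt n" z]
      \<open>pt m \<in> cball z r\<close> \<open>pt n \<in> cball z r\<close> by auto
  ultimately show False by simp
qed

text \<open>A joint has two neighbours, one of which belongs to the inner part; so exactly one is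
  left for the outer part.\<close>

lemma end_neighbours:
  assumes "a \<in> E" "(Lo a, t) \<in> unoriented T"
  shows "\<exists>s. unoriented R `` {Lo a} = {s} \<and> unoriented D `` {Lo a} = {s, t} \<and> s \<noteq> t \<and> unoriented D `` {Hi a} = {}"
proof -
  have j: "joint D (Lo a)" using joints assms(1) .
  then have hi: "unoriented D `` {Hi a} = {}" by (auto simp: joint_def Image_eq_empty)
  have "card (unoriented D `` {Lo a}) = 2" using j by (simp add: joint_def bivalent_iff)
  moreover have "unoriented T `` {Lo a} = {t}" using tangle assms by (auto simp: tangle_def)
  then have "unoriented D `` {Lo a} = insert t (unoriented R `` {Lo a})" by (auto simp: unoriented_D)
  moreover have t: "t \<notin> unoriented R `` {Lo a}" using R_T_disjoint assms(2) by auto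
  moreover have "finite (unoriented R `` {Lo a})"
    using finite_Image[of "Lo a"] by (simp add: unoriented_D Un_Image)
  ultimately have "card (unoriented R `` {Lo a}) = 1" by simp
  then obtain s where "unoriented R `` {Lo a} = {s}" by (auto simp: card_1_singleton_iff)
  then show ?thesis using hi t \<open>unoriented D `` {Lo a} = insert t _\<close> by auto
qed

lemma end_color:
  assumes \<kappa>: "\<kappa> \<in> half_colorings G X q (unoriented D)" and "a \<in> E" "(Lo a, t) \<in> unoriented T"
    and s: "(Lo a, s) \<in> unoriented R"
  shows "\<kappa> (Lo a, t) = \<kappa> (s, Lo a)"
proof -
  obtain s' where "unoriented R `` {Lo a} = {s'}" "unoriented D `` {Lo a} = {s', t}" "s' \<noteq> t"
    "unoriented D `` {Hi a} = {}"
    using end_neighbours[OF assms(2,3)] by blast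
  moreover from this(1) s have "s' = s" by auto
  ultimately show ?thesis using half_coloringD(3)[OF \<kappa>, of a] unfolding point_rule_def by metis
qed

lemma local_coloring_restrict:
  assumes \<kappa>: "\<kappa> \<in> half_colorings G X q (unoriented D)"
    and \<beta>: "\<And>a m. a \<in> E \<Longrightarrow> (Lo a, m) \<in> unoriented T \<Longrightarrow> \<kappa> (Lo a, m) = \<beta> a"
  shows "local_coloring G X q z r (unoriented T) \<beta> \<kappa>"
  unfolding local_coloring_def
proof (intro conjI ballI allI impI)
  show "point_rule G q (unoriented T) \<kappa> c" if c: "c \<in> ball z r" for c
  proof (rule point_rule_cong)
    show "point_rule G q (unoriented D) \<kappa> c" using half_coloringD(3)[OF \<kappa>] .
    show "unoriented D `` {Hi c} = unoriented T `` {Hi c}" "unoriented D `` {Lo c} = unoriented T `` {Lo c}"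
      using R_inner[OF c] by (simp_all add: unoriented_D Un_Image)
  qed simp
  show "\<kappa> (Lo a, m) = \<beta> a" if "a \<in> sphere z r" "(Lo a, m) \<in> unoriented T" for a m
  proof -
    have "a \<in> E" using that tangle unfolding tangle_def by fastforce
    then show ?thesis using \<beta> that by blast
  qed
qed (use half_coloringD[OF \<kappa>] in \<open>auto simp: unoriented_D simp del: mem_Sigma_iff\<close>)

end

text \<open>Gluing along the circle. The rule at an inner point concerns the inner part only, and
  away from the open disc and the boundary joints it concerns the outer part only. At a boundary
  joint it equates the inward color with the one arriving from outside, and this color is
  \<open>\<beta>\<close> for the old inner part as for the new one.\<close>

lemma switch_extend:
  assumes A: "disc_diagram D R T z r E" and B: "disc_diagram D' R T' z r E"
    and \<kappa>: "\<kappa> \<in> half_colorings G X q (unoriented D)" and X: "quandle_family G X q"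
    and \<beta>: "\<And>a m. a \<in> E \<Longrightarrow> (Lo a, m) \<in> unoriented T \<Longrightarrow> \<kappa> (Lo a, m) = \<beta> a"
    and \<tau>: "local_coloring G X q z r (unoriented T') \<beta> \<tau>"
  shows "\<exists>\<kappa>'\<in>half_colorings G X q (unoriented D'). \<forall>e\<in>unoriented R. \<kappa>' e = \<kappa> e"
proof -
  interpret A: disc_diagram D R T z r E by (rule A)
  interpret B: disc_diagram D' R T' z r E by (rule B)
  interpret quandle_family G X q by (rule X)
  define \<kappa>' where "\<kappa>' = (\<lambda>e\<in>unoriented D'. if e \<in> unoriented R then \<kappa> e else \<tau> e)"
  have R: "\<kappa>' e = \<kappa> e" if "e \<in> unoriented R" for e using that by (simp add: \<kappa>'_def B.unoriented_D)
  have T: "\<kappa>' e = \<tau> e" if "e \<in> unoriented T'" for e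
    using that B.R_T_disjoint[of "fst e" "snd e"] by (auto simp: \<kappa>'_def B.unoriented_D)
  have \<tau>1: "\<tau> e \<in> colors" "(m, n) \<in> unoriented T' \<Longrightarrow> \<tau> (n, m) = bar G (\<tau> (m, n))"
    if "e \<in> unoriented T'" for e m n
    using \<tau> that unfolding local_coloring_def by blast+
  have col: "\<kappa>' e \<in> colors" if "e \<in> unoriented D'" for e
  proof (cases "e \<in> unoriented R")
    case True
    then have "\<kappa> e \<in> colors" using half_coloringD(2)[OF \<kappa>, of e] by (simp add: A.unoriented_D del: mem_Sigma_iff)
    then show ?thesis using R[OF True] by metis
  next
    case False
    then have "e \<in> unoriented T'" using that by (simp add: B.unoriented_D)
    then show ?thesis using T \<tau>1(1) by metis
  qed
  have bar: "\<kappa>' (n, m) = bar G (\<kappa>' (m, n))" if e: "(m, n) \<in> unoriented D'" for m n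
  proof (cases "(m, n) \<in> unoriented R")
    case True
    then have "(n, m) \<in> unoriented R" "(m, n) \<in> unoriented D" using unoriented_sym by (auto simp: A.unoriented_D)
    then show ?thesis using True R half_coloringD(1)[OF \<kappa>] by metis
  next
    case False
    then have "(m, n) \<in> unoriented T'" using e by (simp add: B.unoriented_D)
    moreover from this have "(n, m) \<in> unoriented T'" using unoriented_sym by blast
    ultimately show ?thesis using T \<tau>1(2) by metis
  qed
  have "point_rule G q (unoriented D') \<kappa>' c" for c
  proof -
    consider "c \<in> ball z r" | "c \<in> E" | "c \<notin> ball z r" "c \<notin> E" by blast
    then show ?thesis
    proof cases
      case 1
      show ?thesis
      proof (rule point_rule_cong)
        show "point_rule G q (unoriented T') \<tau> c" using \<tau> 1 by (simp add: local_coloring_def)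
        show "unoriented T' `` {Hi c} = unoriented D' `` {Hi c}" "unoriented T' `` {Lo c} = unoriented D' `` {Lo c}"
          using B.R_inner[OF 1] by (simp_all add: B.unoriented_D Un_Image)
      qed (use T unoriented_sym in blast)
    next
      case 2
      obtain t t' where t: "(Lo c, t) \<in> unoriented T" "(Lo c, t') \<in> unoriented T'"
        using A.tangle B.tangle 2 unfolding tangle_def by blast
      obtain s where s: "unoriented R `` {Lo c} = {s}" "unoriented D' `` {Lo c} = {s, t'}" "s \<noteq> t'"
        "unoriented D' `` {Hi c} = {}"
        using B.end_neighbours[OF 2 t(2)] by blast
      have sR: "(Lo c, s) \<in> unoriented R" "(s, Lo c) \<in> unoriented R" using s(1) unoriented_sym by blast+
      have "\<kappa>' (Lo c, t') = \<beta> c" using T[OF t(2)] \<tau> 2 t(2) B.sphere_E by (simp add: local_coloring_def)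
      also have "\<beta> c = \<kappa> (s, Lo c)" using A.end_color[OF \<kappa> 2 t(1) sR(1)] \<beta>[OF 2 t(1)] by simp
      finally have eq: "\<kappa>' (Lo c, t') = \<kappa>' (s, Lo c)" using R sR by simp
      have "(Lo c, t') \<in> unoriented D'" "(s, Lo c) \<in> unoriented D'" using t sR by (auto simp: B.unoriented_D)
      then have "\<kappa>' (t', Lo c) = \<kappa>' (Lo c, s)" using bar eq by metis
      moreover have "\<not> ccw c (pt y1) (pt y2) (pt y3)" if "y1 \<in> {s, t'}" "y2 \<in> {s, t'}" "y3 \<in> {s, t'}" for y1 y2 y3
      proof -
        have "y1 = y2 \<or> y2 = y3 \<or> y1 = y3" using that by auto
        then show ?thesis using ccw_distinct(4-6) by metis
      qed
      ultimately show ?thesis using eq unfolding point_rule_def s(2,4) by (auto simp: doubleton_eq_iff)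
    next
      case 3
      have e: "unoriented T `` {N c} = {}" "unoriented T' `` {N c} = {}" if "N \<in> {Hi, Lo}" for N :: "complex \<Rightarrow> complex node"
      proof -
        have p: "pt (N c) = c" using that by auto
        show "unoriented T `` {N c} = {}" "unoriented T' `` {N c} = {}"
          using A.T_outer[OF 3 p] B.T_outer[OF 3 p] .
      qed
      show ?thesis
      proof (rule point_rule_cong)
        show "point_rule G q (unoriented D) \<kappa> c" using half_coloringD(3)[OF \<kappa>] .
        show "unoriented D `` {Hi c} = unoriented D' `` {Hi c}" "unoriented D `` {Lo c} = unoriented D' `` {Lo c}"
          using e[of Hi] e[of Lo] by (simp_all add: A.unoriented_D B.unoriented_D Un_Image)
        show "\<kappa>' (N c, y) = \<kappa> (N c, y) \<and> \<kappa>' (y, N c) = \<kappa> (y, N c)"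
          if "N \<in> {Hi, Lo}" "(N c, y) \<in> unoriented D" for N :: "complex \<Rightarrow> complex node" and y
        proof -
          have "(N c, y) \<in> unoriented R" using that e(1)[OF that(1)] by (auto simp: A.unoriented_D)
          then show ?thesis using R unoriented_sym by blast
        qed
      qed
    qed
  qed
  moreover have "\<kappa>' \<in> extensional (unoriented D')" by (simp add: \<kappa>'_def)
  ultimately have "\<kappa>' \<in> half_colorings G X q (unoriented D')"
    using col bar unfolding in_half_colorings by blast
  then show ?thesis using R by blast
qed

text \<open>Colorings that agree outside arrive at the boundary joints with the same colors, hence
  restrict to local colorings with a common \<open>\<beta>\<close>.\<close>

lemma switch_unique:
  assumes B: "disc_diagram D R T z r E"
    and \<kappa>: "\<kappa>1 \<in> half_colorings G X q (unoriented D)" "\<kappa>2 \<in> half_colorings G X q (unoriented D)"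
      "\<forall>e\<in>unoriented R. \<kappa>1 e = \<kappa>2 e"
    and uniq: "\<And>\<beta> e. local_coloring G X q z r (unoriented T) \<beta> \<kappa>1 \<Longrightarrow> local_coloring G X q z r (unoriented T) \<beta> \<kappa>2 \<Longrightarrow>
      e \<in> unoriented T \<Longrightarrow> \<kappa>1 e = \<kappa>2 e"
  shows "\<kappa>1 = \<kappa>2"
proof (rule half_coloring_ext[OF \<kappa>(1,2)])
  interpret B: disc_diagram D R T z r E by (rule B)
  obtain f where f: "\<And>a. a \<in> E \<Longrightarrow> (Lo a, f a) \<in> unoriented T \<and> (\<forall>m. (Lo a, m) \<in> unoriented T \<longrightarrow> m = f a)"
    using B.tangle unfolding tangle_def by metis
  define \<beta> where "\<beta> a = \<kappa>1 (Lo a, f a)" for a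
  have \<beta>1: "\<kappa>1 (Lo a, m) = \<beta> a" if "a \<in> E" "(Lo a, m) \<in> unoriented T" for a m
    using f that unfolding \<beta>_def by blast
  have \<beta>2: "\<kappa>2 (Lo a, m) = \<beta> a" if am: "a \<in> E" "(Lo a, m) \<in> unoriented T" for a m
  proof -
    obtain s where "unoriented R `` {Lo a} = {s}" using B.end_neighbours[OF am] by blast
    then have s: "(Lo a, s) \<in> unoriented R" "(s, Lo a) \<in> unoriented R" using unoriented_sym by blast+
    have "\<kappa>2 (Lo a, m) = \<kappa>2 (s, Lo a)" "\<kappa>1 (Lo a, m) = \<kappa>1 (s, Lo a)"
      using B.end_color[OF \<kappa>(2) am s(1)] B.end_color[OF \<kappa>(1) am s(1)] .
    then show ?thesis using \<kappa>(3) s(2) \<beta>1[OF am] by metis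
  qed
  fix e assume "e \<in> unoriented D"
  then consider "e \<in> unoriented R" | "e \<in> unoriented T" unfolding B.unoriented_D by blast
  then show "\<kappa>1 e = \<kappa>2 e"
    using \<kappa>(3) uniq[OF B.local_coloring_restrict[OF \<kappa>(1) \<beta>1] B.local_coloring_restrict[OF \<kappa>(2) \<beta>2]] by cases auto
qed

text \<open>The relation is agreement on the common outer part, which does not mention the
  underlying set, as \<open>recolorable\<close> demands. Equal solvability for given boundary colors
  provides partners; unique solvability makes them unique.\<close>

lemma switch_recolorable:
  assumes G: "group G" and A: "disc_diagram D R T z r E" and B: "disc_diagram D' R T' z r E"
    and solve: "\<And>X \<beta>. quandle_family G X q \<Longrightarrow> (\<forall>a\<in>E. \<beta> a \<in> carrier G \<times> X) \<Longrightarrow>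
      (\<exists>\<kappa>. local_coloring G X q z r (unoriented T) \<beta> \<kappa>) \<longleftrightarrow> (\<exists>\<kappa>. local_coloring G X q z r (unoriented T') \<beta> \<kappa>)"
    and uniq: "\<And>X \<beta> \<kappa>1 \<kappa>2 e. quandle_family G X q \<Longrightarrow> local_coloring G X q z r (unoriented T) \<beta> \<kappa>1 \<Longrightarrow>
        local_coloring G X q z r (unoriented T) \<beta> \<kappa>2 \<Longrightarrow> e \<in> unoriented T \<Longrightarrow> \<kappa>1 e = \<kappa>2 e"
    and uniq': "\<And>X \<beta> \<kappa>1 \<kappa>2 e. quandle_family G X q \<Longrightarrow> local_coloring G X q z r (unoriented T') \<beta> \<kappa>1 \<Longrightarrow>
        local_coloring G X q z r (unoriented T') \<beta> \<kappa>2 \<Longrightarrow> e \<in> unoriented T' \<Longrightarrow> \<kappa>1 e = \<kappa>2 e"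
  shows "recolorable G q (unoriented D) (unoriented D')"
proof -
  have ext: "\<exists>\<kappa>'\<in>half_colorings G X q (unoriented D2). \<forall>e\<in>unoriented R. \<kappa>' e = \<kappa> e"
    if X: "quandle_family G X q" and d: "disc_diagram D1 R T1 z r E" "disc_diagram D2 R T2 z r E"
      and s: "\<And>\<beta> \<kappa>. (\<forall>a\<in>E. \<beta> a \<in> carrier G \<times> X) \<Longrightarrow> local_coloring G X q z r (unoriented T1) \<beta> \<kappa> \<Longrightarrow>
        \<exists>\<kappa>. local_coloring G X q z r (unoriented T2) \<beta> \<kappa>"
      and \<kappa>: "\<kappa> \<in> half_colorings G X q (unoriented D1)" for X D1 D2 T1 T2 \<kappa>
  proof -
    interpret C: disc_diagram D1 R T1 z r E by (rule d(1))
    obtain f where f: "\<And>a. a \<in> E \<Longrightarrow> (Lo a, f a) \<in> unoriented T1 \<and> (\<forall>m. (Lo a, m) \<in> unoriented T1 \<longrightarrow> m = f a)"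
      using C.tangle unfolding tangle_def by metis
    define \<beta> where "\<beta> a = \<kappa> (Lo a, f a)" for a
    have \<beta>: "\<kappa> (Lo a, m) = \<beta> a" if "a \<in> E" "(Lo a, m) \<in> unoriented T1" for a m
      using f that unfolding \<beta>_def by blast
    have "\<forall>a\<in>E. \<beta> a \<in> carrier G \<times> X"
      using half_coloringD(2)[OF \<kappa>] f unfolding \<beta>_def C.unoriented_D by blast
    then obtain \<tau> where "local_coloring G X q z r (unoriented T2) \<beta> \<tau>"
      using s C.local_coloring_restrict[OF \<kappa> \<beta>] by blast
    then show ?thesis using switch_extend[OF d \<kappa> X \<beta>] by blast
  qed
  show ?thesis
    unfolding recolorable_def
  proof (intro exI[of _ "\<lambda>\<kappa> \<kappa>'. \<forall>e\<in>unoriented R. \<kappa> e = \<kappa>' e"] allI impI conjI ballI)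
    fix X assume "G_family G X q"
    then have X: "quandle_family G X q" using G by (simp add: quandle_family_def quandle_family_axioms_def)
    show "\<exists>\<kappa>'\<in>half_colorings G X q (unoriented D'). \<forall>e\<in>unoriented R. \<kappa> e = \<kappa>' e"
      if "\<kappa> \<in> half_colorings G X q (unoriented D)" for \<kappa>
      using ext[OF X A B _ that] solve[OF X] by metis
    show "\<exists>\<kappa>'\<in>half_colorings G X q (unoriented D). \<forall>e\<in>unoriented R. \<kappa>' e = \<kappa> e"
      if "\<kappa> \<in> half_colorings G X q (unoriented D')" for \<kappa>
      using ext[OF X B A _ that] solve[OF X] by metis
    show "\<kappa>1 = \<kappa>2" if "\<kappa>1 \<in> half_colorings G X q (unoriented D')" "\<kappa>2 \<in> half_colorings G X q (unoriented D')"
      "\<forall>e\<in>unoriented R. \<kappa> e = \<kappa>1 e" "\<forall>e\<in>unoriented R. \<kappa> e = \<kappa>2 e" for \<kappa> \<kappa>1 \<kappa>2 :: "seg \<Rightarrow> _"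
    proof (rule switch_unique[OF B that(1,2)])
      show "\<forall>e\<in>unoriented R. \<kappa>1 e = \<kappa>2 e" using that(3,4) by metis
    qed (rule uniq'[OF X])
    show "\<kappa>1 = \<kappa>2" if "\<kappa>1 \<in> half_colorings G X q (unoriented D)" "\<kappa>2 \<in> half_colorings G X q (unoriented D)"
      "\<forall>e\<in>unoriented R. \<kappa>1 e = \<kappa> e" "\<forall>e\<in>unoriented R. \<kappa>2 e = \<kappa> e" for \<kappa> \<kappa>1 \<kappa>2 :: "seg \<Rightarrow> _"
    proof (rule switch_unique[OF A that(1,2)])
      show "\<forall>e\<in>unoriented R. \<kappa>1 e = \<kappa>2 e" using that(3,4) by metis
    qed (rule uniq[OF X])
  qed
qed

section \<open>Paths inside the disc and their sides\<close>

fun edges :: "complex node list \<Rightarrow> diagram" where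
  "edges (m # n # ns) = {(m, n), (n, m)} \<union> edges (n # ns)"
| "edges _ = {}"

lemma edges_eq: "edges ns = unoriented (set (zip ns (tl ns)))"
  by (induction ns rule: edges.induct) (auto simp: unoriented_def)

lemma edges_append: "edges (ms @ n # ns) = edges (ms @ [n]) \<union> edges (n # ns)"
proof (induction ms)
  case (Cons m ms)
  then show ?case by (cases ms) auto
qed auto

lemma edges_rev: "edges (rev ns) = edges ns"
proof (induction ns rule: edges.induct)
  case (1 m n ns)
  have "edges (rev ns @ [n, m]) = edges (rev ns @ [n]) \<union> edges [n, m]"
    using edges_append[of "rev ns" n "[m]"] by simp
  then show ?case using 1 by auto
qed auto

lemma unoriented_strand [simp]: "unoriented (strand b ns) = edges ns"
  using edges_eq[of ns] edges_eq[of "rev ns"] by (auto simp: strand_def Let_def edges_rev)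

text \<open>The sign of \<open>side\<close> at a point \<open>e\<close> of the circle, for every
  path in the disc from \<open>a\<close> to \<open>a'\<close>. It is the yardstick by which the two
  pictures of a move are compared.\<close>

definition left_end :: "complex \<Rightarrow> complex \<Rightarrow> complex \<Rightarrow> bool" where
  "left_end a a' e \<longleftrightarrow> Arg ((a' - e) / (a - e)) - chord_angle a a' e > 0"

definition left_of :: "complex node list \<Rightarrow> complex \<Rightarrow> bool" where
  "left_of ns u \<longleftrightarrow> side (map pt ns) u > 0"

context Y_diagram
begin

lemma crossing_sides:
  assumes "unoriented D `` {Hi c} = {p, p'}" "p \<noteq> p'" "unoriented D `` {Lo c} = {u, u'}" "u \<noteq> u'"
  shows "on_left (pt p) c (pt p') (pt u) \<and> on_right (pt p) c (pt p') (pt u') \<or>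
    on_right (pt p) c (pt p') (pt u) \<and> on_left (pt p) c (pt p') (pt u')"
proof -
  have "Hi c \<in> Field D" using assms(1) Image_eq_empty by blast
  then have c: "crossing D c" by (rule crossing_Hi)
  then have b: "bivalent D (Hi c)" "bivalent D (Lo c)" by (auto simp: crossing_def)
  have cond: "on_left (pt p) c (pt p') (pt u) \<and> on_right (pt p) c (pt p') (pt u') \<or>
      on_right (pt p) c (pt p') (pt u) \<and> on_left (pt p) c (pt p') (pt u')"
    if "(p, Hi c) \<in> D" "(Hi c, p') \<in> D" "(u, Lo c) \<in> D" "(Lo c, u') \<in> D" for p p' u u'
    using c that unfolding crossing_def by blast
  have swap: "on_right (pt p') c (pt p) x \<longleftrightarrow> on_left (pt p) c (pt p') x"
    "on_left (pt p') c (pt p) x \<longleftrightarrow> on_right (pt p) c (pt p') x" for p p' x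
    by (auto simp: on_right_def on_left_def)
  from bivalent_cases[OF b(1), of p p'] bivalent_cases[OF b(2), of u u'] assms
  show ?thesis using cond swap by blast
qed

end

context disc_diagram
begin

abbreviation V where "V \<equiv> unoriented T"

text \<open>Distinctness is required of the points, so the path does not cross itself; other strands
  may cross it at its nodes.\<close>

definition cutting :: "complex node list \<Rightarrow> bool" where
  "cutting ns \<longleftrightarrow> successively (\<lambda>m n. (m, n) \<in> V) ns \<and> distinct (map pt ns) \<and> 2 \<le> length ns \<and>
     pt (hd ns) \<in> E \<and> pt (last ns) \<in> E \<and> pt ` set (tl (butlast ns)) \<subseteq> ball z r"

lemma V_D: "e \<in> V \<Longrightarrow> e \<in> unoriented D"
  by (simp add: unoriented_D)

text \<open>An edge that ends off the path differs from all segments of the path, and different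
  segments share only ends; as \<open>pt n\<close> is excluded, \<open>pt m\<close> remains.\<close>

lemma edge_meets_path:
  assumes "(m, n) \<in> V" "successively (\<lambda>m n. (m, n) \<in> V) ns" "pt n \<notin> pt ` set ns" "2 \<le> length ns"
  shows "closed_segment (pt m) (pt n) \<inter> poly_image (map pt ns) \<subseteq> {pt m} \<inter> pt ` set ns"
  using assms(2-4)
proof (induction ns rule: edges.induct)
  case (1 a b ns)
  have ab: "(a, b) \<in> V" "pt n \<noteq> pt a" "pt n \<noteq> pt b" using 1 by auto
  then have "{m, n} \<noteq> {a, b}" by (auto simp: doubleton_eq_iff)
  then have seg: "closed_segment (pt m) (pt n) \<inter> closed_segment (pt a) (pt b) \<subseteq> {pt m, pt n} \<inter> {pt a, pt b}"
    using segments_meet_at_ends[OF V_D[OF assms(1)] V_D[OF ab(1)]] by simp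
  show ?case
  proof (cases ns)
    case Nil
    then show ?thesis using seg ab(2,3) by auto
  next
    case (Cons c ns')
    have "closed_segment (pt m) (pt n) \<inter> poly_image (map pt (b # ns)) \<subseteq> {pt m} \<inter> pt ` set (b # ns)"
      using 1 Cons by auto
    then show ?thesis using seg ab(2,3) Cons by auto
  qed
qed auto

lemma simple_path:
  assumes "successively (\<lambda>m n. (m, n) \<in> V) ns" "distinct (map pt ns)"
  shows "simple_poly (map pt ns)"
  using assms
proof (induction ns rule: edges.induct)
  case (1 a b ns)
  have V: "(b, a) \<in> V" using 1 unoriented_sym by auto
  have "closed_segment (pt a) (pt b) \<inter> poly_image (map pt (b # ns)) = {pt b}"
  proof (cases ns)
    case (Cons c ns')
    have "closed_segment (pt b) (pt a) \<inter> poly_image (map pt (b # ns)) \<subseteq> {pt b} \<inter> pt ` set (b # ns)"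
      using edge_meets_path[OF V, of "b # ns"] 1 Cons by auto
    moreover have "pt b \<in> poly_image (map pt (b # ns))" using set_subset_poly_image[of "map pt (b # ns)"] by auto
    moreover have "pt b \<in> closed_segment (pt a) (pt b)" by simp
    ultimately show ?thesis by (auto simp: closed_segment_commute)
  qed auto
  then show ?case using 1 by auto
qed auto

lemma cutting_cut:
  assumes "cutting ns"
  shows "cut z r (map pt ns)"
proof -
  have ne: "ns \<noteq> []" using assms by (auto simp: cutting_def)
  have "hd ns \<noteq> last ns" "pt (hd ns) \<noteq> pt (last ns)"
  proof -
    obtain a ms b where ns: "ns = a # ms @ [b]"
      using assms unfolding cutting_def by (cases ns; cases "tl ns" rule: rev_cases) auto
    then show "pt (hd ns) \<noteq> pt (last ns)" using assms by (auto simp: cutting_def)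
    then show "hd ns \<noteq> last ns" by auto
  qed
  moreover have "pt (hd ns) \<in> sphere z r" "pt (last ns) \<in> sphere z r"
    using assms sphere_E unfolding cutting_def by blast+
  moreover have "set (tl (butlast (map pt ns))) = pt ` set (tl (butlast ns))"
    by (simp add: map_butlast[symmetric] map_tl[symmetric] del: map_butlast map_tl)
  ultimately show ?thesis
    using assms simple_path ne unfolding cut_def cutting_def by (simp add: hd_map last_map)
qed

lemma left_edge:
  assumes "cutting ns" "(m, n) \<in> V" "pt m \<notin> pt ` set ns" "pt n \<notin> pt ` set ns"
  shows "left_of ns (pt m) \<longleftrightarrow> left_of ns (pt n)"
proof -
  have "closed_segment (pt m) (pt n) \<inter> poly_image (map pt ns) = {}"
    using edge_meets_path[OF assms(2) _ assms(4)] assms(1,3) by (auto simp: cutting_def)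
  moreover have "closed_segment (pt m) (pt n) \<subseteq> cball z r"
    using T_cball[OF assms(2)] T_cball[OF unoriented_sym[OF assms(2)]] by (intro closed_segment_subset) auto
  ultimately have "side (map pt ns) (pt m) = side (map pt ns) (pt n)"
    using side_constant[OF cutting_cut[OF assms(1)] connected_segment] by simp
  then show ?thesis by (simp add: left_of_def)
qed

text \<open>\<open>c'\<close> may be the other node over the same point, so that this covers the
  third edge at a vertex as well as the strand crossing the path at \<open>c\<close>.\<close>

lemma left_node:
  assumes "cutting (xs @ p # c # p' # ys)" "(c', u) \<in> V" "pt c' = pt c" "pt u \<notin> pt ` set (xs @ p # c # p' # ys)"
  shows "left_of (xs @ p # c # p' # ys) (pt u) \<longleftrightarrow> on_left (pt p) (pt c) (pt p') (pt u)"
proof -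
  let ?ps = "map pt xs @ pt p # pt c # pt p' # map pt ys"
  have ps: "map pt (xs @ p # c # p' # ys) = ?ps" by simp
  have meet: "closed_segment (pt c) (pt u) \<inter> poly_image ?ps \<subseteq> {pt c}"
    using edge_meets_path[OF assms(2) _ assms(4)] assms(1,3) by (auto simp: cutting_def)
  have ne: "pt u \<noteq> pt c" using assms(4) by auto
  then have "pt u \<notin> poly_image ?ps" "open_segment (pt c) (pt u) \<inter> poly_image ?ps = {}"
    using meet ends_in_segment(2)[of "pt u" "pt c"] by (auto simp: open_segment_def)
  moreover have "pt u \<in> cball z r" using T_cball unoriented_sym assms(2) by blast
  ultimately have "side ?ps (pt u) = (if on_left (pt p) (pt c) (pt p') (pt u) then pi else - pi)"
    using side_at_node[of z r "map pt xs" "pt p" "pt c" "pt p'" "map pt ys" "pt u"]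
      cutting_cut[OF assms(1)] ne unfolding ps by blast
  then show ?thesis by (simp add: left_of_def)
qed

lemma left_on_sphere:
  assumes "cutting ns" "e \<in> E" "e \<notin> pt ` set ns"
  shows "left_of ns e \<longleftrightarrow> left_end (pt (hd ns)) (pt (last ns)) e"
proof -
  have "ns \<noteq> []" using assms(1) by (auto simp: cutting_def)
  then show ?thesis
    using side_on_sphere[OF cutting_cut[OF assms(1)] sphere_E[OF assms(2)]] assms(3)
    by (simp add: left_of_def left_end_def hd_map last_map)
qed

end

section \<open>The rules at joints, crossings and vertices as equations\<close>

definition twist :: "('g, 'm) monoid_scheme \<Rightarrow> bool \<Rightarrow> 'g \<times> 'x \<Rightarrow> 'g \<times> 'x" where
  "twist G s a = (if s then a else bar G a)"

definition bar_symmetric :: "('g, 'm) monoid_scheme \<Rightarrow> 'x set \<Rightarrow> diagram \<Rightarrow> (seg \<Rightarrow> 'g \<times> 'x) \<Rightarrow> bool" where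
  "bar_symmetric G X V \<kappa> \<longleftrightarrow> (\<forall>e\<in>V. \<kappa> e \<in> carrier G \<times> X) \<and> (\<forall>m n. (m, n) \<in> V \<longrightarrow> \<kappa> (n, m) = bar G (\<kappa> (m, n)))"

text \<open>At inner points outside \<open>I\<close> there is no node and the rule is
  vacuous.\<close>

lemma local_coloring_iff:
  assumes "tangle z r E V" "\<And>m n. (m, n) \<in> V \<Longrightarrow> m \<in> Lo ` E \<or> pt m \<in> I" "I \<subseteq> ball z r"
  shows "local_coloring G X q z r V \<beta> \<kappa> \<longleftrightarrow> bar_symmetric G X V \<kappa> \<and> (\<forall>c\<in>I. point_rule G q V \<kappa> c) \<and>
    (\<forall>a\<in>E. \<forall>m. (Lo a, m) \<in> V \<longrightarrow> \<kappa> (Lo a, m) = \<beta> a)"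
proof -
  have "point_rule G q V \<kappa> c" if "c \<in> ball z r" "c \<notin> I" for c
  proof -
    have "(m, n) \<notin> V" if "pt m = c" for m n
    proof
      assume "(m, n) \<in> V"
      then have "m \<in> Lo ` E" using assms(2) that \<open>c \<notin> I\<close> by blast
      then have "c \<in> sphere z r" using assms(1) that by (auto simp: tangle_def)
      then show False using \<open>c \<in> ball z r\<close> by auto
    qed
    then show ?thesis by (intro point_rule_empty) auto
  qed
  then have "(\<forall>c\<in>ball z r. point_rule G q V \<kappa> c) \<longleftrightarrow> (\<forall>c\<in>I. point_rule G q V \<kappa> c)"
    using assms(3) by blast
  moreover have "a \<in> E" if "a \<in> sphere z r" "(Lo a, m) \<in> V" for a m
    using assms(1) that unfolding tangle_def by fastforce
  then have "(\<forall>a\<in>sphere z r. \<forall>m. (Lo a, m) \<in> V \<longrightarrow> \<kappa> (Lo a, m) = \<beta> a) \<longleftrightarrow>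
      (\<forall>a\<in>E. \<forall>m. (Lo a, m) \<in> V \<longrightarrow> \<kappa> (Lo a, m) = \<beta> a)"
    using assms(1) unfolding tangle_def by blast
  ultimately show ?thesis unfolding local_coloring_def bar_symmetric_def by blast
qed

lemma no_ccw_of_two:
  assumes "y1 \<in> {p, p'}" "y2 \<in> {p, p'}" "y3 \<in> {p, p'}"
  shows "\<not> ccw c (pt y1) (pt y2) (pt y3)"
proof -
  have "y1 = y2 \<or> y2 = y3 \<or> y1 = y3" using assms by auto
  then show ?thesis using ccw_distinct(4-6) by metis
qed

context quandle_family
begin

lemma twist_closed [simp]: "a \<in> colors \<Longrightarrow> twist G s a \<in> colors"
  by (simp add: twist_def)

lemma op_twist_cancel [simp]: "a \<in> colors \<Longrightarrow> b \<in> colors \<Longrightarrow> a \<rhd> twist G s b \<rhd> twist G (\<not> s) b = a"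
  "a \<in> colors \<Longrightarrow> b \<in> colors \<Longrightarrow> a \<rhd> twist G (\<not> s) b \<rhd> twist G s b = a"
  by (auto simp: twist_def)

lemma op_twist_eq_iff: "a \<in> colors \<Longrightarrow> b \<in> colors \<Longrightarrow> c \<in> colors \<Longrightarrow>
    a \<rhd> twist G s c = b \<longleftrightarrow> a = b \<rhd> twist G (\<not> s) c"
  using op_twist_cancel by metis

lemma bar_symmetricD:
  assumes "bar_symmetric G X V \<kappa>" "(m, n) \<in> V"
  shows "\<kappa> (m, n) \<in> colors" "\<kappa> (n, m) \<in> colors" "\<kappa> (n, m) = bar G (\<kappa> (m, n))"
  using assms bar_closed[of "\<kappa> (m, n)"] unfolding bar_symmetric_def by (auto simp del: mem_Sigma_iff bar_closed)

lemma joint_iff: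
  assumes \<kappa>: "bar_symmetric G X V \<kappa>" and V: "sym V" "V `` {Hi c} = {}" "V `` {Lo c} = {p, p'}" "p \<noteq> p'"
  shows "point_rule G q V \<kappa> c \<longleftrightarrow> \<kappa> (Lo c, p') = \<kappa> (p, Lo c)"
proof -
  have e: "(p, Lo c) \<in> V" "(Lo c, p') \<in> V" using V by (auto dest: symD)
  have "\<kappa> (p', Lo c) = \<kappa> (Lo c, p)" if "\<kappa> (p, Lo c) = \<kappa> (Lo c, p')"
    using bar_symmetricD(3)[OF \<kappa> e(1)] bar_symmetricD(3)[OF \<kappa> e(2)] that by simp
  moreover have "\<not> ccw c (pt y1) (pt y2) (pt y3)" if "y1 \<in> {p, p'}" "y2 \<in> {p, p'}" "y3 \<in> {p, p'}" for y1 y2 y3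
    using no_ccw_of_two that .
  ultimately show ?thesis unfolding point_rule_def V(2,3) using V(4) by (auto simp: doubleton_eq_iff)
qed

lemma on_left_right_ex: "on_right p c p' u \<Longrightarrow> \<not> on_left p c p' u"
  using ccw_rotate ccw_asym unfolding on_right_def on_left_def by blast

text \<open>The rule has one instance for each direction of the over-strand. Either is the other one
  inverted and solved for the other under-arc, so a single equation remains. Whether the over-color
  acts directly or inverted, which \<open>twist\<close> expresses, depends on the side from which
  \<open>u\<close> arrives.\<close>

lemma crossing_iff:
  assumes \<kappa>: "bar_symmetric G X V \<kappa>" and V: "sym V" "V `` {Hi c} = {p, p'}" "p \<noteq> p'" "V `` {Lo c} = {u, u'}"
    and sides: "on_left (pt p) c (pt p') (pt u) \<and> on_right (pt p) c (pt p') (pt u') \<or>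
      on_right (pt p) c (pt p') (pt u) \<and> on_left (pt p) c (pt p') (pt u')"
  shows "point_rule G q V \<kappa> c \<longleftrightarrow> \<kappa> (Hi c, p') = \<kappa> (p, Hi c) \<and>
    \<kappa> (Lo c, u') = \<kappa> (u, Lo c) \<rhd> twist G (on_right (pt p) c (pt p') (pt u)) (\<kappa> (p, Hi c))"
proof -
  define s where "s = on_right (pt p) c (pt p') (pt u)"
  have e: "(p, Hi c) \<in> V" "(Hi c, p') \<in> V" "(u, Lo c) \<in> V" "(Lo c, u') \<in> V" using V by (auto dest: symD)
  note bs = bar_symmetricD[OF \<kappa> e(1)] bar_symmetricD[OF \<kappa> e(2)] bar_symmetricD[OF \<kappa> e(3)] bar_symmetricD[OF \<kappa> e(4)]
  have swap: "on_right (pt p') c (pt p) x \<longleftrightarrow> on_left (pt p) c (pt p') x"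
    "on_left (pt p') c (pt p) x \<longleftrightarrow> on_right (pt p) c (pt p') x" for x
    by (auto simp: on_right_def on_left_def)
  have no: "\<not> on_right (pt p) c (pt p) x" "\<not> on_left (pt p) c (pt p) x" for p x
    using ccw_distinct(6) unfolding on_right_def on_left_def by blast+
  have lr: "on_left (pt p) c (pt p') (pt u) \<longleftrightarrow> \<not> s" "on_right (pt p) c (pt p') (pt u') \<longleftrightarrow> \<not> s"
    "on_left (pt p) c (pt p') (pt u') \<longleftrightarrow> s"
    using sides on_left_right_ex unfolding s_def by blast+
  have noccw: "\<not> ccw c (pt y1) (pt y2) (pt y3)" if "y1 \<in> {u, u'}" "y2 \<in> {u, u'}" "y3 \<in> {u, u'}" for y1 y2 y3
    using no_ccw_of_two that .
  have thr: "(\<forall>x x'. {p, p'} = {x, x'} \<and> x \<noteq> x' \<longrightarrow> \<kappa> (x, Hi c) = \<kappa> (Hi c, x')) \<longleftrightarrow> \<kappa> (Hi c, p') = \<kappa> (p, Hi c)"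
    using bs(3,6) V(3) by (auto simp: doubleton_eq_iff)
  have cr: "(\<forall>x x' y y'. x \<in> {p, p'} \<and> x' \<in> {p, p'} \<and> y \<in> {u, u'} \<and> y' \<in> {u, u'} \<and>
        on_right (pt x) c (pt x') (pt y) \<and> on_left (pt x) c (pt x') (pt y') \<longrightarrow>
        \<kappa> (Lo c, y') = \<kappa> (y, Lo c) \<rhd> \<kappa> (x, Hi c)) \<longleftrightarrow>
      \<kappa> (Lo c, u') = \<kappa> (u, Lo c) \<rhd> twist G s (\<kappa> (p, Hi c))" (is "?L \<longleftrightarrow> ?R")
    if pp: "\<kappa> (Hi c, p') = \<kappa> (p, Hi c)"
  proof -
    have p': "\<kappa> (p', Hi c) = bar G (\<kappa> (p, Hi c))" using bs(6) pp by simp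
    have R1: "?R \<longleftrightarrow> \<kappa> (Lo c, u) = \<kappa> (u', Lo c) \<rhd> twist G (\<not> s) (\<kappa> (p, Hi c))"
    proof -
      have "\<kappa> (Lo c, u) = bar G (\<kappa> (u, Lo c))" "\<kappa> (u', Lo c) = bar G (\<kappa> (Lo c, u'))" using bs(9,12) .
      moreover have "bar G (\<kappa> (Lo c, u')) \<rhd> twist G (\<not> s) (\<kappa> (p, Hi c)) = bar G (\<kappa> (Lo c, u') \<rhd> twist G (\<not> s) (\<kappa> (p, Hi c)))"
        using bs by (simp add: bar_op)
      ultimately have "\<kappa> (Lo c, u) = \<kappa> (u', Lo c) \<rhd> twist G (\<not> s) (\<kappa> (p, Hi c)) \<longleftrightarrow>
          \<kappa> (u, Lo c) = \<kappa> (Lo c, u') \<rhd> twist G (\<not> s) (\<kappa> (p, Hi c))"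
        using bs by (simp add: bar_inject)
      then show ?thesis using op_twist_eq_iff[of "\<kappa> (u, Lo c)" "\<kappa> (Lo c, u')" "\<kappa> (p, Hi c)" s] bs by metis
    qed
    show ?thesis
    proof (cases s)
      case True
      have "?L \<longleftrightarrow> \<kappa> (Lo c, u') = \<kappa> (u, Lo c) \<rhd> \<kappa> (p, Hi c) \<and> \<kappa> (Lo c, u) = \<kappa> (u', Lo c) \<rhd> \<kappa> (p', Hi c)"
      proof
        assume L: ?L
        show "\<kappa> (Lo c, u') = \<kappa> (u, Lo c) \<rhd> \<kappa> (p, Hi c) \<and> \<kappa> (Lo c, u) = \<kappa> (u', Lo c) \<rhd> \<kappa> (p', Hi c)"
          using L[rule_format, of p p' u u'] L[rule_format, of p' p u' u] lr swap True s_def by simp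
      qed (use True lr no swap s_def in auto)
      then show ?thesis using R1 True p' by (simp add: twist_def)
    next
      case False
      have "?L \<longleftrightarrow> \<kappa> (Lo c, u) = \<kappa> (u', Lo c) \<rhd> \<kappa> (p, Hi c) \<and> \<kappa> (Lo c, u') = \<kappa> (u, Lo c) \<rhd> \<kappa> (p', Hi c)"
      proof
        assume L: ?L
        show "\<kappa> (Lo c, u) = \<kappa> (u', Lo c) \<rhd> \<kappa> (p, Hi c) \<and> \<kappa> (Lo c, u') = \<kappa> (u, Lo c) \<rhd> \<kappa> (p', Hi c)"
          using L[rule_format, of p p' u' u] L[rule_format, of p' p u u'] lr swap False s_def by simp
      qed (use False lr no swap s_def in auto)
      then show ?thesis using R1 False p' by (simp add: twist_def)
    qed
  qed
  have "point_rule G q V \<kappa> c \<longleftrightarrow> (\<forall>x x'. {p, p'} = {x, x'} \<and> x \<noteq> x' \<longrightarrow> \<kappa> (x, Hi c) = \<kappa> (Hi c, x')) \<and>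
      (\<forall>x x' y y'. x \<in> {p, p'} \<and> x' \<in> {p, p'} \<and> y \<in> {u, u'} \<and> y' \<in> {u, u'} \<and>
        on_right (pt x) c (pt x') (pt y) \<and> on_left (pt x) c (pt x') (pt y') \<longrightarrow>
        \<kappa> (Lo c, y') = \<kappa> (y, Lo c) \<rhd> \<kappa> (x, Hi c))"
    (is "_ \<longleftrightarrow> ?A \<and> ?C")
  proof
    assume "point_rule G q V \<kappa> c"
    then show "?A \<and> ?C" unfolding point_rule_def V(2,4) by (elim conjE, intro conjI)
  next
    assume AC: "?A \<and> ?C"
    show "point_rule G q V \<kappa> c"
      unfolding point_rule_def V(2,4)
    proof (intro conjI)
      show ?A by (rule conjunct1[OF AC])
      show ?C by (rule conjunct2[OF AC])
      show "{p, p'} = {} \<longrightarrow> (\<forall>x x'. {u, u'} = {x, x'} \<and> x \<noteq> x' \<longrightarrow> \<kappa> (x, Lo c) = \<kappa> (Lo c, x'))" by simp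
      show "\<forall>n1 n2 n3. n1 \<in> {u, u'} \<and> n2 \<in> {u, u'} \<and> n3 \<in> {u, u'} \<and> ccw c (pt n1) (pt n2) (pt n3) \<longrightarrow>
          vertex_rule G (\<kappa> (Lo c, n1)) (\<kappa> (Lo c, n2)) (\<kappa> (Lo c, n3))"
        using noccw by metis
    qed
  qed
  then show ?thesis using thr cr unfolding s_def by argo
qed

text \<open>Of the six orders of the neighbours, three are not counterclockwise and the other three
  are rotations of the given one.\<close>

lemma vertex_iff:
  assumes \<kappa>: "bar_symmetric G X V \<kappa>" and V: "V `` {Hi c} = {}" "V `` {Lo c} = {n1, n2, n3}"
    and dist: "n1 \<noteq> n2" "n2 \<noteq> n3" "n1 \<noteq> n3" and ccw: "ccw c (pt n1) (pt n2) (pt n3)"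
  shows "point_rule G q V \<kappa> c \<longleftrightarrow> vertex_rule G (\<kappa> (Lo c, n1)) (\<kappa> (Lo c, n2)) (\<kappa> (Lo c, n3))"
proof -
  have e: "\<kappa> (Lo c, n1) \<in> colors" "\<kappa> (Lo c, n2) \<in> colors" "\<kappa> (Lo c, n3) \<in> colors"
  proof -
    have "n1 \<in> V `` {Lo c}" "n2 \<in> V `` {Lo c}" "n3 \<in> V `` {Lo c}" by (simp_all only: V(2) insertI1 insertI2)
    then have "(Lo c, n1) \<in> V" "(Lo c, n2) \<in> V" "(Lo c, n3) \<in> V" by simp_all
    then show "\<kappa> (Lo c, n1) \<in> colors" "\<kappa> (Lo c, n2) \<in> colors" "\<kappa> (Lo c, n3) \<in> colors"
      by (simp_all only: bar_symmetricD(1)[OF \<kappa>])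
  qed
  have "{p, p'} \<noteq> {n1, n2, n3}" for p p'
  proof
    assume "{p, p'} = {n1, n2, n3}"
    moreover have "card {n1, n2, n3} = 3" using dist by simp
    moreover have "card {p, p'} \<le> 2" by (simp add: card_insert_if)
    ultimately show False by simp
  qed
  moreover have "vertex_rule G (\<kappa> (Lo c, y1)) (\<kappa> (Lo c, y2)) (\<kappa> (Lo c, y3))"
    if r: "vertex_rule G (\<kappa> (Lo c, n1)) (\<kappa> (Lo c, n2)) (\<kappa> (Lo c, n3))"
      and y: "y1 \<in> {n1, n2, n3}" "y2 \<in> {n1, n2, n3}" "y3 \<in> {n1, n2, n3}" and cy: "ccw c (pt y1) (pt y2) (pt y3)" for y1 y2 y3
  proof -
    have rot: "vertex_rule G (\<kappa> (Lo c, n2)) (\<kappa> (Lo c, n3)) (\<kappa> (Lo c, n1))"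
      by (rule vertex_rule_rotate[OF r e])
    then have rot2: "vertex_rule G (\<kappa> (Lo c, n3)) (\<kappa> (Lo c, n1)) (\<kappa> (Lo c, n2))"
      by (rule vertex_rule_rotate[OF _ e(2,3,1)])
    have "\<not> ccw c (pt n1) (pt n3) (pt n2)" using ccw ccw_asym by blast
    then have no: "\<not> ccw c (pt n1) (pt n3) (pt n2)" "\<not> ccw c (pt n3) (pt n2) (pt n1)" "\<not> ccw c (pt n2) (pt n1) (pt n3)"
      using ccw_rotate by blast+
    have "y1 \<noteq> y2" "y2 \<noteq> y3" "y1 \<noteq> y3" using cy ccw_distinct(4-6) by metis+
    then have "(y1, y2, y3) \<in> {(n1, n2, n3), (n2, n3, n1), (n3, n1, n2), (n1, n3, n2), (n3, n2, n1), (n2, n1, n3)}"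
      using y by auto
    then show ?thesis using r rot rot2 no cy by auto
  qed
  ultimately show ?thesis unfolding point_rule_def V
    using ccw by (intro iffI conjI allI impI) (elim conjE, auto)
qed

text \<open>By the assumption \<open>d\<close> every segment is listed in one direction only, so
  arbitrary listed colors extend to the reverse directions without conflict.\<close>

lemma table_coloring:
  assumes V: "V = fst ` set tbl \<union> (fst ` set tbl)\<inverse>" and d: "distinct (map fst tbl @ map (prod.swap \<circ> fst) tbl)"
    and c: "\<forall>x\<in>set tbl. snd x \<in> colors"
  obtains \<kappa> where "bar_symmetric G X V \<kappa>" "\<forall>((m, n), a)\<in>set tbl. \<kappa> (m, n) = a \<and> \<kappa> (n, m) = bar G a"
proof
  define \<kappa> where "\<kappa> e = (case map_of tbl e of Some a \<Rightarrow> a | None \<Rightarrow> bar G (the (map_of tbl (prod.swap e))))" for e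
  have key: "map_of tbl e = Some a" if "(e, a) \<in> set tbl" for e a
    using that d by (simp add: map_of_is_SomeI)
  have nokey: "map_of tbl (n, m) = None" if "((m, n), a) \<in> set tbl" for m n a
  proof -
    have "(n, m) \<in> set (map (prod.swap \<circ> fst) tbl)" using that by force
    then have "(n, m) \<notin> set (map fst tbl)" using d by auto
    then show ?thesis by (simp add: map_of_eq_None_iff)
  qed
  show val: "\<forall>((m, n), a)\<in>set tbl. \<kappa> (m, n) = a \<and> \<kappa> (n, m) = bar G a"
    using key nokey by (auto simp: \<kappa>_def)
  show "bar_symmetric G X V \<kappa>"
    unfolding bar_symmetric_def
  proof (intro conjI ballI allI impI)
    have ex: "\<exists>a\<in>colors. (\<kappa> (m, n) = a \<and> \<kappa> (n, m) = bar G a) \<or> (\<kappa> (n, m) = a \<and> \<kappa> (m, n) = bar G a)"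
      if "(m, n) \<in> V" for m n
    proof -
      have "(m, n) \<in> fst ` set tbl \<or> (n, m) \<in> fst ` set tbl" using that V by auto
      then obtain x where x: "x \<in> set tbl" "(m, n) = fst x \<or> (n, m) = fst x" by blast
      then have "((m, n), snd x) \<in> set tbl \<or> ((n, m), snd x) \<in> set tbl" by (metis prod.collapse)
      then show ?thesis using val c by fastforce
    qed
    show "\<kappa> e \<in> colors" if eV: "e \<in> V" for e
    proof -
      obtain m n where e: "e = (m, n)" by (cases e)
      obtain a where "a \<in> colors" "\<kappa> (m, n) = a \<or> \<kappa> (m, n) = bar G a" using ex[of m n] eV e by metis
      then show ?thesis using bar_closed e by metis
    qed
    show "\<kappa> (n, m) = bar G (\<kappa> (m, n))" if "(m, n) \<in> V" for m n
      using ex[OF that] bar_bar by metis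
  qed
qed

end

text \<open>
  Both sides of a move turn out to be solved by the same condition \<open>P\<close> on the boundary colors \<open>\<beta>\<close>.
\<close>

definition solved ::
  "('g, 'm) monoid_scheme \<Rightarrow> 'x set \<Rightarrow> ('g \<Rightarrow> 'x \<Rightarrow> 'x \<Rightarrow> 'x) \<Rightarrow> complex \<Rightarrow> real \<Rightarrow> diagram \<Rightarrow>
   (complex \<Rightarrow> 'g \<times> 'x) \<Rightarrow> bool \<Rightarrow> bool" where
  "solved G X q z r V \<beta> P \<longleftrightarrow> ((\<exists>\<kappa>. local_coloring G X q z r V \<beta> \<kappa>) \<longleftrightarrow> P) \<and>
     (\<forall>\<kappa>1 \<kappa>2. local_coloring G X q z r V \<beta> \<kappa>1 \<longrightarrow> local_coloring G X q z r V \<beta> \<kappa>2 \<longrightarrow> (\<forall>e\<in>V. \<kappa>1 e = \<kappa>2 e))"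

lemma switch_solved:
  assumes G: "group G" and A: "disc_diagram D R T z r E" and B: "disc_diagram D' R T' z r E"
    and solve: "\<And>X \<beta>. quandle_family G X q \<Longrightarrow> (\<And>a. a \<in> E \<Longrightarrow> \<beta> a \<in> carrier G \<times> X) \<Longrightarrow>
      \<exists>P. solved G X q z r (unoriented T) \<beta> P \<and> solved G X q z r (unoriented T') \<beta> P"
  shows "recolorable G q (unoriented D) (unoriented D')"
proof (rule switch_recolorable[OF G A B])
  fix X \<beta> assume "quandle_family G X q" "\<forall>a\<in>E. \<beta> a \<in> carrier G \<times> X"
  then obtain P where "solved G X q z r (unoriented T) \<beta> P" "solved G X q z r (unoriented T') \<beta> P"
    using solve by meson
  then show "(\<exists>\<kappa>. local_coloring G X q z r (unoriented T) \<beta> \<kappa>) \<longleftrightarrow> (\<exists>\<kappa>. local_coloring G X q z r (unoriented T') \<beta> \<kappa>)"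
    unfolding solved_def by blast
next
  \<comment> \<open>The assumption \<open>solve\<close> applies only to boundary colors from the
    family; those of a local coloring are of this kind.\<close>
  have bd: "\<beta> a \<in> carrier G \<times> X"
    if d: "disc_diagram D R T z r E" and l: "local_coloring G X q z r (unoriented T) \<beta> \<kappa>" and a: "a \<in> E"
    for D T X \<beta> \<kappa> a
  proof -
    interpret disc_diagram D R T z r E by (rule d)
    obtain m where m: "(Lo a, m) \<in> unoriented T" using tangle a unfolding tangle_def by blast
    then have "\<kappa> (Lo a, m) = \<beta> a" "\<kappa> (Lo a, m) \<in> carrier G \<times> X"
      using l sphere_E[OF a] unfolding local_coloring_def by blast+
    then show ?thesis by simp
  qed
  fix X \<beta> \<kappa>1 \<kappa>2 e assume X: "quandle_family G X q"
  show "\<kappa>1 e = \<kappa>2 e" if l: "local_coloring G X q z r (unoriented T) \<beta> \<kappa>1" "local_coloring G X q z r (unoriented T) \<beta> \<kappa>2"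
    "e \<in> unoriented T"
  proof -
    obtain P where "solved G X q z r (unoriented T) \<beta> P" using solve[where \<beta> = \<beta>, OF X bd[OF A l(1)]] by blast
    then show ?thesis using l unfolding solved_def by blast
  qed
  show "\<kappa>1 e = \<kappa>2 e" if l: "local_coloring G X q z r (unoriented T') \<beta> \<kappa>1" "local_coloring G X q z r (unoriented T') \<beta> \<kappa>2"
    "e \<in> unoriented T'"
  proof -
    obtain P where "solved G X q z r (unoriented T') \<beta> P" using solve[where \<beta> = \<beta>, OF X bd[OF B l(1)]] by blast
    then show ?thesis using l unfolding solved_def by blast
  qed
qed

fun table_edges :: "(seg \<times> 'c) list \<Rightarrow> diagram" where
  "table_edges (((m, n), a) # t) = {(m, n), (n, m)} \<union> table_edges t"
| "table_edges [] = {}"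

lemma table_edges_eq: "table_edges t = fst ` set t \<union> (fst ` set t)\<inverse>"
  by (induction t rule: table_edges.induct) auto

text \<open>The table lists the only possible local coloring; \<open>P\<close> is the condition for it to be one.\<close>

lemma (in quandle_family) solvedI:
  assumes V: "V = table_edges tbl" and d: "distinct (map fst tbl @ map (prod.swap \<circ> fst) tbl)"
    and c: "\<forall>x\<in>set tbl. snd x \<in> colors"
    and det: "\<And>\<kappa>. bar_symmetric G X V \<kappa> \<Longrightarrow> local_coloring G X q z r V \<beta> \<kappa> \<Longrightarrow> \<forall>(e, x)\<in>set tbl. \<kappa> e = x"
    and iff: "\<And>\<kappa>. bar_symmetric G X V \<kappa> \<Longrightarrow> \<forall>((m, n), x)\<in>set tbl. \<kappa> (m, n) = x \<and> \<kappa> (n, m) = bar G x \<Longrightarrow>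
      local_coloring G X q z r V \<beta> \<kappa> \<longleftrightarrow> P"
  shows "solved G X q z r V \<beta> P"
  unfolding solved_def
proof (intro conjI allI impI ballI)
  have V': "V = fst ` set tbl \<union> (fst ` set tbl)\<inverse>" using V table_edges_eq by metis
  have bs: "bar_symmetric G X V \<kappa>" if "local_coloring G X q z r V \<beta> \<kappa>" for \<kappa>
    using that unfolding local_coloring_def bar_symmetric_def by blast
  have val: "\<forall>((m, n), x)\<in>set tbl. \<kappa> (m, n) = x \<and> \<kappa> (n, m) = bar G x" if l: "local_coloring G X q z r V \<beta> \<kappa>" for \<kappa>
  proof clarify
    fix m n x y assume x: "((m, n), x, y) \<in> set tbl"
    then have "(m, n) \<in> fst ` set tbl" by force
    then have "(m, n) \<in> V" unfolding V' by blast
    then have "\<kappa> (n, m) = bar G (\<kappa> (m, n))" by (rule bar_symmetricD(3)[OF bs[OF l]])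
    moreover have "\<kappa> (m, n) = (x, y)" using bspec[OF det[OF bs[OF l] l] x] by simp
    ultimately show "\<kappa> (m, n) = (x, y) \<and> \<kappa> (n, m) = bar G (x, y)" by simp
  qed
  show "(\<exists>\<kappa>. local_coloring G X q z r V \<beta> \<kappa>) \<longleftrightarrow> P"
  proof
    assume P
    obtain \<kappa> where "bar_symmetric G X V \<kappa>" "\<forall>((m, n), x)\<in>set tbl. \<kappa> (m, n) = x \<and> \<kappa> (n, m) = bar G x"
      using table_coloring[OF V' d c] by blast
    then show "\<exists>\<kappa>. local_coloring G X q z r V \<beta> \<kappa>" using iff \<open>P\<close> by blast
  next
    assume "\<exists>\<kappa>. local_coloring G X q z r V \<beta> \<kappa>"
    then obtain \<kappa> where l: "local_coloring G X q z r V \<beta> \<kappa>" ..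
    then show P using iff[OF bs[OF l] val[OF l]] by simp
  qed
  fix \<kappa>1 \<kappa>2 e assume l: "local_coloring G X q z r V \<beta> \<kappa>1" "local_coloring G X q z r V \<beta> \<kappa>2" and e: "e \<in> V"
  obtain m n where mn: "e = (m, n)" by (cases e)
  then have "(m, n) \<in> fst ` set tbl \<or> (n, m) \<in> fst ` set tbl" using e unfolding V' by blast
  then obtain w where "w \<in> set tbl" "fst w = (m, n) \<or> fst w = (n, m)" by auto
  then have "((m, n), snd w) \<in> set tbl \<or> ((n, m), snd w) \<in> set tbl" by (metis prod.collapse)
  then show "\<kappa>1 e = \<kappa>2 e" using val[OF l(1)] val[OF l(2)] mn by fastforce
qed

section \<open>Setting up the pictures of the moves\<close>

lemma tangleI:
  assumes "E \<subseteq> sphere z r" "I \<subseteq> ball z r"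
    and "\<And>m n. (m, n) \<in> unoriented T \<Longrightarrow> m \<in> Lo ` E \<or> pt m \<in> I" "\<And>a. a \<in> E \<Longrightarrow> \<exists>!m. (Lo a, m) \<in> unoriented T"
  shows "tangle z r E (unoriented T)"
proof -
  have "sym (unoriented T)" by (auto simp: sym_def unoriented_def)
  then show ?thesis using assms(1,3,4) subsetD[OF assms(2)] unfolding tangle_def by metis
qed

lemma sphere_ball_disjoint: "a \<in> sphere z r \<Longrightarrow> b \<in> ball z r \<Longrightarrow> a \<noteq> b"
  by auto

text \<open>What a picture provides as a mere list of segments, before any geometry. By the last
  clause its inner points are distinct: in every picture of a move any two of them are joined by a
  segment, and segments have distinct ends. \<open>I\<close> holds the inner points of one picture,
  whereas the list in a move contains those of both.\<close>

definition tangle_shape :: "complex list \<Rightarrow> complex list \<Rightarrow> diagram \<Rightarrow> bool" where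
  "tangle_shape es I V \<longleftrightarrow> (\<forall>e\<in>V. fst e \<in> Lo ` set es \<or> pt (fst e) \<in> set I) \<and>
     (distinct (es @ I) \<longrightarrow> (\<forall>a\<in>set es. \<exists>!m. (Lo a, m) \<in> V)) \<and>
     ((\<forall>e\<in>V. pt (fst e) \<noteq> pt (snd e)) \<longrightarrow> distinct I)"

lemma local_coloring_shape:
  assumes "tangle z r (set es) V" "tangle_shape es I V" "set I \<subseteq> ball z r"
  shows "local_coloring G X q z r V \<beta> \<kappa> \<longleftrightarrow> bar_symmetric G X V \<kappa> \<and> (\<forall>c\<in>set I. point_rule G q V \<kappa> c) \<and>
    (\<forall>a\<in>set es. \<forall>m\<in>V `` {Lo a}. \<kappa> (Lo a, m) = \<beta> a)"
proof -
  have nodes: "m \<in> Lo ` set es \<or> pt m \<in> set I" if "(m, n) \<in> V" for m n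
    using assms(2) that unfolding tangle_shape_def by fastforce
  have iff: "local_coloring G X q z r V \<beta> \<kappa> \<longleftrightarrow> bar_symmetric G X V \<kappa> \<and> (\<forall>c\<in>set I. point_rule G q V \<kappa> c) \<and>
      (\<forall>a\<in>set es. \<forall>m. (Lo a, m) \<in> V \<longrightarrow> \<kappa> (Lo a, m) = \<beta> a)"
    by (rule local_coloring_iff[OF assms(1) nodes assms(3)])
  have "(\<forall>m\<in>V `` {Lo a}. Q m) \<longleftrightarrow> (\<forall>m. (Lo a, m) \<in> V \<longrightarrow> Q m)" for a Q by auto
  then show ?thesis using iff by (simp only:)
qed

text \<open>Distinctness with both orientations of every inequality, for use as rewrite rules.\<close>

fun apart :: "'a list \<Rightarrow> bool" where
  "apart (x # xs) \<longleftrightarrow> (\<forall>y\<in>set xs. x \<noteq> y \<and> y \<noteq> x) \<and> apart xs"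
| "apart [] \<longleftrightarrow> True"

lemma apart_eq: "apart xs \<longleftrightarrow> distinct xs"
  by (induction xs) auto

lemma switch_disc_diagrams:
  assumes sw: "switch_in_disc es is T T' D D'" and Y: "Y_oriented_diagram D" "Y_oriented_diagram D'"
    and T: "tangle_shape es I (unoriented T)" "tangle_shape es I' (unoriented T')"
    and I: "set I \<subseteq> set is" "set I' \<subseteq> set is"
  obtains z r R where "disc_diagram D R T z r (set es)" "disc_diagram D' R T' z r (set es)"
    "apart (es @ I)" "apart (es @ I')" "set I \<subseteq> ball z r" "set I' \<subseteq> ball z r"
proof -
  obtain z r R where sw: "D = R \<union> T" "D' = R \<union> T'" "distinct es" "set es \<subseteq> sphere z r" "set is \<subseteq> ball z r"
    "\<forall>s\<in>R. seg_line s \<inter> cball z r \<subseteq> set es" "\<forall>e\<in>set es. joint D (Lo e) \<and> joint D' (Lo e)"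
    using sw unfolding switch_in_disc_def by blast
  have one: "disc_diagram D R T z r (set es) \<and> distinct (es @ I) \<and> set I \<subseteq> ball z r"
    if Y: "Y_oriented_diagram D" and T: "tangle_shape es I (unoriented T)" and I: "set I \<subseteq> set is"
      and D: "D = R \<union> T" "\<forall>e\<in>set es. joint D (Lo e)" for D T I
  proof -
    interpret D: Y_diagram D using Y by unfold_locales
    have ball: "set I \<subseteq> ball z r" using I sw(5) by blast
    have "set es \<inter> set I = {}" using ball sw(4) sphere_ball_disjoint by blast
    moreover have "pt (fst e) \<noteq> pt (snd e)" if "e \<in> unoriented T" for e
      using D.pt_neq[of "fst e" "snd e"] that by (simp add: D(1) unoriented_Un)
    then have "distinct I" using T by (simp add: tangle_shape_def)
    ultimately have dist: "distinct (es @ I)" using sw(3) by simp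
    have "tangle z r (set es) (unoriented T)"
    proof (rule tangleI[OF sw(4) ball])
      show "m \<in> Lo ` set es \<or> pt m \<in> set I" if "(m, n) \<in> unoriented T" for m n
        using T that unfolding tangle_shape_def by fastforce
      show "\<exists>!m. (Lo a, m) \<in> unoriented T" if "a \<in> set es" for a
        using T dist that unfolding tangle_shape_def by blast
    qed
    then have "disc_diagram D R T z r (set es)" using sw(6) D by unfold_locales auto
    then show ?thesis using dist ball by blast
  qed
  show thesis using that one[OF Y(1) T(1) I(1) sw(1)] one[OF Y(2) T(2) I(2) sw(2)] sw(7)
    unfolding apart_eq by blast
qed

context disc_diagram
begin

lemma inner_Image: "pt n \<in> ball z r \<Longrightarrow> unoriented D `` {n} = V `` {n}"
  using R_inner[of "pt n" n] by (auto simp: unoriented_D)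

lemma tangle_crossing:
  assumes "c \<in> ball z r" "V `` {Hi c} = {p, p'}" "p \<noteq> p'" "V `` {Lo c} = {u, u'}" "u \<noteq> u'"
  shows "on_left (pt p) c (pt p') (pt u) \<and> on_right (pt p) c (pt p') (pt u') \<or>
    on_right (pt p) c (pt p') (pt u) \<and> on_left (pt p) c (pt p') (pt u')"
  using crossing_sides[of c p p' u u'] inner_Image[of "Hi c"] inner_Image[of "Lo c"] assms by simp

lemma sym_V: "sym V"
  using tangle by (simp add: tangle_def)

text \<open>All questions about sides at a crossing, also those asked along the under-strand, reduce
  to a single Boolean.\<close>

lemma crossing_sign:
  assumes "c \<in> ball z r" "V `` {Hi c} = {p, p'}" "p \<noteq> p'" "V `` {Lo c} = {u, u'}" "u \<noteq> u'"
  shows "on_left (pt p) c (pt p') (pt u) \<longleftrightarrow> \<not> on_right (pt p) c (pt p') (pt u)"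
    "on_left (pt p) c (pt p') (pt u') \<longleftrightarrow> on_right (pt p) c (pt p') (pt u)"
    "on_left (pt u) c (pt u') (pt p) \<longleftrightarrow> on_right (pt p) c (pt p') (pt u)"
    "on_left (pt u) c (pt u') (pt p') \<longleftrightarrow> \<not> on_right (pt p) c (pt p') (pt u)"
proof -
  have ex: "\<not> (on_right p c p' u \<and> on_left p c p' u)" for p p' u
    using ccw_rotate ccw_asym unfolding on_right_def on_left_def by blast
  note sides = tangle_crossing[OF assms]
  show 1: "on_left (pt p) c (pt p') (pt u) \<longleftrightarrow> \<not> on_right (pt p) c (pt p') (pt u)"
    "on_left (pt p) c (pt p') (pt u') \<longleftrightarrow> on_right (pt p) c (pt p') (pt u)"
    using sides ex by blast+
  show "on_left (pt u) c (pt u') (pt p) \<longleftrightarrow> on_right (pt p) c (pt p') (pt u)"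
    "on_left (pt u) c (pt u') (pt p') \<longleftrightarrow> \<not> on_right (pt p) c (pt p') (pt u)"
    using crossing_symmetric(1,3)[OF sides] 1(1) by simp_all
qed

text \<open>Three distinct rays have just two cyclic orders, so one Boolean also answers all
  questions about sides at a vertex.\<close>

lemma vertex_sign:
  assumes "V `` {Lo v} = {n1, n2, n3}" "distinct [n1, n2, n3]"
  shows "ccw v (pt n1) (pt n3) (pt n2) \<longleftrightarrow> \<not> ccw v (pt n1) (pt n2) (pt n3)"
    "on_left (pt n1) v (pt n2) (pt n3) \<longleftrightarrow> ccw v (pt n1) (pt n2) (pt n3)"
    "on_left (pt n2) v (pt n3) (pt n1) \<longleftrightarrow> ccw v (pt n1) (pt n2) (pt n3)"
    "on_left (pt n3) v (pt n1) (pt n2) \<longleftrightarrow> ccw v (pt n1) (pt n2) (pt n3)"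
    "on_left (pt n2) v (pt n1) (pt n3) \<longleftrightarrow> \<not> ccw v (pt n1) (pt n2) (pt n3)"
    "on_left (pt n1) v (pt n3) (pt n2) \<longleftrightarrow> \<not> ccw v (pt n1) (pt n2) (pt n3)"
    "on_left (pt n3) v (pt n2) (pt n1) \<longleftrightarrow> \<not> ccw v (pt n1) (pt n2) (pt n3)"
proof -
  have "n1 \<in> V `` {Lo v}" "n2 \<in> V `` {Lo v}" "n3 \<in> V `` {Lo v}" by (simp_all only: assms(1) insertI1 insertI2)
  then have e: "(Lo v, n1) \<in> unoriented D" "(Lo v, n2) \<in> unoriented D" "(Lo v, n3) \<in> unoriented D"
    using V_D by simp_all
  have "\<not> same_ray v (pt n1) (pt n2)" "\<not> same_ray v (pt n1) (pt n3)" "\<not> same_ray v (pt n2) (pt n3)"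
    using not_same_ray[OF e(1,2)] not_same_ray[OF e(1,3)] not_same_ray[OF e(2,3)] assms(2) by simp_all
  then show 1: "ccw v (pt n1) (pt n3) (pt n2) \<longleftrightarrow> \<not> ccw v (pt n1) (pt n2) (pt n3)" by (rule ccw_total)
  show "on_left (pt n1) v (pt n2) (pt n3) \<longleftrightarrow> ccw v (pt n1) (pt n2) (pt n3)"
    "on_left (pt n2) v (pt n3) (pt n1) \<longleftrightarrow> ccw v (pt n1) (pt n2) (pt n3)"
    "on_left (pt n3) v (pt n1) (pt n2) \<longleftrightarrow> ccw v (pt n1) (pt n2) (pt n3)"
    "on_left (pt n2) v (pt n1) (pt n3) \<longleftrightarrow> \<not> ccw v (pt n1) (pt n2) (pt n3)"
    "on_left (pt n1) v (pt n3) (pt n2) \<longleftrightarrow> \<not> ccw v (pt n1) (pt n2) (pt n3)"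
    "on_left (pt n3) v (pt n2) (pt n1) \<longleftrightarrow> \<not> ccw v (pt n1) (pt n2) (pt n3)"
    unfolding on_left_def 1[symmetric] using ccw_rotate by blast+
qed

end

text \<open>\<open>s\<close> tells whether the edges are listed counterclockwise; a picture and its
  mirror image differ in this.\<close>

definition vertex_sign_rule :: "('g, 'm) monoid_scheme \<Rightarrow> bool \<Rightarrow> 'g \<times> 'x \<Rightarrow> 'g \<times> 'x \<Rightarrow> 'g \<times> 'x \<Rightarrow> bool" where
  "vertex_sign_rule G s a b c \<longleftrightarrow> (if s then vertex_rule G a b c else vertex_rule G a c b)"

section \<open>The algebra of the moves\<close>

context quandle_family
begin

text \<open>Self-distributivity with arbitrary signs, which is the algebra of (R3).\<close>

lemma op_twist_distrib:
  "a \<in> colors \<Longrightarrow> b \<in> colors \<Longrightarrow> c \<in> colors \<Longrightarrow>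
    a \<rhd> twist G s b \<rhd> twist G t c = a \<rhd> twist G t c \<rhd> twist G s (b \<rhd> twist G t c)"
  using op_distrib[of a "twist G s b" "twist G t c"] bar_op[of b "twist G t c"] by (auto simp: twist_def)

lemma op_twist_self [simp]: "a \<in> colors \<Longrightarrow> a \<rhd> twist G s a = a"
  by (simp add: twist_def)

lemma bar_op_twist: "a \<in> colors \<Longrightarrow> b \<in> colors \<Longrightarrow> bar G (a \<rhd> twist G s b) = bar G a \<rhd> twist G s b"
  by (simp add: bar_op)

lemma vertex_sign_iff:
  assumes \<kappa>: "bar_symmetric G X V \<kappa>" and V: "V `` {Hi c} = {}" "V `` {Lo c} = {n1, n2, n3}"
    and dist: "distinct [n1, n2, n3]" and tot: "ccw c (pt n1) (pt n3) (pt n2) \<longleftrightarrow> \<not> ccw c (pt n1) (pt n2) (pt n3)"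
  shows "point_rule G q V \<kappa> c \<longleftrightarrow>
    vertex_sign_rule G (ccw c (pt n1) (pt n2) (pt n3)) (\<kappa> (Lo c, n1)) (\<kappa> (Lo c, n2)) (\<kappa> (Lo c, n3))"
proof (cases "ccw c (pt n1) (pt n2) (pt n3)")
  case True
  then show ?thesis using vertex_iff[OF \<kappa> V] dist by (simp add: vertex_sign_rule_def)
next
  case False
  then have "ccw c (pt n1) (pt n3) (pt n2)" using tot by simp
  moreover have "V `` {Lo c} = {n1, n3, n2}" using V(2) by (simp add: insert_commute)
  moreover have "n1 \<noteq> n3" "n3 \<noteq> n2" "n1 \<noteq> n2" using dist by auto
  ultimately show ?thesis using vertex_iff[OF \<kappa> V(1), of n1 n3 n2] False by (simp add: vertex_sign_rule_def)
qed

text \<open>Both signs of (R4) come from \<open>vertex_rule_twist\<close>: once directly, and once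
  with \<open>b\<close> already acted upon.\<close>

lemma vertex_sign_rule_twist:
  assumes "a \<in> colors" "b \<in> colors" "c \<in> colors"
  shows "vertex_sign_rule G (\<not> s) (bar G a) (bar G (b \<rhd> twist G s a)) (bar G c) \<longleftrightarrow>
    vertex_sign_rule G s (bar G a) (bar G b) (bar G c)"
  using vertex_rule_twist[of "bar G a" "bar G b" "bar G c"] vertex_rule_twist[of "bar G a" "bar G b \<rhd> bar G a" "bar G c"]
    assms by (simp add: vertex_sign_rule_def twist_def bar_op)

lemma vertex_sign_rule_op:
  assumes "a \<in> colors" "b \<in> colors" "c \<in> colors" "d \<in> colors"
  shows "vertex_sign_rule G s (a \<rhd> d) (b \<rhd> d) (c \<rhd> d) \<longleftrightarrow> vertex_sign_rule G s a b c"
  using vertex_rule_op_iff assms by (simp add: vertex_sign_rule_def)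

text \<open>The algebra of moving a strand over a vertex. Acting on all three edges preserves the
  rule, so acting on one edge is as good as acting inversely on the other two.\<close>

lemma vertex_sign_rule_pull:
  assumes "a \<in> colors" "b \<in> colors" "c \<in> colors" "d \<in> colors"
  shows "vertex_sign_rule G t (bar G a) (bar G (b \<rhd> twist G (\<not> s) d)) (bar G (c \<rhd> twist G (\<not> s) d)) \<longleftrightarrow>
    vertex_sign_rule G t (bar G (a \<rhd> twist G s d)) (bar G b) (bar G c)"
  using vertex_sign_rule_op[of "bar G a" "bar G b \<rhd> twist G (\<not> s) d" "bar G c \<rhd> twist G (\<not> s) d" "twist G s d" t] assms
  by (simp add: bar_op_twist)

text \<open>Rearranged from the fact that the three edges together act trivially. The factors appear
  in the right order because the same \<open>s\<close> is the sign of the action and the cyclic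
  order at the vertex.\<close>

lemma vertex_sign_rule_acts:
  assumes "vertex_sign_rule G s (bar G a) (bar G b) (bar G c)" "a \<in> colors" "b \<in> colors" "c \<in> colors" "d \<in> colors"
  shows "d \<rhd> twist G (\<not> s) b \<rhd> twist G (\<not> s) c = d \<rhd> twist G s a"
proof (cases s)
  case True
  then have "d \<rhd> a \<rhd> bar G a \<rhd> bar G b \<rhd> bar G c = d \<rhd> a"
    using assms vertex_rule_acts_trivially[of "bar G a" "bar G b" "bar G c" "d \<rhd> a"] by (simp add: vertex_sign_rule_def)
  then show ?thesis using True assms by (simp add: twist_def)
next
  case False
  then have "d \<rhd> bar G a \<rhd> bar G c \<rhd> bar G b = d"
  proof -
    have r: "vertex_rule G (bar G a) (bar G c) (bar G b)" using False assms(1) by (simp add: vertex_sign_rule_def)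
    show ?thesis using vertex_rule_acts_trivially[OF r, of d] assms by simp
  qed
  then have "d \<rhd> b \<rhd> c = (d \<rhd> bar G a \<rhd> bar G c \<rhd> bar G b) \<rhd> b \<rhd> c" by simp
  also have "\<dots> = d \<rhd> bar G a" using assms op_bar_cancel(2) by simp
  finally show ?thesis using False by (simp add: twist_def)
qed

text \<open>The color that two edges with a common second component force on the third edge of a
  vertex.\<close>

definition vertex_join :: "bool \<Rightarrow> 'g \<times> 'x \<Rightarrow> 'g \<times> 'x \<Rightarrow> 'g \<times> 'x" where
  "vertex_join s a b = (if s then inv (fst a \<otimes> fst b) else inv (fst b \<otimes> fst a), snd a)"

lemma vertex_join_closed [simp]: "a \<in> colors \<Longrightarrow> b \<in> colors \<Longrightarrow> vertex_join s a b \<in> colors"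
  by (auto simp: vertex_join_def)

lemma vertex_sign_rule_join:
  assumes "a \<in> colors" "b \<in> colors" "c \<in> colors"
  shows "vertex_sign_rule G s a b c \<longleftrightarrow> snd a = snd b \<and> c = vertex_join s a b"
proof -
  have inv: "x \<otimes> y = \<one> \<longleftrightarrow> y = inv x" if "x \<in> carrier G" "y \<in> carrier G" for x y
    using that by (metis inv_equality inv_inv inv_closed r_inv)
  have ab: "vertex_rule G a b c \<longleftrightarrow> snd a = snd b \<and> c = (inv (fst a \<otimes> fst b), snd a)"
    if "a \<in> colors" "b \<in> colors" "c \<in> colors" for a b c
    using that inv[of "fst a \<otimes> fst b" "fst c"] by (auto simp: vertex_rule_def)
  have "vertex_rule G a c b \<longleftrightarrow> vertex_rule G b a c"
    using vertex_rule_rotate[of a c b] vertex_rule_rotate[of c b a] vertex_rule_rotate[of b a c] assms by blast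
  then show ?thesis using ab[OF assms] ab[OF assms(2,1,3)] by (auto simp: vertex_sign_rule_def vertex_join_def)
qed

text \<open>Either side says that all four second components agree and that the product of the four
  group components in cyclic order is one, and the latter does not depend on the starting point.
  This is the algebra of (R6).\<close>

lemma vertex_join_cyclic:
  assumes "a \<in> colors" "b \<in> colors" "c \<in> colors" "d \<in> colors"
  shows "snd a = snd b \<and> snd c = snd d \<and> bar G (vertex_join s a b) = vertex_join s c d \<longleftrightarrow>
    snd d = snd a \<and> snd b = snd c \<and> bar G (vertex_join s d a) = vertex_join s b c"
proof -
  have inv: "x = inv y \<longleftrightarrow> x \<otimes> y = \<one>" if "x \<in> carrier G" "y \<in> carrier G" for x y
    using that by (metis inv_equality l_inv)
  have rot: "x \<otimes> y = \<one> \<longleftrightarrow> y \<otimes> x = \<one>" if "x \<in> carrier G" "y \<in> carrier G" for x y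
    using that inv_comm by blast
  have "fst a \<otimes> fst b \<otimes> (fst c \<otimes> fst d) = \<one> \<longleftrightarrow> fst d \<otimes> fst a \<otimes> (fst b \<otimes> fst c) = \<one>"
    using rot[of "fst a \<otimes> (fst b \<otimes> fst c)" "fst d"] assms by (simp add: m_assoc)
  moreover have "fst b \<otimes> fst a \<otimes> (fst d \<otimes> fst c) = \<one> \<longleftrightarrow> fst a \<otimes> fst d \<otimes> (fst c \<otimes> fst b) = \<one>"
    using rot[of "fst b" "fst a \<otimes> (fst d \<otimes> fst c)"] assms by (simp add: m_assoc)
  ultimately show ?thesis
    using assms by (auto simp: vertex_join_def bar_def inv)
qed

end

lemma edges_Image: "edges (m # n # ns) `` {x} =
    (if x = m then {n} else {}) \<union> (if x = n then {m} else {}) \<union> edges (n # ns) `` {x}"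
  "edges [m] `` {x} = {}"
  by auto

context disc_diagram
begin

lemma joint_rule:
  assumes "quandle_family G X q" "bar_symmetric G X V \<kappa>"
    and "V `` {Hi c} = {}" "V `` {Lo c} = {p, p'}" "p \<noteq> p'"
  shows "point_rule G q V \<kappa> c \<longleftrightarrow> \<kappa> (Lo c, p') = \<kappa> (p, Lo c)"
  using quandle_family.joint_iff[OF assms(1,2) sym_V assms(3-5)] .

lemma crossing_rule:
  assumes "quandle_family G X q" "bar_symmetric G X V \<kappa>"
    and "c \<in> ball z r" "V `` {Hi c} = {p, p'}" "p \<noteq> p'" "V `` {Lo c} = {u, u'}" "u \<noteq> u'"
  shows "point_rule G q V \<kappa> c \<longleftrightarrow> \<kappa> (Hi c, p') = \<kappa> (p, Hi c) \<and>
    \<kappa> (Lo c, u') = assoc_op G q (\<kappa> (u, Lo c)) (twist G (on_right (pt p) c (pt p') (pt u)) (\<kappa> (p, Hi c)))"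
  using quandle_family.crossing_iff[OF assms(1,2) sym_V assms(4-6) tangle_crossing[OF assms(3-7)]] .

lemma vertex_rule_iff:
  assumes "quandle_family G X q" "bar_symmetric G X V \<kappa>"
    and "V `` {Hi c} = {}" "V `` {Lo c} = {n1, n2, n3}" "distinct [n1, n2, n3]"
  shows "point_rule G q V \<kappa> c \<longleftrightarrow>
    vertex_sign_rule G (ccw c (pt n1) (pt n2) (pt n3)) (\<kappa> (Lo c, n1)) (\<kappa> (Lo c, n2)) (\<kappa> (Lo c, n3))"
  using quandle_family.vertex_sign_iff[OF assms vertex_sign(1)[OF assms(4,5)]] .

end

section \<open>The local moves\<close>

lemma R1_recolorable:
  assumes sw: "switch_in_disc [a, b] [c, j, k]
      (strand o1 [Lo a, Lo b])
      (strand o1 [Lo a, Hi c, Lo j, Lo k, Lo c, Lo b]) D D'" (is "switch_in_disc ?es _ ?T ?T' _ _")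
    and Y: "Y_oriented_diagram D" "Y_oriented_diagram D'" and G: "group G"
  shows "recolorable G q (unoriented D) (unoriented D')"
proof -
  define T T' where "T = ?T" and "T' = ?T'"
  then have V: "unoriented T = edges [Lo a, Lo b]"
    "unoriented T' = edges [Lo a, Hi c, Lo j, Lo k, Lo c, Lo b]"
    by (simp_all add: unoriented_Un)
  have shape: "tangle_shape ?es [] (unoriented T)" "tangle_shape ?es [c, j, k] (unoriented T')"
    unfolding V by (auto simp: tangle_shape_def)
  obtain z r R where dd: "disc_diagram D R T z r (set ?es)" "disc_diagram D' R T' z r (set ?es)"
    and dist: "apart (?es @ [])" "apart (?es @ [c, j, k])"
    and ball: "set [] \<subseteq> ball z r" "set [c, j, k] \<subseteq> ball z r"
    by (rule switch_disc_diagrams[OF sw[folded T_def T'_def] Y shape]) (simp, simp, rule that)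
  note ne = dist[simplified] ball[simplified]
  interpret A: disc_diagram D R T z r "set ?es" by (rule dd)
  interpret B: disc_diagram D' R T' z r "set ?es" by (rule dd)
  have ends_A: "A.V `` {Lo a} = {Lo b}" "A.V `` {Lo b} = {Lo a}"
    by (simp_all add: ne V Un_Image edges_Image insert_commute del: edges.simps)
  have at_c: "c \<in> ball z r" "B.V `` {Hi c} = {Lo a, Lo j}" "Lo a \<noteq> Lo j" "B.V `` {Lo c} = {Lo k, Lo b}" "Lo k \<noteq> Lo b"
    and at_j: "B.V `` {Hi j} = {}" "B.V `` {Lo j} = {Hi c, Lo k}" "Hi c \<noteq> Lo k"
    and at_k: "B.V `` {Hi k} = {}" "B.V `` {Lo k} = {Lo j, Lo c}" "Lo j \<noteq> Lo c"
    and ends_B: "B.V `` {Lo a} = {Hi c}" "B.V `` {Lo b} = {Lo c}"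
    by (simp_all add: ne V Un_Image edges_Image insert_commute del: edges.simps)
  note sign_c = B.crossing_sign[OF at_c, unfolded node.sel]
  \<comment> \<open>Nothing determines the sign of a kink, and either value works, since a color and
    its inverse act trivially on that color.\<close>
  define s where "s = on_right a c j k"
  note signs = s_def[symmetric]
  show ?thesis
  proof (rule switch_solved[OF G dd])
    fix X and \<beta> :: "complex \<Rightarrow> _" assume X: "quandle_family G X q"
      and \<beta>: "\<And>e. e \<in> set ?es \<Longrightarrow> \<beta> e \<in> carrier G \<times> X"
    interpret quandle_family G X q by (rule X)
    have \<beta>c: "\<beta> a \<in> colors" "\<beta> b \<in> colors" using \<beta> by auto
    let ?P = "\<beta> b = bar G (\<beta> a)"
    let ?A = "[((Lo a, Lo b), \<beta> a)]"
    let ?B = "[((Lo a, Hi c), \<beta> a),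
      ((Hi c, Lo j), \<beta> a),
      ((Lo j, Lo k), \<beta> a),
      ((Lo k, Lo c), \<beta> a),
      ((Lo c, Lo b), \<beta> a)]"
    have "solved G X q z r A.V \<beta> ?P"
    proof (rule solvedI[where tbl = ?A])
      fix \<kappa> assume \<kappa>: "bar_symmetric G X A.V \<kappa>"
      have L: "local_coloring G X q z r A.V \<beta> \<kappa> \<longleftrightarrow>
          \<kappa> (Lo a, Lo b) = \<beta> a \<and>
          \<kappa> (Lo b, Lo a) = \<beta> b" (is "?L \<longleftrightarrow> _")
        unfolding local_coloring_shape[OF A.tangle shape(1) ball(1)]
        using \<kappa>
        by (simp add: ends_A)
      show "\<forall>(e, x)\<in>set ?A. \<kappa> e = x" if ?L
        using that \<beta>c by (simp add: L del: mem_Sigma_iff)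
      show "?L \<longleftrightarrow> ?P"
        if "\<forall>((m, n), x)\<in>set ?A. \<kappa> (m, n) = x \<and> \<kappa> (n, m) = bar G x"
        using that \<beta>c by (auto simp: L simp del: mem_Sigma_iff)
    qed (use \<beta>c in \<open>simp_all add: V ne del: mem_Sigma_iff\<close>)
    moreover have "solved G X q z r B.V \<beta> ?P"
    proof (rule solvedI[where tbl = ?B])
      fix \<kappa> assume \<kappa>: "bar_symmetric G X B.V \<kappa>"
      have L: "local_coloring G X q z r B.V \<beta> \<kappa> \<longleftrightarrow>
          \<kappa> (Hi c, Lo j) = \<kappa> (Lo a, Hi c) \<and>
          \<kappa> (Lo c, Lo b) = \<kappa> (Lo k, Lo c) \<rhd> twist G s (\<kappa> (Lo a, Hi c)) \<and>
          \<kappa> (Lo j, Lo k) = \<kappa> (Hi c, Lo j) \<and>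
          \<kappa> (Lo k, Lo c) = \<kappa> (Lo j, Lo k) \<and>
          \<kappa> (Lo a, Hi c) = \<beta> a \<and>
          \<kappa> (Lo b, Lo c) = \<beta> b" (is "?L \<longleftrightarrow> _")
        unfolding local_coloring_shape[OF B.tangle shape(2) ball(2)]
        using \<kappa>
          B.crossing_rule[OF X \<kappa> at_c]
          B.joint_rule[OF X \<kappa> at_j]
          B.joint_rule[OF X \<kappa> at_k]
        by (simp add: ends_B signs)
      show "\<forall>(e, x)\<in>set ?B. \<kappa> e = x" if ?L
        using that \<beta>c by (simp add: L del: mem_Sigma_iff)
      show "?L \<longleftrightarrow> ?P"
        if "\<forall>((m, n), x)\<in>set ?B. \<kappa> (m, n) = x \<and> \<kappa> (n, m) = bar G x"
        using that \<beta>c by (auto simp: L simp del: mem_Sigma_iff)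
    qed (use \<beta>c in \<open>simp_all add: V ne del: mem_Sigma_iff\<close>)
    ultimately show "\<exists>P. solved G X q z r A.V \<beta> P \<and> solved G X q z r B.V \<beta> P" by blast
  qed
qed

lemma R2_recolorable:
  assumes sw: "switch_in_disc [a, a', b, b'] [c, d, j]
      (strand o1 [Lo a, Lo a'] \<union>
       strand o2 [Lo b, Lo b'])
      (strand o1 [Lo a, Hi c, Hi d, Lo a'] \<union>
       strand o2 [Lo b, Lo c, Lo j, Lo d, Lo b']) D D'" (is "switch_in_disc ?es _ ?T ?T' _ _")
    and Y: "Y_oriented_diagram D" "Y_oriented_diagram D'" and G: "group G"
  shows "recolorable G q (unoriented D) (unoriented D')"
proof -
  define T T' where "T = ?T" and "T' = ?T'"
  then have V: "unoriented T = edges [Lo a, Lo a'] \<union> edges [Lo b, Lo b']"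
    "unoriented T' = edges [Lo a, Hi c, Hi d, Lo a'] \<union> edges [Lo b, Lo c, Lo j, Lo d, Lo b']"
    by (simp_all add: unoriented_Un)
  have shape: "tangle_shape ?es [] (unoriented T)" "tangle_shape ?es [c, d, j] (unoriented T')"
    unfolding V by (auto simp: tangle_shape_def)
  obtain z r R where dd: "disc_diagram D R T z r (set ?es)" "disc_diagram D' R T' z r (set ?es)"
    and dist: "apart (?es @ [])" "apart (?es @ [c, d, j])"
    and ball: "set [] \<subseteq> ball z r" "set [c, d, j] \<subseteq> ball z r"
    by (rule switch_disc_diagrams[OF sw[folded T_def T'_def] Y shape]) (simp, simp, rule that)
  note ne = dist[simplified] ball[simplified]
  interpret A: disc_diagram D R T z r "set ?es" by (rule dd)
  interpret B: disc_diagram D' R T' z r "set ?es" by (rule dd)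
  have ends_A: "A.V `` {Lo a} = {Lo a'}" "A.V `` {Lo a'} = {Lo a}" "A.V `` {Lo b} = {Lo b'}" "A.V `` {Lo b'} = {Lo b}"
    by (simp_all add: ne V Un_Image edges_Image insert_commute del: edges.simps)
  have at_c: "c \<in> ball z r" "B.V `` {Hi c} = {Lo a, Hi d}" "Lo a \<noteq> Hi d" "B.V `` {Lo c} = {Lo b, Lo j}" "Lo b \<noteq> Lo j"
    and at_d: "d \<in> ball z r" "B.V `` {Hi d} = {Hi c, Lo a'}" "Hi c \<noteq> Lo a'" "B.V `` {Lo d} = {Lo j, Lo b'}" "Lo j \<noteq> Lo b'"
    and at_j: "B.V `` {Hi j} = {}" "B.V `` {Lo j} = {Lo c, Lo d}" "Lo c \<noteq> Lo d"
    and ends_B: "B.V `` {Lo a} = {Hi c}" "B.V `` {Lo a'} = {Hi d}" "B.V `` {Lo b} = {Lo c}" "B.V `` {Lo b'} = {Lo d}"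
    by (simp_all add: ne V Un_Image edges_Image insert_commute del: edges.simps)
  note sign_c = B.crossing_sign[OF at_c, unfolded node.sel]
    and sign_d = B.crossing_sign[OF at_d, unfolded node.sel]
  define s where "s = on_right a c d b"
  \<comment> \<open>The joint \<open>j\<close> between the crossings lies on the same side of the
    over-strand at both of them. So the lower strand enters that side and leaves it again, and the
    signs are opposite.\<close>
  have path: "B.cutting [Lo a, Hi c, Hi d, Lo a']"
    unfolding B.cutting_def by (simp add: V ne)
  have j1: "left_of [Lo a, Hi c, Hi d, Lo a'] j \<longleftrightarrow> on_left a c d j"
    and j2: "left_of [Lo a, Hi c, Hi d, Lo a'] j \<longleftrightarrow> on_left c d a' j"
    using path
      B.left_node[of "[]" "Lo a" "Hi c" "Hi d" "[Lo a']" "Lo c" "Lo j"]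
      B.left_node[of "[Lo a]" "Hi c" "Hi d" "Lo a'" "[]" "Lo d" "Lo j"]
    by (simp_all add: V ne)
  have signs: "on_right a c d b \<longleftrightarrow> s" "on_right c d a' j \<longleftrightarrow> \<not> s"
    using j1 j2 sign_c sign_d by (auto simp: s_def)
  show ?thesis
  proof (rule switch_solved[OF G dd])
    fix X and \<beta> :: "complex \<Rightarrow> _" assume X: "quandle_family G X q"
      and \<beta>: "\<And>e. e \<in> set ?es \<Longrightarrow> \<beta> e \<in> carrier G \<times> X"
    interpret quandle_family G X q by (rule X)
    have \<beta>c: "\<beta> a \<in> colors" "\<beta> a' \<in> colors" "\<beta> b \<in> colors" "\<beta> b' \<in> colors" using \<beta> by auto
    let ?P = "\<beta> a' = bar G (\<beta> a) \<and> \<beta> b' = bar G (\<beta> b)"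
    let ?A = "[((Lo a, Lo a'), \<beta> a),
      ((Lo b, Lo b'), \<beta> b)]"
    let ?B = "[((Lo a, Hi c), \<beta> a),
      ((Hi c, Hi d), \<beta> a),
      ((Hi d, Lo a'), \<beta> a),
      ((Lo b, Lo c), \<beta> b),
      ((Lo c, Lo j), \<beta> b \<rhd> twist G s (\<beta> a)),
      ((Lo j, Lo d), \<beta> b \<rhd> twist G s (\<beta> a)),
      ((Lo d, Lo b'), \<beta> b)]"
    have "solved G X q z r A.V \<beta> ?P"
    proof (rule solvedI[where tbl = ?A])
      fix \<kappa> assume \<kappa>: "bar_symmetric G X A.V \<kappa>"
      have L: "local_coloring G X q z r A.V \<beta> \<kappa> \<longleftrightarrow>
          \<kappa> (Lo a, Lo a') = \<beta> a \<and>
          \<kappa> (Lo a', Lo a) = \<beta> a' \<and>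
          \<kappa> (Lo b, Lo b') = \<beta> b \<and>
          \<kappa> (Lo b', Lo b) = \<beta> b'" (is "?L \<longleftrightarrow> _")
        unfolding local_coloring_shape[OF A.tangle shape(1) ball(1)]
        using \<kappa>
        by (simp add: ends_A)
      show "\<forall>(e, x)\<in>set ?A. \<kappa> e = x" if ?L
        using that \<beta>c by (simp add: L del: mem_Sigma_iff)
      show "?L \<longleftrightarrow> ?P"
        if "\<forall>((m, n), x)\<in>set ?A. \<kappa> (m, n) = x \<and> \<kappa> (n, m) = bar G x"
        using that \<beta>c by (auto simp: L simp del: mem_Sigma_iff)
    qed (use \<beta>c in \<open>simp_all add: V ne del: mem_Sigma_iff\<close>)
    moreover have "solved G X q z r B.V \<beta> ?P"
    proof (rule solvedI[where tbl = ?B])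
      fix \<kappa> assume \<kappa>: "bar_symmetric G X B.V \<kappa>"
      have L: "local_coloring G X q z r B.V \<beta> \<kappa> \<longleftrightarrow>
          \<kappa> (Hi c, Hi d) = \<kappa> (Lo a, Hi c) \<and>
          \<kappa> (Lo c, Lo j) = \<kappa> (Lo b, Lo c) \<rhd> twist G s (\<kappa> (Lo a, Hi c)) \<and>
          \<kappa> (Hi d, Lo a') = \<kappa> (Hi c, Hi d) \<and>
          \<kappa> (Lo d, Lo b') = \<kappa> (Lo j, Lo d) \<rhd> twist G (\<not> s) (\<kappa> (Hi c, Hi d)) \<and>
          \<kappa> (Lo j, Lo d) = \<kappa> (Lo c, Lo j) \<and>
          \<kappa> (Lo a, Hi c) = \<beta> a \<and>
          \<kappa> (Lo a', Hi d) = \<beta> a' \<and>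
          \<kappa> (Lo b, Lo c) = \<beta> b \<and>
          \<kappa> (Lo b', Lo d) = \<beta> b'" (is "?L \<longleftrightarrow> _")
        unfolding local_coloring_shape[OF B.tangle shape(2) ball(2)]
        using \<kappa>
          B.crossing_rule[OF X \<kappa> at_c]
          B.crossing_rule[OF X \<kappa> at_d]
          B.joint_rule[OF X \<kappa> at_j]
        by (simp add: ends_B signs)
      show "\<forall>(e, x)\<in>set ?B. \<kappa> e = x" if ?L
        using that \<beta>c by (simp add: L del: mem_Sigma_iff)
      show "?L \<longleftrightarrow> ?P"
        if "\<forall>((m, n), x)\<in>set ?B. \<kappa> (m, n) = x \<and> \<kappa> (n, m) = bar G x"
        using that \<beta>c by (auto simp: L simp del: mem_Sigma_iff)
    qed (use \<beta>c in \<open>simp_all add: V ne del: mem_Sigma_iff\<close>)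
    ultimately show "\<exists>P. solved G X q z r A.V \<beta> P \<and> solved G X q z r B.V \<beta> P" by blast
  qed
qed

lemma R3_recolorable:
  assumes sw: "switch_in_disc [a, a', b, b', c, c'] [x, y, w, x', y', w']
      (strand o1 [Lo a, Hi x, Hi y, Lo a'] \<union>
       strand o2 [Lo b, Lo x, Hi w, Lo b'] \<union>
       strand o3 [Lo c, Lo y, Lo w, Lo c'])
      (strand o1 [Lo a, Hi y', Hi x', Lo a'] \<union>
       strand o2 [Lo b, Hi w', Lo x', Lo b'] \<union>
       strand o3 [Lo c, Lo w', Lo y', Lo c']) D D'" (is "switch_in_disc ?es _ ?T ?T' _ _")
    and Y: "Y_oriented_diagram D" "Y_oriented_diagram D'" and G: "group G"
  shows "recolorable G q (unoriented D) (unoriented D')"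
proof -
  define T T' where "T = ?T" and "T' = ?T'"
  then have V: "unoriented T = edges [Lo a, Hi x, Hi y, Lo a'] \<union> edges [Lo b, Lo x, Hi w, Lo b'] \<union> edges [Lo c, Lo y, Lo w, Lo c']"
    "unoriented T' = edges [Lo a, Hi y', Hi x', Lo a'] \<union> edges [Lo b, Hi w', Lo x', Lo b'] \<union> edges [Lo c, Lo w', Lo y', Lo c']"
    by (simp_all add: unoriented_Un)
  have shape: "tangle_shape ?es [x, y, w] (unoriented T)" "tangle_shape ?es [y', x', w'] (unoriented T')"
    unfolding V by (auto simp: tangle_shape_def)
  obtain z r R where dd: "disc_diagram D R T z r (set ?es)" "disc_diagram D' R T' z r (set ?es)"
    and dist: "apart (?es @ [x, y, w])" "apart (?es @ [y', x', w'])"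
    and ball: "set [x, y, w] \<subseteq> ball z r" "set [y', x', w'] \<subseteq> ball z r"
    by (rule switch_disc_diagrams[OF sw[folded T_def T'_def] Y shape]) (simp, simp, rule that)
  note ne = dist[simplified] ball[simplified]
  interpret A: disc_diagram D R T z r "set ?es" by (rule dd)
  interpret B: disc_diagram D' R T' z r "set ?es" by (rule dd)
  have at_x: "x \<in> ball z r" "A.V `` {Hi x} = {Lo a, Hi y}" "Lo a \<noteq> Hi y" "A.V `` {Lo x} = {Lo b, Hi w}" "Lo b \<noteq> Hi w"
    and at_y: "y \<in> ball z r" "A.V `` {Hi y} = {Hi x, Lo a'}" "Hi x \<noteq> Lo a'" "A.V `` {Lo y} = {Lo c, Lo w}" "Lo c \<noteq> Lo w"
    and at_w: "w \<in> ball z r" "A.V `` {Hi w} = {Lo x, Lo b'}" "Lo x \<noteq> Lo b'" "A.V `` {Lo w} = {Lo y, Lo c'}" "Lo y \<noteq> Lo c'"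
    and ends_A: "A.V `` {Lo a} = {Hi x}" "A.V `` {Lo a'} = {Hi y}" "A.V `` {Lo b} = {Lo x}" "A.V `` {Lo b'} = {Hi w}" "A.V `` {Lo c} = {Lo y}" "A.V `` {Lo c'} = {Lo w}"
    by (simp_all add: ne V Un_Image edges_Image insert_commute del: edges.simps)
  note sign_x = A.crossing_sign[OF at_x, unfolded node.sel]
    and sign_y = A.crossing_sign[OF at_y, unfolded node.sel]
    and sign_w = A.crossing_sign[OF at_w, unfolded node.sel]
  have at_yp: "y' \<in> ball z r" "B.V `` {Hi y'} = {Lo a, Hi x'}" "Lo a \<noteq> Hi x'" "B.V `` {Lo y'} = {Lo w', Lo c'}" "Lo w' \<noteq> Lo c'"
    and at_xp: "x' \<in> ball z r" "B.V `` {Hi x'} = {Hi y', Lo a'}" "Hi y' \<noteq> Lo a'" "B.V `` {Lo x'} = {Hi w', Lo b'}" "Hi w' \<noteq> Lo b'"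
    and at_wp: "w' \<in> ball z r" "B.V `` {Hi w'} = {Lo b, Lo x'}" "Lo b \<noteq> Lo x'" "B.V `` {Lo w'} = {Lo c, Lo y'}" "Lo c \<noteq> Lo y'"
    and ends_B: "B.V `` {Lo a} = {Hi y'}" "B.V `` {Lo a'} = {Hi x'}" "B.V `` {Lo b} = {Hi w'}" "B.V `` {Lo b'} = {Lo x'}" "B.V `` {Lo c} = {Lo w'}" "B.V `` {Lo c'} = {Lo y'}"
    by (simp_all add: ne V Un_Image edges_Image insert_commute del: edges.simps)
  note sign_yp = B.crossing_sign[OF at_yp, unfolded node.sel]
    and sign_xp = B.crossing_sign[OF at_xp, unfolded node.sel]
    and sign_wp = B.crossing_sign[OF at_wp, unfolded node.sel]
  \<comment> \<open>\<open>s\<close> is the sign of both crossings under the top strand and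
    \<open>t\<close> that of the crossing of the other two, in either picture.\<close>
  define s where "s = on_right a x y b"
  define t where "t = on_right x w b' y"
  \<comment> \<open>The two lower strands proceed from \<open>x\<close> and \<open>y\<close> to
    their common crossing \<open>w\<close>, hence to the same side of the top strand.\<close>
  have path1: "A.cutting [Lo a, Hi x, Hi y, Lo a']"
    unfolding A.cutting_def by (simp add: V ne)
  have w1: "left_of [Lo a, Hi x, Hi y, Lo a'] w \<longleftrightarrow> on_left a x y w"
    and w2: "left_of [Lo a, Hi x, Hi y, Lo a'] w \<longleftrightarrow> on_left x y a' w"
    and b1: "left_of [Lo a, Hi x, Hi y, Lo a'] b \<longleftrightarrow> on_left a x y b"
    and b2: "left_of [Lo a, Hi x, Hi y, Lo a'] b \<longleftrightarrow> left_end a a' b"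
    using path1
      A.left_node[of "[]" "Lo a" "Hi x" "Hi y" "[Lo a']" "Lo x" "Hi w"]
      A.left_node[of "[Lo a]" "Hi x" "Hi y" "Lo a'" "[]" "Lo y" "Lo w"]
      A.left_node[of "[]" "Lo a" "Hi x" "Hi y" "[Lo a']" "Lo x" "Lo b"]
      A.left_on_sphere[of "[Lo a, Hi x, Hi y, Lo a']" b]
    by (simp_all add: V ne)
  \<comment> \<open>The bottom strand reaches \<open>w\<close> from \<open>y\<close>, which lies on
    the same side of the middle strand as the end \<open>c\<close>.\<close>
  have path2: "A.cutting [Lo b, Lo x, Hi w, Lo b']"
    unfolding A.cutting_def by (simp add: V ne)
  have y1: "left_of [Lo b, Lo x, Hi w, Lo b'] y \<longleftrightarrow> on_left x w b' y"
    and y2: "left_of [Lo b, Lo x, Hi w, Lo b'] y \<longleftrightarrow> left_of [Lo b, Lo x, Hi w, Lo b'] c"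
    and y3: "left_of [Lo b, Lo x, Hi w, Lo b'] c \<longleftrightarrow> left_end b b' c"
    using path2
      A.left_node[of "[Lo b]" "Lo x" "Hi w" "Lo b'" "[]" "Lo w" "Lo y"]
      A.left_edge[of "[Lo b, Lo x, Hi w, Lo b']" "Lo y" "Lo c"]
      A.left_on_sphere[of "[Lo b, Lo x, Hi w, Lo b']" c]
    by (simp_all add: V ne)
  \<comment> \<open>Now the lower strands meet at \<open>w'\<close> before passing the top strand;
    \<open>w'\<close> lies on the side of \<open>b\<close>, as the edge between them avoids the top
    strand.\<close>
  have path3: "B.cutting [Lo a, Hi y', Hi x', Lo a']"
    unfolding B.cutting_def by (simp add: V ne)
  have v1: "left_of [Lo a, Hi y', Hi x', Lo a'] w' \<longleftrightarrow> on_left a y' x' w'"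
    and v2: "left_of [Lo a, Hi y', Hi x', Lo a'] w' \<longleftrightarrow> on_left y' x' a' w'"
    and v3: "left_of [Lo a, Hi y', Hi x', Lo a'] w' \<longleftrightarrow> left_of [Lo a, Hi y', Hi x', Lo a'] b"
    and v4: "left_of [Lo a, Hi y', Hi x', Lo a'] b \<longleftrightarrow> left_end a a' b"
    using path3
      B.left_node[of "[]" "Lo a" "Hi y'" "Hi x'" "[Lo a']" "Lo y'" "Lo w'"]
      B.left_node[of "[Lo a]" "Hi y'" "Hi x'" "Lo a'" "[]" "Lo x'" "Hi w'"]
      B.left_edge[of "[Lo a, Hi y', Hi x', Lo a']" "Hi w'" "Lo b"]
      B.left_on_sphere[of "[Lo a, Hi y', Hi x', Lo a']" b]
    by (simp_all add: V ne)
  have path4: "B.cutting [Lo b, Hi w', Lo x', Lo b']"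
    unfolding B.cutting_def by (simp add: V ne)
  have c1: "left_of [Lo b, Hi w', Lo x', Lo b'] c \<longleftrightarrow> on_left b w' x' c"
    and c2: "left_of [Lo b, Hi w', Lo x', Lo b'] c \<longleftrightarrow> left_end b b' c"
    using path4
      B.left_node[of "[]" "Lo b" "Hi w'" "Lo x'" "[Lo b']" "Lo w'" "Lo c"]
      B.left_on_sphere[of "[Lo b, Hi w', Lo x', Lo b']" c]
    by (simp_all add: V ne)
  have signs: "on_right a x y b \<longleftrightarrow> s" "on_right x y a' c \<longleftrightarrow> s" "on_right x w b' y \<longleftrightarrow> t"
    "on_right a y' x' w' \<longleftrightarrow> s" "on_right y' x' a' w' \<longleftrightarrow> s" "on_right b w' x' c \<longleftrightarrow> t"
    using w1 w2 b1 b2 y1 y2 y3 v1 v2 v3 v4 c1 c2 sign_x sign_y sign_w sign_xp sign_yp sign_wp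
    by (auto simp: s_def t_def)
  show ?thesis
  proof (rule switch_solved[OF G dd])
    fix X and \<beta> :: "complex \<Rightarrow> _" assume X: "quandle_family G X q"
      and \<beta>: "\<And>e. e \<in> set ?es \<Longrightarrow> \<beta> e \<in> carrier G \<times> X"
    interpret quandle_family G X q by (rule X)
    have \<beta>c: "\<beta> a \<in> colors" "\<beta> a' \<in> colors" "\<beta> b \<in> colors" "\<beta> b' \<in> colors" "\<beta> c \<in> colors" "\<beta> c' \<in> colors" using \<beta> by auto
    let ?P = "\<beta> a' = bar G (\<beta> a) \<and> \<beta> b' = bar G (\<beta> b \<rhd> twist G s (\<beta> a)) \<and> \<beta> c' = bar G (\<beta> c \<rhd> twist G s (\<beta> a) \<rhd> twist G t (\<beta> b \<rhd> twist G s (\<beta> a)))"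
    let ?A = "[((Lo a, Hi x), \<beta> a),
      ((Hi x, Hi y), \<beta> a),
      ((Hi y, Lo a'), \<beta> a),
      ((Lo b, Lo x), \<beta> b),
      ((Lo x, Hi w), \<beta> b \<rhd> twist G s (\<beta> a)),
      ((Hi w, Lo b'), \<beta> b \<rhd> twist G s (\<beta> a)),
      ((Lo c, Lo y), \<beta> c),
      ((Lo y, Lo w), \<beta> c \<rhd> twist G s (\<beta> a)),
      ((Lo w, Lo c'), \<beta> c \<rhd> twist G s (\<beta> a) \<rhd> twist G t (\<beta> b \<rhd> twist G s (\<beta> a)))]"
    let ?B = "[((Lo a, Hi y'), \<beta> a),
      ((Hi y', Hi x'), \<beta> a),
      ((Hi x', Lo a'), \<beta> a),
      ((Lo b, Hi w'), \<beta> b),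
      ((Hi w', Lo x'), \<beta> b),
      ((Lo x', Lo b'), \<beta> b \<rhd> twist G s (\<beta> a)),
      ((Lo c, Lo w'), \<beta> c),
      ((Lo w', Lo y'), \<beta> c \<rhd> twist G t (\<beta> b)),
      ((Lo y', Lo c'), \<beta> c \<rhd> twist G t (\<beta> b) \<rhd> twist G s (\<beta> a))]"
    \<comment> \<open>The bottom strand passes under the other two in opposite orders in the two
      pictures.\<close>
    have distr: "\<beta> c \<rhd> twist G t (\<beta> b) \<rhd> twist G s (\<beta> a) =
        \<beta> c \<rhd> twist G s (\<beta> a) \<rhd> twist G t (\<beta> b \<rhd> twist G s (\<beta> a))"
      by (rule op_twist_distrib[OF \<beta>c(5,3,1)])
    have "solved G X q z r A.V \<beta> ?P"
    proof (rule solvedI[where tbl = ?A])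
      fix \<kappa> assume \<kappa>: "bar_symmetric G X A.V \<kappa>"
      have L: "local_coloring G X q z r A.V \<beta> \<kappa> \<longleftrightarrow>
          \<kappa> (Hi x, Hi y) = \<kappa> (Lo a, Hi x) \<and>
          \<kappa> (Lo x, Hi w) = \<kappa> (Lo b, Lo x) \<rhd> twist G s (\<kappa> (Lo a, Hi x)) \<and>
          \<kappa> (Hi y, Lo a') = \<kappa> (Hi x, Hi y) \<and>
          \<kappa> (Lo y, Lo w) = \<kappa> (Lo c, Lo y) \<rhd> twist G s (\<kappa> (Hi x, Hi y)) \<and>
          \<kappa> (Hi w, Lo b') = \<kappa> (Lo x, Hi w) \<and>
          \<kappa> (Lo w, Lo c') = \<kappa> (Lo y, Lo w) \<rhd> twist G t (\<kappa> (Lo x, Hi w)) \<and>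
          \<kappa> (Lo a, Hi x) = \<beta> a \<and>
          \<kappa> (Lo a', Hi y) = \<beta> a' \<and>
          \<kappa> (Lo b, Lo x) = \<beta> b \<and>
          \<kappa> (Lo b', Hi w) = \<beta> b' \<and>
          \<kappa> (Lo c, Lo y) = \<beta> c \<and>
          \<kappa> (Lo c', Lo w) = \<beta> c'" (is "?L \<longleftrightarrow> _")
        unfolding local_coloring_shape[OF A.tangle shape(1) ball(1)]
        using \<kappa>
          A.crossing_rule[OF X \<kappa> at_x]
          A.crossing_rule[OF X \<kappa> at_y]
          A.crossing_rule[OF X \<kappa> at_w]
        by (simp add: ends_A signs)
      show "\<forall>(e, x)\<in>set ?A. \<kappa> e = x" if ?L
        using that \<beta>c by (simp add: L del: mem_Sigma_iff)
      show "?L \<longleftrightarrow> ?P"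
        if "\<forall>((m, n), x)\<in>set ?A. \<kappa> (m, n) = x \<and> \<kappa> (n, m) = bar G x"
        using that \<beta>c by (auto simp: L simp del: mem_Sigma_iff)
    qed (use \<beta>c in \<open>simp_all add: V ne del: mem_Sigma_iff\<close>)
    moreover have "solved G X q z r B.V \<beta> ?P"
    proof (rule solvedI[where tbl = ?B])
      fix \<kappa> assume \<kappa>: "bar_symmetric G X B.V \<kappa>"
      have L: "local_coloring G X q z r B.V \<beta> \<kappa> \<longleftrightarrow>
          \<kappa> (Hi y', Hi x') = \<kappa> (Lo a, Hi y') \<and>
          \<kappa> (Lo y', Lo c') = \<kappa> (Lo w', Lo y') \<rhd> twist G s (\<kappa> (Lo a, Hi y')) \<and>
          \<kappa> (Hi x', Lo a') = \<kappa> (Hi y', Hi x') \<and>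
          \<kappa> (Lo x', Lo b') = \<kappa> (Hi w', Lo x') \<rhd> twist G s (\<kappa> (Hi y', Hi x')) \<and>
          \<kappa> (Hi w', Lo x') = \<kappa> (Lo b, Hi w') \<and>
          \<kappa> (Lo w', Lo y') = \<kappa> (Lo c, Lo w') \<rhd> twist G t (\<kappa> (Lo b, Hi w')) \<and>
          \<kappa> (Lo a, Hi y') = \<beta> a \<and>
          \<kappa> (Lo a', Hi x') = \<beta> a' \<and>
          \<kappa> (Lo b, Hi w') = \<beta> b \<and>
          \<kappa> (Lo b', Lo x') = \<beta> b' \<and>
          \<kappa> (Lo c, Lo w') = \<beta> c \<and>
          \<kappa> (Lo c', Lo y') = \<beta> c'" (is "?L \<longleftrightarrow> _")
        unfolding local_coloring_shape[OF B.tangle shape(2) ball(2)]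
        using \<kappa>
          B.crossing_rule[OF X \<kappa> at_yp]
          B.crossing_rule[OF X \<kappa> at_xp]
          B.crossing_rule[OF X \<kappa> at_wp]
        by (simp add: ends_B signs)
      show "\<forall>(e, x)\<in>set ?B. \<kappa> e = x" if ?L
        using that \<beta>c by (simp add: L del: mem_Sigma_iff)
      show "?L \<longleftrightarrow> ?P"
        if "\<forall>((m, n), x)\<in>set ?B. \<kappa> (m, n) = x \<and> \<kappa> (n, m) = bar G x"
        using that \<beta>c by (auto simp: L distr simp del: mem_Sigma_iff)
    qed (use \<beta>c in \<open>simp_all add: V ne del: mem_Sigma_iff\<close>)
    ultimately show "\<exists>P. solved G X q z r A.V \<beta> P \<and> solved G X q z r B.V \<beta> P" by blast
  qed
qed

lemma R4_recolorable:
  assumes sw: "switch_in_disc [a, b, c] [v, v', x, j]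
      (strand o1 [Lo a, Lo v] \<union>
       strand o2 [Lo b, Lo v] \<union>
       strand o3 [Lo c, Lo v])
      (strand o1 [Lo a, Hi x, Lo j, Lo v'] \<union>
       strand o2 [Lo b, Lo x, Lo v'] \<union>
       strand o3 [Lo c, Lo v']) D D'" (is "switch_in_disc ?es _ ?T ?T' _ _")
    and Y: "Y_oriented_diagram D" "Y_oriented_diagram D'" and G: "group G"
  shows "recolorable G q (unoriented D) (unoriented D')"
proof -
  define T T' where "T = ?T" and "T' = ?T'"
  then have V: "unoriented T = edges [Lo a, Lo v] \<union> edges [Lo b, Lo v] \<union> edges [Lo c, Lo v]"
    "unoriented T' = edges [Lo a, Hi x, Lo j, Lo v'] \<union> edges [Lo b, Lo x, Lo v'] \<union> edges [Lo c, Lo v']"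
    by (simp_all add: unoriented_Un)
  have shape: "tangle_shape ?es [v] (unoriented T)" "tangle_shape ?es [x, j, v'] (unoriented T')"
    unfolding V by (auto simp: tangle_shape_def)
  obtain z r R where dd: "disc_diagram D R T z r (set ?es)" "disc_diagram D' R T' z r (set ?es)"
    and dist: "apart (?es @ [v])" "apart (?es @ [x, j, v'])"
    and ball: "set [v] \<subseteq> ball z r" "set [x, j, v'] \<subseteq> ball z r"
    by (rule switch_disc_diagrams[OF sw[folded T_def T'_def] Y shape]) (simp, simp, rule that)
  note ne = dist[simplified] ball[simplified]
  interpret A: disc_diagram D R T z r "set ?es" by (rule dd)
  interpret B: disc_diagram D' R T' z r "set ?es" by (rule dd)
  have at_v: "A.V `` {Hi v} = {}" "A.V `` {Lo v} = {Lo a, Lo b, Lo c}" "distinct [Lo a, Lo b, Lo c]"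
    and ends_A: "A.V `` {Lo a} = {Lo v}" "A.V `` {Lo b} = {Lo v}" "A.V `` {Lo c} = {Lo v}"
    by (simp_all add: ne V Un_Image edges_Image insert_commute del: edges.simps)
  note sign_v = A.vertex_sign[OF at_v(2,3), unfolded node.sel]
  have at_x: "x \<in> ball z r" "B.V `` {Hi x} = {Lo a, Lo j}" "Lo a \<noteq> Lo j" "B.V `` {Lo x} = {Lo b, Lo v'}" "Lo b \<noteq> Lo v'"
    and at_j: "B.V `` {Hi j} = {}" "B.V `` {Lo j} = {Hi x, Lo v'}" "Hi x \<noteq> Lo v'"
    and at_vp: "B.V `` {Hi v'} = {}" "B.V `` {Lo v'} = {Lo j, Lo x, Lo c}" "distinct [Lo j, Lo x, Lo c]"
    and ends_B: "B.V `` {Lo a} = {Hi x}" "B.V `` {Lo b} = {Lo x}" "B.V `` {Lo c} = {Lo v'}"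
    by (simp_all add: ne V Un_Image edges_Image insert_commute del: edges.simps)
  note sign_x = B.crossing_sign[OF at_x, unfolded node.sel]
    and sign_vp = B.vertex_sign[OF at_vp(2,3), unfolded node.sel]
  define s where "s = ccw v a b c"
  \<comment> \<open>Both pictures contain a path from \<open>b\<close> to \<open>c\<close> through
    the vertex, and the end \<open>a\<close> is on the same side of either.\<close>
  have path1: "A.cutting [Lo b, Lo v, Lo c]"
    unfolding A.cutting_def by (simp add: V ne)
  have a1: "left_of [Lo b, Lo v, Lo c] a \<longleftrightarrow> on_left b v c a"
    and a2: "left_of [Lo b, Lo v, Lo c] a \<longleftrightarrow> left_end b c a"
    using path1
      A.left_node[of "[]" "Lo b" "Lo v" "Lo c" "[]" "Lo v" "Lo a"]
      A.left_on_sphere[of "[Lo b, Lo v, Lo c]" a]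
    by (simp_all add: V ne)
  \<comment> \<open>Here the edge from \<open>a\<close> crosses the path at \<open>x\<close> and
    reaches the vertex from the other side, which reverses the cyclic order there.\<close>
  have path2: "B.cutting [Lo b, Lo x, Lo v', Lo c]"
    unfolding B.cutting_def by (simp add: V ne)
  have a3: "left_of [Lo b, Lo x, Lo v', Lo c] a \<longleftrightarrow> on_left b x v' a"
    and a4: "left_of [Lo b, Lo x, Lo v', Lo c] a \<longleftrightarrow> left_end b c a"
    and j1: "left_of [Lo b, Lo x, Lo v', Lo c] j \<longleftrightarrow> on_left b x v' j"
    and j2: "left_of [Lo b, Lo x, Lo v', Lo c] j \<longleftrightarrow> on_left x v' c j"
    using path2
      B.left_node[of "[]" "Lo b" "Lo x" "Lo v'" "[Lo c]" "Hi x" "Lo a"]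
      B.left_on_sphere[of "[Lo b, Lo x, Lo v', Lo c]" a]
      B.left_node[of "[]" "Lo b" "Lo x" "Lo v'" "[Lo c]" "Hi x" "Lo j"]
      B.left_node[of "[Lo b]" "Lo x" "Lo v'" "Lo c" "[]" "Lo v'" "Lo j"]
    by (simp_all add: V ne)
  have signs: "ccw v a b c \<longleftrightarrow> s" "on_right a x j b \<longleftrightarrow> s" "ccw v' j x c \<longleftrightarrow> \<not> s"
    using a1 a2 a3 a4 j1 j2 sign_v sign_x sign_vp by (auto simp: s_def)
  show ?thesis
  proof (rule switch_solved[OF G dd])
    fix X and \<beta> :: "complex \<Rightarrow> _" assume X: "quandle_family G X q"
      and \<beta>: "\<And>e. e \<in> set ?es \<Longrightarrow> \<beta> e \<in> carrier G \<times> X"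
    interpret quandle_family G X q by (rule X)
    have \<beta>c: "\<beta> a \<in> colors" "\<beta> b \<in> colors" "\<beta> c \<in> colors" using \<beta> by auto
    let ?P = "vertex_sign_rule G s (bar G (\<beta> a)) (bar G (\<beta> b)) (bar G (\<beta> c))"
    let ?A = "[((Lo a, Lo v), \<beta> a),
      ((Lo b, Lo v), \<beta> b),
      ((Lo c, Lo v), \<beta> c)]"
    let ?B = "[((Lo a, Hi x), \<beta> a),
      ((Hi x, Lo j), \<beta> a),
      ((Lo j, Lo v'), \<beta> a),
      ((Lo b, Lo x), \<beta> b),
      ((Lo x, Lo v'), \<beta> b \<rhd> twist G s (\<beta> a)),
      ((Lo c, Lo v'), \<beta> c)]"
    have "solved G X q z r A.V \<beta> ?P"
    proof (rule solvedI[where tbl = ?A])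
      fix \<kappa> assume \<kappa>: "bar_symmetric G X A.V \<kappa>"
      have L: "local_coloring G X q z r A.V \<beta> \<kappa> \<longleftrightarrow>
          vertex_sign_rule G s (\<kappa> (Lo v, Lo a)) (\<kappa> (Lo v, Lo b)) (\<kappa> (Lo v, Lo c)) \<and>
          \<kappa> (Lo a, Lo v) = \<beta> a \<and>
          \<kappa> (Lo b, Lo v) = \<beta> b \<and>
          \<kappa> (Lo c, Lo v) = \<beta> c" (is "?L \<longleftrightarrow> _")
        unfolding local_coloring_shape[OF A.tangle shape(1) ball(1)]
        using \<kappa>
          A.vertex_rule_iff[OF X \<kappa> at_v]
        by (simp add: ends_A signs)
      show "\<forall>(e, x)\<in>set ?A. \<kappa> e = x" if ?L
        using that \<beta>c by (simp add: L del: mem_Sigma_iff)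
      show "?L \<longleftrightarrow> ?P"
        if "\<forall>((m, n), x)\<in>set ?A. \<kappa> (m, n) = x \<and> \<kappa> (n, m) = bar G x"
        using that \<beta>c by (auto simp: L simp del: mem_Sigma_iff)
    qed (use \<beta>c in \<open>simp_all add: V ne del: mem_Sigma_iff\<close>)
    moreover have "solved G X q z r B.V \<beta> ?P"
    proof (rule solvedI[where tbl = ?B])
      fix \<kappa> assume \<kappa>: "bar_symmetric G X B.V \<kappa>"
      have L: "local_coloring G X q z r B.V \<beta> \<kappa> \<longleftrightarrow>
          \<kappa> (Hi x, Lo j) = \<kappa> (Lo a, Hi x) \<and>
          \<kappa> (Lo x, Lo v') = \<kappa> (Lo b, Lo x) \<rhd> twist G s (\<kappa> (Lo a, Hi x)) \<and>
          \<kappa> (Lo j, Lo v') = \<kappa> (Hi x, Lo j) \<and>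
          vertex_sign_rule G (\<not> s) (\<kappa> (Lo v', Lo j)) (\<kappa> (Lo v', Lo x)) (\<kappa> (Lo v', Lo c)) \<and>
          \<kappa> (Lo a, Hi x) = \<beta> a \<and>
          \<kappa> (Lo b, Lo x) = \<beta> b \<and>
          \<kappa> (Lo c, Lo v') = \<beta> c" (is "?L \<longleftrightarrow> _")
        unfolding local_coloring_shape[OF B.tangle shape(2) ball(2)]
        using \<kappa>
          B.crossing_rule[OF X \<kappa> at_x]
          B.joint_rule[OF X \<kappa> at_j]
          B.vertex_rule_iff[OF X \<kappa> at_vp]
        by (simp add: ends_B signs)
      show "\<forall>(e, x)\<in>set ?B. \<kappa> e = x" if ?L
        using that \<beta>c by (simp add: L del: mem_Sigma_iff)
      show "?L \<longleftrightarrow> ?P"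
        if "\<forall>((m, n), x)\<in>set ?B. \<kappa> (m, n) = x \<and> \<kappa> (n, m) = bar G x"
        using that \<beta>c by (auto simp: L vertex_sign_rule_twist simp del: mem_Sigma_iff)
    qed (use \<beta>c in \<open>simp_all add: V ne del: mem_Sigma_iff\<close>)
    ultimately show "\<exists>P. solved G X q z r A.V \<beta> P \<and> solved G X q z r B.V \<beta> P" by blast
  qed
qed

lemma R5_over_recolorable:
  assumes sw: "switch_in_disc [a, b, c, d, d'] [v, v', x, y, w]
      (strand o4 [Lo d, Hi x, Lo d'] \<union>
       strand o1 [Lo a, Lo x, Lo v] \<union>
       strand o2 [Lo b, Lo v] \<union>
       strand o3 [Lo c, Lo v])
      (strand o4 [Lo d, Hi y, Hi w, Lo d'] \<union>
       strand o1 [Lo a, Lo v'] \<union>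
       strand o2 [Lo b, Lo y, Lo v'] \<union>
       strand o3 [Lo c, Lo w, Lo v']) D D'" (is "switch_in_disc ?es _ ?T ?T' _ _")
    and Y: "Y_oriented_diagram D" "Y_oriented_diagram D'" and G: "group G"
  shows "recolorable G q (unoriented D) (unoriented D')"
proof -
  define T T' where "T = ?T" and "T' = ?T'"
  then have V: "unoriented T = edges [Lo d, Hi x, Lo d'] \<union> edges [Lo a, Lo x, Lo v] \<union> edges [Lo b, Lo v] \<union> edges [Lo c, Lo v]"
    "unoriented T' = edges [Lo d, Hi y, Hi w, Lo d'] \<union> edges [Lo a, Lo v'] \<union> edges [Lo b, Lo y, Lo v'] \<union> edges [Lo c, Lo w, Lo v']"
    by (simp_all add: unoriented_Un)
  have shape: "tangle_shape ?es [x, v] (unoriented T)" "tangle_shape ?es [y, w, v'] (unoriented T')"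
    unfolding V by (auto simp: tangle_shape_def)
  obtain z r R where dd: "disc_diagram D R T z r (set ?es)" "disc_diagram D' R T' z r (set ?es)"
    and dist: "apart (?es @ [x, v])" "apart (?es @ [y, w, v'])"
    and ball: "set [x, v] \<subseteq> ball z r" "set [y, w, v'] \<subseteq> ball z r"
    by (rule switch_disc_diagrams[OF sw[folded T_def T'_def] Y shape]) (simp, simp, rule that)
  note ne = dist[simplified] ball[simplified]
  interpret A: disc_diagram D R T z r "set ?es" by (rule dd)
  interpret B: disc_diagram D' R T' z r "set ?es" by (rule dd)
  have at_x: "x \<in> ball z r" "A.V `` {Hi x} = {Lo d, Lo d'}" "Lo d \<noteq> Lo d'" "A.V `` {Lo x} = {Lo a, Lo v}" "Lo a \<noteq> Lo v"
    and at_v: "A.V `` {Hi v} = {}" "A.V `` {Lo v} = {Lo x, Lo b, Lo c}" "distinct [Lo x, Lo b, Lo c]"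
    and ends_A: "A.V `` {Lo a} = {Lo x}" "A.V `` {Lo b} = {Lo v}" "A.V `` {Lo c} = {Lo v}" "A.V `` {Lo d} = {Hi x}" "A.V `` {Lo d'} = {Hi x}"
    by (simp_all add: ne V Un_Image edges_Image insert_commute del: edges.simps)
  note sign_x = A.crossing_sign[OF at_x, unfolded node.sel]
    and sign_v = A.vertex_sign[OF at_v(2,3), unfolded node.sel]
  have at_y: "y \<in> ball z r" "B.V `` {Hi y} = {Lo d, Hi w}" "Lo d \<noteq> Hi w" "B.V `` {Lo y} = {Lo b, Lo v'}" "Lo b \<noteq> Lo v'"
    and at_w: "w \<in> ball z r" "B.V `` {Hi w} = {Hi y, Lo d'}" "Hi y \<noteq> Lo d'" "B.V `` {Lo w} = {Lo c, Lo v'}" "Lo c \<noteq> Lo v'"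
    and at_vp: "B.V `` {Hi v'} = {}" "B.V `` {Lo v'} = {Lo a, Lo y, Lo w}" "distinct [Lo a, Lo y, Lo w]"
    and ends_B: "B.V `` {Lo a} = {Lo v'}" "B.V `` {Lo b} = {Lo y}" "B.V `` {Lo c} = {Lo w}" "B.V `` {Lo d} = {Hi y}" "B.V `` {Lo d'} = {Hi w}"
    by (simp_all add: ne V Un_Image edges_Image insert_commute del: edges.simps)
  note sign_y = B.crossing_sign[OF at_y, unfolded node.sel]
    and sign_w = B.crossing_sign[OF at_w, unfolded node.sel]
    and sign_vp = B.vertex_sign[OF at_vp(2,3), unfolded node.sel]
  define s where "s = on_right d x d' a"
  define t where "t = ccw v x b c"
  \<comment> \<open>The vertex lies on the same side of the strand as \<open>b\<close> and
    \<open>c\<close>, opposite to where the edge of \<open>a\<close> enters. This fixes the signs at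
    \<open>y\<close> and \<open>w\<close> once that at \<open>x\<close> is known.\<close>
  have path1: "A.cutting [Lo d, Hi x, Lo d']"
    unfolding A.cutting_def by (simp add: V ne)
  have v1: "left_of [Lo d, Hi x, Lo d'] v \<longleftrightarrow> on_left d x d' v"
    and v2: "left_of [Lo d, Hi x, Lo d'] v \<longleftrightarrow> left_of [Lo d, Hi x, Lo d'] b"
    and v3: "left_of [Lo d, Hi x, Lo d'] b \<longleftrightarrow> left_end d d' b"
    and v4: "left_of [Lo d, Hi x, Lo d'] v \<longleftrightarrow> left_of [Lo d, Hi x, Lo d'] c"
    and v5: "left_of [Lo d, Hi x, Lo d'] c \<longleftrightarrow> left_end d d' c"
    using path1
      A.left_node[of "[]" "Lo d" "Hi x" "Lo d'" "[]" "Lo x" "Lo v"]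
      A.left_edge[of "[Lo d, Hi x, Lo d']" "Lo v" "Lo b"]
      A.left_on_sphere[of "[Lo d, Hi x, Lo d']" b]
      A.left_edge[of "[Lo d, Hi x, Lo d']" "Lo v" "Lo c"]
      A.left_on_sphere[of "[Lo d, Hi x, Lo d']" c]
    by (simp_all add: V ne)
  \<comment> \<open>The cyclic orders at the two vertices are compared by means of paths from
    \<open>a\<close> to \<open>c\<close>, with \<open>b\<close> as witness.\<close>
  have path2: "A.cutting [Lo a, Lo x, Lo v, Lo c]"
    unfolding A.cutting_def by (simp add: V ne)
  have b1: "left_of [Lo a, Lo x, Lo v, Lo c] b \<longleftrightarrow> on_left x v c b"
    and b2: "left_of [Lo a, Lo x, Lo v, Lo c] b \<longleftrightarrow> left_end a c b"
    using path2
      A.left_node[of "[Lo a]" "Lo x" "Lo v" "Lo c" "[]" "Lo v" "Lo b"]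
      A.left_on_sphere[of "[Lo a, Lo x, Lo v, Lo c]" b]
    by (simp_all add: V ne)
  have path3: "B.cutting [Lo d, Hi y, Hi w, Lo d']"
    unfolding B.cutting_def by (simp add: V ne)
  have b3: "left_of [Lo d, Hi y, Hi w, Lo d'] b \<longleftrightarrow> on_left d y w b"
    and b4: "left_of [Lo d, Hi y, Hi w, Lo d'] b \<longleftrightarrow> left_end d d' b"
    and c3: "left_of [Lo d, Hi y, Hi w, Lo d'] c \<longleftrightarrow> on_left y w d' c"
    and c4: "left_of [Lo d, Hi y, Hi w, Lo d'] c \<longleftrightarrow> left_end d d' c"
    using path3
      B.left_node[of "[]" "Lo d" "Hi y" "Hi w" "[Lo d']" "Lo y" "Lo b"]
      B.left_on_sphere[of "[Lo d, Hi y, Hi w, Lo d']" b]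
      B.left_node[of "[Lo d]" "Hi y" "Hi w" "Lo d'" "[]" "Lo w" "Lo c"]
      B.left_on_sphere[of "[Lo d, Hi y, Hi w, Lo d']" c]
    by (simp_all add: V ne)
  have path4: "B.cutting [Lo a, Lo v', Lo w, Lo c]"
    unfolding B.cutting_def by (simp add: V ne)
  have y1: "left_of [Lo a, Lo v', Lo w, Lo c] y \<longleftrightarrow> on_left a v' w y"
    and y2: "left_of [Lo a, Lo v', Lo w, Lo c] y \<longleftrightarrow> left_of [Lo a, Lo v', Lo w, Lo c] b"
    and y3: "left_of [Lo a, Lo v', Lo w, Lo c] b \<longleftrightarrow> left_end a c b"
    using path4
      B.left_node[of "[]" "Lo a" "Lo v'" "Lo w" "[Lo c]" "Lo v'" "Lo y"]
      B.left_edge[of "[Lo a, Lo v', Lo w, Lo c]" "Lo y" "Lo b"]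
      B.left_on_sphere[of "[Lo a, Lo v', Lo w, Lo c]" b]
    by (simp_all add: V ne)
  have signs: "on_right d x d' a \<longleftrightarrow> s" "ccw v x b c \<longleftrightarrow> t" "on_right d y w b \<longleftrightarrow> \<not> s" "on_right y w d' c \<longleftrightarrow> \<not> s"
    "ccw v' a y w \<longleftrightarrow> t"
    using v1 v2 v3 v4 v5 b1 b2 b3 b4 c3 c4 y1 y2 y3 sign_x sign_v sign_y sign_w sign_vp by (auto simp: s_def t_def)
  show ?thesis
  proof (rule switch_solved[OF G dd])
    fix X and \<beta> :: "complex \<Rightarrow> _" assume X: "quandle_family G X q"
      and \<beta>: "\<And>e. e \<in> set ?es \<Longrightarrow> \<beta> e \<in> carrier G \<times> X"
    interpret quandle_family G X q by (rule X)
    have \<beta>c: "\<beta> a \<in> colors" "\<beta> b \<in> colors" "\<beta> c \<in> colors" "\<beta> d \<in> colors" "\<beta> d' \<in> colors" using \<beta> by auto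
    let ?P = "\<beta> d' = bar G (\<beta> d) \<and> vertex_sign_rule G t (bar G (\<beta> a \<rhd> twist G s (\<beta> d))) (bar G (\<beta> b)) (bar G (\<beta> c))"
    let ?A = "[((Lo d, Hi x), \<beta> d),
      ((Hi x, Lo d'), \<beta> d),
      ((Lo a, Lo x), \<beta> a),
      ((Lo x, Lo v), \<beta> a \<rhd> twist G s (\<beta> d)),
      ((Lo b, Lo v), \<beta> b),
      ((Lo c, Lo v), \<beta> c)]"
    let ?B = "[((Lo d, Hi y), \<beta> d),
      ((Hi y, Hi w), \<beta> d),
      ((Hi w, Lo d'), \<beta> d),
      ((Lo a, Lo v'), \<beta> a),
      ((Lo b, Lo y), \<beta> b),
      ((Lo y, Lo v'), \<beta> b \<rhd> twist G (\<not> s) (\<beta> d)),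
      ((Lo c, Lo w), \<beta> c),
      ((Lo w, Lo v'), \<beta> c \<rhd> twist G (\<not> s) (\<beta> d))]"
    have "solved G X q z r A.V \<beta> ?P"
    proof (rule solvedI[where tbl = ?A])
      fix \<kappa> assume \<kappa>: "bar_symmetric G X A.V \<kappa>"
      have L: "local_coloring G X q z r A.V \<beta> \<kappa> \<longleftrightarrow>
          \<kappa> (Hi x, Lo d') = \<kappa> (Lo d, Hi x) \<and>
          \<kappa> (Lo x, Lo v) = \<kappa> (Lo a, Lo x) \<rhd> twist G s (\<kappa> (Lo d, Hi x)) \<and>
          vertex_sign_rule G t (\<kappa> (Lo v, Lo x)) (\<kappa> (Lo v, Lo b)) (\<kappa> (Lo v, Lo c)) \<and>
          \<kappa> (Lo a, Lo x) = \<beta> a \<and>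
          \<kappa> (Lo b, Lo v) = \<beta> b \<and>
          \<kappa> (Lo c, Lo v) = \<beta> c \<and>
          \<kappa> (Lo d, Hi x) = \<beta> d \<and>
          \<kappa> (Lo d', Hi x) = \<beta> d'" (is "?L \<longleftrightarrow> _")
        unfolding local_coloring_shape[OF A.tangle shape(1) ball(1)]
        using \<kappa>
          A.crossing_rule[OF X \<kappa> at_x]
          A.vertex_rule_iff[OF X \<kappa> at_v]
        by (simp add: ends_A signs)
      show "\<forall>(e, x)\<in>set ?A. \<kappa> e = x" if ?L
        using that \<beta>c by (simp add: L del: mem_Sigma_iff)
      show "?L \<longleftrightarrow> ?P"
        if "\<forall>((m, n), x)\<in>set ?A. \<kappa> (m, n) = x \<and> \<kappa> (n, m) = bar G x"
        using that \<beta>c by (auto simp: L simp del: mem_Sigma_iff)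
    qed (use \<beta>c in \<open>simp_all add: V ne del: mem_Sigma_iff\<close>)
    moreover have "solved G X q z r B.V \<beta> ?P"
    proof (rule solvedI[where tbl = ?B])
      fix \<kappa> assume \<kappa>: "bar_symmetric G X B.V \<kappa>"
      have L: "local_coloring G X q z r B.V \<beta> \<kappa> \<longleftrightarrow>
          \<kappa> (Hi y, Hi w) = \<kappa> (Lo d, Hi y) \<and>
          \<kappa> (Lo y, Lo v') = \<kappa> (Lo b, Lo y) \<rhd> twist G (\<not> s) (\<kappa> (Lo d, Hi y)) \<and>
          \<kappa> (Hi w, Lo d') = \<kappa> (Hi y, Hi w) \<and>
          \<kappa> (Lo w, Lo v') = \<kappa> (Lo c, Lo w) \<rhd> twist G (\<not> s) (\<kappa> (Hi y, Hi w)) \<and>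
          vertex_sign_rule G t (\<kappa> (Lo v', Lo a)) (\<kappa> (Lo v', Lo y)) (\<kappa> (Lo v', Lo w)) \<and>
          \<kappa> (Lo a, Lo v') = \<beta> a \<and>
          \<kappa> (Lo b, Lo y) = \<beta> b \<and>
          \<kappa> (Lo c, Lo w) = \<beta> c \<and>
          \<kappa> (Lo d, Hi y) = \<beta> d \<and>
          \<kappa> (Lo d', Hi w) = \<beta> d'" (is "?L \<longleftrightarrow> _")
        unfolding local_coloring_shape[OF B.tangle shape(2) ball(2)]
        using \<kappa>
          B.crossing_rule[OF X \<kappa> at_y]
          B.crossing_rule[OF X \<kappa> at_w]
          B.vertex_rule_iff[OF X \<kappa> at_vp]
        by (simp add: ends_B signs)
      show "\<forall>(e, x)\<in>set ?B. \<kappa> e = x" if ?L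
        using that \<beta>c by (simp add: L del: mem_Sigma_iff)
      show "?L \<longleftrightarrow> ?P"
        if "\<forall>((m, n), x)\<in>set ?B. \<kappa> (m, n) = x \<and> \<kappa> (n, m) = bar G x"
        using that \<beta>c by (auto simp: L vertex_sign_rule_pull simp del: mem_Sigma_iff)
    qed (use \<beta>c in \<open>simp_all add: V ne del: mem_Sigma_iff\<close>)
    ultimately show "\<exists>P. solved G X q z r A.V \<beta> P \<and> solved G X q z r B.V \<beta> P" by blast
  qed
qed

lemma R5_under_recolorable:
  assumes sw: "switch_in_disc [a, b, c, d, d'] [v, v', x, y, w]
      (strand o4 [Lo d, Lo x, Lo d'] \<union>
       strand o1 [Lo a, Hi x, Lo v] \<union>
       strand o2 [Lo b, Lo v] \<union>
       strand o3 [Lo c, Lo v])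
      (strand o4 [Lo d, Lo y, Lo w, Lo d'] \<union>
       strand o1 [Lo a, Lo v'] \<union>
       strand o2 [Lo b, Hi y, Lo v'] \<union>
       strand o3 [Lo c, Hi w, Lo v']) D D'" (is "switch_in_disc ?es _ ?T ?T' _ _")
    and Y: "Y_oriented_diagram D" "Y_oriented_diagram D'" and G: "group G"
  shows "recolorable G q (unoriented D) (unoriented D')"
proof -
  define T T' where "T = ?T" and "T' = ?T'"
  then have V: "unoriented T = edges [Lo d, Lo x, Lo d'] \<union> edges [Lo a, Hi x, Lo v] \<union> edges [Lo b, Lo v] \<union> edges [Lo c, Lo v]"
    "unoriented T' = edges [Lo d, Lo y, Lo w, Lo d'] \<union> edges [Lo a, Lo v'] \<union> edges [Lo b, Hi y, Lo v'] \<union> edges [Lo c, Hi w, Lo v']"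
    by (simp_all add: unoriented_Un)
  have shape: "tangle_shape ?es [x, v] (unoriented T)" "tangle_shape ?es [y, w, v'] (unoriented T')"
    unfolding V by (auto simp: tangle_shape_def)
  obtain z r R where dd: "disc_diagram D R T z r (set ?es)" "disc_diagram D' R T' z r (set ?es)"
    and dist: "apart (?es @ [x, v])" "apart (?es @ [y, w, v'])"
    and ball: "set [x, v] \<subseteq> ball z r" "set [y, w, v'] \<subseteq> ball z r"
    by (rule switch_disc_diagrams[OF sw[folded T_def T'_def] Y shape]) (simp, simp, rule that)
  note ne = dist[simplified] ball[simplified]
  interpret A: disc_diagram D R T z r "set ?es" by (rule dd)
  interpret B: disc_diagram D' R T' z r "set ?es" by (rule dd)
  have at_x: "x \<in> ball z r" "A.V `` {Hi x} = {Lo a, Lo v}" "Lo a \<noteq> Lo v" "A.V `` {Lo x} = {Lo d, Lo d'}" "Lo d \<noteq> Lo d'"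
    and at_v: "A.V `` {Hi v} = {}" "A.V `` {Lo v} = {Hi x, Lo b, Lo c}" "distinct [Hi x, Lo b, Lo c]"
    and ends_A: "A.V `` {Lo a} = {Hi x}" "A.V `` {Lo b} = {Lo v}" "A.V `` {Lo c} = {Lo v}" "A.V `` {Lo d} = {Lo x}" "A.V `` {Lo d'} = {Lo x}"
    by (simp_all add: ne V Un_Image edges_Image insert_commute del: edges.simps)
  note sign_x = A.crossing_sign[OF at_x, unfolded node.sel]
    and sign_v = A.vertex_sign[OF at_v(2,3), unfolded node.sel]
  have at_y: "y \<in> ball z r" "B.V `` {Hi y} = {Lo b, Lo v'}" "Lo b \<noteq> Lo v'" "B.V `` {Lo y} = {Lo d, Lo w}" "Lo d \<noteq> Lo w"
    and at_w: "w \<in> ball z r" "B.V `` {Hi w} = {Lo c, Lo v'}" "Lo c \<noteq> Lo v'" "B.V `` {Lo w} = {Lo y, Lo d'}" "Lo y \<noteq> Lo d'"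
    and at_vp: "B.V `` {Hi v'} = {}" "B.V `` {Lo v'} = {Lo a, Hi y, Hi w}" "distinct [Lo a, Hi y, Hi w]"
    and ends_B: "B.V `` {Lo a} = {Lo v'}" "B.V `` {Lo b} = {Hi y}" "B.V `` {Lo c} = {Hi w}" "B.V `` {Lo d} = {Lo y}" "B.V `` {Lo d'} = {Lo w}"
    by (simp_all add: ne V Un_Image edges_Image insert_commute del: edges.simps)
  note sign_y = B.crossing_sign[OF at_y, unfolded node.sel]
    and sign_w = B.crossing_sign[OF at_w, unfolded node.sel]
    and sign_vp = B.vertex_sign[OF at_vp(2,3), unfolded node.sel]
  \<comment> \<open>A single Boolean is the crossing sign and the cyclic order at the vertex. The
    first picture alone does not tie them together; the second does, since there the strand from
    \<open>d\<close> meets the edge of \<open>b\<close> before that of \<open>c\<close>.\<close>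
  define s where "s = on_right a x v d"
  have swap: "on_left v x a d \<longleftrightarrow> on_right a x v d" by (simp add: on_left_def on_right_def)
  have path1: "A.cutting [Lo b, Lo v, Hi x, Lo a]"
    unfolding A.cutting_def by (simp add: V ne)
  have d1: "left_of [Lo b, Lo v, Hi x, Lo a] d \<longleftrightarrow> on_left v x a d"
    and d2: "left_of [Lo b, Lo v, Hi x, Lo a] d \<longleftrightarrow> left_end b a d"
    using path1
      A.left_node[of "[Lo b]" "Lo v" "Hi x" "Lo a" "[]" "Lo x" "Lo d"]
      A.left_on_sphere[of "[Lo b, Lo v, Hi x, Lo a]" d]
    by (simp_all add: V ne)
  have path2: "A.cutting [Lo a, Hi x, Lo v, Lo c]"
    unfolding A.cutting_def by (simp add: V ne)
  have b1: "left_of [Lo a, Hi x, Lo v, Lo c] b \<longleftrightarrow> on_left x v c b"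
    and b2: "left_of [Lo a, Hi x, Lo v, Lo c] b \<longleftrightarrow> left_end a c b"
    using path2
      A.left_node[of "[Lo a]" "Hi x" "Lo v" "Lo c" "[]" "Lo v" "Lo b"]
      A.left_on_sphere[of "[Lo a, Hi x, Lo v, Lo c]" b]
    by (simp_all add: V ne)
  \<comment> \<open>\<open>d\<close> and \<open>w\<close> are on opposite sides of this path. The
    side of \<open>w\<close> can be read off at the crossing \<open>y\<close> and again at the
    vertex \<open>v'\<close>, which links crossing sign and cyclic order.\<close>
  have path3: "B.cutting [Lo b, Hi y, Lo v', Lo a]"
    unfolding B.cutting_def by (simp add: V ne)
  have d3: "left_of [Lo b, Hi y, Lo v', Lo a] d \<longleftrightarrow> on_left b y v' d"
    and d4: "left_of [Lo b, Hi y, Lo v', Lo a] d \<longleftrightarrow> left_end b a d"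
    and w1: "left_of [Lo b, Hi y, Lo v', Lo a] w \<longleftrightarrow> on_left b y v' w"
    and w2: "left_of [Lo b, Hi y, Lo v', Lo a] w \<longleftrightarrow> on_left y v' a w"
    using path3
      B.left_node[of "[]" "Lo b" "Hi y" "Lo v'" "[Lo a]" "Lo y" "Lo d"]
      B.left_on_sphere[of "[Lo b, Hi y, Lo v', Lo a]" d]
      B.left_node[of "[]" "Lo b" "Hi y" "Lo v'" "[Lo a]" "Lo y" "Lo w"]
      B.left_node[of "[Lo b]" "Hi y" "Lo v'" "Lo a" "[]" "Lo v'" "Hi w"]
    by (simp_all add: V ne)
  have path4: "B.cutting [Lo c, Hi w, Lo v', Lo a]"
    unfolding B.cutting_def by (simp add: V ne)
  have y1: "left_of [Lo c, Hi w, Lo v', Lo a] y \<longleftrightarrow> on_left c w v' y"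
    and y2: "left_of [Lo c, Hi w, Lo v', Lo a] y \<longleftrightarrow> on_left w v' a y"
    using path4
      B.left_node[of "[]" "Lo c" "Hi w" "Lo v'" "[Lo a]" "Lo w" "Lo y"]
      B.left_node[of "[Lo c]" "Hi w" "Lo v'" "Lo a" "[]" "Lo v'" "Hi y"]
    by (simp_all add: V ne)
  \<comment> \<open>This path has the same ends as one in the first picture, so the cyclic order at
    \<open>v'\<close> can be compared with that at \<open>v\<close>.\<close>
  have path5: "B.cutting [Lo a, Lo v', Hi w, Lo c]"
    unfolding B.cutting_def by (simp add: V ne)
  have y3: "left_of [Lo a, Lo v', Hi w, Lo c] y \<longleftrightarrow> on_left a v' w y"
    and y4: "left_of [Lo a, Lo v', Hi w, Lo c] y \<longleftrightarrow> left_of [Lo a, Lo v', Hi w, Lo c] b"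
    and y5: "left_of [Lo a, Lo v', Hi w, Lo c] b \<longleftrightarrow> left_end a c b"
    using path5
      B.left_node[of "[]" "Lo a" "Lo v'" "Hi w" "[Lo c]" "Lo v'" "Hi y"]
      B.left_edge[of "[Lo a, Lo v', Hi w, Lo c]" "Hi y" "Lo b"]
      B.left_on_sphere[of "[Lo a, Lo v', Hi w, Lo c]" b]
    by (simp_all add: V ne)
  have signs: "on_right a x v d \<longleftrightarrow> s" "ccw v x b c \<longleftrightarrow> s" "on_right b y v' d \<longleftrightarrow> \<not> s" "on_right c w v' y \<longleftrightarrow> \<not> s"
    "ccw v' a y w \<longleftrightarrow> s"
    using d1 d2 b1 b2 d3 d4 w1 w2 y1 y2 y3 y4 y5 swap sign_x sign_v sign_y sign_w sign_vp by (auto simp: s_def)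
  show ?thesis
  proof (rule switch_solved[OF G dd])
    fix X and \<beta> :: "complex \<Rightarrow> _" assume X: "quandle_family G X q"
      and \<beta>: "\<And>e. e \<in> set ?es \<Longrightarrow> \<beta> e \<in> carrier G \<times> X"
    interpret quandle_family G X q by (rule X)
    have \<beta>c: "\<beta> a \<in> colors" "\<beta> b \<in> colors" "\<beta> c \<in> colors" "\<beta> d \<in> colors" "\<beta> d' \<in> colors" using \<beta> by auto
    let ?P = "vertex_sign_rule G s (bar G (\<beta> a)) (bar G (\<beta> b)) (bar G (\<beta> c)) \<and> bar G (\<beta> d \<rhd> twist G s (\<beta> a)) = \<beta> d'"
    let ?A = "[((Lo d, Lo x), \<beta> d),
      ((Lo x, Lo d'), \<beta> d \<rhd> twist G s (\<beta> a)),
      ((Lo a, Hi x), \<beta> a),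
      ((Hi x, Lo v), \<beta> a),
      ((Lo b, Lo v), \<beta> b),
      ((Lo c, Lo v), \<beta> c)]"
    let ?B = "[((Lo d, Lo y), \<beta> d),
      ((Lo y, Lo w), \<beta> d \<rhd> twist G (\<not> s) (\<beta> b)),
      ((Lo w, Lo d'), \<beta> d \<rhd> twist G (\<not> s) (\<beta> b) \<rhd> twist G (\<not> s) (\<beta> c)),
      ((Lo a, Lo v'), \<beta> a),
      ((Lo b, Hi y), \<beta> b),
      ((Hi y, Lo v'), \<beta> b),
      ((Lo c, Hi w), \<beta> c),
      ((Hi w, Lo v'), \<beta> c)]"
    have acts: "\<beta> d \<rhd> twist G (\<not> s) (\<beta> b) \<rhd> twist G (\<not> s) (\<beta> c) = \<beta> d \<rhd> twist G s (\<beta> a)"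
      if "vertex_sign_rule G s (bar G (\<beta> a)) (bar G (\<beta> b)) (bar G (\<beta> c))"
      by (rule vertex_sign_rule_acts[OF that \<beta>c(1-4)])
    have "solved G X q z r A.V \<beta> ?P"
    proof (rule solvedI[where tbl = ?A])
      fix \<kappa> assume \<kappa>: "bar_symmetric G X A.V \<kappa>"
      have L: "local_coloring G X q z r A.V \<beta> \<kappa> \<longleftrightarrow>
          \<kappa> (Hi x, Lo v) = \<kappa> (Lo a, Hi x) \<and>
          \<kappa> (Lo x, Lo d') = \<kappa> (Lo d, Lo x) \<rhd> twist G s (\<kappa> (Lo a, Hi x)) \<and>
          vertex_sign_rule G s (\<kappa> (Lo v, Hi x)) (\<kappa> (Lo v, Lo b)) (\<kappa> (Lo v, Lo c)) \<and>
          \<kappa> (Lo a, Hi x) = \<beta> a \<and>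
          \<kappa> (Lo b, Lo v) = \<beta> b \<and>
          \<kappa> (Lo c, Lo v) = \<beta> c \<and>
          \<kappa> (Lo d, Lo x) = \<beta> d \<and>
          \<kappa> (Lo d', Lo x) = \<beta> d'" (is "?L \<longleftrightarrow> _")
        unfolding local_coloring_shape[OF A.tangle shape(1) ball(1)]
        using \<kappa>
          A.crossing_rule[OF X \<kappa> at_x]
          A.vertex_rule_iff[OF X \<kappa> at_v]
        by (simp add: ends_A signs)
      show "\<forall>(e, x)\<in>set ?A. \<kappa> e = x" if ?L
        using that \<beta>c by (simp add: L del: mem_Sigma_iff)
      show "?L \<longleftrightarrow> ?P"
        if "\<forall>((m, n), x)\<in>set ?A. \<kappa> (m, n) = x \<and> \<kappa> (n, m) = bar G x"
        using that \<beta>c by (auto simp: L simp del: mem_Sigma_iff)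
    qed (use \<beta>c in \<open>simp_all add: V ne del: mem_Sigma_iff\<close>)
    moreover have "solved G X q z r B.V \<beta> ?P"
    proof (rule solvedI[where tbl = ?B])
      fix \<kappa> assume \<kappa>: "bar_symmetric G X B.V \<kappa>"
      have L: "local_coloring G X q z r B.V \<beta> \<kappa> \<longleftrightarrow>
          \<kappa> (Hi y, Lo v') = \<kappa> (Lo b, Hi y) \<and>
          \<kappa> (Lo y, Lo w) = \<kappa> (Lo d, Lo y) \<rhd> twist G (\<not> s) (\<kappa> (Lo b, Hi y)) \<and>
          \<kappa> (Hi w, Lo v') = \<kappa> (Lo c, Hi w) \<and>
          \<kappa> (Lo w, Lo d') = \<kappa> (Lo y, Lo w) \<rhd> twist G (\<not> s) (\<kappa> (Lo c, Hi w)) \<and>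
          vertex_sign_rule G s (\<kappa> (Lo v', Lo a)) (\<kappa> (Lo v', Hi y)) (\<kappa> (Lo v', Hi w)) \<and>
          \<kappa> (Lo a, Lo v') = \<beta> a \<and>
          \<kappa> (Lo b, Hi y) = \<beta> b \<and>
          \<kappa> (Lo c, Hi w) = \<beta> c \<and>
          \<kappa> (Lo d, Lo y) = \<beta> d \<and>
          \<kappa> (Lo d', Lo w) = \<beta> d'" (is "?L \<longleftrightarrow> _")
        unfolding local_coloring_shape[OF B.tangle shape(2) ball(2)]
        using \<kappa>
          B.crossing_rule[OF X \<kappa> at_y]
          B.crossing_rule[OF X \<kappa> at_w]
          B.vertex_rule_iff[OF X \<kappa> at_vp]
        by (simp add: ends_B signs)
      show "\<forall>(e, x)\<in>set ?B. \<kappa> e = x" if ?L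
        using that \<beta>c by (simp add: L del: mem_Sigma_iff)
      show "?L \<longleftrightarrow> ?P"
        if "\<forall>((m, n), x)\<in>set ?B. \<kappa> (m, n) = x \<and> \<kappa> (n, m) = bar G x"
        \<comment> \<open>The final color of the strand simplifies only under the vertex condition,
          which is another conjunct; hence \<open>conj_cong\<close>.\<close>
        using that \<beta>c by (simp add: L acts del: mem_Sigma_iff cong: conj_cong)
    qed (use \<beta>c in \<open>simp_all add: V ne del: mem_Sigma_iff\<close>)
    ultimately show "\<exists>P. solved G X q z r A.V \<beta> P \<and> solved G X q z r B.V \<beta> P" by blast
  qed
qed

lemma R6_recolorable:
  assumes sw: "switch_in_disc [a, b, c, d] [v, w, v', w']
      (strand o1 [Lo a, Lo v] \<union>
       strand o2 [Lo b, Lo v] \<union>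
       strand o3 [Lo c, Lo w] \<union>
       strand o4 [Lo d, Lo w] \<union>
       strand o5 [Lo v, Lo w])
      (strand o1 [Lo a, Lo v'] \<union>
       strand o4 [Lo d, Lo v'] \<union>
       strand o2 [Lo b, Lo w'] \<union>
       strand o3 [Lo c, Lo w'] \<union>
       strand o6 [Lo v', Lo w']) D D'" (is "switch_in_disc ?es _ ?T ?T' _ _")
    and Y: "Y_oriented_diagram D" "Y_oriented_diagram D'" and G: "group G"
  shows "recolorable G q (unoriented D) (unoriented D')"
proof -
  define T T' where "T = ?T" and "T' = ?T'"
  then have V: "unoriented T = edges [Lo a, Lo v] \<union> edges [Lo b, Lo v] \<union> edges [Lo c, Lo w] \<union> edges [Lo d, Lo w] \<union> edges [Lo v, Lo w]"
    "unoriented T' = edges [Lo a, Lo v'] \<union> edges [Lo d, Lo v'] \<union> edges [Lo b, Lo w'] \<union> edges [Lo c, Lo w'] \<union> edges [Lo v', Lo w']"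
    by (simp_all add: unoriented_Un)
  have shape: "tangle_shape ?es [v, w] (unoriented T)" "tangle_shape ?es [v', w'] (unoriented T')"
    unfolding V by (auto simp: tangle_shape_def)
  obtain z r R where dd: "disc_diagram D R T z r (set ?es)" "disc_diagram D' R T' z r (set ?es)"
    and dist: "apart (?es @ [v, w])" "apart (?es @ [v', w'])"
    and ball: "set [v, w] \<subseteq> ball z r" "set [v', w'] \<subseteq> ball z r"
    by (rule switch_disc_diagrams[OF sw[folded T_def T'_def] Y shape]) (simp, simp, rule that)
  note ne = dist[simplified] ball[simplified]
  interpret A: disc_diagram D R T z r "set ?es" by (rule dd)
  interpret B: disc_diagram D' R T' z r "set ?es" by (rule dd)
  have at_v: "A.V `` {Hi v} = {}" "A.V `` {Lo v} = {Lo a, Lo b, Lo w}" "distinct [Lo a, Lo b, Lo w]"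
    and at_w: "A.V `` {Hi w} = {}" "A.V `` {Lo w} = {Lo c, Lo d, Lo v}" "distinct [Lo c, Lo d, Lo v]"
    and ends_A: "A.V `` {Lo a} = {Lo v}" "A.V `` {Lo b} = {Lo v}" "A.V `` {Lo c} = {Lo w}" "A.V `` {Lo d} = {Lo w}"
    by (simp_all add: ne V Un_Image edges_Image insert_commute del: edges.simps)
  note sign_v = A.vertex_sign[OF at_v(2,3), unfolded node.sel]
    and sign_w = A.vertex_sign[OF at_w(2,3), unfolded node.sel]
  have at_vp: "B.V `` {Hi v'} = {}" "B.V `` {Lo v'} = {Lo d, Lo a, Lo w'}" "distinct [Lo d, Lo a, Lo w']"
    and at_wp: "B.V `` {Hi w'} = {}" "B.V `` {Lo w'} = {Lo b, Lo c, Lo v'}" "distinct [Lo b, Lo c, Lo v']"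
    and ends_B: "B.V `` {Lo a} = {Lo v'}" "B.V `` {Lo b} = {Lo w'}" "B.V `` {Lo c} = {Lo w'}" "B.V `` {Lo d} = {Lo v'}"
    by (simp_all add: ne V Un_Image edges_Image insert_commute del: edges.simps)
  note sign_vp = B.vertex_sign[OF at_vp(2,3), unfolded node.sel]
    and sign_wp = B.vertex_sign[OF at_wp(2,3), unfolded node.sel]
  define s where "s = ccw v a b w"
  have path1: "A.cutting [Lo a, Lo v, Lo w, Lo d]"
    unfolding A.cutting_def by (simp add: V ne)
  have b1: "left_of [Lo a, Lo v, Lo w, Lo d] b \<longleftrightarrow> on_left a v w b"
    and b2: "left_of [Lo a, Lo v, Lo w, Lo d] b \<longleftrightarrow> left_end a d b"
    and c1: "left_of [Lo a, Lo v, Lo w, Lo d] c \<longleftrightarrow> on_left v w d c"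
    and c2: "left_of [Lo a, Lo v, Lo w, Lo d] c \<longleftrightarrow> left_end a d c"
    using path1
      A.left_node[of "[]" "Lo a" "Lo v" "Lo w" "[Lo d]" "Lo v" "Lo b"]
      A.left_on_sphere[of "[Lo a, Lo v, Lo w, Lo d]" b]
      A.left_node[of "[Lo a]" "Lo v" "Lo w" "Lo d" "[]" "Lo w" "Lo c"]
      A.left_on_sphere[of "[Lo a, Lo v, Lo w, Lo d]" c]
    by (simp_all add: V ne)
  have path2: "A.cutting [Lo b, Lo v, Lo w, Lo c]"
    unfolding A.cutting_def by (simp add: V ne)
  have a1: "left_of [Lo b, Lo v, Lo w, Lo c] a \<longleftrightarrow> on_left b v w a"
    and a2: "left_of [Lo b, Lo v, Lo w, Lo c] a \<longleftrightarrow> left_end b c a"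
    using path2
      A.left_node[of "[]" "Lo b" "Lo v" "Lo w" "[Lo c]" "Lo v" "Lo a"]
      A.left_on_sphere[of "[Lo b, Lo v, Lo w, Lo c]" a]
    by (simp_all add: V ne)
  \<comment> \<open>The edge from \<open>v'\<close> to \<open>w'\<close> leaves this path to one
    side, and \<open>b\<close> and \<open>c\<close> are both found there. This relates the orders at
    the two vertices of the first picture, which it leaves independent on its own.\<close>
  have path3: "B.cutting [Lo a, Lo v', Lo d]"
    unfolding B.cutting_def by (simp add: V ne)
  have w1: "left_of [Lo a, Lo v', Lo d] w' \<longleftrightarrow> on_left a v' d w'"
    and w2: "left_of [Lo a, Lo v', Lo d] w' \<longleftrightarrow> left_of [Lo a, Lo v', Lo d] b"
    and w3: "left_of [Lo a, Lo v', Lo d] b \<longleftrightarrow> left_end a d b"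
    and w4: "left_of [Lo a, Lo v', Lo d] w' \<longleftrightarrow> left_of [Lo a, Lo v', Lo d] c"
    and w5: "left_of [Lo a, Lo v', Lo d] c \<longleftrightarrow> left_end a d c"
    using path3
      B.left_node[of "[]" "Lo a" "Lo v'" "Lo d" "[]" "Lo v'" "Lo w'"]
      B.left_edge[of "[Lo a, Lo v', Lo d]" "Lo w'" "Lo b"]
      B.left_on_sphere[of "[Lo a, Lo v', Lo d]" b]
      B.left_edge[of "[Lo a, Lo v', Lo d]" "Lo w'" "Lo c"]
      B.left_on_sphere[of "[Lo a, Lo v', Lo d]" c]
    by (simp_all add: V ne)
  have path4: "B.cutting [Lo b, Lo w', Lo c]"
    unfolding B.cutting_def by (simp add: V ne)
  have v1: "left_of [Lo b, Lo w', Lo c] v' \<longleftrightarrow> on_left b w' c v'"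
    and v2: "left_of [Lo b, Lo w', Lo c] v' \<longleftrightarrow> left_of [Lo b, Lo w', Lo c] a"
    and v3: "left_of [Lo b, Lo w', Lo c] a \<longleftrightarrow> left_end b c a"
    using path4
      B.left_node[of "[]" "Lo b" "Lo w'" "Lo c" "[]" "Lo w'" "Lo v'"]
      B.left_edge[of "[Lo b, Lo w', Lo c]" "Lo v'" "Lo a"]
      B.left_on_sphere[of "[Lo b, Lo w', Lo c]" a]
    by (simp_all add: V ne)
  have signs: "ccw v a b w \<longleftrightarrow> s" "ccw w c d v \<longleftrightarrow> s" "ccw v' d a w' \<longleftrightarrow> s" "ccw w' b c v' \<longleftrightarrow> s"
    using b1 b2 c1 c2 a1 a2 w1 w2 w3 w4 w5 v1 v2 v3 sign_v sign_w sign_vp sign_wp by (auto simp: s_def)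
  show ?thesis
  proof (rule switch_solved[OF G dd])
    fix X and \<beta> :: "complex \<Rightarrow> _" assume X: "quandle_family G X q"
      and \<beta>: "\<And>e. e \<in> set ?es \<Longrightarrow> \<beta> e \<in> carrier G \<times> X"
    interpret quandle_family G X q by (rule X)
    have \<beta>c: "\<beta> a \<in> colors" "\<beta> b \<in> colors" "\<beta> c \<in> colors" "\<beta> d \<in> colors" using \<beta> by auto
    let ?P = "snd (\<beta> a) = snd (\<beta> b) \<and> snd (\<beta> c) = snd (\<beta> d) \<and> bar G (vertex_join s (bar G (\<beta> a)) (bar G (\<beta> b))) = vertex_join s (bar G (\<beta> c)) (bar G (\<beta> d))"
    \<comment> \<open>The bar has no end on the circle. Its color is computed at the vertex
      \<open>v\<close>, and the rule at \<open>w\<close> turns into the last part of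
      \<open>?P\<close>.\<close>
    let ?A = "[((Lo a, Lo v), \<beta> a),
      ((Lo b, Lo v), \<beta> b),
      ((Lo c, Lo w), \<beta> c),
      ((Lo d, Lo w), \<beta> d),
      ((Lo v, Lo w), vertex_join s (bar G (\<beta> a)) (bar G (\<beta> b)))]"
    let ?B = "[((Lo a, Lo v'), \<beta> a),
      ((Lo d, Lo v'), \<beta> d),
      ((Lo b, Lo w'), \<beta> b),
      ((Lo c, Lo w'), \<beta> c),
      ((Lo v', Lo w'), vertex_join s (bar G (\<beta> d)) (bar G (\<beta> a)))]"
    let ?Q = "snd (\<beta> d) = snd (\<beta> a) \<and> snd (\<beta> b) = snd (\<beta> c) \<and> bar G (vertex_join s (bar G (\<beta> d)) (bar G (\<beta> a))) = vertex_join s (bar G (\<beta> b)) (bar G (\<beta> c))"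
    have snd_bar: "snd (bar G x) = snd x" for x :: "_ \<times> _" by (simp add: bar_def)
    have cyc: "?P \<longleftrightarrow> ?Q"
      using vertex_join_cyclic[of "bar G (\<beta> a)" "bar G (\<beta> b)" "bar G (\<beta> c)" "bar G (\<beta> d)" s] \<beta>c
      by (simp add: snd_bar del: mem_Sigma_iff)
    have "solved G X q z r A.V \<beta> ?P"
    proof (rule solvedI[where tbl = ?A])
      fix \<kappa> assume \<kappa>: "bar_symmetric G X A.V \<kappa>"
      have L: "local_coloring G X q z r A.V \<beta> \<kappa> \<longleftrightarrow>
          vertex_sign_rule G s (\<kappa> (Lo v, Lo a)) (\<kappa> (Lo v, Lo b)) (\<kappa> (Lo v, Lo w)) \<and>
          vertex_sign_rule G s (\<kappa> (Lo w, Lo c)) (\<kappa> (Lo w, Lo d)) (\<kappa> (Lo w, Lo v)) \<and>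
          \<kappa> (Lo a, Lo v) = \<beta> a \<and>
          \<kappa> (Lo b, Lo v) = \<beta> b \<and>
          \<kappa> (Lo c, Lo w) = \<beta> c \<and>
          \<kappa> (Lo d, Lo w) = \<beta> d" (is "?L \<longleftrightarrow> _")
        unfolding local_coloring_shape[OF A.tangle shape(1) ball(1)]
        using \<kappa>
          A.vertex_rule_iff[OF X \<kappa> at_v]
          A.vertex_rule_iff[OF X \<kappa> at_w]
        by (simp add: ends_A signs)
      show "\<forall>(e, x)\<in>set ?A. \<kappa> e = x" if ?L
        using that[unfolded L] bar_symmetricD[OF \<kappa>, of "Lo v" "Lo w"] \<beta>c
          bar_symmetricD(3)[OF \<kappa>, of "Lo a" "Lo v"]
          bar_symmetricD(3)[OF \<kappa>, of "Lo b" "Lo v"]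
          bar_symmetricD(3)[OF \<kappa>, of "Lo c" "Lo w"]
          bar_symmetricD(3)[OF \<kappa>, of "Lo d" "Lo w"]
        by (elim conjE) (simp add: V vertex_sign_rule_join del: mem_Sigma_iff)
      show "?L \<longleftrightarrow> ?P"
        if "\<forall>((m, n), x)\<in>set ?A. \<kappa> (m, n) = x \<and> \<kappa> (n, m) = bar G x"
        using that \<beta>c by (auto simp: L vertex_sign_rule_join snd_bar simp del: mem_Sigma_iff)
    qed (use \<beta>c in \<open>simp_all add: V ne del: mem_Sigma_iff\<close>)
    moreover have "solved G X q z r B.V \<beta> ?P"
      unfolding cyc
    proof (rule solvedI[where tbl = ?B])
      fix \<kappa> assume \<kappa>: "bar_symmetric G X B.V \<kappa>"
      have L: "local_coloring G X q z r B.V \<beta> \<kappa> \<longleftrightarrow>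
          vertex_sign_rule G s (\<kappa> (Lo v', Lo d)) (\<kappa> (Lo v', Lo a)) (\<kappa> (Lo v', Lo w')) \<and>
          vertex_sign_rule G s (\<kappa> (Lo w', Lo b)) (\<kappa> (Lo w', Lo c)) (\<kappa> (Lo w', Lo v')) \<and>
          \<kappa> (Lo a, Lo v') = \<beta> a \<and>
          \<kappa> (Lo b, Lo w') = \<beta> b \<and>
          \<kappa> (Lo c, Lo w') = \<beta> c \<and>
          \<kappa> (Lo d, Lo v') = \<beta> d" (is "?L \<longleftrightarrow> _")
        unfolding local_coloring_shape[OF B.tangle shape(2) ball(2)]
        using \<kappa>
          B.vertex_rule_iff[OF X \<kappa> at_vp]
          B.vertex_rule_iff[OF X \<kappa> at_wp]
        by (simp add: ends_B signs)
      show "\<forall>(e, x)\<in>set ?B. \<kappa> e = x" if ?L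
        using that[unfolded L] bar_symmetricD[OF \<kappa>, of "Lo v'" "Lo w'"] \<beta>c
          bar_symmetricD(3)[OF \<kappa>, of "Lo a" "Lo v'"]
          bar_symmetricD(3)[OF \<kappa>, of "Lo d" "Lo v'"]
          bar_symmetricD(3)[OF \<kappa>, of "Lo b" "Lo w'"]
          bar_symmetricD(3)[OF \<kappa>, of "Lo c" "Lo w'"]
        by (elim conjE) (simp add: V vertex_sign_rule_join del: mem_Sigma_iff)
      show "?L \<longleftrightarrow> ?Q"
        if "\<forall>((m, n), x)\<in>set ?B. \<kappa> (m, n) = x \<and> \<kappa> (n, m) = bar G x"
        using that \<beta>c by (auto simp: L vertex_sign_rule_join snd_bar simp del: mem_Sigma_iff)
    qed (use \<beta>c in \<open>simp_all add: V ne del: mem_Sigma_iff\<close>)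
    ultimately show "\<exists>P. solved G X q z r A.V \<beta> P \<and> solved G X q z r B.V \<beta> P" by blast
  qed
qed

section \<open>From single moves to the invariants\<close>

lemma reidemeister_recolorable:
  assumes "reidemeister D D'" and G: "group G"
  shows "recolorable G q (unoriented D) (unoriented D') \<and> Y_oriented_diagram D \<and> Y_oriented_diagram D'"
  using assms(1)
proof cases
  case subdivision
  then show ?thesis using subdivision_recolorable by blast
next
  case motion
  then show ?thesis using motion_recolorable by blast
next
  case R1
  then show ?thesis using R1_recolorable[OF _ _ _ G] by blast
next
  case R2
  then show ?thesis using R2_recolorable[OF _ _ _ G] by blast
next
  case R3
  then show ?thesis using R3_recolorable[OF _ _ _ G] by blast
next
  case R4
  then show ?thesis using R4_recolorable[OF _ _ _ G] by blast
next
  case R5_over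
  then show ?thesis using R5_over_recolorable[OF _ _ _ G] by blast
next
  case R5_under
  then show ?thesis using R5_under_recolorable[OF _ _ _ G] by blast
next
  case R6
  then show ?thesis using R6_recolorable[OF _ _ _ G] by blast
qed

text \<open>With an arbitrary function \<open>P\<close> of the image subfamily, one equality of
  multisets yields both invariants.\<close>

lemma reidemeister_invariant:
  assumes "reidemeister D D'" and G: "group G" and X: "G_family G X q"
  shows "image_mset (\<lambda>f. P (image_subfamily G X q D f)) (mset_set (colorings G X q D)) =
    image_mset (\<lambda>f. P (image_subfamily G X q D' f)) (mset_set (colorings G X q D'))"
proof -
  have rec: "recolorable G q (unoriented D) (unoriented D')" "Y_diagram D" "Y_diagram D'"
    using reidemeister_recolorable[OF assms(1) G] by (auto simp: Y_diagram_def)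
  have fam: "quandle_family G X q" using G X by (simp add: quandle_family_def quandle_family_axioms_def)
  show ?thesis
    unfolding invariant_via_half_colorings[OF fam rec(2)] invariant_via_half_colorings[OF fam rec(3)]
    by (rule recolorable_imp_invariant_eq[OF X rec(1)])
qed

theorem proposition3:
  fixes G :: "('g, 'm) monoid_scheme"
    and X :: "'x set"
    and q :: "'g \<Rightarrow> 'x \<Rightarrow> 'x \<Rightarrow> 'x"
    and L L' :: diagram
  assumes "group G" and "finite (carrier G)" and "finite X" and "G_family G X q"
    and "Y_oriented_diagram L" and "Y_oriented_diagram L'"
    and "reidemeister_equiv L L'"
  shows "G_family_invariant G X q L = G_family_invariant G X q L' \<and>
         assoc_invariant G X q L = assoc_invariant G X q L'"
proof -
  have step: "G_family_invariant G X q D = G_family_invariant G X q D' \<and>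
      assoc_invariant G X q D = assoc_invariant G X q D'" if "symclp reidemeister D D'" for D D'
  proof -
    have "G_family_invariant G X q D = G_family_invariant G X q D' \<and>
        assoc_invariant G X q D = assoc_invariant G X q D'" if "reidemeister D D'" for D D'
      using reidemeister_invariant[OF that assms(1,4), of "G_subfamily_poly G X q"]
        reidemeister_invariant[OF that assms(1,4), of "assoc_subquandle_poly G X q"]
      by (simp add: G_family_invariant_def assoc_invariant_def)
    then show ?thesis using that by (auto simp: symclp_def)
  qed
  have "(symclp reidemeister)\<^sup>*\<^sup>* L L'" using assms(7) by (simp add: reidemeister_equiv_def)
  then show ?thesis
    by (induction rule: rtranclp_induct) (use step in metis)+
qed

end
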